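(* Let $M$ be a sphere with a Euclidean polyhedral metric with singular set $\Sigma$, let $P=(T,r)$ be a generalized convex polytope with boundary $M$, and let $P^*=(T,\phi,h)$ be the generalized convex polyhedron dual to $P$. The Hessian of the total scalar curvature at $P$ is equal to the Hessian of the volume at $P^*$: $$\frac{\partial^2 H}{\partial r_i\,\partial r_j}(P)=\frac{\partial^2 \mathrm{vol}}{\partial h_i\,\partial h_j}(P^* )\qquad\text{for all } i,j\in\Sigma .$$ Equivalently, the Jacobian of the curvatures of $P$ with respect to the radii equals the Jacobian of the face areas of $P^*$ with respect to the altitudes: $$\frac{\partial\kappa_i}{\partial r_j}(P)=\frac{\partial F_i}{\partial h_j}(P^* )\qquad\text{for all } i,j\in\Sigma .$$
   Context: A Euclidean polyhedral metric on the sphere $M$: every point has a neighborhood isometric to an open subset of $\mathbb{R}^2$ or, for the finitely many singular points (set $\Sigma$), to an open subset of a Euclidean cone of angle $\neq2\pi$ with the point at the apex. A geodesic triangulation $T$ of $M$ is a decomposition of $M$ into Euclidean triangles by geodesics with endpoints in $\Sigma$, with vertex set $\mathcal V(T)=\Sigma$, edge set $\mathcal E(T)$, face set $\mathcal F(T)$; loops, multiple edges and self-identifications of triangles on the boundary are allowed. Generalized convex polytope: let $r=(r_i)_{i\in\Sigma}$ be positive numbers such that over every $ijk\in\mathcal F(T)$ there is a (non-degenerate) pyramid with base $ijk$ and side edges $r_i,r_j,r_k$. Gluing these pyramids following $T$ gives the generalized polytope $(T,r)$ with apex $a$. $\omega_i$ is the sum of dihedral angles of the pyramids at the edge $ai$,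 $\kappa_i=2\pi-\omega_i$; $\theta_{ij}$ is the sum of dihedral angles of the pyramids at the boundary edge $ij$, $\ell_{ij}$ its length. Couples $(T,r)$ are considered equivalent if the resulting polyhedra are isometric by an isometry that is the identity on the boundary and maps apex to apex. It is convex if all $\theta_{ij}\le\pi$. For fixed $M$, a generalized convex polytope with boundary $M$ is uniquely determined by $r$, so the set $\mathcal P(M)$ of all of them is identified with a subset of $\mathbb{R}^\Sigma$ with coordinates $(r_i)$; $\kappa_i$ and the total scalar curvature $$H(P)=\sum_{i\in\mathcal V(T)} r_i\kappa_i+\sum_{ij\in\mathcal E(T)}\ell_{ij}(\pi-\theta_{ij})$$ are functions on $\mathcal P(M)$ (derivatives at boundary points are understood as continuous extensions from the interior). Generalized convex polyhedron: a generalized simplicial fan is a couple $(T,\phi)$, where $T$ is a triangulation of the sphere (loops and multiple edges allowed) and $\phi:\mathcal E(T)\to(0,\pi)$ is such that for each $ijk\in\mathcal F(T)$ there is a spherical triangle with side lengths $\phi_{ij},\phi_{jk},\phi_{ik}$. Given $h:\mathcal V(T)\to\mathbb{R}$ (altitudes), put for an oriented edge $e$ from $i$ to $j$: $h_e=\dfrac{h_j-h_i\cos\phi_e}{\sin\phi_e}$ (with $\phi_e=\phi_{-e}$). For a vertex $i$ let $e_1,\ldots,e_m$ be the oriented edges starting at $i$ in cyclic order (indices mod $m$) and $\omega_s\in(0,\pi)$ the angle at $i$, between $e_s$ and $e_{s+1}$, of the corresponding spherical triangle of the fan. Put $$\ell^*_{e_s}=\frac{h_{e_{s+1}}-h_{e_s}\cos\omega_s}{\sin\omega_s}+\frac{h_{e_{s-1}}-h_{e_s}\cos\omega_{s-1}}{\sin\omega_{s-1}},\qquad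 F_i=\frac12\sum_{s}h_{e_s}\ell^*_{e_s},\qquad \mathrm{vol}=\frac13\sum_i h_iF_i .$$ The triple $(T,\phi,h)$ is a generalized convex polyhedron if $\ell^*_e\ge0$ for every edge $e$ ($\ell^*_e$ does not depend on the orientation). $F_i$ is the area of the $i$-th face. With $(T,\phi)$ fixed, $F_i$ and $\mathrm{vol}$ are polynomial functions of $h$, and their derivatives in $h$ are taken with $(T,\phi)$ fixed. Dual: for $P=(T,r)$ the dual is $P^*=(T,\phi,h)$, where $\phi_{ij}$ is the angle at the apex $a$ in the triangle $aij$ and $h_i=1/r_i$. *)

theory Defs
  imports "HOL-Analysis.Analysis"
begin

section \<open>Euclidean polyhedral metrics on the sphere\<close>

text \<open>
  The Euclidean cone of angle \<open>\<alpha>\<close> in polar coordinates: \<open>(\<rho>, x)\<close> with radius \<open>\<rho>\<close> and angular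
  coordinate \<open>x\<close> in a circle of length \<open>\<alpha>\<close>.  The apex is \<open>(0, 0)\<close>.  Two points at angular
  distance at least \<open>pi\<close> are joined by a shortest path through the apex, whence the cut-off at \<open>pi\<close>.
\<close>

definition cone :: "real \<Rightarrow> (real \<times> real) set" where
  "cone \<alpha> = {(\<rho>, x). 0 \<le> \<rho> \<and> 0 \<le> x \<and> x < \<alpha> \<and> (\<rho> = 0 \<longrightarrow> x = 0)}"

definition cone_dist :: "real \<Rightarrow> real \<times> real \<Rightarrow> real \<times> real \<Rightarrow> real" where
  "cone_dist \<alpha> v w =
     (let \<delta> = \<bar>snd v - snd w\<bar>
      in sqrt ((fst v)\<^sup>2 + (fst w)\<^sup>2 - 2 * fst v * fst w * cos (min pi (min \<delta> (\<alpha> - \<delta>)))))"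

definition cone_open :: "real \<Rightarrow> (real \<times> real) set \<Rightarrow> bool" where
  "cone_open \<alpha> W \<longleftrightarrow>
     W \<subseteq> cone \<alpha> \<and> (\<forall>w\<in>W. \<exists>e>0. \<forall>w'\<in>cone \<alpha>. cone_dist \<alpha> w w' < e \<longrightarrow> w' \<in> W)"

definition flat_point :: "'m::metric_space \<Rightarrow> bool" where
  "flat_point p \<longleftrightarrow>
     (\<exists>N W (f :: 'm \<Rightarrow> real^2). open N \<and> p \<in> N \<and> open W \<and> f ` N = W \<and>
        (\<forall>x\<in>N. \<forall>y\<in>N. dist (f x) (f y) = dist x y))"

definition cone_point :: "real \<Rightarrow> 'm::metric_space \<Rightarrow> bool" where
  "cone_point \<alpha> p \<longleftrightarrow>
     (\<exists>N W (f :: 'm \<Rightarrow> real \<times> real). open N \<and> p \<in> N \<and> cone_open \<alpha> W \<and> f ` N = W \<and> f p = (0, 0) \<and>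
        (\<forall>x\<in>N. \<forall>y\<in>N. cone_dist \<alpha> (f x) (f y) = dist x y))"

text \<open>
  The surface \<open>M\<close> is the whole type \<open>'m\<close>.  Its finite singular set is the range of \<open>s\<close>; the index
  type \<open>'v\<close> makes the space of radii the Euclidean space \<open>real ^ 'v\<close>.
\<close>

definition polyhedral_sphere :: "('v::finite \<Rightarrow> 'm::metric_space) \<Rightarrow> bool" where
  "polyhedral_sphere s \<longleftrightarrow>
     (UNIV :: 'm set) homeomorphic sphere (0 :: real^3) 1 \<and>
     inj s \<and>
     (\<forall>p. p \<notin> range s \<longrightarrow> flat_point p) \<and>
     (\<forall>i. \<exists>\<alpha>>0. \<alpha> \<noteq> 2 * pi \<and> cone_point \<alpha> (s i))"


section \<open>Triangulations of the sphere\<close>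

text \<open>
  A triangulation is given by its oriented edges (darts).  Every dart \<open>d\<close> lies on the boundary
  of one face, the one to its left; \<open>nxt d\<close> is the dart following \<open>d\<close> on that boundary, \<open>opp d\<close> is
  \<open>d\<close> with the opposite orientation, and \<open>orig d\<close> is the vertex from which \<open>d\<close> starts.  Loops,
  multiple edges and faces glued to themselves are possible.
\<close>

record 'v tri =
  darts :: "nat set"
  opp :: "nat \<Rightarrow> nat"
  nxt :: "nat \<Rightarrow> nat"
  orig :: "nat \<Rightarrow> 'v"

definition target :: "('v, 'z) tri_scheme \<Rightarrow> nat \<Rightarrow> 'v" where
  "target T d = orig T (opp T d)"

definition face :: "('v, 'z) tri_scheme \<Rightarrow> nat \<Rightarrow> nat set" where
  "face T d = {d, nxt T d, nxt T (nxt T d)}"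

definition faces :: "('v, 'z) tri_scheme \<Rightarrow> nat set set" where
  "faces T = face T ` darts T"

definition edges :: "('v, 'z) tri_scheme \<Rightarrow> nat set set" where
  "edges T = (\<lambda>d. {d, opp T d}) ` darts T"

text \<open>
  The successor and the predecessor of a dart in the cyclic order of the darts starting at the same
  vertex.  The corner between \<open>d\<close> and \<open>rot T d\<close> belongs to the face of \<open>d\<close>, and the corner between
  \<open>rot' T d\<close> and \<open>d\<close> to the face of \<open>rot' T d\<close>.
\<close>

definition rot :: "('v, 'z) tri_scheme \<Rightarrow> nat \<Rightarrow> nat" where
  "rot T d = opp T (nxt T (nxt T d))"

definition rot' :: "('v, 'z) tri_scheme \<Rightarrow> nat \<Rightarrow> nat" where
  "rot' T d = nxt T (opp T d)"

definition sphere_triangulation :: "('v::finite, 'z) tri_scheme \<Rightarrow> bool" where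
  "sphere_triangulation T \<longleftrightarrow>
     finite (darts T) \<and>
     (\<forall>d\<in>darts T. opp T d \<in> darts T \<and> opp T d \<noteq> d \<and> opp T (opp T d) = d) \<and>
     (\<forall>d\<in>darts T. nxt T d \<in> darts T \<and> nxt T d \<noteq> d \<and> nxt T (nxt T (nxt T d)) = d) \<and>
     (\<forall>d\<in>darts T. \<forall>d'\<in>darts T. orig T d = orig T d' \<longleftrightarrow> (\<exists>n. (rot T ^^ n) d = d')) \<and>
     orig T ` darts T = UNIV \<and>
     (\<forall>d\<in>darts T. \<forall>d'\<in>darts T.
        (d, d') \<in> ({(x, opp T x) | x. x \<in> darts T} \<union> {(x, nxt T x) | x. x \<in> darts T})\<^sup>*) \<and>
     int CARD('v) - int (card (edges T)) + int (card (faces T)) = 2"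


section \<open>Geodesic triangulations\<close>

text \<open>
  The face of \<open>d\<close> is the image of a Euclidean triangle in the plane under \<open>chart d\<close>, and \<open>corner d\<close>
  is the vertex of this triangle corresponding to the origin of \<open>d\<close>.
\<close>

record ('v, 'm) geo_tri = "'v tri" +
  corner :: "nat \<Rightarrow> real^2"
  chart :: "nat \<Rightarrow> real^2 \<Rightarrow> 'm"

definition len :: "('v, 'm, 'z) geo_tri_scheme \<Rightarrow> nat \<Rightarrow> real" where
  "len T d = dist (corner T d) (corner T (nxt T d))"

definition triangle :: "('v, 'm, 'z) geo_tri_scheme \<Rightarrow> nat \<Rightarrow> (real^2) set" where
  "triangle T d = convex hull (corner T ` face T d)"

definition edge_pt :: "('v, 'm, 'z) geo_tri_scheme \<Rightarrow> nat \<Rightarrow> real \<Rightarrow> real^2" where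
  "edge_pt T d t = (1 - t) *\<^sub>R corner T d + t *\<^sub>R corner T (nxt T d)"

text \<open>
  \<open>T\<close> decomposes \<open>M\<close> into Euclidean triangles: \<open>M\<close> is obtained from the disjoint union of the
  triangles by exactly the identifications of sides (and the resulting identifications of corners)
  that \<open>T\<close> prescribes, and the charts are local isometries away from the corners, including at
  interior points of sides, so that sides are mapped to geodesics.  At the corners only continuity
  is required: when the total angle at a singular point is small, a corner may fail to be
  isometrically embedded in any neighbourhood of its vertex.
\<close>

definition geodesic_triangulation ::
    "('v::finite \<Rightarrow> 'm::metric_space) \<Rightarrow> ('v, 'm) geo_tri \<Rightarrow> bool" where
  "geodesic_triangulation s T \<longleftrightarrow>
     sphere_triangulation T \<and>
     (\<forall>d\<in>darts T.
        \<not> collinear (corner T ` face T d) \<and>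
        chart T (nxt T d) = chart T d \<and>
        chart T d (corner T d) = s (orig T d) \<and>
        continuous_on (triangle T d) (chart T d) \<and>
        len T (opp T d) = len T d \<and>
        (\<forall>t\<in>{0..1}. chart T d (edge_pt T d t) = chart T (opp T d) (edge_pt T (opp T d) (1 - t))) \<and>
        (\<forall>x\<in>triangle T d - corner T ` face T d. \<exists>e>0.
           \<forall>y\<in>triangle T d \<inter> ball x e. \<forall>z\<in>triangle T d \<inter> ball x e.
             dist (chart T d y) (chart T d z) = dist y z)) \<and>
     (\<Union>d\<in>darts T. chart T d ` triangle T d) = UNIV \<and>
     (\<forall>d\<in>darts T. \<forall>d'\<in>darts T. \<forall>x\<in>interior (triangle T d). \<forall>y\<in>triangle T d'.
        chart T d x = chart T d' y \<longrightarrow> d' \<in> face T d \<and> y = x) \<and>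
     (\<forall>d\<in>darts T. \<forall>d'\<in>darts T. \<forall>t\<in>{0<..<1}. \<forall>y\<in>triangle T d'.
        chart T d (edge_pt T d t) = chart T d' y \<longrightarrow>
          (d' \<in> face T d \<and> y = edge_pt T d t) \<or>
          (d' \<in> face T (opp T d) \<and> y = edge_pt T (opp T d) (1 - t)))"


section \<open>Angles\<close>

definition vec_angle :: "'a::real_inner \<Rightarrow> 'a \<Rightarrow> real" where
  "vec_angle u v = arccos (u \<bullet> v / (norm u * norm v))"

definition perp_part :: "'a::real_inner \<Rightarrow> 'a \<Rightarrow> 'a" where
  "perp_part n w = w - ((w \<bullet> n) / (n \<bullet> n)) *\<^sub>R n"

text \<open>The angle between the half-planes bounded by the line \<open>p q\<close> that contain \<open>u\<close> and \<open>v\<close>.\<close>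

definition dihedral_angle :: "'a::real_inner \<Rightarrow> 'a \<Rightarrow> 'a \<Rightarrow> 'a \<Rightarrow> real" where
  "dihedral_angle p q u v = vec_angle (perp_part (q - p) (u - p)) (perp_part (q - p) (v - p))"


section \<open>Generalized convex polytopes\<close>

text \<open>
  \<open>(a, x, y, z)\<close> is a non-degenerate pyramid with apex \<open>a\<close> over the face of \<open>d\<close>; the base vertices
  \<open>x\<close>, \<open>y\<close>, \<open>z\<close> correspond to the origins of \<open>d\<close>, \<open>nxt d\<close>, \<open>nxt (nxt d)\<close>.
\<close>

definition is_pyramid ::
    "('v::finite, 'm, 'z) geo_tri_scheme \<Rightarrow> real^'v \<Rightarrow> nat \<Rightarrow> (real^3) \<times> (real^3) \<times> (real^3) \<times> (real^3) \<Rightarrow> bool" where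
  "is_pyramid T r d = (\<lambda>(a, x, y, z).
     dist x y = len T d \<and> dist y z = len T (nxt T d) \<and> dist z x = len T (nxt T (nxt T d)) \<and>
     dist a x = r $ orig T d \<and> dist a y = r $ orig T (nxt T d) \<and>
     dist a z = r $ orig T (nxt T (nxt T d)) \<and>
     \<not> coplanar {a, x, y, z})"

text \<open>The pyramid is unique up to isometry, so the angles below do not depend on the choice.\<close>

definition pyramid :: "('v::finite, 'm, 'z) geo_tri_scheme \<Rightarrow> real^'v \<Rightarrow> nat \<Rightarrow>
    (real^3) \<times> (real^3) \<times> (real^3) \<times> (real^3)" where
  "pyramid T r d = (SOME p. is_pyramid T r d p)"

definition side_dihedral :: "('v::finite, 'm, 'z) geo_tri_scheme \<Rightarrow> real^'v \<Rightarrow> nat \<Rightarrow> real" where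
  "side_dihedral T r d = (case pyramid T r d of (a, x, y, z) \<Rightarrow> dihedral_angle a x y z)"

definition base_dihedral :: "('v::finite, 'm, 'z) geo_tri_scheme \<Rightarrow> real^'v \<Rightarrow> nat \<Rightarrow> real" where
  "base_dihedral T r d = (case pyramid T r d of (a, x, y, z) \<Rightarrow> dihedral_angle x y a z)"

definition apex_angle :: "('v::finite, 'm, 'z) geo_tri_scheme \<Rightarrow> real^'v \<Rightarrow> nat \<Rightarrow> real" where
  "apex_angle T r d = (case pyramid T r d of (a, x, y, z) \<Rightarrow> vec_angle (x - a) (y - a))"

definition omega :: "('v::finite, 'm, 'z) geo_tri_scheme \<Rightarrow> real^'v \<Rightarrow> 'v \<Rightarrow> real" where
  "omega T r i = (\<Sum>d | d \<in> darts T \<and> orig T d = i. side_dihedral T r d)"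

definition kappa :: "('v::finite, 'm, 'z) geo_tri_scheme \<Rightarrow> real^'v \<Rightarrow> 'v \<Rightarrow> real" where
  "kappa T r i = 2 * pi - omega T r i"

definition theta :: "('v::finite, 'm, 'z) geo_tri_scheme \<Rightarrow> real^'v \<Rightarrow> nat \<Rightarrow> real" where
  "theta T r d = base_dihedral T r d + base_dihedral T r (opp T d)"

text \<open>Each edge is represented by two darts, hence the factor \<open>1/2\<close> in the sum over edges.\<close>

definition total_scalar_curvature :: "('v::finite, 'm, 'z) geo_tri_scheme \<Rightarrow> real^'v \<Rightarrow> real" where
  "total_scalar_curvature T r =
     (\<Sum>i\<in>UNIV. r $ i * kappa T r i) + (\<Sum>d\<in>darts T. len T d * (pi - theta T r d)) / 2"

definition gen_convex_polytope ::
    "('v::finite \<Rightarrow> 'm::metric_space) \<Rightarrow> ('v, 'm) geo_tri \<Rightarrow> real^'v \<Rightarrow> bool" where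
  "gen_convex_polytope s T r \<longleftrightarrow>
     geodesic_triangulation s T \<and>
     (\<forall>i. 0 < r $ i) \<and>
     (\<forall>d\<in>darts T. \<exists>p. is_pyramid T r d p) \<and>
     (\<forall>d\<in>darts T. theta T r d \<le> pi)"

text \<open>
  The space of all generalized convex polytopes with boundary \<open>M\<close>, as a set of radii, and the
  curvatures and the total scalar curvature as functions on it.  The triangulation may vary from
  point to point; a convex polytope is determined by its radii, so any triangulation
  with these radii gives the same values.
\<close>

definition polytope_space :: "('v::finite \<Rightarrow> 'm::metric_space) \<Rightarrow> (real^'v) set" where
  "polytope_space s = {r. \<exists>T. gen_convex_polytope s T r}"

definition polytope_tri :: "('v::finite \<Rightarrow> 'm::metric_space) \<Rightarrow> real^'v \<Rightarrow> ('v, 'm) geo_tri" where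
  "polytope_tri s r = (SOME T. gen_convex_polytope s T r)"

definition curvature :: "('v::finite \<Rightarrow> 'm::metric_space) \<Rightarrow> 'v \<Rightarrow> real^'v \<Rightarrow> real" where
  "curvature s i r = kappa (polytope_tri s r) r i"

definition scalar_curvature :: "('v::finite \<Rightarrow> 'm::metric_space) \<Rightarrow> real^'v \<Rightarrow> real" where
  "scalar_curvature s r = total_scalar_curvature (polytope_tri s r) r"


section \<open>Generalized convex polyhedra\<close>

definition is_spherical_triangle ::
    "('v::finite, 'z) tri_scheme \<Rightarrow> (nat \<Rightarrow> real) \<Rightarrow> nat \<Rightarrow> (real^3) \<times> (real^3) \<times> (real^3) \<Rightarrow> bool" where
  "is_spherical_triangle T \<phi> d = (\<lambda>(u, v, w).
     norm u = 1 \<and> norm v = 1 \<and> norm w = 1 \<and>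
     vec_angle u v = \<phi> d \<and> vec_angle v w = \<phi> (nxt T d) \<and> vec_angle w u = \<phi> (nxt T (nxt T d)) \<and>
     \<not> coplanar {0, u, v, w})"

definition spherical_triangle ::
    "('v::finite, 'z) tri_scheme \<Rightarrow> (nat \<Rightarrow> real) \<Rightarrow> nat \<Rightarrow> (real^3) \<times> (real^3) \<times> (real^3)" where
  "spherical_triangle T \<phi> d = (SOME p. is_spherical_triangle T \<phi> d p)"

definition gen_simplicial_fan :: "('v::finite, 'z) tri_scheme \<Rightarrow> (nat \<Rightarrow> real) \<Rightarrow> bool" where
  "gen_simplicial_fan T \<phi> \<longleftrightarrow>
     sphere_triangulation T \<and>
     (\<forall>d\<in>darts T. 0 < \<phi> d \<and> \<phi> d < pi \<and> \<phi> (opp T d) = \<phi> d) \<and>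
     (\<forall>d\<in>darts T. \<exists>p. is_spherical_triangle T \<phi> d p)"

text \<open>The angle of the spherical triangle of the face of \<open>d\<close> at its corner between \<open>d\<close> and \<open>rot T d\<close>.\<close>

definition fan_angle :: "('v::finite, 'z) tri_scheme \<Rightarrow> (nat \<Rightarrow> real) \<Rightarrow> nat \<Rightarrow> real" where
  "fan_angle T \<phi> d = (case spherical_triangle T \<phi> d of (u, v, w) \<Rightarrow> dihedral_angle 0 u v w)"

definition edge_altitude ::
    "('v::finite, 'z) tri_scheme \<Rightarrow> (nat \<Rightarrow> real) \<Rightarrow> real^'v \<Rightarrow> nat \<Rightarrow> real" where
  "edge_altitude T \<phi> h d = (h $ target T d - h $ orig T d * cos (\<phi> d)) / sin (\<phi> d)"

definition dual_len ::
    "('v::finite, 'z) tri_scheme \<Rightarrow> (nat \<Rightarrow> real) \<Rightarrow> real^'v \<Rightarrow> nat \<Rightarrow> real" where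
  "dual_len T \<phi> h d =
     (edge_altitude T \<phi> h (rot T d) - edge_altitude T \<phi> h d * cos (fan_angle T \<phi> d))
       / sin (fan_angle T \<phi> d) +
     (edge_altitude T \<phi> h (rot' T d) - edge_altitude T \<phi> h d * cos (fan_angle T \<phi> (rot' T d)))
       / sin (fan_angle T \<phi> (rot' T d))"

definition face_area ::
    "('v::finite, 'z) tri_scheme \<Rightarrow> (nat \<Rightarrow> real) \<Rightarrow> 'v \<Rightarrow> real^'v \<Rightarrow> real" where
  "face_area T \<phi> i h =
     (\<Sum>d | d \<in> darts T \<and> orig T d = i. edge_altitude T \<phi> h d * dual_len T \<phi> h d) / 2"

definition polyhedron_volume :: "('v::finite, 'z) tri_scheme \<Rightarrow> (nat \<Rightarrow> real) \<Rightarrow> real^'v \<Rightarrow> real" where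
  "polyhedron_volume T \<phi> h = (\<Sum>i\<in>UNIV. h $ i * face_area T \<phi> i h) / 3"

definition gen_convex_polyhedron ::
    "('v::finite, 'z) tri_scheme \<Rightarrow> (nat \<Rightarrow> real) \<Rightarrow> real^'v \<Rightarrow> bool" where
  "gen_convex_polyhedron T \<phi> h \<longleftrightarrow>
     gen_simplicial_fan T \<phi> \<and> (\<forall>d\<in>darts T. 0 \<le> dual_len T \<phi> h d)"

text \<open>
  The dual of \<open>(T, r)\<close> is \<open>(T, apex_angle T r, dual_altitude r)\<close>.
\<close>

definition dual_altitude :: "real^'v::finite \<Rightarrow> real^'v" where
  "dual_altitude r = (\<chi> i. 1 / r $ i)"


section \<open>Partial derivatives\<close>

definition has_partial :: "(real^'v::finite \<Rightarrow> real) \<Rightarrow> 'v \<Rightarrow> real \<Rightarrow> real^'v \<Rightarrow> bool" where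
  "has_partial f i D x \<longleftrightarrow> ((\<lambda>t. f (x + t *\<^sub>R axis i 1)) has_real_derivative D) (at 0)"

text \<open>
  Partial derivatives of a function on \<open>S\<close>: the usual ones at interior points of \<open>S\<close>, and their
  limit from the interior at the other points.  The values of \<open>f\<close> outside \<open>S\<close> play no role.
\<close>

definition has_partial_on ::
    "(real^'v::finite) set \<Rightarrow> (real^'v \<Rightarrow> real) \<Rightarrow> 'v \<Rightarrow> real \<Rightarrow> real^'v \<Rightarrow> bool" where
  "has_partial_on S f i D x \<longleftrightarrow>
     (\<exists>g. (\<forall>y\<in>interior S. has_partial f i (g y) y) \<and>
          (if x \<in> interior S then g x = D else (g \<longlongrightarrow> D) (at x within interior S)))"

definition has_partial2_on ::
    "(real^'v::finite) set \<Rightarrow> (real^'v \<Rightarrow> real) \<Rightarrow> 'v \<Rightarrow> 'v \<Rightarrow> real \<Rightarrow> real^'v \<Rightarrow> bool" where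
  "has_partial2_on S f i j D x \<longleftrightarrow>
     (\<exists>g. (\<forall>y\<in>interior S. has_partial f j (g y) y) \<and> has_partial_on S g i D x)"

end

theory Submission
  imports Defs
begin

text \<open>
  A face is put into normal form: the origin of the dart \<open>d\<close> is \<open>0\<close>, its end is \<open>len T d\<close> on the
  real axis, and the third vertex \<open>tip T d\<close> lies in the upper half-plane.  The apex then projects to
  the point \<open>foot T r d\<close>, whose imaginary part \<open>inset T r d\<close> is its signed distance from the edge, and
  \<open>height2 T r d\<close> is the square of its height.  All angles are elementary functions of these data;
  in particular, the dihedral angle at the edge has cotangent \<open>inset / height\<close>, so that
  \<open>theta <= pi\<close> says that the insets on the two sides of the edge have a nonnegative sum.

  For a fixed triangulation the theorem is a computation.  Both Jacobians equal
  \<open>- (sum over d at i of edge_cot d * edge_rate d)\<close>: the curvatures by differentiating the angles at the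
  side edges (\<open>kappa_jacobian\<close>), the face areas because \<open>edge_cot / line_dist\<close> is the length of the
  dual edge (\<open>dual_len_dual\<close>, \<open>face_area_jacobian\<close>).  The gradients of the total scalar curvature and
  of the volume are the curvatures, by the formula of Schlaefli, and the face areas
  (\<open>total_scalar_curvature_gradient\<close>, \<open>volume_gradient\<close>).

  The functions on the space of polytopes, however, use at every point of that space whichever
  convex triangulation is available there.  Two things have to be shown.

  Firstly, the values do not depend on the triangulation.  The squared distance from the apex is a
  function on the surface (\<open>apex_dist2\<close>) whose restriction to a geodesic of speed \<open>L\<close>, minus \<open>L^2 t^2\<close>,
  is linear inside faces and, by convexity, concave across edges.  It is therefore determined by its
  values at the singular points (\<open>apex_dist2_unique\<close>).  The edges with angle less than \<open>pi\<close> are the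
  places where this function has a kink, so that any two convex triangulations with the same radii
  share them, together with the insets (\<open>strict_edge_sum\<close>); the other edges contribute
  nothing to the Jacobian or to the mean curvature term.  To compare the curvatures
  themselves, all squared radii are increased by a constant \<open>c\<close>.  This keeps the insets and hence
  convexity, the curvatures move at the same rate, and for \<open>c\<close> to infinity they tend to \<open>2 pi\<close> minus the
  sum of the planar corner angles, which is \<open>2 pi\<close> minus the cone angle for every triangulation
  (\<open>corner_angle_sum\<close>, \<open>kappa_eq\<close>).

  Secondly, near a given point finitely many triangulations suffice, all of them convex at that point
  (\<open>finitely_many_local_triangulations\<close>).  Edges of a convex polytope are geodesics between
  singular points, no longer than the sum of two radii, and only finitely many lengths of this size
  occur (\<open>finite_geodesic_lengths\<close>): a geodesic can be unfolded across a bounded number of triangles of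
  a fixed triangulation, which leaves finitely many positions for its end.  Hence there are finitely many
  combinatorial types with edge lengths, and the radii for which a given type is convex form a
  relatively closed set.  As these triangulations agree to first order at the given point, the functions on
  the space of polytopes are differentiable there, with continuous partial derivatives.
\<close>

section \<open>The normal form of a face\<close>

abbreviation prv :: "('v, 'z) tri_scheme => nat => nat" where
 "prv T d \<equiv> nxt T (nxt T d)"

abbreviation cr :: "real => complex" where
 "cr \<equiv> complex_of_real"

text \<open>
 The law of cosines gives the third vertex in terms of the side lengths alone, so that everything below
 depends on the triangulation only through its combinatorics and its edge lengths.
\<close>

definition tip :: "('v, 'm, 'z) geo_tri_scheme => nat => complex" where
 "tip T d =
   (let l = len T d; b = len T (nxt T d); c = len T (prv T d);
     x = (l^2 + c^2 - b^2) / (2 * l)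
   in Complex x (sqrt (c^2 - x^2)))"

text \<open>
 The projection of the apex to the line of the edge divides that line according to the difference of the
 squared radii.
\<close>

definition foot_along :: "('v::finite, 'm, 'z) geo_tri_scheme => real^'v => nat => real" where
 "foot_along T r d =
   ((r $ orig T d)^2 + (len T d)^2 - (r $ orig T (nxt T d))^2) / (2 * len T d)"

definition inset :: "('v::finite, 'm, 'z) geo_tri_scheme => real^'v => nat => real" where
 "inset T r d =
   ((cmod (tip T d))^2 + (r $ orig T d)^2 - (r $ orig T (prv T d))^2
    - 2 * Re (tip T d) * foot_along T r d) / (2 * Im (tip T d))"

text \<open>
 The square of the distance of the apex from the line that contains the edge.
\<close>

definition line_dist2 :: "('v::finite, 'm, 'z) geo_tri_scheme => real^'v => nat => real" where
 "line_dist2 T r d = (r $ orig T d)^2 - (foot_along T r d)^2"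

definition height2 :: "('v::finite, 'm, 'z) geo_tri_scheme => real^'v => nat => real" where
 "height2 T r d = line_dist2 T r d - (inset T r d)^2"

definition foot :: "('v::finite, 'm, 'z) geo_tri_scheme => real^'v => nat => complex" where
 "foot T r d = Complex (foot_along T r d) (inset T r d)"

locale metric_triangulation =
 fixes T :: "('v::finite, 'm, 'z) geo_tri_scheme"
 assumes tri: "sphere_triangulation T"
  and len_opp: "d \<in> darts T ==> len T (opp T d) = len T d"
  and nondegenerate: "d \<in> darts T ==> \<not> collinear (corner T ` face T d)"
begin

lemma finite_darts [simp, intro]: "finite (darts T)"
 using tri by (simp add: sphere_triangulation_def)

lemma dart_simps [simp]:
 assumes "d \<in> darts T"
 shows "opp T d \<in> darts T" "opp T (opp T d) = d" "opp T d ~= d"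
  "nxt T d \<in> darts T" "prv T (nxt T d) = d" "nxt T d ~= d"
  "rot T d \<in> darts T" "rot' T d \<in> darts T"
 using tri assms unfolding sphere_triangulation_def rot_def rot'_def by auto

lemma rot_rot' [simp]:
 assumes "d \<in> darts T" shows "rot T (rot' T d) = d" "rot' T (rot T d) = d"
 using assms by (auto simp: rot_def rot'_def)

lemma orig_rot [simp]:
 assumes "d \<in> darts T" shows "orig T (rot T d) = orig T d"
proof -
 have "(rot T ^^ 1) d = rot T d" by simp
 thus ?thesis using tri assms dart_simps(7)[OF assms]
  unfolding sphere_triangulation_def by (metis (no_types))
qed

lemma orig_rot' [simp]:
 assumes "d \<in> darts T" shows "orig T (rot' T d) = orig T d"
 using orig_rot[OF dart_simps(8)[OF assms]] assms by simp

lemma orig_opp [simp]: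
 assumes "d \<in> darts T" shows "orig T (opp T d) = orig T (nxt T d)"
 using orig_rot[of "nxt T d"] assms by (simp add: rot_def)

lemma target_eq [simp]:
 assumes "d \<in> darts T" shows "target T d = orig T (nxt T d)"
 using assms by (simp add: target_def)

lemma orig_nxt_opp [simp]:
 assumes "d \<in> darts T" shows "orig T (nxt T (opp T d)) = orig T d"
 using orig_rot'[OF assms] by (simp add: rot'_def)

lemma face_nxt: "d \<in> darts T ==> face T (nxt T d) = face T d"
 by (auto simp: face_def)

lemma corners_distinct:
 assumes "d \<in> darts T"
 shows "corner T d ~= corner T (nxt T d)" "corner T (nxt T d) ~= corner T (prv T d)"
  "corner T d ~= corner T (prv T d)"
 using nondegenerate[OF assms] by (auto simp: face_def insert_commute)

lemma len_pos [simp]: assumes "d \<in> darts T" shows "0 < len T d"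
 using corners_distinct(1)[OF assms] by (simp add: len_def)

lemma len_neq [simp]: assumes "d \<in> darts T" shows "len T d ~= 0"
 using len_pos[OF assms] by simp

lemma tip_props:
 assumes "d \<in> darts T"
 defines "w \<equiv> tip T d"
 shows "0 < Im w" "cmod w = len T (prv T d)"
  "cmod (w - cr (len T d)) = len T (nxt T d)"
  "Re w = ((corner T (nxt T d) - corner T d) \<bullet> (corner T (prv T d) - corner T d)) / len T d"
proof -
 define l b c where "l = len T d" and "b = len T (nxt T d)" and "c = len T (prv T d)"
 define U V where "U = corner T (nxt T d) - corner T d"
  and "V = corner T (prv T d) - corner T d"
 have lp: "l > 0" "b > 0" "c > 0" using assms by (auto simp: l_def b_def c_def)
 have l: "l^2 = U \<bullet> U" unfolding l_def U_def len_def dist_norm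
  by (simp add: power2_norm_eq_inner inner_diff inner_commute)
 have c: "c^2 = V \<bullet> V" unfolding c_def V_def len_def dist_norm
  using assms(1) by (simp add: power2_norm_eq_inner)
 have b: "b^2 = (U - V) \<bullet> (U - V)" unfolding b_def V_def U_def len_def dist_norm
  by (simp add: power2_norm_eq_inner)
 have lbc: "l^2 + c^2 - b^2 = 2 * (U \<bullet> V)"
  unfolding l b c by (simp add: inner_diff inner_commute)
 define x where "x = (U \<bullet> V) / l"
 have w: "w = Complex x (sqrt (c^2 - x^2))"
  using lp unfolding w_def tip_def x_def
  by (simp add: Let_def l_def[symmetric] b_def[symmetric] c_def[symmetric] lbc)
 have "\<bar>U \<bullet> V\<bar> ~= norm U * norm V"
 proof
  assume "\<bar>U \<bullet> V\<bar> = norm U * norm V"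
  hence "collinear {0, U, V}" by (simp add: norm_cauchy_schwarz_equal)
  hence "collinear {corner T (nxt T d), corner T d, corner T (prv T d)}"
   unfolding U_def V_def by (subst collinear_3) (simp_all add: NO_MATCH_def)
  thus False using nondegenerate[OF assms(1)] by (simp add: face_def insert_commute)
 qed
 hence "\<bar>U \<bullet> V\<bar> < norm U * norm V" using Cauchy_Schwarz_ineq2[of U V] by linarith
 hence "\<bar>U \<bullet> V\<bar>^2 < (norm U * norm V)^2" by (intro power_strict_mono) auto
 hence "(U \<bullet> V)^2 < l^2 * c^2"
  by (simp add: power_mult_distrib l c power2_norm_eq_inner)
 hence pos: "c^2 - x^2 > 0" using lp unfolding x_def by (simp add: field_simps)
 show "0 < Im w" using pos by (simp add: w)
 show cw: "cmod w = len T (prv T d)"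
  using pos lp unfolding w c_def[symmetric] by (simp add: complex_norm)
 show "cmod (w - cr (len T d)) = len T (nxt T d)"
 proof -
  have "(cmod (w - cr l))^2 = (x - l)^2 + (c^2 - x^2)"
   using pos by (simp add: w cmod_power2)
  also have "\<dots> = l^2 + c^2 - 2 * (U \<bullet> V)" using lp by (simp add: x_def power2_eq_square algebra_simps)
  also have "\<dots> = b^2" using lbc by simp
  finally show ?thesis using lp by (simp add: l_def b_def)
 qed
 show "Re w = (U \<bullet> V) / len T d" by (simp add: w x_def l_def)
qed

lemma tip_unique:
 assumes d: "d \<in> darts T" and "0 < Im z" "cmod z = len T (prv T d)"
  "cmod (z - cr (len T d)) = len T (nxt T d)"
 shows "z = tip T d"
proof -
 let ?w = "tip T d" and ?l = "len T d"
 note w = tip_props[OF d]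
 have 1: "(Re z)^2 + (Im z)^2 = (Re ?w)^2 + (Im ?w)^2"
  using assms(3) w(2) by (metis cmod_power2)
 have 2: "(Re z - ?l)^2 + (Im z)^2 = (Re ?w - ?l)^2 + (Im ?w)^2"
 proof -
  have "(cmod (z - cr ?l))^2 = (cmod (?w - cr ?l))^2" using assms(4) w(3) by simp
  thus ?thesis by (simp add: cmod_power2)
 qed
 have "2 * ?l * Re z = 2 * ?l * Re ?w" using 1 2 by algebra
 hence re: "Re z = Re ?w" using len_pos[OF d] by simp
 hence "(Im z)^2 = (Im ?w)^2" using 1 by simp
 hence "Im z = Im ?w" using assms(2) w(1) by (simp add: power2_eq_iff_nonneg)
 with re show ?thesis by (simp add: complex_eq_iff)
qed

lemma foot_equations:
 assumes d: "d \<in> darts T"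
 shows "(cmod (foot T r d))^2 + height2 T r d = (r $ orig T d)^2"
  "(cmod (foot T r d - cr (len T d)))^2 + height2 T r d = (r $ orig T (nxt T d))^2"
  "(cmod (foot T r d - tip T d))^2 + height2 T r d = (r $ orig T (prv T d))^2"
proof -
 let ?x = "foot_along T r d" and ?y = "inset T r d" and ?w = "tip T d"
 have l: "len T d > 0" "Im ?w > 0" using d tip_props(1) by auto
 show 1: "(cmod (foot T r d))^2 + height2 T r d = (r $ orig T d)^2"
  by (simp add: foot_def height2_def line_dist2_def cmod_power2)
 have "2 * len T d * ?x = (r $ orig T d)^2 + (len T d)^2 - (r $ orig T (nxt T d))^2"
  using l by (simp add: foot_along_def)
 moreover have "(cmod (foot T r d - cr (len T d)))^2 = (?x - len T d)^2 + ?y^2"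
  by (simp add: foot_def cmod_power2)
 ultimately show "(cmod (foot T r d - cr (len T d)))^2 + height2 T r d = (r $ orig T (nxt T d))^2"
  unfolding height2_def line_dist2_def by algebra
 have "2 * Im ?w * ?y = (cmod ?w)^2 + (r $ orig T d)^2 - (r $ orig T (prv T d))^2
    - 2 * Re ?w * ?x" using l by (simp add: inset_def)
 moreover have "(cmod (foot T r d - ?w))^2 = (?x - Re ?w)^2 + (?y - Im ?w)^2"
  by (simp add: foot_def cmod_power2)
 moreover have "(cmod ?w)^2 = (Re ?w)^2 + (Im ?w)^2" by (simp add: cmod_power2)
 ultimately show "(cmod (foot T r d - ?w))^2 + height2 T r d = (r $ orig T (prv T d))^2"
  unfolding height2_def line_dist2_def by algebra
qed

text \<open>
 The equations between the foot and the three radii are linear in the foot after subtraction, which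
 makes the normal forms at the three darts of a face comparable.
\<close>

lemma foot_unique:
 assumes d: "d \<in> darts T"
  and "(cmod p)^2 + e = (r $ orig T d)^2"
  "(cmod (p - cr (len T d)))^2 + e = (r $ orig T (nxt T d))^2"
  "(cmod (p - tip T d))^2 + e = (r $ orig T (prv T d))^2"
 shows "p = foot T r d" "e = height2 T r d"
proof -
 let ?w = "tip T d" and ?q = "foot T r d"
 have l: "len T d > 0" "Im ?w > 0" using d tip_props(1) by auto
 note q = foot_equations[OF d, of r]
 have E: "(cmod (x - cr (len T d)))^2 = (cmod x)^2 - 2 * len T d * Re x + (len T d)^2"
   "(cmod (x - ?w))^2 = (cmod x)^2 - 2 * (Re x * Re ?w + Im x * Im ?w) + (cmod ?w)^2" for x
  unfolding cmod_power2 by (simp_all add: power2_eq_square algebra_simps)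
 have "2 * len T d * Re p = 2 * len T d * Re ?q"
  using assms(2,3) q(1,2) unfolding E by linarith
 hence re: "Re p = Re ?q" using l by simp
 have "Re p * Re ?w + Im p * Im ?w = Re ?q * Re ?w + Im ?q * Im ?w"
  using assms(2,4) q(1,3) unfolding E by algebra
 hence im: "Im p = Im ?q" using l re by simp
 show "p = ?q" using re im by (simp add: complex_eq_iff)
 thus "e = height2 T r d" using assms(2) q(1) by simp
qed

definition side_dir :: "nat => complex" where
 "side_dir d = (tip T d - cr (len T d)) / cr (len T (nxt T d))"

lemma side_dir:
 assumes d: "d \<in> darts T"
 shows "cmod (side_dir d) = 1"
  "tip T d = cr (len T d) + cr (len T (nxt T d)) * side_dir d"
  "Im (side_dir d) > 0"
proof -
 have l: "len T (nxt T d) > 0" "Im (tip T d) > 0" using d tip_props(1) by auto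
 show "cmod (side_dir d) = 1" "tip T d = cr (len T d) + cr (len T (nxt T d)) * side_dir d"
  using l tip_props(3)[OF d] by (auto simp: side_dir_def norm_divide)
 show "Im (side_dir d) > 0" using l by (simp add: side_dir_def)
qed

text \<open>
 The change of coordinates from the normal form at \<open>nxt T d\<close> to the normal form at
 \<open>d\<close>.
\<close>

definition frame_nxt :: "nat => complex => complex" where
 "frame_nxt d z = cr (len T d) + z * side_dir d"

lemma tip_nxt:
 assumes d: "d \<in> darts T"
 shows "frame_nxt d (tip T (nxt T d)) = 0"
proof -
 let ?u = "side_dir d"
 note u = side_dir[OF d]
 have u0: "?u ~= 0" using u by auto
 have cu: "cnj ?u * ?u = 1" using u(1) complex_norm_square[of ?u] by (simp add: mult.commute)
 have "- (len T d) *\<^sub>R cnj ?u = tip T (nxt T d)"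
 proof (rule tip_unique)
  show "0 < Im (- len T d *\<^sub>R cnj ?u)" using u(3) d by simp
  show "cmod (- len T d *\<^sub>R cnj ?u) = len T (prv T (nxt T d))"
   using u(1) d by (simp add: less_imp_le)
  have "cmod (- len T d *\<^sub>R cnj ?u - cr (len T (nxt T d)))
    = cmod (?u * (- len T d *\<^sub>R cnj ?u - cr (len T (nxt T d))))"
   using u(1) by (simp only: norm_mult)
  also have "?u * (- len T d *\<^sub>R cnj ?u - cr (len T (nxt T d))) = - tip T d"
   using u(2) cu by (simp add: scaleR_conv_of_real algebra_simps)
  finally show "cmod (- len T d *\<^sub>R cnj ?u - cr (len T (nxt T d))) = len T (prv T d)"
   using tip_props(2)[OF d] by simp
  show "nxt T d \<in> darts T" using d by simp
 qed
 hence w: "tip T (nxt T d) = - (len T d) *\<^sub>R cnj ?u" by simp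
 show ?thesis using cu unfolding frame_nxt_def w
  by (simp add: scaleR_conv_of_real algebra_simps)
qed

lemma frame_nxt_dist:
 assumes d: "d \<in> darts T"
 shows "cmod (frame_nxt d z - frame_nxt d z') = cmod (z - z')"
proof -
 have "frame_nxt d z - frame_nxt d z' = (z - z') * side_dir d"
  by (simp add: frame_nxt_def algebra_simps)
 thus ?thesis by (simp add: norm_mult side_dir(1)[OF d])
qed

lemma frame_nxt_simps [simp]:
 "frame_nxt d 0 = cr (len T d)"
 "d \<in> darts T ==> frame_nxt d (cr (len T (nxt T d))) = tip T d"
 using side_dir(2) by (auto simp: frame_nxt_def)

lemma frame_nxt_surj:
 assumes d: "d \<in> darts T" shows "\<exists>z'. frame_nxt d z' = z"
proof -
 have "side_dir d ~= 0" using side_dir(1)[OF d] by auto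
 thus ?thesis by (intro exI[of _ "(z - cr (len T d)) / side_dir d"]) (simp add: frame_nxt_def)
qed

lemma foot_nxt:
 assumes d: "d \<in> darts T"
 shows "frame_nxt d (foot T r (nxt T d)) = foot T r d" "height2 T r (nxt T d) = height2 T r d"
proof -
 obtain q where q: "frame_nxt d q = foot T r d" using frame_nxt_surj[OF d] by blast
 note e = foot_equations[OF d, of r]
 have "(cmod q)^2 + height2 T r d = (r $ orig T (nxt T d))^2"
  using frame_nxt_dist[OF d, of q 0] e(2) by (simp add: q)
 moreover have "(cmod (q - cr (len T (nxt T d))))^2 + height2 T r d = (r $ orig T (prv T d))^2"
  using frame_nxt_dist[OF d, of q "cr (len T (nxt T d))"] e(3) d by (simp add: q)
 moreover have "(cmod (q - tip T (nxt T d)))^2 + height2 T r d = (r $ orig T (prv T (nxt T d)))^2"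
  using frame_nxt_dist[OF d, of q "tip T (nxt T d)"] e(1) d tip_nxt[OF d] by (simp add: q)
 ultimately have "q = foot T r (nxt T d)" "height2 T r d = height2 T r (nxt T d)"
  using foot_unique[of "nxt T d" q "height2 T r d" r] d by auto
 thus "frame_nxt d (foot T r (nxt T d)) = foot T r d" "height2 T r (nxt T d) = height2 T r d"
  using q by auto
qed

lemma tip_nxt_nxt:
 assumes d: "d \<in> darts T"
 defines "e \<equiv> prv T d"
 shows "frame_nxt d (frame_nxt (nxt T d) z) = (cr (len T e) - z) * (tip T d / cr (len T e))"
proof -
 let ?u = "side_dir d" and ?u' = "side_dir (nxt T d)" and ?l = "cr (len T d) :: complex"
  and ?m = "cr (len T (nxt T d)) :: complex" and ?n = "cr (len T e) :: complex"
 have d': "nxt T d \<in> darts T" using d by simp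
 have n0: "?n ~= 0" using d by (simp add: e_def)
 have w: "tip T d = ?l + ?m * ?u" using side_dir(2)[OF d] .
 have "tip T (nxt T d) = ?m + ?n * ?u'" using side_dir(2)[OF d'] by (simp add: e_def)
 hence z: "?l + (?m + ?n * ?u') * ?u = 0" using tip_nxt[OF d] by (simp add: frame_nxt_def)
 have "?u' * ?u = - tip T d / ?n"
 proof -
  have "?n * (?u' * ?u) = ?l + (?m + ?n * ?u') * ?u - (?l + ?m * ?u)" by (simp add: algebra_simps)
  also have "\<dots> = - tip T d" by (simp add: z w)
  finally show ?thesis using n0 by (simp add: field_simps)
 qed
 hence "frame_nxt d (frame_nxt (nxt T d) z) = tip T d + z * (- tip T d / ?n)"
  by (simp add: frame_nxt_def w algebra_simps)
 also have "\<dots> = (?n - z) * (tip T d / ?n)" using n0 by (simp add: field_simps)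
 finally show ?thesis .
qed

text \<open>
 The same apex, seen from the other edge at the origin of \<open>d\<close>.  The angle \<open>Arg (tip T
 d)\<close> between the two edges enters through its cosine and sine.
\<close>

lemma foot_rot:
 assumes d: "d \<in> darts T"
 defines "e \<equiv> prv T d"
 shows "foot T r d * cnj (tip T d / cr (len T e)) = cr (len T e) - foot T r e"
  and "height2 T r e = height2 T r d"
  and "foot_along T r (rot T d) = len T e - foot_along T r e"
  and "line_dist2 T r (rot T d) = height2 T r d + (inset T r e)^2"
  and "len T (rot T d) = len T e"
  and "line_dist2 T r (rot T d) = line_dist2 T r e"
proof -
 have d': "nxt T d \<in> darts T" "e \<in> darts T" using d by (auto simp: e_def)
 have l: "len T e > 0" using d' by simp
 let ?k = "tip T d / cr (len T e)"
 have k: "cmod ?k = 1" using tip_props(2)[OF d] l by (simp add: norm_divide e_def)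
 have "foot T r d = frame_nxt d (frame_nxt (nxt T d) (foot T r e))"
  using foot_nxt(1)[OF d, of r] foot_nxt(1)[OF d'(1), of r] by (simp add: e_def)
 also have "\<dots> = (cr (len T e) - foot T r e) * ?k"
  using tip_nxt_nxt[OF d] by (simp add: e_def)
 finally have "foot T r d * cnj ?k = (cr (len T e) - foot T r e) * (?k * cnj ?k)" by (simp add: mult.assoc)
 thus "foot T r d * cnj ?k = cr (len T e) - foot T r e"
  using k complex_norm_square[of ?k] by simp
 show h: "height2 T r e = height2 T r d" using foot_nxt(2)[OF d] foot_nxt(2)[OF d'(1)] by (simp add: e_def)
 show lr: "len T (rot T d) = len T e" using d' by (simp add: rot_def e_def[symmetric] len_opp)
 have o: "orig T (nxt T (rot T d)) = orig T e" "orig T (nxt T e) = orig T d"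
  using d d' by (auto simp: rot_def e_def)
 show f: "foot_along T r (rot T d) = len T e - foot_along T r e"
  using l d orig_rot[OF d] unfolding foot_along_def lr o by (simp add: field_simps power2_eq_square)
 have "(len T e - foot_along T r e)^2 = (len T e)^2 - 2 * len T e * foot_along T r e + (foot_along T r e)^2"
  by (simp add: power2_eq_square algebra_simps)
 moreover have "2 * len T e * foot_along T r e = (r $ orig T e)^2 + (len T e)^2 - (r $ orig T d)^2"
  using l by (simp add: foot_along_def o)
 ultimately show g: "line_dist2 T r (rot T d) = line_dist2 T r e"
  using d unfolding line_dist2_def f by simp
 show "line_dist2 T r (rot T d) = height2 T r d + (inset T r e)^2"
  using h by (simp add: g height2_def)
qed

lemma line_dist2_opp:
 assumes d: "d \<in> darts T"
 shows "foot_along T r (opp T d) = len T d - foot_along T r d" "line_dist2 T r (opp T d) = line_dist2 T r d"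
proof -
 have l: "len T d > 0" using d by simp
 show f: "foot_along T r (opp T d) = len T d - foot_along T r d"
  using l d by (simp add: foot_along_def len_opp field_simps power2_eq_square)
 have "(len T d - foot_along T r d)^2 = (len T d)^2 - 2 * len T d * foot_along T r d + (foot_along T r d)^2"
  by (simp add: power2_eq_square algebra_simps)
 moreover have "2 * len T d * foot_along T r d = (r $ orig T d)^2 + (len T d)^2 - (r $ orig T (nxt T d))^2"
  using l by (simp add: foot_along_def)
 ultimately show "line_dist2 T r (opp T d) = line_dist2 T r d"
  using d unfolding line_dist2_def f by simp
qed

end

section \<open>Pyramids over the faces\<close>

definition acot :: "real => real" where "acot x = pi / 2 - arctan x"

lemma acot_bounds: "0 < acot x" "acot x < pi"
 using arctan_lbound[of x] arctan_ubound[of x] by (auto simp: acot_def)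

lemma cos_acot: "cos (acot x) = x / sqrt (1 + x^2)"
 by (simp add: acot_def cos_diff sin_arctan)

lemma sin_acot: "sin (acot x) = 1 / sqrt (1 + x^2)"
 by (simp add: acot_def sin_diff cos_arctan)

lemma arccos_eq_acot:
 assumes "y > 0" "s > 0" "s^2 = x^2 + y^2"
 shows "arccos (x / s) = acot (x / y)"
proof -
 have "sqrt (1 + (x / y)^2) = s / y"
 proof (rule real_sqrt_unique)
  show "(s / y)^2 = 1 + (x / y)^2" using assms by (simp add: power_divide field_simps)
 qed (use assms in simp)
 hence "cos (acot (x / y)) = x / s" using assms by (simp add: cos_acot)
 thus ?thesis using acot_bounds[of "x / y"] by (metis arccos_cos less_imp_le)
qed

lemma perp_part_inner:
 assumes "n ~= 0"
 shows "perp_part n a \<bullet> perp_part n b = a \<bullet> b - (a \<bullet> n) * (b \<bullet> n) / (n \<bullet> n)"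
 using assms by (simp add: perp_part_def inner_diff inner_commute field_simps)

text \<open>
 Only scalar products with the edge vectors occur, so that the angle can be computed from distances,
 without coordinates for the pyramid in space.
\<close>

lemma dihedral_angle_eq:
 fixes p q u v :: "'a::real_inner"
 assumes "q ~= p"
 defines "n \<equiv> q - p" and "a \<equiv> u - p" and "b \<equiv> v - p"
 shows "dihedral_angle p q u v =
  arccos ((a \<bullet> b - (a \<bullet> n) * (b \<bullet> n) / (n \<bullet> n)) /
   (sqrt (a \<bullet> a - (a \<bullet> n)^2 / (n \<bullet> n)) * sqrt (b \<bullet> b - (b \<bullet> n)^2 / (n \<bullet> n))))"
proof -
 have "n ~= 0" using assms by simp
 note P = perp_part_inner[OF this]
 show ?thesis
  unfolding dihedral_angle_def vec_angle_def norm_eq_sqrt_inner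
  by (simp add: P n_def[symmetric] a_def[symmetric] b_def[symmetric] power2_eq_square)
qed

lemma vec_angle_dist:
 assumes "dist x y = l" "dist a x = p" "dist a y = q" "0 < p" "0 < q"
 shows "vec_angle (x - a) (y - a) = arccos ((p^2 + q^2 - l^2) / (2 * p * q))"
proof -
 have n: "norm (x - a) = p" "norm (y - a) = q" "norm ((x - a) - (y - a)) = l"
  using assms by (auto simp: dist_norm norm_minus_commute)
 have "(x - a) \<bullet> (y - a) = (p^2 + q^2 - l^2) / 2"
  using dot_norm_neg[of "x - a" "y - a"] unfolding n .
 hence "(x - a) \<bullet> (y - a) / (p * q) = (p^2 + q^2 - l^2) / (2 * p * q)"
  using assms(4,5) by (simp add: field_simps)
 thus ?thesis by (simp add: vec_angle_def n)
qed

lemma coplanar_common_normal: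
 fixes p :: "real^3"
 assumes "coplanar {p, q, r, s}"
 shows "\<exists>n. n ~= 0 \<and> n \<bullet> (q - p) = 0 \<and> n \<bullet> (r - p) = 0 \<and> n \<bullet> (s - p) = 0"
proof -
 obtain u v w where uvw: "{p, q, r, s} \<subseteq> affine hull {u, v, w}"
  using assms unfolding coplanar_def by blast
 have "dim {v - u, w - u} <= card {v - u, w - u}" by (rule dim_le_card') auto
 also have "\<dots> <= 2" by (simp add: card_insert_if)
 finally have "dim {v - u, w - u} < DIM(real^3)" by simp
 then obtain n where n: "n ~= 0" "span {v - u, w - u} \<subseteq> {x. n \<bullet> x = 0}"
  using lowdim_subset_hyperplane by blast
 have "{v - u, w - u} \<subseteq> {x. n \<bullet> x = 0}" using span_superset n(2) by (rule order_trans)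
 hence nv: "n \<bullet> (v - u) = 0" "n \<bullet> (w - u) = 0" by auto
 have "n \<bullet> x = n \<bullet> u" if "x \<in> {p, q, r, s}" for x
 proof -
  have "x \<in> affine hull {u, v, w}" using uvw that by blast
  then obtain a b c where "a + b + c = 1" "x = a *\<^sub>R u + b *\<^sub>R v + c *\<^sub>R w"
   unfolding affine_hull_3 by blast
  moreover have "n \<bullet> v = n \<bullet> u" "n \<bullet> w = n \<bullet> u" using nv by (auto simp: inner_diff_right)
  ultimately show ?thesis by (simp add: inner_add_right distrib_right[symmetric])
 qed
 thus ?thesis using n(1) by (intro exI[of _ n]) (simp add: inner_diff_right)
qed

definition apex_height :: "('v::finite, 'm, 'z) geo_tri_scheme => real^'v => nat => real" where
 "apex_height T r d = sqrt (height2 T r d)"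

definition line_dist :: "('v::finite, 'm, 'z) geo_tri_scheme => real^'v => nat => real" where
 "line_dist T r d = sqrt (line_dist2 T r d)"

context metric_triangulation
begin

lemma pyramid_inner:
 assumes d: "d \<in> darts T" and pyr: "is_pyramid T r d (a, x, y, z)"
 defines "A \<equiv> a - x" and "B \<equiv> y - x" and "C \<equiv> z - x" and "w \<equiv> tip T d"
 shows "A \<bullet> A = (r $ orig T d)^2" "B \<bullet> B = (len T d)^2" "C \<bullet> C = (cmod w)^2"
  "A \<bullet> B = len T d * foot_along T r d"
  "A \<bullet> C = Re w * foot_along T r d + Im w * inset T r d"
  "B \<bullet> C = len T d * Re w"
proof -
 note P = pyr[unfolded is_pyramid_def prod.case]
 have l: "len T d > 0" "Im w > 0" using d tip_props(1) by (auto simp: w_def)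
 have *: "(u - v) \<bullet> (u - v) = k^2" if "dist u v = k" for u v :: "real^3" and k
  using power2_norm_eq_inner[of "u - v"] that by (simp add: dist_norm)
 show AA: "A \<bullet> A = (r $ orig T d)^2" using *[of a x] P by (simp add: A_def)
 show BB: "B \<bullet> B = (len T d)^2" using *[of y x] P by (simp add: B_def dist_commute)
 show CC: "C \<bullet> C = (cmod w)^2" using *[of z x] P d by (simp add: C_def w_def tip_props)
 have "(A - B) \<bullet> (A - B) = (r $ orig T (nxt T d))^2" using *[of a y] P by (simp add: A_def B_def)
 hence AB: "2 * (A \<bullet> B) = (r $ orig T d)^2 + (len T d)^2 - (r $ orig T (nxt T d))^2"
  using AA BB by (simp add: inner_diff inner_commute)
 thus "A \<bullet> B = len T d * foot_along T r d" using l by (simp add: foot_along_def)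
 have "(A - C) \<bullet> (A - C) = (r $ orig T (prv T d))^2" using *[of a z] P by (simp add: A_def C_def)
 hence AC: "2 * (A \<bullet> C) = (r $ orig T d)^2 + (cmod w)^2 - (r $ orig T (prv T d))^2"
  using AA CC by (simp add: inner_diff inner_commute)
 have "2 * Im w * inset T r d = (cmod w)^2 + (r $ orig T d)^2 - (r $ orig T (prv T d))^2
    - 2 * Re w * foot_along T r d" using l by (simp add: inset_def w_def)
 thus "A \<bullet> C = Re w * foot_along T r d + Im w * inset T r d" using AC by linarith
 have "(C - B) \<bullet> (C - B) = (len T (nxt T d))^2" using *[of z y] P by (simp add: C_def B_def dist_commute)
 also have "\<dots> = (cmod (w - cr (len T d)))^2" using d by (simp add: w_def tip_props)
 also have "\<dots> = (cmod w)^2 - 2 * (len T d * Re w) + (len T d)^2"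
  unfolding cmod_power2 by (simp add: power2_eq_square algebra_simps)
 finally show "B \<bullet> C = len T d * Re w" using CC BB by (simp add: inner_diff inner_commute)
qed

lemma pyramid_height_pos:
 assumes d: "d \<in> darts T" and pyr: "is_pyramid T r d p"
 shows "height2 T r d > 0"
proof -
 obtain a x y z where p: "p = (a, x, y, z)" by (cases p) auto
 define A B C where "A = a - x" and "B = y - x" and "C = z - x"
 define w px sg where "w = tip T d" and "px = foot_along T r d" and "sg = inset T r d"
 note I = pyramid_inner[OF d pyr[unfolded p], folded A_def B_def C_def w_def px_def sg_def]
 have l: "len T d > 0" "Im w > 0" using d tip_props(1) by (auto simp: w_def)
 define g b where "g = sg / Im w" and "b = (px - g * Re w) / len T d"
 have g: "g * Im w = sg" and b: "b * len T d = px - g * Re w" using l by (auto simp: g_def b_def)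
 define E where "E = A - b *\<^sub>R B - g *\<^sub>R C"
 have EB: "E \<bullet> B = 0"
  unfolding E_def using I b by (simp add: inner_diff inner_commute power2_eq_square) algebra
 have EC: "E \<bullet> C = 0"
  unfolding E_def using I b g by (simp add: inner_diff inner_commute cmod_power2) algebra
 have "E \<bullet> E = E \<bullet> A" using EB EC by (simp add: E_def inner_diff)
 also have "\<dots> = height2 T r d"
  unfolding E_def using I b g
  by (simp add: inner_diff inner_commute height2_def line_dist2_def px_def[symmetric] sg_def[symmetric]) algebra
 finally have EE: "E \<bullet> E = height2 T r d" .
 have "E ~= 0"
 proof
  assume "E = 0"
  hence "a = (1 - b - g) *\<^sub>R x + b *\<^sub>R y + g *\<^sub>R z"
   by (simp add: E_def A_def B_def C_def algebra_simps)
  hence "a \<in> affine hull {x, y, z}" unfolding affine_hull_3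
   by (intro CollectI exI[of _ "1 - b - g"] exI[of _ b] exI[of _ g]) simp
  hence "{a, x, y, z} \<subseteq> affine hull {x, y, z}" by (simp add: hull_inc)
  hence "coplanar {a, x, y, z}" unfolding coplanar_def by blast
  thus False using pyr by (simp add: p is_pyramid_def)
 qed
 thus ?thesis using EE by (metis inner_gt_zero_iff)
qed

text \<open>
 Placing the base in a coordinate plane gives the pyramid.  The statement on normals rules out
 coplanarity and is used again for the spherical triangle cut out at the apex.
\<close>

lemma spanning_pyramid_exists:
 assumes d: "d \<in> darts T" and r: "!!i. 0 < r $ i" and h: "height2 T r d > 0"
 shows "\<exists>a x y z. is_pyramid T r d (a, x, y, z) \<and>
  (\<forall>n. n \<bullet> (x - a) = 0 \<and> n \<bullet> (y - a) = 0 \<and> n \<bullet> (z - a) = 0 --> n = 0)"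
proof -
 define w px sg where "w = tip T d" and "px = foot_along T r d" and "sg = inset T r d"
 have l: "len T d > 0" "Im w > 0" using d tip_props(1) by (auto simp: w_def)
 define H where "H = sqrt (height2 T r d)"
 have H: "H^2 = height2 T r d" "H > 0" using h by (auto simp: H_def)
 define a x y z :: "real^3" where "a = vector [px, sg, H]" and "x = 0"
  and "y = vector [len T d, 0, 0]" and "z = vector [Re w, Im w, 0]"
 have D: "dist u v = k" if "(u $ 1 - v $ 1)^2 + (u $ 2 - v $ 2)^2 + (u $ 3 - v $ 3)^2 = k^2" "k > 0"
  for u v :: "real^3" and k
  using that by (simp add: dist_norm norm_eq_sqrt_inner inner_vec_def sum_3 flip: power2_eq_square)
 note F = foot_equations[OF d, of r]
 have c: "(cmod (foot T r d))^2 = px^2 + sg^2"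
  "(cmod (foot T r d - cr (len T d)))^2 = (px - len T d)^2 + sg^2"
  "(cmod (foot T r d - w))^2 = (px - Re w)^2 + (sg - Im w)^2"
  by (simp_all add: foot_def cmod_power2 px_def sg_def)
 have "dist x y = len T d" by (rule D) (use l in \<open>auto simp: x_def y_def\<close>)
 moreover have "dist y z = len T (nxt T d)"
 proof (rule D)
  show "(y $ 1 - z $ 1)^2 + (y $ 2 - z $ 2)^2 + (y $ 3 - z $ 3)^2 = (len T (nxt T d))^2"
   unfolding tip_props(3)[OF d, symmetric] cmod_power2
   by (simp add: y_def z_def w_def power2_commute)
 qed (use d in simp)
 moreover have "dist z x = len T (prv T d)"
 proof (rule D)
  show "(z $ 1 - x $ 1)^2 + (z $ 2 - x $ 2)^2 + (z $ 3 - x $ 3)^2 = (len T (prv T d))^2"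
   unfolding tip_props(2)[OF d, symmetric] cmod_power2
   by (simp add: x_def z_def w_def)
 qed (use d in simp)
 moreover have "dist a x = r $ orig T d"
  by (rule D) (use F(1) c r H in \<open>auto simp: a_def x_def\<close>)
 moreover have "dist a y = r $ orig T (nxt T d)"
  by (rule D) (use F(2) c r H in \<open>auto simp: a_def y_def\<close>)
 moreover have "dist a z = r $ orig T (prv T d)"
  by (rule D) (use F(3) c r H in \<open>auto simp: a_def z_def w_def\<close>)
 moreover have N: "n = 0" if "n \<bullet> y = 0" "n \<bullet> z = 0" "n \<bullet> a = 0" for n
  using that l H by (auto simp: inner_vec_def sum_3 a_def y_def z_def vec_eq_iff forall_3)
 moreover have "\<not> coplanar {a, x, y, z}"
 proof
  assume "coplanar {a, x, y, z}"
  hence "coplanar {x, y, z, a}" by (simp add: insert_commute)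
  from coplanar_common_normal[OF this] obtain n where
   "n ~= 0" "n \<bullet> y = 0" "n \<bullet> z = 0" "n \<bullet> a = 0" by (auto simp: x_def)
  thus False using N by blast
 qed
 ultimately have "is_pyramid T r d (a, x, y, z)" by (simp add: is_pyramid_def)
 moreover have "n = 0" if "n \<bullet> (x - a) = 0" "n \<bullet> (y - a) = 0" "n \<bullet> (z - a) = 0" for n
  using that by (intro N) (auto simp: x_def inner_diff_right)
 ultimately show ?thesis by blast
qed

lemma pyramid_exists:
 assumes "d \<in> darts T" "!!i. 0 < r $ i" "height2 T r d > 0"
 shows "\<exists>p. is_pyramid T r d p"
 using spanning_pyramid_exists[OF assms] by blast

text \<open>
 This is the existence of all pyramids, expressed through the heights (\<open>admissible_iff\<close>).
\<close>

definition admissible :: "real^'v => bool" where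
 "admissible r \<longleftrightarrow> (\<forall>i. 0 < r $ i) \<and> (\<forall>d\<in>darts T. 0 < height2 T r d)"

lemma admissible_iff:
 "admissible r \<longleftrightarrow> (\<forall>i. 0 < r $ i) \<and> (\<forall>d\<in>darts T. \<exists>p. is_pyramid T r d p)"
 unfolding admissible_def using pyramid_height_pos pyramid_exists by blast

lemma admissibleD:
 assumes "admissible r"
 shows "0 < r $ i" "d \<in> darts T ==> 0 < height2 T r d" "d \<in> darts T ==> 0 < apex_height T r d"
  "d \<in> darts T ==> (apex_height T r d)^2 = height2 T r d"
  "d \<in> darts T ==> 0 < line_dist2 T r d" "d \<in> darts T ==> 0 < line_dist T r d"
  "d \<in> darts T ==> (line_dist T r d)^2 = line_dist2 T r d"
  "d \<in> darts T ==> (line_dist T r d)^2 = (apex_height T r d)^2 + (inset T r d)^2"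
proof -
 have *: "0 < height2 T r d" if "d \<in> darts T" for d using assms that by (simp add: admissible_def)
 have **: "0 < line_dist2 T r d" if "d \<in> darts T" for d using *[OF that]
  unfolding height2_def using zero_le_power2[of "inset T r d"] by linarith
 show "0 < r $ i" "d \<in> darts T ==> 0 < height2 T r d" "d \<in> darts T ==> 0 < apex_height T r d"
  "d \<in> darts T ==> (apex_height T r d)^2 = height2 T r d"
  "d \<in> darts T ==> 0 < line_dist2 T r d" "d \<in> darts T ==> 0 < line_dist T r d"
  "d \<in> darts T ==> (line_dist T r d)^2 = line_dist2 T r d"
  "d \<in> darts T ==> (line_dist T r d)^2 = (apex_height T r d)^2 + (inset T r d)^2"
  using * ** assms by (auto simp: admissible_def apex_height_def line_dist_def height2_def less_imp_le)
qed

lemma pyramid_some: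
 assumes "d \<in> darts T" "admissible r"
 obtains a x y z where "pyramid T r d = (a, x, y, z)" "is_pyramid T r d (a, x, y, z)"
proof -
 have "is_pyramid T r d (pyramid T r d)"
  unfolding pyramid_def by (rule someI_ex) (use assms admissible_iff in blast)
 thus ?thesis using that by (cases "pyramid T r d") auto
qed

lemma base_dihedral_eq:
 assumes d: "d \<in> darts T" and r: "admissible r"
 shows "base_dihedral T r d = acot (inset T r d / apex_height T r d)"
  "base_dihedral T r d = arccos (inset T r d / line_dist T r d)"
proof -
 obtain a x y z where p: "pyramid T r d = (a, x, y, z)" "is_pyramid T r d (a, x, y, z)"
  using pyramid_some[OF d r] .
 define w px sg where "w = tip T d" and "px = foot_along T r d" and "sg = inset T r d"
 note I = pyramid_inner[OF d p(2), folded w_def px_def sg_def]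
 have l: "len T d > 0" "Im w > 0" using d tip_props(1) by (auto simp: w_def)
 note A = admissibleD[OF r]
 have "y ~= x" using p(2) l by (auto simp: is_pyramid_def)
 note D = dihedral_angle_eq[OF this, of a z]
 have e: "(a - x) \<bullet> (z - x) - (a - x) \<bullet> (y - x) * ((z - x) \<bullet> (y - x)) / ((y - x) \<bullet> (y - x)) = sg * Im w"
  using I l by (simp add: inner_commute field_simps power2_eq_square)
 have f: "(a - x) \<bullet> (a - x) - ((a - x) \<bullet> (y - x))^2 / ((y - x) \<bullet> (y - x)) = line_dist2 T r d"
  using I l by (simp add: inner_commute field_simps power2_eq_square line_dist2_def px_def)
 have g: "(z - x) \<bullet> (z - x) - ((z - x) \<bullet> (y - x))^2 / ((y - x) \<bullet> (y - x)) = (Im w)^2"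
  using I l by (simp add: inner_commute cmod_power2 power_mult_distrib)
 have "base_dihedral T r d = dihedral_angle x y a z" using p by (simp add: base_dihedral_def)
 also have "\<dots> = arccos (sg / line_dist T r d)"
  unfolding D e f g using l by (simp add: line_dist_def)
 finally show 1: "base_dihedral T r d = arccos (inset T r d / line_dist T r d)" by (simp add: sg_def)
 show "base_dihedral T r d = acot (inset T r d / apex_height T r d)"
  unfolding 1 using A(3,6)[OF d] by (rule arccos_eq_acot) (simp add: A(8)[OF d])
qed

text \<open>
 The cotangent of the dihedral angle at the side edge over the origin of \<open>d\<close>.
\<close>

definition side_cot :: "real^'v => nat => real" where
 "side_cot r d = (line_dist2 T r d * (Re (tip T d) / Im (tip T d))
   - foot_along T r d * inset T r d) / (r $ orig T d * apex_height T r d)"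

lemma side_dihedral_eq:
 assumes d: "d \<in> darts T" and r: "admissible r"
 shows "side_dihedral T r d = acot (side_cot r d)"
proof -
 obtain a x y z where p: "pyramid T r d = (a, x, y, z)" "is_pyramid T r d (a, x, y, z)"
  using pyramid_some[OF d r] .
 define w px sg r0 R where "w = tip T d" and "px = foot_along T r d" and "sg = inset T r d"
  and "r0 = r $ orig T d" and "R = r0^2"
 note I = pyramid_inner[OF d p(2), folded w_def px_def sg_def r0_def, folded R_def]
 have l: "len T d > 0" "Im w > 0" using d tip_props(1) by (auto simp: w_def)
 note A = admissibleD[OF r]
 have r0: "r0 > 0" "R > 0" using A(1)[of "orig T d"] by (auto simp: r0_def R_def)
 define m where "m = Re w * px + Im w * sg"
 have "x ~= a" using p(2) r0 by (auto simp: is_pyramid_def r0_def)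
 note D = dihedral_angle_eq[OF this, of y z]
 have I': "(y - a) \<bullet> (z - a) = len T d * Re w - len T d * px - m + R"
  "(y - a) \<bullet> (x - a) = R - len T d * px" "(z - a) \<bullet> (x - a) = R - m" "(x - a) \<bullet> (x - a) = R"
  "(y - a) \<bullet> (y - a) = (len T d)^2 - 2 * (len T d * px) + R"
  "(z - a) \<bullet> (z - a) = (cmod w)^2 - 2 * m + R"
 proof -
  define A B C where ABC: "A = a - x" "B = y - x" "C = z - x"
  have e: "y - a = B - A" "z - a = C - A" "x - a = - A" by (auto simp: ABC)
  note I = I[folded ABC]
  show "(y - a) \<bullet> (z - a) = len T d * Re w - len T d * px - m + R"
  "(y - a) \<bullet> (x - a) = R - len T d * px" "(z - a) \<bullet> (x - a) = R - m" "(x - a) \<bullet> (x - a) = R"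
  "(y - a) \<bullet> (y - a) = (len T d)^2 - 2 * (len T d * px) + R"
  "(z - a) \<bullet> (z - a) = (cmod w)^2 - 2 * m + R"
   unfolding e using I by (simp_all add: inner_diff inner_commute m_def)
 qed
 define L V where "L = line_dist2 T r d" and "V = (cmod w)^2 * R - m^2"
 have L: "L > 0" "L = R - px^2" using A d by (auto simp: L_def line_dist2_def r0_def R_def px_def)
 define h where "h = apex_height T r d"
 have h: "h > 0" "h^2 = L - sg^2" using A d by (auto simp: h_def L_def height2_def sg_def)
 have key: "(Re w * R - px * m)^2 + (r0 * h * Im w)^2 = L * V"
  using h(2) L(2) R_def unfolding V_def m_def cmod_power2 by algebra
 have LV: "0 < L * V" unfolding key[symmetric] using r0 h l by (intro add_nonneg_pos) auto
 hence V: "V > 0" using L by (simp add: zero_less_mult_iff)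
 have "side_dihedral T r d = dihedral_angle a x y z" using p by (simp add: side_dihedral_def)
 also have "\<dots> = arccos ((len T d * (Re w * R - px * m) / R) / (sqrt ((len T d)^2 * L / R) * sqrt (V / R)))"
 proof -
  have 1: "len T d * Re w - len T d * px - m + R - (R - len T d * px) * (R - m) / R
    = len T d * (Re w * R - px * m) / R" using r0 by (simp add: field_simps)
  have 2: "(len T d)^2 - 2 * (len T d * px) + R - (R - len T d * px)^2 / R = (len T d)^2 * L / R"
   using r0 unfolding L(2) by (simp add: field_simps power2_eq_square)
  have 3: "(cmod w)^2 - 2 * m + R - (R - m)^2 / R = V / R"
   using r0 unfolding V_def by (simp add: field_simps power2_eq_square)
  show ?thesis unfolding D I' 1 2 3 ..
 qed
 also have "(len T d * (Re w * R - px * m) / R) / (sqrt ((len T d)^2 * L / R) * sqrt (V / R))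
   = (Re w * R - px * m) / sqrt (L * V)"
  using l r0 by (simp add: real_sqrt_divide real_sqrt_mult)
 also have "arccos \<dots> = acot ((Re w * R - px * m) / (r0 * h * Im w))"
  by (rule arccos_eq_acot) (use r0 h l LV key in auto)
 also have "(Re w * R - px * m) / (r0 * h * Im w) = side_cot r d"
 proof -
  have "Re w * R - px * m = Re w * L - px * sg * Im w"
   unfolding L(2) m_def by (simp add: algebra_simps power2_eq_square)
  thus ?thesis using l r0 h unfolding side_cot_def
   by (simp add: w_def[symmetric] px_def[symmetric] sg_def[symmetric] L_def[symmetric] h_def[symmetric]
     r0_def[symmetric] field_simps)
 qed
 finally show ?thesis .
qed

lemma apex_angle_eq_vec_angle:
 fixes a x y :: "real^3"
 assumes d: "d \<in> darts T" and r: "admissible r"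
  and "dist x y = len T d" "dist a x = r $ orig T d" "dist a y = r $ orig T (nxt T d)"
 shows "apex_angle T r d = vec_angle (x - a) (y - a)"
proof -
 obtain b u v w where p: "pyramid T r d = (b, u, v, w)" "is_pyramid T r d (b, u, v, w)"
  using pyramid_some[OF d r] .
 thus ?thesis using vec_angle_dist[of x y "len T d" a] vec_angle_dist[of u v "len T d" b]
   admissibleD(1)[OF r] assms
  by (simp add: apex_angle_def is_pyramid_def)
qed

lemma apex_angle_eq:
 assumes d: "d \<in> darts T" and r: "admissible r"
 defines "i \<equiv> orig T d" and "j \<equiv> orig T (nxt T d)"
 shows "0 < apex_angle T r d" "apex_angle T r d < pi"
  "cos (apex_angle T r d) = ((r $ i)^2 + (r $ j)^2 - (len T d)^2) / (2 * r $ i * r $ j)"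
  "sin (apex_angle T r d) = len T d * line_dist T r d / (r $ i * r $ j)"
  "apex_angle T r (opp T d) = apex_angle T r d"
proof -
 note A = admissibleD[OF r]
 define c where "c = (%d. ((r $ orig T d)^2 + (r $ orig T (nxt T d))^2 - (len T d)^2)
   / (2 * r $ orig T d * r $ orig T (nxt T d)))"
 have gen: "apex_angle T r d = arccos (c d)" if d: "d \<in> darts T" for d
 proof -
  obtain a x y z where p: "pyramid T r d = (a, x, y, z)" "is_pyramid T r d (a, x, y, z)"
   using pyramid_some[OF d r] .
  thus ?thesis using vec_angle_dist[of x y "len T d" a] A(1)
   by (simp add: apex_angle_def c_def is_pyramid_def)
 qed
 have lp: "len T d > 0" "r $ i > 0" "r $ j > 0" using d A by auto
 have s: "1 - (c d)^2 = (len T d * line_dist T r d / (r $ i * r $ j))^2"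
 proof -
  have f: "2 * len T d * foot_along T r d = (r $ i)^2 + (len T d)^2 - (r $ j)^2"
   using lp by (simp add: foot_along_def i_def j_def)
  have L: "(line_dist T r d)^2 = (r $ i)^2 - (foot_along T r d)^2"
   using A d by (simp add: line_dist2_def i_def)
  define M N where "M = 2 * r $ i * r $ j" and "N = (r $ i)^2 + (r $ j)^2 - (len T d)^2"
  have "M^2 - N^2 = (2 * (len T d * line_dist T r d))^2"
   using f L unfolding M_def N_def by algebra
  moreover have "1 - (c d)^2 = (M^2 - N^2) / M^2"
  proof -
   have cd: "c d = N / M" by (simp add: c_def i_def M_def N_def j_def)
   have "M ~= 0" using lp by (simp add: M_def)
   thus ?thesis by (simp add: cd power_divide diff_divide_distrib)
  qed
  ultimately have "1 - (c d)^2 = (2 * (len T d * line_dist T r d))^2 / M^2" by simp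
  thus ?thesis by (simp add: M_def power_divide power_mult_distrib)
 qed
 have pos: "len T d * line_dist T r d / (r $ i * r $ j) > 0" using lp A d by simp
 hence "(c d)^2 < 1" using s by (metis diff_gt_0_iff_gt zero_less_power)
 hence c1: "-1 < c d" "c d < 1" by (simp_all add: abs_square_less_1 abs_less_iff)
 show "0 < apex_angle T r d" "apex_angle T r d < pi"
  unfolding gen[OF d] using arccos_lt_bounded[OF c1] by auto
 show "cos (apex_angle T r d) = ((r $ i)^2 + (r $ j)^2 - (len T d)^2) / (2 * r $ i * r $ j)"
  unfolding gen[OF d] using c1 by (simp add: cos_arccos c_def i_def j_def)
 show "sin (apex_angle T r d) = len T d * line_dist T r d / (r $ i * r $ j)"
 proof -
  have "sin (arccos (c d)) = sqrt (1 - (c d)^2)" using c1 by (intro sin_arccos) auto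
  also have "\<dots> = len T d * line_dist T r d / (r $ i * r $ j)"
   unfolding s real_sqrt_abs using pos by (rule abs_of_pos)
  finally show ?thesis unfolding gen[OF d] .
 qed
 have "c (opp T d) = c d" using d by (simp add: c_def len_opp mult.commute mult.left_commute add.commute)
 thus "apex_angle T r (opp T d) = apex_angle T r d" using gen d by simp
qed

end

section \<open>Variation of the curvatures\<close>

lemma DERIV_acot [derivative_intros]:
 assumes "(f has_real_derivative f') (at t)"
 shows "((%t. acot (f t)) has_real_derivative - f' / (1 + (f t)^2)) (at t)"
 unfolding acot_def by (rule derivative_eq_intros assms refl)+ (simp add: field_simps)

lemma DERIV_sqrt_pos:
 assumes "(f has_real_derivative f') (at t)" "0 < f t"
 shows "((%t. sqrt (f t)) has_real_derivative f' / (2 * sqrt (f t))) (at t)"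
 using DERIV_chain2[OF DERIV_real_sqrt[OF assms(2)] assms(1)] by (simp add: field_simps)

lemma isCont_tendsto_nhds:
 fixes f :: "real => real"
 assumes "isCont f t" shows "(f \<longlongrightarrow> f t) (nhds t)"
 using assms by (simp add: isCont_def tendsto_at_iff_tendsto_nhds)

text \<open>
 Spherical trigonometry at a vertex: the derivative of the angle of a spherical triangle opposite to a
 constant side, expressed by the variations of the two adjacent sides and by the cotangents of the other
 two angles.
\<close>

lemma corner_angle_derivative:
 fixes px sg r0 :: "real => real" and c s :: real
 assumes px: "(px has_real_derivative px') (at t)" and sg: "(sg has_real_derivative sg') (at t)"
  and r0: "(r0 has_real_derivative r0') (at t)"
  and pos: "0 < r0 t" "0 < (r0 t)^2 - (px t)^2 - (sg t)^2" and s: "0 < s" "c^2 + s^2 = 1"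
 defines "h \<equiv> sqrt ((r0 t)^2 - (px t)^2 - (sg t)^2)" and "m \<equiv> c * px t + s * sg t"
  and "se \<equiv> s * px t - c * sg t"
 shows "((%t. acot ((((r0 t)^2 - (px t)^2) * (c / s) - px t * sg t) /
       (r0 t * sqrt ((r0 t)^2 - (px t)^2 - (sg t)^2)))) has_real_derivative
   (sg t / h * ((r0 t * px' - px t * r0') / ((r0 t)^2 - (px t)^2)) +
    se / h * ((r0 t * (c * px' + s * sg') - m * r0') / (h^2 + se^2)))) (at t)"
proof -
 have hp: "h > 0" and h2: "h^2 = (r0 t)^2 - (px t)^2 - (sg t)^2" using pos by (auto simp: h_def)
 define a b g R where "a = r0 t" and "b = px t" and "g = sg t" and "R = a^2 - b^2"
 have Rp: "R > 0" using pos zero_le_power2[of "sg t"] unfolding R_def a_def b_def by linarith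
 have h2': "h^2 = a^2 - b^2 - g^2" using h2 by (simp add: a_def b_def g_def)
 have ap: "a > 0" using pos by (simp add: a_def)
 define h' where "h' = (a * r0' - b * px' - g * sg') / h"
 have dh: "((%t. sqrt ((r0 t)^2 - (px t)^2 - (sg t)^2)) has_real_derivative h') (at t)"
 proof -
  have "((%t. (r0 t)^2 - (px t)^2 - (sg t)^2) has_real_derivative 2 * (a * r0' - b * px' - g * sg')) (at t)"
   by (rule derivative_eq_intros px sg r0 refl)+ (simp add: a_def b_def g_def algebra_simps)
  from DERIV_sqrt_pos[OF this pos(2)] show ?thesis
   unfolding mult_divide_mult_cancel_left_if by (simp add: h'_def h_def)
 qed
 define N N' where "N = R * (c / s) - b * g" and
  "N' = (2 * a * r0' - 2 * b * px') * (c / s) - (px' * g + b * sg')"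
 have dN: "((%t. ((r0 t)^2 - (px t)^2) * (c / s) - px t * sg t) has_real_derivative N') (at t)"
  by (rule derivative_eq_intros px sg r0 refl)+ (simp add: N'_def a_def b_def g_def)
 have dM: "((%t. r0 t * sqrt ((r0 t)^2 - (px t)^2 - (sg t)^2)) has_real_derivative (r0' * h + a * h')) (at t)"
  by (rule derivative_eq_intros r0 dh refl)+ (simp add: a_def h_def)
 have M0: "a * h ~= 0" using ap hp by simp
 have M0': "r0 t * sqrt ((r0 t)^2 - (px t)^2 - (sg t)^2) ~= 0" using M0 by (simp add: a_def h_def)
 have D: "((%t. acot ((((r0 t)^2 - (px t)^2) * (c / s) - px t * sg t) /
       (r0 t * sqrt ((r0 t)^2 - (px t)^2 - (sg t)^2)))) has_real_derivative
   - ((N' * (a * h) - N * (r0' * h + a * h')) / (a * h * (a * h))) / (1 + (N / (a * h))^2)) (at t)"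
  using DERIV_acot[OF DERIV_divide[OF dN dM M0']]
  by (simp add: N_def R_def a_def b_def g_def h_def)
 have se: "se = s * b - c * g" and m: "m = c * b + s * g" by (simp_all add: se_def m_def b_def g_def)
 have key: "((a * h)^2 + N^2) * s^2 = R * (h^2 + se^2)"
 proof -
  have "N * s = R * c - b * g * s" using s by (simp add: N_def field_simps)
  thus ?thesis using s(2) h2' R_def unfolding se by algebra
 qed
 have pe: "h^2 + se^2 > 0" using hp by (simp add: add_pos_nonneg)
 have "- ((N' * (a * h) - N * (r0' * h + a * h')) / (a * h * (a * h))) / (1 + (N / (a * h))^2)
   = - (N' * (a * h) - N * (r0' * h + a * h')) / ((a * h)^2 + N^2)"
 proof -
  have "1 + (N / (a * h))^2 = ((a * h)^2 + N^2) / (a * h)^2"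
   using M0 by (simp add: power_divide add_divide_distrib)
  thus ?thesis using M0 by (simp add: power2_eq_square)
 qed
 also have "\<dots> = - (N' * (a * h) - N * (r0' * h + a * h')) * s^2 / (R * (h^2 + se^2))"
  using s(1) by (simp add: key[symmetric])
 also have "\<dots> = (g / h * (a * px' - b * r0') * (h^2 + se^2) + se / h * (a * (c * px' + s * sg') - m * r0') * R)
   / (R * (h^2 + se^2))"
 proof -
  define n n' where "n = N * s" and "n' = N' * s"
  have n: "n = R * c - b * g * s" using s by (simp add: n_def N_def field_simps)
  have n': "n' = (2 * a * r0' - 2 * b * px') * c - (px' * g + b * sg') * s"
   using s by (simp add: n'_def N'_def field_simps)
  have hh': "h * h' = a * r0' - b * px' - g * sg'" using hp by (simp add: h'_def)
  have "h * (- (N' * (a * h) - N * (r0' * h + a * h')) * s^2)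
    = - (n' * a * h^2 - n * (r0' * h^2 + a * (h * h'))) * s"
   by (simp add: n_def n'_def power2_eq_square algebra_simps)
  also have "\<dots> = g * (a * px' - b * r0') * (h^2 + se^2) + se * (a * (c * px' + s * sg') - m * r0') * R"
   unfolding hh' n n' se m R_def h2' using s(2) by algebra
  also have "\<dots> = h * (g / h * (a * px' - b * r0') * (h^2 + se^2) + se / h * (a * (c * px' + s * sg') - m * r0') * R)"
   using hp by (simp add: algebra_simps)
  finally show ?thesis using hp by simp
 qed
 also have "\<dots> = g / h * ((a * px' - b * r0') / R) + se / h * ((a * (c * px' + s * sg') - m * r0') / (h^2 + se^2))"
  using Rp pe by (simp add: add_divide_distrib)
 finally show ?thesis using D by (simp add: a_def b_def g_def R_def)
qed

lemma base_angle_derivative: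
 fixes q sg :: "real => real"
 assumes q: "(q has_real_derivative q') (at t)" and sg: "(sg has_real_derivative sg') (at t)"
  and pos: "0 < q t - (sg t)^2"
 defines "h \<equiv> sqrt (q t - (sg t)^2)"
 shows "((%t. acot (sg t / sqrt (q t - (sg t)^2))) has_real_derivative
   - sg' / h + sg t / h * (q' / (2 * q t))) (at t)"
proof -
 have hp: "h > 0" and h2: "h^2 = q t - (sg t)^2" using pos by (auto simp: h_def)
 have qp: "q t > 0" using pos zero_le_power2[of "sg t"] by linarith
 define h' where "h' = (q' - 2 * sg t * sg') / (2 * h)"
 have dh: "((%t. sqrt (q t - (sg t)^2)) has_real_derivative h') (at t)"
 proof -
  have "((%t. q t - (sg t)^2) has_real_derivative q' - 2 * sg t * sg') (at t)"
   by (rule derivative_eq_intros q sg refl)+ simp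
  from DERIV_sqrt_pos[OF this pos] show ?thesis by (simp add: h'_def h_def[symmetric])
 qed
 have "((%t. acot (sg t / sqrt (q t - (sg t)^2))) has_real_derivative
   - ((sg' * h - sg t * h') / (h * h)) / (1 + (sg t / h)^2)) (at t)"
  using DERIV_acot[OF DERIV_divide[OF sg dh]] hp by (simp add: h_def)
 moreover have "- ((sg' * h - sg t * h') / (h * h)) / (1 + (sg t / h)^2) = - sg' / h + sg t / h * (q' / (2 * q t))"
 proof -
  have "1 + (sg t / h)^2 = q t / h^2" using hp h2 by (simp add: field_simps power_divide)
  hence "- ((sg' * h - sg t * h') / (h * h)) / (1 + (sg t / h)^2) = - (sg' * h - sg t * h') / q t"
   using hp by (simp add: power2_eq_square)
  also have "\<dots> = - (sg' * h^2 - sg t * (h * h')) / (h * q t)" using hp qp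
   by (simp add: field_simps power2_eq_square)
  also have "h * h' = q' / 2 - sg t * sg'" using hp by (simp add: h'_def field_simps)
  also have "- (sg' * h^2 - sg t * (q' / 2 - sg t * sg')) = - sg' * q t + sg t * q' / 2"
   unfolding h2 by (simp add: power2_eq_square algebra_simps)
  also have "(- sg' * q t + sg t * q' / 2) / (h * q t) = - sg' / h + sg t / h * (q' / (2 * q t))"
   using hp qp by (simp add: field_simps)
  finally show ?thesis .
 qed
 ultimately show ?thesis by simp
qed

definition edge_cot :: "('v::finite, 'm, 'z) geo_tri_scheme => real^'v => nat => real" where
 "edge_cot T r d = inset T r d / apex_height T r d
   + inset T r (opp T d) / apex_height T r (opp T d)"

definition foot_along_deriv :: "('v::finite, 'm, 'z) geo_tri_scheme => real^'v => real^'v => nat => real" where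
 "foot_along_deriv T r v d =
   (r $ orig T d * v $ orig T d - r $ orig T (nxt T d) * v $ orig T (nxt T d)) / len T d"

definition inset_deriv :: "('v::finite, 'm, 'z) geo_tri_scheme => real^'v => real^'v => nat => real" where
 "inset_deriv T r v d =
   (r $ orig T d * v $ orig T d - r $ orig T (prv T d) * v $ orig T (prv T d)
    - Re (tip T d) * foot_along_deriv T r v d) / Im (tip T d)"

text \<open>
 With \<open>beta\<close> the angle at the origin of \<open>d\<close> between the side edge and
 \<open>d\<close>, this is \<open>- beta' / sin beta\<close>.
\<close>

definition edge_rate :: "('v::finite, 'm, 'z) geo_tri_scheme => real^'v => real^'v => nat => real" where
 "edge_rate T r v d = (r $ orig T d * foot_along_deriv T r v d - foot_along T r d * v $ orig T d)
   / line_dist2 T r d"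

context metric_triangulation
begin

lemma sum_darts_at:
 "(\<Sum>d | d \<in> darts T \<and> orig T d = i. f (rot T d)) = (\<Sum>d | d \<in> darts T \<and> orig T d = i. f d)"
 by (rule sum.reindex_bij_witness[of _ "rot' T" "rot T"]) auto

lemma sum_darts_opp: "(\<Sum>d\<in>darts T. f (opp T d)) = (\<Sum>d\<in>darts T. f d)"
 by (rule sum.reindex_bij_witness[of _ "opp T" "opp T"]) auto

lemma sum_darts_nxt: "(\<Sum>d\<in>darts T. f (nxt T d)) = (\<Sum>d\<in>darts T. f d)"
 by (rule sum.reindex_bij_witness[of _ "%d. prv T d" "nxt T"]) auto

lemma sum_by_orig: "(\<Sum>i\<in>UNIV. \<Sum>d | d \<in> darts T \<and> orig T d = i. f d) = (\<Sum>d\<in>darts T. f d)"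
 using sum.group[of "darts T" UNIV "orig T" f] by simp

lemma orig_in_darts: "\<exists>d\<in>darts T. orig T d = i"
proof -
 have "i \<in> orig T ` darts T" using tri by (simp add: sphere_triangulation_def)
 thus ?thesis by auto
qed

text \<open>
 Twice the area of the base is constant.  Its vanishing derivative removes the terms in Schlaefli's
 formula that involve the variation of the insets.
\<close>

lemma inset_area:
 assumes d: "d \<in> darts T"
 shows "len T d * inset T r d + len T (nxt T d) * inset T r (nxt T d)
   + len T (prv T d) * inset T r (prv T d) = len T d * Im (tip T d)"
proof -
 define p w l u e where "p = foot T r d" and "w = tip T d" and "l = len T d" and "u = side_dir d"
  and "e = prv T d"
 have e: "e \<in> darts T" "len T e > 0" using d by (auto simp: e_def)
 have cu: "u * cnj u = 1" using side_dir(1)[OF d] complex_norm_square[of u] by (simp add: u_def)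
 have "foot T r (nxt T d) = (p - cr l) * cnj u"
 proof -
  have "p - cr l = foot T r (nxt T d) * u"
   using foot_nxt(1)[OF d, of r]
   by (simp only: frame_nxt_def p_def l_def u_def[symmetric]) (metis add_diff_cancel_left')
  thus ?thesis using cu by (simp add: mult.assoc)
 qed
 hence "cr (len T (nxt T d)) * foot T r (nxt T d) = (p - cr l) * cnj (cr (len T (nxt T d)) * u)" by simp
 also have "cr (len T (nxt T d)) * u = w - cr l" using side_dir(2)[OF d] by (simp add: u_def w_def l_def)
 finally have "Im (cr (len T (nxt T d)) * foot T r (nxt T d)) = Im ((p - cr l) * cnj (w - cr l))"
  by simp
 hence 1: "len T (nxt T d) * inset T r (nxt T d) = Im ((p - cr l) * cnj (w - cr l))"
  by (simp add: foot_def)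
 have "p * cnj (w / cr (len T e)) = cr (len T e) - foot T r e"
  using foot_rot(1)[OF d, of r] by (simp add: p_def w_def e_def)
 hence "p * cnj w = cr (len T e) * (cr (len T e) - foot T r e)" using e by (simp add: field_simps)
 hence "Im (p * cnj w) = Im (cr (len T e) * (cr (len T e) - foot T r e))" by simp
 hence 2: "len T e * inset T r e = - Im (p * cnj w)" by (simp add: foot_def)
 show ?thesis unfolding 1 e_def[symmetric] 2
  by (simp add: p_def foot_def l_def[symmetric] w_def[symmetric] algebra_simps)
qed

context
 fixes y :: "real => real^'v" and v :: "real^'v" and t :: real
 assumes dy: "!!i. ((%t. y t $ i) has_real_derivative v $ i) (at t)"
begin

lemma foot_along_derivative:
 assumes d: "d \<in> darts T"
 shows "((%t. foot_along T (y t) d) has_real_derivative foot_along_deriv T (y t) v d) (at t)"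
 unfolding foot_along_def foot_along_deriv_def
 by (rule derivative_eq_intros dy refl)+ (use d in \<open>simp_all add: field_simps\<close>)

lemma inset_derivative:
 assumes d: "d \<in> darts T"
 shows "((%t. inset T (y t) d) has_real_derivative inset_deriv T (y t) v d) (at t)"
 unfolding inset_def inset_deriv_def
 by (rule derivative_eq_intros foot_along_derivative[OF d] dy refl)+
   (use tip_props(1)[OF d] in \<open>simp_all add: field_simps\<close>)

lemma line_dist2_derivative:
 assumes d: "d \<in> darts T"
 shows "((%t. line_dist2 T (y t) d) has_real_derivative
   2 * (y t $ orig T d * v $ orig T d - foot_along T (y t) d * foot_along_deriv T (y t) v d)) (at t)"
 unfolding line_dist2_def
 by (rule derivative_eq_intros foot_along_derivative[OF d] dy refl)+ (simp add: field_simps)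

lemma eventually_admissible:
 assumes r: "admissible (y t)"
 shows "\<forall>\<^sub>F s in nhds t. admissible (y s)"
proof -
 have "\<forall>\<^sub>F s in nhds t. 0 < y s $ i" for i
  using order_tendstoD(1)[OF isCont_tendsto_nhds[OF DERIV_isCont[OF dy[of i]]], of 0]
   admissibleD(1)[OF r] by blast
 hence 1: "\<forall>\<^sub>F s in nhds t. \<forall>i. 0 < y s $ i" by (rule eventually_all_finite)
 have "\<forall>\<^sub>F s in nhds t. 0 < height2 T (y s) d" if d: "d \<in> darts T" for d
 proof -
  have "isCont (%s. height2 T (y s) d) t" unfolding height2_def
   by (intro continuous_intros DERIV_isCont[OF line_dist2_derivative[OF d]] DERIV_isCont[OF inset_derivative[OF d]])
  from order_tendstoD(1)[OF isCont_tendsto_nhds[OF this], of 0]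
  show ?thesis using admissibleD(2)[OF r d] by blast
 qed
 hence 2: "\<forall>\<^sub>F s in nhds t. \<forall>d\<in>darts T. 0 < height2 T (y s) d" by (intro eventually_ball_finite) auto
 show ?thesis using 1 2 by eventually_elim (simp add: admissible_def)
qed

lemma side_dihedral_derivative:
 assumes d: "d \<in> darts T" and r: "admissible (y t)"
 shows "((%t. side_dihedral T (y t) d) has_real_derivative
   inset T (y t) d / apex_height T (y t) d * edge_rate T (y t) v d
   + inset T (y t) (opp T (rot T d)) / apex_height T (y t) (opp T (rot T d)) * edge_rate T (y t) v (rot T d)) (at t)"
proof -
 define w e c s where "w = tip T d" and "e = prv T d" and "c = Re w / cmod w" and "s = Im w / cmod w"
 have e: "e \<in> darts T" "opp T (rot T d) = e" using d by (auto simp: e_def rot_def)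
 have w: "Im w > 0" "cmod w = len T e" "cmod w > 0" using tip_props[OF d] e by (auto simp: w_def e_def)
 have "(Re w)^2 + (Im w)^2 ~= 0" using w(3) by (simp flip: cmod_power2)
 hence cs: "0 < s" "c^2 + s^2 = 1"
  using w(1,3) by (auto simp: s_def c_def power_divide add_divide_distrib[symmetric] cmod_power2)
 have cdivs: "c / s = Re w / Im w" using w by (simp add: c_def s_def)
 note A = admissibleD[OF r]
 have h: "line_dist2 T (y t) d = (y t $ orig T d)^2 - (foot_along T (y t) d)^2" for t by (simp add: line_dist2_def)
 have ap: "apex_height T (y t) d = sqrt ((y t $ orig T d)^2 - (foot_along T (y t) d)^2 - (inset T (y t) d)^2)" for t
  by (simp add: apex_height_def height2_def line_dist2_def)
 have pos: "0 < (y t $ orig T d)^2 - (foot_along T (y t) d)^2 - (inset T (y t) d)^2"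
  using A(2)[OF d] by (simp add: height2_def line_dist2_def)
 have F: "foot T (y t) d * cnj (w / cr (len T e)) = cr (len T e) - foot T (y t) e" for t
  using foot_rot(1)[OF d, of "y t"] by (simp add: w_def e_def)
 have Fre: "c * foot_along T (y t) d + s * inset T (y t) d = foot_along T (y t) (rot T d)" for t
  using arg_cong[OF F[of t], of Re] foot_rot(3)[OF d, of "y t"]
  by (simp add: foot_def c_def s_def w(2) e_def[symmetric] mult.commute add_divide_distrib)
 have Fim: "s * foot_along T (y t) d - c * inset T (y t) d = inset T (y t) e" for t
  using arg_cong[OF F[of t], of Im]
  by (simp add: foot_def c_def s_def w(2) mult.commute diff_divide_distrib)
 have Fd: "c * foot_along_deriv T (y t) v d + s * inset_deriv T (y t) v d = foot_along_deriv T (y t) v (rot T d)"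
 proof (rule DERIV_unique)
  show "((%t. foot_along T (y t) (rot T d)) has_real_derivative foot_along_deriv T (y t) v (rot T d)) (at t)"
   by (rule foot_along_derivative) (use d in simp)
  show "((%t. foot_along T (y t) (rot T d)) has_real_derivative
    c * foot_along_deriv T (y t) v d + s * inset_deriv T (y t) v d) (at t)"
   unfolding Fre[symmetric]
   by (rule derivative_eq_intros foot_along_derivative[OF d] inset_derivative[OF d] refl)+ simp
 qed
 have hL: "height2 T (y t) d + (inset T (y t) e)^2 = line_dist2 T (y t) (rot T d)"
  using foot_rot(4)[OF d, of "y t"] by (simp add: e_def)
 have he: "apex_height T (y t) e = apex_height T (y t) d"
  using foot_rot(2)[OF d, of "y t"] by (simp add: apex_height_def e_def)
 have "((%t. acot (side_cot (y t) d)) has_real_derivative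
   inset T (y t) d / apex_height T (y t) d * edge_rate T (y t) v d
   + inset T (y t) e / apex_height T (y t) e * edge_rate T (y t) v (rot T d)) (at t)"
  using corner_angle_derivative[OF foot_along_derivative[OF d] inset_derivative[OF d] dy[of "orig T d"] A(1) pos cs]
  unfolding ap[symmetric] unfolding h[symmetric] Fre Fim Fd A(4)[OF d] hL cdivs
  by (simp add: side_cot_def edge_rate_def w_def he d)
 thus ?thesis unfolding e(2)
  by (rule DERIV_cong_ev[THEN iffD2, rotated -1])
   (use eventually_admissible[OF r] in \<open>auto elim!: eventually_mono simp: side_dihedral_eq d\<close>)
qed

text \<open>
 Each edge is adjacent to two corners at the vertex; collecting the two contributions of the edge turns
 the two cotangents into \<open>edge_cot\<close>.
\<close>

lemma kappa_derivative:
 assumes r: "admissible (y t)"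
 shows "((%t. kappa T (y t) i) has_real_derivative
   - (\<Sum>d | d \<in> darts T \<and> orig T d = i. edge_cot T (y t) d * edge_rate T (y t) v d)) (at t)"
proof -
 let ?D = "{d \<in> darts T. orig T d = i}"
 let ?f = "%d. inset T (y t) d / apex_height T (y t) d * edge_rate T (y t) v d"
 let ?g = "%d. inset T (y t) (opp T d) / apex_height T (y t) (opp T d) * edge_rate T (y t) v d"
 have "((%t. omega T (y t) i) has_real_derivative (\<Sum>d\<in>?D. ?f d + ?g (rot T d))) (at t)"
  unfolding omega_def by (rule DERIV_sum) (use side_dihedral_derivative[OF _ r] in auto)
 also have "(\<Sum>d\<in>?D. ?f d + ?g (rot T d)) = (\<Sum>d\<in>?D. edge_cot T (y t) d * edge_rate T (y t) v d)"
  using sum_darts_at[of ?g i] by (simp add: sum.distrib edge_cot_def distrib_right)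
 finally show ?thesis unfolding kappa_def by (auto intro!: derivative_eq_intros)
qed

lemma base_dihedral_derivative:
 assumes d: "d \<in> darts T" and r: "admissible (y t)"
 shows "((%t. base_dihedral T (y t) d) has_real_derivative
   - inset_deriv T (y t) v d / apex_height T (y t) d
   + inset T (y t) d / apex_height T (y t) d *
    ((y t $ orig T d * v $ orig T d - foot_along T (y t) d * foot_along_deriv T (y t) v d) / line_dist2 T (y t) d)) (at t)"
proof -
 note A = admissibleD[OF r]
 have pos: "0 < line_dist2 T (y t) d - (inset T (y t) d)^2"
  using A(2)[OF d] by (simp add: height2_def)
 have ap: "sqrt (line_dist2 T (y t) d - (inset T (y t) d)^2) = apex_height T (y t) d" for t
  by (simp add: apex_height_def height2_def)
 have "((%t. acot (inset T (y t) d / apex_height T (y t) d)) has_real_derivative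
   - inset_deriv T (y t) v d / apex_height T (y t) d
   + inset T (y t) d / apex_height T (y t) d *
    ((y t $ orig T d * v $ orig T d - foot_along T (y t) d * foot_along_deriv T (y t) v d) / line_dist2 T (y t) d)) (at t)"
  using base_angle_derivative[OF line_dist2_derivative[OF d] inset_derivative[OF d] pos]
  unfolding ap mult_divide_mult_cancel_left_if by simp
 thus ?thesis
  by (rule DERIV_cong_ev[THEN iffD2, rotated -1])
   (use eventually_admissible[OF r] in \<open>auto elim!: eventually_mono simp: base_dihedral_eq(1) d\<close>)
qed

lemma inset_deriv_sum:
 assumes d: "d \<in> darts T"
 shows "len T d * inset_deriv T (y t) v d + len T (nxt T d) * inset_deriv T (y t) v (nxt T d)
   + len T (prv T d) * inset_deriv T (y t) v (prv T d) = 0"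
proof (rule DERIV_unique)
 let ?f = "%t. len T d * inset T (y t) d + len T (nxt T d) * inset T (y t) (nxt T d)
   + len T (prv T d) * inset T (y t) (prv T d)"
 show "(?f has_real_derivative 0) (at t)" unfolding inset_area[OF d] by simp
 show "(?f has_real_derivative len T d * inset_deriv T (y t) v d + len T (nxt T d) * inset_deriv T (y t) v (nxt T d)
   + len T (prv T d) * inset_deriv T (y t) v (prv T d)) (at t)"
  by (intro DERIV_add DERIV_cmult inset_derivative) (use d in auto)
qed

lemma edge_rate_sum:
 assumes d: "d \<in> darts T"
 shows "y t $ orig T d * edge_rate T (y t) v d + y t $ orig T (nxt T d) * edge_rate T (y t) v (opp T d) =
  - len T d * ((y t $ orig T d * v $ orig T d - foot_along T (y t) d * foot_along_deriv T (y t) v d) / line_dist2 T (y t) d)"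
proof -
 define a b a' b' l px px' L where "a = y t $ orig T d" and "b = y t $ orig T (nxt T d)"
  and "a' = v $ orig T d" and "b' = v $ orig T (nxt T d)" and "l = len T d"
  and "px = foot_along T (y t) d" and "px' = foot_along_deriv T (y t) v d" and "L = line_dist2 T (y t) d"
 have l: "l > 0" using d by (simp add: l_def)
 have px: "2 * l * px = a^2 + l^2 - b^2" using l by (simp add: px_def foot_along_def a_def b_def l_def)
 have px': "l * px' = a * a' - b * b'" using l by (simp add: px'_def foot_along_deriv_def a_def b_def a'_def b'_def l_def)
 have po: "foot_along_deriv T (y t) v (opp T d) = - px'"
  using d by (simp add: foot_along_deriv_def px'_def len_opp minus_divide_left)
 have "l * (a * (a * px' - px * a') + b * (b * (- px') - (l - px) * b')) = l * (- l * (a * a' - px * px'))"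
  using px px' by algebra
 hence e: "a * (a * px' - px * a') + b * (b * (- px') - (l - px) * b') = - l * (a * a' - px * px')"
  using mult_left_cancel[of l] l by blast
 have "a * edge_rate T (y t) v d + b * edge_rate T (y t) v (opp T d)
   = (a * (a * px' - px * a') + b * (b * (- px') - (l - px) * b')) / L"
  unfolding edge_rate_def po line_dist2_opp[OF d]
  using d by (simp add: a_def b_def a'_def b'_def l_def px_def px'_def L_def add_divide_distrib)
 also have "\<dots> = - l * ((a * a' - px * px') / L)" unfolding e by simp
 finally show ?thesis by (simp add: a_def b_def a'_def b'_def l_def px_def px'_def L_def)
qed

text \<open>
 Schlaefli's formula: the terms that come from the variation of the angles cancel, by
 \<open>edge_rate_sum\<close> along each edge and \<open>inset_deriv_sum\<close> in each face.
\<close>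

lemma total_scalar_curvature_derivative:
 assumes r: "admissible (y t)"
 shows "((%t. total_scalar_curvature T (y t)) has_real_derivative (\<Sum>i\<in>UNIV. v $ i * kappa T (y t) i)) (at t)"
proof -
 define K where "K i = - (\<Sum>d | d \<in> darts T \<and> orig T d = i. edge_cot T (y t) d * edge_rate T (y t) v d)" for i
 define E where "E d = (y t $ orig T d * v $ orig T d - foot_along T (y t) d * foot_along_deriv T (y t) v d)
   / line_dist2 T (y t) d" for d
 define c where "c d = inset T (y t) d / apex_height T (y t) d" for d
 define P where "P d = inset_deriv T (y t) v d / apex_height T (y t) d" for d
 define B where "B d = - P d + c d * E d" for d
 have dB: "((%t. base_dihedral T (y t) d) has_real_derivative B d) (at t)" if "d \<in> darts T" for d
  using base_dihedral_derivative[OF that r] by (simp add: B_def P_def c_def E_def)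
 have D: "((%t. total_scalar_curvature T (y t)) has_real_derivative
  (\<Sum>i\<in>UNIV. v $ i * kappa T (y t) i + y t $ i * K i) + (\<Sum>d\<in>darts T. len T d * - (B d + B (opp T d))) / 2) (at t)"
  unfolding total_scalar_curvature_def theta_def
  by (rule derivative_eq_intros dy kappa_derivative[OF r] dB refl | simp)+
   (simp add: K_def algebra_simps)
 have "(\<Sum>i\<in>UNIV. y t $ i * K i) = - (\<Sum>d\<in>darts T. y t $ orig T d * (edge_cot T (y t) d * edge_rate T (y t) v d))"
  unfolding K_def sum_by_orig[symmetric] by (simp add: sum_distrib_left sum_negf)
 also have "\<dots> = - (\<Sum>d\<in>darts T. c d * (y t $ orig T d * edge_rate T (y t) v d))
   - (\<Sum>d\<in>darts T. c (opp T d) * (y t $ orig T d * edge_rate T (y t) v d))"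
  by (simp add: edge_cot_def c_def[symmetric] algebra_simps sum.distrib)
 also have "(\<Sum>d\<in>darts T. c (opp T d) * (y t $ orig T d * edge_rate T (y t) v d))
   = (\<Sum>d\<in>darts T. c d * (y t $ orig T (nxt T d) * edge_rate T (y t) v (opp T d)))"
  by (subst sum_darts_opp[symmetric]) (rule sum.cong; simp)
 also have "- (\<Sum>d\<in>darts T. c d * (y t $ orig T d * edge_rate T (y t) v d)) - \<dots>
   = - (\<Sum>d\<in>darts T. c d * (y t $ orig T d * edge_rate T (y t) v d + y t $ orig T (nxt T d) * edge_rate T (y t) v (opp T d)))"
  by (simp add: algebra_simps sum.distrib)
 also have "\<dots> = (\<Sum>d\<in>darts T. len T d * (c d * E d))"
  unfolding sum_negf[symmetric] by (rule sum.cong) (simp_all add: edge_rate_sum E_def)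
 finally have 1: "(\<Sum>i\<in>UNIV. y t $ i * K i) = (\<Sum>d\<in>darts T. len T d * (c d * E d))" .
 have "(\<Sum>d\<in>darts T. len T d * B (opp T d)) = (\<Sum>d\<in>darts T. len T d * B d)"
  by (subst sum_darts_opp[symmetric]) (rule sum.cong; simp add: len_opp)
 hence "(\<Sum>d\<in>darts T. len T d * - (B d + B (opp T d))) / 2 = - (\<Sum>d\<in>darts T. len T d * B d)"
  by (simp add: algebra_simps sum.distrib sum_negf sum_subtractf)
 also have "\<dots> = (\<Sum>d\<in>darts T. len T d * P d) - (\<Sum>d\<in>darts T. len T d * (c d * E d))"
  by (simp add: B_def algebra_simps sum.distrib sum_negf sum_subtractf)
 also have "(\<Sum>d\<in>darts T. len T d * P d) = 0"
 proof -
  let ?f = "%d. len T d * P d"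
  have "3 * (\<Sum>d\<in>darts T. ?f d) = (\<Sum>d\<in>darts T. ?f d) + (\<Sum>d\<in>darts T. ?f (nxt T d)) + (\<Sum>d\<in>darts T. ?f (prv T d))"
   using sum_darts_nxt[of ?f] sum_darts_nxt[of "%d. ?f (nxt T d)"] by simp
  also have "\<dots> = (\<Sum>d\<in>darts T. ?f d + ?f (nxt T d) + ?f (prv T d))" by (simp add: sum.distrib)
  also have "\<dots> = 0"
  proof (rule sum.neutral, safe)
   fix d assume d: "d \<in> darts T"
   have h: "apex_height T (y t) (nxt T d) = apex_height T (y t) d"
    "apex_height T (y t) (prv T d) = apex_height T (y t) d"
    using foot_nxt(2)[OF d] foot_nxt(2)[of "nxt T d"] d by (auto simp: apex_height_def)
   show "?f d + ?f (nxt T d) + ?f (prv T d) = 0"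
    using inset_deriv_sum[OF d] by (simp add: P_def h add_divide_distrib[symmetric])
  qed
  finally show ?thesis by simp
 qed
 finally have 2: "(\<Sum>d\<in>darts T. len T d * - (B d + B (opp T d))) / 2 = - (\<Sum>d\<in>darts T. len T d * (c d * E d))" by simp
 show ?thesis using D unfolding 2 sum.distrib 1 by simp
qed

end

end

section \<open>The dual polyhedron\<close>

lemma vec_angle_scale:
 assumes "0 < k" "0 < m"
 shows "vec_angle (k *\<^sub>R u) (m *\<^sub>R v) = vec_angle u v"
 using assms by (simp add: vec_angle_def)

lemma inner_eq_cos_vec_angle: "x \<bullet> y = norm x * norm y * cos (vec_angle x y)"
 using Cauchy_Schwarz_ineq2[of x y]
 by (cases "x = 0 \<or> y = 0") (auto simp: vec_angle_def cos_arccos_abs abs_mult field_simps)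

text \<open>
 The contribution of one corner to the length of the dual edge is the cotangent of the adjacent boundary
 dihedral angle, divided by the distance of the edge from the apex.
\<close>

lemma corner_cotangent_formula:
 fixes px sg r0 h c s :: real
 assumes pos: "0 < r0" "0 < h" "0 < s" "c^2 + s^2 = 1" and h2: "h^2 = r0^2 - px^2 - sg^2"
 defines "m \<equiv> c * px + s * sg" and "se \<equiv> s * px - c * sg"
  and "L \<equiv> sqrt (r0^2 - px^2)" and "Le \<equiv> sqrt (h^2 + (s * px - c * sg)^2)"
  and "w \<equiv> acot (((r0^2 - px^2) * (c / s) - px * sg) / (r0 * h))"
 shows "(m / (r0 * Le) - px / (r0 * L) * cos w) / sin w = sg / h / L"
  "(px / (r0 * L) - m / (r0 * Le) * cos w) / sin w = se / h / Le"
proof -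
 define n where "n = (r0^2 - px^2) * c - px * sg * s"
 define X where "X = n / (r0 * h * s)"
 have X: "((r0^2 - px^2) * (c / s) - px * sg) / (r0 * h) = X"
  using pos by (simp add: X_def n_def field_simps)
 have "r0^2 - px^2 = h^2 + sg^2" using h2 by simp
 moreover have hp: "h^2 > 0" using pos by simp
 ultimately have "r0^2 - px^2 > 0" using zero_le_power2[of sg] by linarith
 hence Lp: "L > 0" "L^2 = r0^2 - px^2" by (auto simp: L_def)
 have "h^2 + se^2 > 0" using hp zero_le_power2[of se] by linarith
 hence Lep: "Le > 0" "Le^2 = h^2 + se^2" by (auto simp: Le_def se_def)
 have Lem: "Le^2 = r0^2 - m^2" using Lep(2) h2 pos(4) unfolding se_def m_def by algebra
 have key: "(r0 * h * s)^2 + n^2 = (L * Le)^2"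
 proof -
  define R where "R = r0^2 - px^2"
  have n: "n = R * c - px * sg * s" by (simp add: n_def R_def)
  have "(r0 * h * s)^2 + n^2 = R * (h^2 + se^2)"
   using R_def h2 pos(4) unfolding se_def n by algebra
  thus ?thesis by (simp add: power_mult_distrib Lp(2) Lep(2) R_def)
 qed
 define S where "S = sqrt (1 + X^2)"
 have S: "S = L * Le / (r0 * h * s)"
  unfolding S_def
 proof (rule real_sqrt_unique)
  have "(L * Le / (r0 * h * s))^2 = ((r0 * h * s)^2 + n^2) / (r0 * h * s)^2" by (simp add: power_divide key)
  also have "\<dots> = 1 + X^2" using pos by (simp add: X_def power_divide add_divide_distrib)
  finally show "(L * Le / (r0 * h * s))^2 = 1 + X^2" .
 qed (use pos Lp Lep in simp)
 have Sp: "S > 0" using pos Lp Lep by (simp add: S)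
 have cs: "cos w = X / S" "sin w = 1 / S" unfolding w_def X S_def by (auto simp: cos_acot sin_acot)
 have E: "(p - q * cos w) / sin w = p * S - q * X" for p q
  using Sp unfolding cs by (simp add: field_simps)
 have "m * L^2 - px * n = s * sg * r0^2"
  using Lp(2) unfolding m_def n_def by algebra
 hence "(m * L^2 - px * n) / (r0^2 * h * s * L) = s * sg * r0^2 / (r0^2 * h * s * L)" by simp
 also have "\<dots> = sg / h / L" using pos by simp
 also have "(m * L^2 - px * n) / (r0^2 * h * s * L) = m / (r0 * Le) * S - px / (r0 * L) * X"
  using pos Lp(1) Lep(1) unfolding S X_def by (simp add: field_simps power2_eq_square)
 finally show "(m / (r0 * Le) - px / (r0 * L) * cos w) / sin w = sg / h / L" by (simp only: E)
 have "px * Le^2 - m * n = s * se * r0^2"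
  using Lem pos(4) unfolding m_def n_def se_def by algebra
 hence "(px * Le^2 - m * n) / (r0^2 * h * s * Le) = s * se * r0^2 / (r0^2 * h * s * Le)" by simp
 also have "\<dots> = se / h / Le" using pos by simp
 also have "(px * Le^2 - m * n) / (r0^2 * h * s * Le) = px / (r0 * L) * S - m / (r0 * Le) * X"
  using pos Lp(1) Lep(1) unfolding S X_def by (simp add: field_simps power2_eq_square)
 finally show "(px / (r0 * L) - m / (r0 * Le) * cos w) / sin w = se / h / Le" by (simp only: E)
qed

lemma arccos_sum_le_pi:
 assumes "\<bar>a\<bar> <= 1" "\<bar>b\<bar> <= 1"
 shows "arccos a + arccos b <= pi \<longleftrightarrow> 0 <= a + b" "arccos a + arccos b = pi \<longleftrightarrow> a + b = 0"
proof -
 have "arccos (- b) = pi - arccos b" using assms by (simp add: arccos_minus)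
 moreover have "arccos a <= arccos (- b) \<longleftrightarrow> - b <= a" "arccos a = arccos (- b) \<longleftrightarrow> a = - b"
  using assms arccos_le_mono[of "-b" a] arccos_eq_iff[of a "-b"] by (auto simp: abs_le_iff)
 ultimately show "arccos a + arccos b <= pi \<longleftrightarrow> 0 <= a + b" "arccos a + arccos b = pi \<longleftrightarrow> a + b = 0" by auto
qed

lemma fan_angle_eq:
 assumes ex: "\<exists>p. is_spherical_triangle T \<phi> d p"
  and b: "0 < \<phi> d" "\<phi> d < pi" "0 < \<phi> (prv T d)" "\<phi> (prv T d) < pi"
 shows "fan_angle T \<phi> d = arccos ((cos (\<phi> (nxt T d)) - cos (\<phi> d) * cos (\<phi> (prv T d)))
   / (sin (\<phi> d) * sin (\<phi> (prv T d))))" (is ?a)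
  "cos (fan_angle T \<phi> d) = (cos (\<phi> (nxt T d)) - cos (\<phi> d) * cos (\<phi> (prv T d)))
   / (sin (\<phi> d) * sin (\<phi> (prv T d)))" (is ?b)
proof -
 obtain u v w where p: "spherical_triangle T \<phi> d = (u, v, w)" "is_spherical_triangle T \<phi> d (u, v, w)"
  using someI_ex[OF ex] unfolding spherical_triangle_def[symmetric]
  by (cases "spherical_triangle T \<phi> d") auto
 note P = p(2)[unfolded is_spherical_triangle_def prod.case]
 have I1: "x \<bullet> x = 1" if "norm x = 1" for x :: "real^3" using that by (simp add: norm_eq_1)
 have uv: "u \<bullet> v = cos (\<phi> d)" "v \<bullet> w = cos (\<phi> (nxt T d))" "w \<bullet> u = cos (\<phi> (prv T d))"
  "u \<bullet> u = 1" "v \<bullet> v = 1" "w \<bullet> w = 1"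
  using inner_eq_cos_vec_angle[of u v] inner_eq_cos_vec_angle[of v w] inner_eq_cos_vec_angle[of w u] I1 P by auto
 have s: "sqrt (1 - (cos x)^2) = sin x" if "0 < x" "x < pi" for x :: real
  using sin_cos_sqrt[of x] that by (simp add: sin_ge_zero)
 have nz: "u ~= 0" using P by auto
 from dihedral_angle_eq[of u 0 v w] nz show ?a
  by (simp add: fan_angle_def p(1) uv inner_commute[of v u] s b mult.commute)
 let ?P = "perp_part u v" and ?Q = "perp_part u w"
 have n: "norm ?P = sin (\<phi> d)" "norm ?Q = sin (\<phi> (prv T d))"
  unfolding norm_eq_sqrt_inner perp_part_inner[OF nz]
  using s b by (auto simp: uv inner_commute[of v u] power2_eq_square[symmetric])
 have "?P \<bullet> ?Q = norm ?P * norm ?Q * cos (vec_angle ?P ?Q)" by (rule inner_eq_cos_vec_angle)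
 moreover have "?P \<bullet> ?Q = cos (\<phi> (nxt T d)) - cos (\<phi> d) * cos (\<phi> (prv T d))"
  unfolding perp_part_inner[OF nz] by (simp add: uv inner_commute[of v u])
 moreover have "sin (\<phi> d) > 0" "sin (\<phi> (prv T d)) > 0" using b by (auto intro!: sin_gt_zero)
 ultimately show ?b
  by (simp add: fan_angle_def p(1) dihedral_angle_def n)
qed

context metric_triangulation
begin

lemma is_spherical_triangle_dual:
 assumes d: "d \<in> darts T" and r: "admissible r"
 shows "\<exists>p. is_spherical_triangle T (apex_angle T r) d p"
proof -
 note A = admissibleD[OF r]
 obtain a x y z where p: "is_pyramid T r d (a, x, y, z)" and
  n: "!!n. n \<bullet> (x - a) = 0 ==> n \<bullet> (y - a) = 0 ==> n \<bullet> (z - a) = 0 ==> n = 0"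
  using spanning_pyramid_exists[OF d A(1) A(2)[OF d]] by blast
 note P = p[unfolded is_pyramid_def prod.case]
 have nz: "x ~= a" "y ~= a" "z ~= a"
  using P A(1)[of "orig T d"] A(1)[of "orig T (nxt T d)"] A(1)[of "orig T (prv T d)"] by auto
 define k where "k u = 1 / norm (u - a)" for u
 have k: "k x > 0" "k y > 0" "k z > 0" using nz by (auto simp: k_def)
 define U where "U u = k u *\<^sub>R (u - a)" for u
 have nrm: "norm (U x) = 1" "norm (U y) = 1" "norm (U z) = 1" using nz by (auto simp: U_def k_def)
 have "vec_angle (U x) (U y) = apex_angle T r d"
  unfolding U_def vec_angle_scale[OF k(1,2)]
  by (rule apex_angle_eq_vec_angle[symmetric]) (use d r P in auto)
 moreover have "vec_angle (U y) (U z) = apex_angle T r (nxt T d)"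
  unfolding U_def vec_angle_scale[OF k(2,3)]
  by (rule apex_angle_eq_vec_angle[symmetric]) (use d r P in auto)
 moreover have "vec_angle (U z) (U x) = apex_angle T r (prv T d)"
  unfolding U_def vec_angle_scale[OF k(3,1)]
  by (rule apex_angle_eq_vec_angle[symmetric]) (use d r P in auto)
 moreover have "\<not> coplanar {0, U x, U y, U z}"
 proof
  assume "coplanar {0, U x, U y, U z}"
  from coplanar_common_normal[OF this] obtain m where
   "m ~= 0" "m \<bullet> U x = 0" "m \<bullet> U y = 0" "m \<bullet> U z = 0" by auto
  thus False using n[of m] k by (simp add: U_def)
 qed
 ultimately have "is_spherical_triangle T (apex_angle T r) d (U x, U y, U z)"
  using nrm by (simp add: is_spherical_triangle_def)
 thus ?thesis by blast
qed

text \<open>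
 The spherical triangle of the fan is cut out by the pyramid on a sphere around the apex, so its angles
 are the dihedral angles at the side edges.
\<close>

lemma fan_angle_dual:
 assumes d: "d \<in> darts T" and r: "admissible r"
 shows "fan_angle T (apex_angle T r) d = side_dihedral T r d"
proof -
 let ?n = "nxt T d" and ?nn = "prv T d"
 have dd: "?n \<in> darts T" "?nn \<in> darts T" using d by auto
 note a = apex_angle_eq[OF d r] and an = apex_angle_eq[OF dd(1) r] and ann = apex_angle_eq[OF dd(2) r]
 note A = admissibleD[OF r]
 obtain a x y z where p: "pyramid T r d = (a, x, y, z)" "is_pyramid T r d (a, x, y, z)"
  using pyramid_some[OF d r] .
 note P = p(2)[unfolded is_pyramid_def prod.case]
 have nz: "x ~= a" using P A(1)[of "orig T d"] by auto
 define r0 r1 r2 where "r0 = r $ orig T d" and "r1 = r $ orig T ?n" and "r2 = r $ orig T ?nn"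
 have rp: "r0 > 0" "r1 > 0" "r2 > 0" using A(1) by (auto simp: r0_def r1_def r2_def)
 define U V W where "U = x - a" and "V = y - a" and "W = z - a"
 have n: "norm U = r0" "norm V = r1" "norm W = r2"
  using P by (auto simp: U_def V_def W_def r0_def r1_def r2_def dist_norm norm_minus_commute)
 have uv: "U \<bullet> V = r0 * r1 * cos (apex_angle T r d)"
  using apex_angle_eq_vec_angle[OF d r, of x y a] P inner_eq_cos_vec_angle[of U V] n by (simp add: U_def V_def)
 have vw: "V \<bullet> W = r1 * r2 * cos (apex_angle T r ?n)"
  using apex_angle_eq_vec_angle[OF dd(1) r, of y z a] P inner_eq_cos_vec_angle[of V W] n by (simp add: W_def V_def)
 have wu: "W \<bullet> U = r2 * r0 * cos (apex_angle T r ?nn)"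
  using apex_angle_eq_vec_angle[OF dd(2) r, of z x a] P inner_eq_cos_vec_angle[of W U] n d by (simp add: W_def U_def)
 have sq: "U \<bullet> U = r0^2" "V \<bullet> V = r1^2" "W \<bullet> W = r2^2" using n by (auto simp: power2_norm_eq_inner[symmetric])
 have s: "sqrt (x^2 - (x * y * cos b)^2 / y^2) = x * sin b" if "0 < b" "b < pi" "x > 0" "y > 0" for x y b :: real
 proof -
  have "x^2 - (x * y * cos b)^2 / y^2 = (x * sin b)^2"
   using that by (simp add: power_mult_distrib sin_squared_eq algebra_simps)
  thus ?thesis using that by (simp add: sin_ge_zero)
 qed
 have vu: "V \<bullet> U = r1 * r0 * cos (apex_angle T r d)" using uv by (simp add: inner_commute)
 have s1: "sqrt (V \<bullet> V - (V \<bullet> U)^2 / (U \<bullet> U)) = r1 * sin (apex_angle T r d)"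
  unfolding sq vu by (rule s) (use a rp in auto)
 have s2: "sqrt (W \<bullet> W - (W \<bullet> U)^2 / (U \<bullet> U)) = r2 * sin (apex_angle T r ?nn)"
  unfolding sq wu by (rule s) (use ann rp in auto)
 have num: "V \<bullet> W - (V \<bullet> U) * (W \<bullet> U) / (U \<bullet> U)
   = r1 * r2 * (cos (apex_angle T r ?n) - cos (apex_angle T r d) * cos (apex_angle T r ?nn))"
  unfolding sq vw wu vu using rp by (simp add: field_simps power2_eq_square)
 have "side_dihedral T r d = dihedral_angle a x y z" by (simp add: side_dihedral_def p)
 also have "\<dots> = arccos (r1 * r2 * (cos (apex_angle T r ?n) - cos (apex_angle T r d) * cos (apex_angle T r ?nn)) /
   (r1 * sin (apex_angle T r d) * (r2 * sin (apex_angle T r ?nn))))"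
  unfolding num[symmetric] s1[symmetric] s2[symmetric] unfolding U_def V_def W_def by (rule dihedral_angle_eq[OF nz])
 also have "r1 * r2 * (cos (apex_angle T r ?n) - cos (apex_angle T r d) * cos (apex_angle T r ?nn)) /
   (r1 * sin (apex_angle T r d) * (r2 * sin (apex_angle T r ?nn)))
   = (cos (apex_angle T r ?n) - cos (apex_angle T r d) * cos (apex_angle T r ?nn)) /
   (sin (apex_angle T r d) * sin (apex_angle T r ?nn))"
  using rp by simp
 also have "arccos \<dots> = fan_angle T (apex_angle T r) d"
  by (rule fan_angle_eq(1)[symmetric]) (use is_spherical_triangle_dual[OF d r] a ann in auto)
 finally show ?thesis by simp
qed

lemma gen_simplicial_fan_dual:
 assumes r: "admissible r" shows "gen_simplicial_fan T (apex_angle T r)"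
 unfolding gen_simplicial_fan_def using tri apex_angle_eq[OF _ r] is_spherical_triangle_dual[OF _ r] by auto

lemma edge_altitude_dual:
 assumes d: "d \<in> darts T" and r: "admissible r"
 shows "edge_altitude T (apex_angle T r) (dual_altitude r) d = foot_along T r d / (r $ orig T d * line_dist T r d)"
proof -
 note a = apex_angle_eq[OF d r] and A = admissibleD[OF r]
 define r0 r1 l L where "r0 = r $ orig T d" and "r1 = r $ orig T (nxt T d)" and "l = len T d" and "L = line_dist T r d"
 have p: "r0 > 0" "r1 > 0" "l > 0" "L > 0" using A d by (auto simp: r0_def r1_def l_def L_def)
 have "edge_altitude T (apex_angle T r) (dual_altitude r) d
   = (1 / r1 - 1 / r0 * ((r0^2 + r1^2 - l^2) / (2 * r0 * r1))) / (l * L / (r0 * r1))"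
  using d by (simp add: edge_altitude_def dual_altitude_def a r0_def r1_def l_def L_def)
 also have "\<dots> = ((r0^2 + l^2 - r1^2) / (2 * l)) / (r0 * L)"
  using p by (simp add: field_simps power2_eq_square)
 finally show ?thesis by (simp add: foot_along_def r0_def r1_def l_def L_def)
qed

lemma dual_len_dual:
 assumes d: "d \<in> darts T" and r: "admissible r"
 shows "dual_len T (apex_angle T r) (dual_altitude r) d = edge_cot T r d / line_dist T r d"
proof -
 note A = admissibleD[OF r]
 have corner: "(edge_altitude T (apex_angle T r) (dual_altitude r) (rot T d)
   - edge_altitude T (apex_angle T r) (dual_altitude r) d * cos (fan_angle T (apex_angle T r) d))
    / sin (fan_angle T (apex_angle T r) d) = inset T r d / apex_height T r d / line_dist T r d" (is ?th1)
  "(edge_altitude T (apex_angle T r) (dual_altitude r) d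
   - edge_altitude T (apex_angle T r) (dual_altitude r) (rot T d) * cos (fan_angle T (apex_angle T r) d))
    / sin (fan_angle T (apex_angle T r) d)
   = inset T r (opp T (rot T d)) / apex_height T r (opp T (rot T d)) / line_dist T r (rot T d)" (is ?th2)
  if d: "d \<in> darts T" for d
 proof -
  define w e c s where "w = tip T d" and "e = prv T d" and "c = Re w / cmod w" and "s = Im w / cmod w"
  have e: "e \<in> darts T" "opp T (rot T d) = e" using d by (auto simp: e_def rot_def)
  have w: "Im w > 0" "cmod w = len T e" "cmod w > 0" using tip_props[OF d] e by (auto simp: w_def e_def)
  have "(Re w)^2 + (Im w)^2 ~= 0" using w(3) by (simp flip: cmod_power2)
  hence cs: "0 < s" "c^2 + s^2 = 1"
   using w(1,3) by (auto simp: s_def c_def power_divide add_divide_distrib[symmetric] cmod_power2)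
  have cdivs: "c / s = Re w / Im w" using w by (simp add: c_def s_def)
  have F: "foot T r d * cnj (w / cr (len T e)) = cr (len T e) - foot T r e"
   using foot_rot(1)[OF d, of "r"] by (simp add: w_def e_def)
  have Fre: "c * foot_along T r d + s * inset T r d = foot_along T r (rot T d)"
   using arg_cong[OF F, of Re] foot_rot(3)[OF d, of r]
   by (simp add: foot_def c_def s_def w(2) e_def[symmetric] mult.commute add_divide_distrib)
  have Fim: "s * foot_along T r d - c * inset T r d = inset T r e"
   using arg_cong[OF F, of Im]
   by (simp add: foot_def c_def s_def w(2) mult.commute diff_divide_distrib)
  have hL: "sqrt ((apex_height T r d)^2 + (inset T r e)^2) = line_dist T r (rot T d)"
   using foot_rot(4)[OF d, of r] A(4)[OF d] by (simp add: e_def line_dist_def)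
  have he: "apex_height T r e = apex_height T r d"
   using foot_rot(2)[OF d, of r] by (simp add: apex_height_def e_def)
  have h: "line_dist2 T r d = (r $ orig T d)^2 - (foot_along T r d)^2" by (simp add: line_dist2_def)
  have L: "sqrt (line_dist2 T r d) = line_dist T r d" by (simp add: line_dist_def)
  have h2: "(apex_height T r d)^2 = (r $ orig T d)^2 - (foot_along T r d)^2 - (inset T r d)^2"
   using A(4)[OF d] by (simp add: height2_def line_dist2_def)
  have dr: "rot T d \<in> darts T" using d by simp
  have fa: "fan_angle T (apex_angle T r) d = acot ((line_dist2 T r d * (c / s)
   - foot_along T r d * inset T r d) / (r $ orig T d * apex_height T r d))"
   using d by (simp add: fan_angle_dual r side_dihedral_eq side_cot_def cdivs w_def)
  have or: "orig T (rot T d) = orig T d" using d by simp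
  note C = corner_cotangent_formula[OF A(1) A(3)[OF d] cs h2, unfolded Fre Fim hL, folded h, unfolded L]
  show ?th1 unfolding edge_altitude_dual[OF d r] edge_altitude_dual[OF dr r] fa or by (rule C(1))
  show ?th2 unfolding edge_altitude_dual[OF d r] edge_altitude_dual[OF dr r] fa or e(2) he by (rule C(2))
 qed
 have rr: "rot T (rot' T d) = d" "rot' T d \<in> darts T" using d by auto
 have "line_dist T r (opp T d) = line_dist T r d" by (simp add: line_dist_def line_dist2_opp d)
 thus ?thesis
  unfolding dual_len_def corner(1)[OF d] using corner(2)[OF rr(2)]
  by (simp add: rr(1) edge_cot_def add_divide_distrib)
qed

text \<open>
 On both sides of the edge the apex has the same distance from the line of the edge, so the two
 arccosines have the same denominator.
\<close>

lemma theta_le_pi_iff: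
 assumes d: "d \<in> darts T" and r: "admissible r"
 shows "theta T r d <= pi \<longleftrightarrow> 0 <= inset T r d + inset T r (opp T d)"
  "theta T r d = pi \<longleftrightarrow> inset T r d + inset T r (opp T d) = 0"
proof -
 note A = admissibleD[OF r]
 have o: "opp T d \<in> darts T" using d by simp
 define L where "L = line_dist T r d"
 have L: "L > 0" "line_dist T r (opp T d) = L" using A d by (auto simp: L_def line_dist_def line_dist2_opp)
 have le: "\<bar>inset T r e\<bar> <= line_dist T r e" if "e \<in> darts T" for e
 proof (rule power2_le_imp_le)
  show "\<bar>inset T r e\<bar>^2 <= (line_dist T r e)^2" using A(8)[OF that] by simp
 qed (use A(6)[OF that] in simp)
 have b: "\<bar>inset T r d / L\<bar> <= 1" "\<bar>inset T r (opp T d) / L\<bar> <= 1"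
  using L(1) le[OF d, folded L_def] le[OF o, unfolded L(2)] by (simp_all add: abs_divide divide_le_eq)
 have s: "inset T r d / L + inset T r (opp T d) / L = (inset T r d + inset T r (opp T d)) / L"
  by (simp add: add_divide_distrib)
 show "theta T r d <= pi \<longleftrightarrow> 0 <= inset T r d + inset T r (opp T d)"
  "theta T r d = pi \<longleftrightarrow> inset T r d + inset T r (opp T d) = 0"
  using arccos_sum_le_pi[OF b] L unfolding theta_def base_dihedral_eq(2)[OF d r] base_dihedral_eq(2)[OF o r] s
  by (auto simp: L_def zero_le_divide_iff)
qed

lemma edge_cot_sign:
 assumes d: "d \<in> darts T" and r: "admissible r"
 shows "0 <= edge_cot T r d \<longleftrightarrow> 0 <= inset T r d + inset T r (opp T d)"
  "edge_cot T r d = 0 \<longleftrightarrow> inset T r d + inset T r (opp T d) = 0"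
proof -
 have o: "opp T d \<in> darts T" using d by simp
 have *: "theta T r d = pi - (arctan (inset T r d / apex_height T r d)
   + arctan (inset T r (opp T d) / apex_height T r (opp T d)))"
  using base_dihedral_eq(1)[OF d r] base_dihedral_eq(1)[OF o r] by (simp add: theta_def acot_def)
 have e: "0 <= x + y \<longleftrightarrow> - y <= x" "x + y = 0 \<longleftrightarrow> - y = x" for x y :: real by auto
 have F: "0 <= arctan a + arctan b \<longleftrightarrow> 0 <= a + b" "arctan a + arctan b = 0 \<longleftrightarrow> a + b = 0" for a b
  unfolding e arctan_minus[symmetric] by (rule arctan_le_iff, rule arctan_eq_iff)
 have G: "pi - x <= pi \<longleftrightarrow> 0 <= x" "pi - x = pi \<longleftrightarrow> x = 0" for x :: real by auto
 show "0 <= edge_cot T r d \<longleftrightarrow> 0 <= inset T r d + inset T r (opp T d)"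
  unfolding theta_le_pi_iff[OF d r, symmetric] * edge_cot_def G by (rule F(1)[symmetric])
 show "edge_cot T r d = 0 \<longleftrightarrow> inset T r d + inset T r (opp T d) = 0"
  unfolding theta_le_pi_iff[OF d r, symmetric] * edge_cot_def G by (rule F(2)[symmetric])
qed

lemma gen_convex_polyhedron_dual:
 assumes r: "admissible r" and th: "!!d. d \<in> darts T ==> theta T r d <= pi"
 shows "gen_convex_polyhedron T (apex_angle T r) (dual_altitude r)"
 unfolding gen_convex_polyhedron_def
proof (intro conjI ballI gen_simplicial_fan_dual[OF r])
 fix d assume d: "d \<in> darts T"
 have "0 <= edge_cot T r d" using th[OF d] theta_le_pi_iff(1)[OF d r] edge_cot_sign(1)[OF d r] by simp
 thus "0 <= dual_len T (apex_angle T r) (dual_altitude r) d"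
  unfolding dual_len_dual[OF d r] using admissibleD(6)[OF r d] by (simp add: less_imp_le)
qed

lemma edge_altitude_linear:
 "edge_altitude T \<phi> (x + t *\<^sub>R v) d = edge_altitude T \<phi> x d + t * edge_altitude T \<phi> v d"
 by (simp add: edge_altitude_def algebra_simps add_divide_distrib diff_divide_distrib)

lemma dual_len_linear:
 "dual_len T \<phi> (x + t *\<^sub>R v) d = dual_len T \<phi> x d + t * dual_len T \<phi> v d"
 by (simp add: dual_len_def edge_altitude_linear algebra_simps add_divide_distrib diff_divide_distrib)

text \<open>
 The area of a polygon is a quadratic form in the distances of its sides; this is the symmetry of its
 polar form.
\<close>

lemma face_area_bilinear_sym:
 "(\<Sum>d | d \<in> darts T \<and> orig T d = i. edge_altitude T \<phi> x d * dual_len T \<phi> v d)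
  = (\<Sum>d | d \<in> darts T \<and> orig T d = i. edge_altitude T \<phi> v d * dual_len T \<phi> x d)"
proof -
 let ?D = "{d \<in> darts T. orig T d = i}" and ?H = "edge_altitude T \<phi>" and ?w = "fan_angle T \<phi>"
 have *: "(\<Sum>d\<in>?D. ?H x d * dual_len T \<phi> v d)
   = (\<Sum>d\<in>?D. ?H x d * ((?H v (rot T d) - ?H v d * cos (?w d)) / sin (?w d))
    + ?H x (rot T d) * ((?H v d - ?H v (rot T d) * cos (?w d)) / sin (?w d)))" for x v
 proof -
  let ?g = "%d. ?H x d * ((?H v (rot' T d) - ?H v d * cos (?w (rot' T d))) / sin (?w (rot' T d)))"
  have "(\<Sum>d\<in>?D. ?H x d * dual_len T \<phi> v d)
   = (\<Sum>d\<in>?D. ?H x d * ((?H v (rot T d) - ?H v d * cos (?w d)) / sin (?w d))) + (\<Sum>d\<in>?D. ?g d)"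
   by (simp add: dual_len_def distrib_left sum.distrib)
  also have "(\<Sum>d\<in>?D. ?g d) = (\<Sum>d\<in>?D. ?g (rot T d))" by (rule sum_darts_at[symmetric])
  also have "\<dots> = (\<Sum>d\<in>?D. ?H x (rot T d) * ((?H v d - ?H v (rot T d) * cos (?w d)) / sin (?w d)))"
   by (rule sum.cong) auto
  finally show ?thesis by (simp add: sum.distrib)
 qed
 show ?thesis unfolding * by (rule sum.cong) (auto simp: algebra_simps add_divide_distrib diff_divide_distrib)
qed

lemma face_area_derivative:
 "((%t. face_area T \<phi> i (x + t *\<^sub>R v)) has_real_derivative
  (\<Sum>d | d \<in> darts T \<and> orig T d = i. dual_len T \<phi> x d * edge_altitude T \<phi> v d)) (at 0)"
proof -
 let ?D = "{d \<in> darts T. orig T d = i}" and ?H = "edge_altitude T \<phi>" and ?L = "dual_len T \<phi>"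
 have "((%t. face_area T \<phi> i (x + t *\<^sub>R v)) has_real_derivative
   (\<Sum>d\<in>?D. ?H v d * ?L x d + ?H x d * ?L v d) / 2) (at 0)"
  unfolding face_area_def edge_altitude_linear dual_len_linear
  by (rule DERIV_cdivide, rule DERIV_sum) (auto intro!: derivative_eq_intros)
 thus ?thesis unfolding sum.distrib face_area_bilinear_sym[of \<phi> x v] by (simp add: mult.commute)
qed

text \<open>
 Both end faces of the edge \<open>d\<close> see the same dual edge.  The symmetry holds separately for
 the contributions of the two spherical triangles at \<open>d\<close>.
\<close>

lemma dual_len_opp:
 assumes fan: "gen_simplicial_fan T \<phi>" and w: "!!d. d \<in> darts T ==> 0 < fan_angle T \<phi> d \<and> fan_angle T \<phi> d < pi"
  and d: "d \<in> darts T"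
 shows "dual_len T \<phi> h (opp T d) = dual_len T \<phi> h d"
proof -
 let ?H = "edge_altitude T \<phi> h" and ?w = "fan_angle T \<phi>"
 have ph: "0 < \<phi> d" "\<phi> d < pi" "\<phi> (opp T d) = \<phi> d" if "d \<in> darts T" for d
  using fan that by (auto simp: gen_simplicial_fan_def)
 have piece: "(?H (rot T d) - ?H d * cos (?w d)) / sin (?w d)
   = (?H (nxt T d) - ?H (opp T d) * cos (?w (nxt T d))) / sin (?w (nxt T d))" if d: "d \<in> darts T" for d
 proof -
  let ?n = "nxt T d" and ?nn = "prv T d"
  have dd: "?n \<in> darts T" "?nn \<in> darts T" using d by auto
  define x y z where "x = cos (\<phi> d)" and "y = cos (\<phi> ?n)" and "z = cos (\<phi> ?nn)"
  define sx sy sz where "sx = sin (\<phi> d)" and "sy = sin (\<phi> ?n)" and "sz = sin (\<phi> ?nn)"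
  have s: "sx > 0" "sy > 0" "sz > 0" using ph d dd by (auto simp: sx_def sy_def sz_def intro!: sin_gt_zero)
  have s2: "sx^2 = 1 - x^2" "sy^2 = 1 - y^2" "sz^2 = 1 - z^2"
   by (auto simp: sx_def sy_def sz_def x_def y_def z_def sin_squared_eq)
  have ex: "\<exists>p. is_spherical_triangle T \<phi> d p" if "d \<in> darts T" for d
   using fan that by (auto simp: gen_simplicial_fan_def)
  have w1: "cos (?w d) = (y - x * z) / (sx * sz)"
   using fan_angle_eq(2)[OF ex[OF d]] ph d dd by (simp add: x_def y_def z_def sx_def sz_def)
  have w2: "cos (?w ?n) = (z - y * x) / (sy * sx)"
   using fan_angle_eq(2)[OF ex[OF dd(1)]] ph d dd by (simp add: x_def y_def z_def sx_def sy_def)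
  have sp: "sin (?w d) > 0" "sin (?w ?n) > 0" using w[OF d] w[OF dd(1)] by (auto intro!: sin_gt_zero)
  define Q where "Q = sin (?w d) * sz"
  have Q: "Q > 0" using sp s by (simp add: Q_def)
  have "(sx * Q)^2 = (sx * (sin (?w ?n) * sy))^2"
  proof -
   have 1: "cos (?w d) * (sx * sz) = y - x * z" "cos (?w ?n) * (sy * sx) = z - y * x"
    using s unfolding w1 w2 by simp_all
   have "(sin (?w d))^2 = 1 - (cos (?w d))^2" "(sin (?w ?n))^2 = 1 - (cos (?w ?n))^2"
    by (simp_all add: sin_squared_eq)
   thus ?thesis unfolding Q_def using 1 s2 by algebra
  qed
  hence "sx * Q = sx * (sin (?w ?n) * sy)" using s Q sp by (simp add: power2_eq_iff_nonneg)
  hence Q': "Q = sin (?w ?n) * sy" using s by simp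
  have S: "sin (?w d) = Q / sz" using s by (simp add: Q_def)
  have S2: "sin (?w ?n) = Q / sy" using s by (simp add: Q')
  define u v t where "u = h $ orig T d" and "v = h $ orig T ?n" and "t = h $ orig T ?nn"
  have H: "?H (rot T d) = (t - u * z) / sz" "?H d = (v - u * x) / sx" "?H ?n = (t - v * y) / sy"
   "?H (opp T d) = (u - v * x) / sx"
   using d dd ph by (auto simp: edge_altitude_def rot_def u_def v_def t_def x_def y_def z_def sx_def sy_def sz_def target_def)
  have "(?H (rot T d) - ?H d * cos (?w d)) / sin (?w d) = ((t - u * z) - (v - u * x) * (y - x * z) / sx^2) / Q"
   unfolding H w1 S using s Q by (simp add: field_simps power2_eq_square)
  also have "(t - u * z) - (v - u * x) * (y - x * z) / sx^2 = (t - v * y) - (u - v * x) * (z - y * x) / sx^2"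
  proof -
   have "sx^2 * (t - u * z) - (v - u * x) * (y - x * z) = sx^2 * (t - v * y) - (u - v * x) * (z - y * x)"
    unfolding s2 by (simp add: power2_eq_square algebra_simps)
   hence "(sx^2 * (t - u * z) - (v - u * x) * (y - x * z)) / sx^2 = (sx^2 * (t - v * y) - (u - v * x) * (z - y * x)) / sx^2"
    by simp
   thus ?thesis using s by (simp add: diff_divide_distrib)
  qed
  also have "((t - v * y) - (u - v * x) * (z - y * x) / sx^2) / Q = (?H ?n - ?H (opp T d) * cos (?w ?n)) / sin (?w ?n)"
   unfolding H w2 S2 using s Q by (simp add: field_simps power2_eq_square)
  finally show ?thesis .
 qed
 have o: "opp T d \<in> darts T" using d by simp
 show ?thesis unfolding dual_len_def piece[OF d] piece[OF o] using d by (simp add: rot'_def)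
qed

text \<open>
 Because the volume is a cubic form, the derivative of \<open>3 vol\<close> is the area term plus
 \<open>sum h_i dF_i\<close>; symmetry of the dual lengths turns the latter into twice the area term.
\<close>

lemma volume_derivative:
 assumes fan: "gen_simplicial_fan T \<phi>" and w: "!!d. d \<in> darts T ==> 0 < fan_angle T \<phi> d \<and> fan_angle T \<phi> d < pi"
 shows "((%t. polyhedron_volume T \<phi> (x + t *\<^sub>R v)) has_real_derivative (\<Sum>i\<in>UNIV. v $ i * face_area T \<phi> i x)) (at 0)"
proof -
 let ?H = "edge_altitude T \<phi>" and ?L = "dual_len T \<phi> x"
 have D: "((%t. polyhedron_volume T \<phi> (x + t *\<^sub>R v)) has_real_derivative
   (\<Sum>i\<in>UNIV. v $ i * face_area T \<phi> i x + x $ i * (\<Sum>d | d \<in> darts T \<and> orig T d = i. ?L d * ?H v d)) / 3) (at 0)"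
  unfolding polyhedron_volume_def
  by (rule DERIV_cdivide, rule DERIV_sum) (auto intro!: derivative_eq_intros face_area_derivative)
 have S: "(\<Sum>i\<in>UNIV. a $ i * (\<Sum>d | d \<in> darts T \<and> orig T d = i. ?L d * ?H b d))
   = (\<Sum>d\<in>darts T. ?L d * (a $ orig T d * b $ orig T (nxt T d) + a $ orig T (nxt T d) * b $ orig T d
    - cos (\<phi> d) * (a $ orig T d * b $ orig T d + a $ orig T (nxt T d) * b $ orig T (nxt T d))) / sin (\<phi> d)) / 2" for a b :: "real^'v"
 proof -
  let ?f = "%d. a $ orig T d * (?L d * ?H b d)"
  have "(\<Sum>i\<in>UNIV. a $ i * (\<Sum>d | d \<in> darts T \<and> orig T d = i. ?L d * ?H b d)) = (\<Sum>d\<in>darts T. ?f d)"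
   unfolding sum_by_orig[symmetric] by (simp add: sum_distrib_left)
  also have "\<dots> = (\<Sum>d\<in>darts T. ?f d + ?f (opp T d)) / 2"
   using sum_darts_opp[of ?f] by (simp add: sum.distrib)
  also have "(\<Sum>d\<in>darts T. ?f d + ?f (opp T d)) = (\<Sum>d\<in>darts T. ?L d * (a $ orig T d * b $ orig T (nxt T d) + a $ orig T (nxt T d) * b $ orig T d
    - cos (\<phi> d) * (a $ orig T d * b $ orig T d + a $ orig T (nxt T d) * b $ orig T (nxt T d))) / sin (\<phi> d))"
   by (rule sum.cong) (use fan in \<open>auto simp: dual_len_opp[OF fan w] edge_altitude_def gen_simplicial_fan_def target_def
     algebra_simps add_divide_distrib diff_divide_distrib\<close>)
  finally show ?thesis .
 qed
 have sym: "(\<Sum>i\<in>UNIV. x $ i * (\<Sum>d | d \<in> darts T \<and> orig T d = i. ?L d * ?H v d))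
   = (\<Sum>i\<in>UNIV. v $ i * (\<Sum>d | d \<in> darts T \<and> orig T d = i. ?L d * ?H x d))"
  unfolding S by (simp add: algebra_simps)
 have F: "(\<Sum>d | d \<in> darts T \<and> orig T d = i. ?L d * ?H x d) = 2 * face_area T \<phi> i x" for i
  by (simp add: face_area_def mult.commute)
 have "(\<Sum>i\<in>UNIV. v $ i * face_area T \<phi> i x + x $ i * (\<Sum>d | d \<in> darts T \<and> orig T d = i. ?L d * ?H v d)) / 3
   = (\<Sum>i\<in>UNIV. v $ i * face_area T \<phi> i x)"
  unfolding sum.distrib sym F mult.left_commute[of _ 2] sum_distrib_left[symmetric] by simp
 with D show ?thesis by simp
qed

definition jacobian :: "real^'v => 'v => 'v => real" where
 "jacobian r i j = - (\<Sum>d | d \<in> darts T \<and> orig T d = i. edge_cot T r d * edge_rate T r (axis j 1) d)"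

lemma face_area_jacobian:
 assumes r: "admissible r"
 shows "has_partial (face_area T (apex_angle T r) i) j (jacobian r i j) (dual_altitude r)"
proof -
 note A = admissibleD[OF r]
 have "dual_len T (apex_angle T r) (dual_altitude r) d * edge_altitude T (apex_angle T r) (axis j 1) d
   = - (edge_cot T r d * edge_rate T r (axis j 1) d)" if d: "d \<in> darts T" for d
 proof -
  note a = apex_angle_eq[OF d r]
  define r0 r1 l L u v where "r0 = r $ orig T d" and "r1 = r $ orig T (nxt T d)" and "l = len T d" and "L = line_dist T r d"
   and "u = axis j (1::real) $ orig T d" and "v = axis j (1::real) $ orig T (nxt T d)"
  have p: "r0 > 0" "r1 > 0" "l > 0" "L > 0" using A d by (auto simp: r0_def r1_def l_def L_def)
  have L2: "line_dist2 T r d = L^2" using A d by (simp add: L_def)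
  have "edge_altitude T (apex_angle T r) (axis j 1) d
   = (v - u * ((r0^2 + r1^2 - l^2) / (2 * r0 * r1))) / (l * L / (r0 * r1))"
   using d by (simp add: edge_altitude_def a r0_def r1_def l_def L_def u_def v_def)
  also have "\<dots> = - ((r0 * ((r0 * u - r1 * v) / l) - (r0^2 + l^2 - r1^2) / (2 * l) * u) / L)"
   using p by (simp add: field_simps power2_eq_square)
  also have "\<dots> = - (edge_rate T r (axis j 1) d * L)"
   using p unfolding edge_rate_def foot_along_deriv_def foot_along_def L2
   by (simp add: r0_def r1_def l_def u_def v_def power2_eq_square)
  finally show ?thesis unfolding dual_len_dual[OF d r] using p by (simp add: L_def)
 qed
 hence "(\<Sum>d | d \<in> darts T \<and> orig T d = i. dual_len T (apex_angle T r) (dual_altitude r) d * edge_altitude T (apex_angle T r) (axis j 1) d)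
  = jacobian r i j" by (simp add: jacobian_def sum_negf[symmetric])
 thus ?thesis unfolding has_partial_def using face_area_derivative[of "apex_angle T r" i "dual_altitude r" "axis j 1"] by simp
qed

lemma volume_gradient:
 assumes r: "admissible r"
 shows "has_partial (polyhedron_volume T (apex_angle T r)) j (face_area T (apex_angle T r) j h) h"
proof -
 have "0 < fan_angle T (apex_angle T r) d \<and> fan_angle T (apex_angle T r) d < pi" if "d \<in> darts T" for d
  using that acot_bounds by (simp add: fan_angle_dual r side_dihedral_eq)
 from volume_derivative[OF gen_simplicial_fan_dual[OF r] this, of h "axis j 1"]
 show ?thesis by (simp add: has_partial_def axis_def if_distrib[of "%x. x * _"] cong: if_cong)
qed

lemma kappa_jacobian:
 assumes r: "admissible r"
 shows "has_partial (%r. kappa T r i) j (jacobian r i j) r"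
proof -
 have "((%t. (r + t *\<^sub>R axis j 1) $ i) has_real_derivative axis j 1 $ i) (at 0)" for i
  by (auto intro!: derivative_eq_intros)
 from kappa_derivative[of "%t. r + t *\<^sub>R axis j 1", OF this] r
 show ?thesis by (simp add: has_partial_def jacobian_def)
qed

lemma total_scalar_curvature_gradient:
 assumes r: "admissible r"
 shows "has_partial (total_scalar_curvature T) j (kappa T r j) r"
proof -
 have "((%t. (r + t *\<^sub>R axis j 1) $ i) has_real_derivative axis j 1 $ i) (at 0)" for i
  by (auto intro!: derivative_eq_intros)
 from total_scalar_curvature_derivative[of "%t. r + t *\<^sub>R axis j 1", OF this] r
 show ?thesis by (simp add: has_partial_def axis_def if_distrib[of "%x. x * _"] cong: if_cong)
qed

end

section \<open>Geodesics in isometric charts\<close>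

lemma orthonormal_expansion:
 fixes a b x :: "real^2"
 assumes "a \<bullet> a = 1" "b \<bullet> b = 1" "a \<bullet> b = 0"
 shows "x = (x \<bullet> a) *\<^sub>R a + (x \<bullet> b) *\<^sub>R b"
proof -
 define a1 a2 b1 b2 x1 x2 where "a1 = a $ 1" "a2 = a $ 2" "b1 = b $ 1" "b2 = b $ 2" "x1 = x $ 1" "x2 = x $ 2"
 have 1: "a1 * a1 + a2 * a2 = 1" "b1 * b1 + b2 * b2 = 1" "a1 * b1 + a2 * b2 = 0"
  using assms by (auto simp: inner_vec_def sum_2 a1_a2_b1_b2_x1_x2_def)
 have "x1 = (x1 * a1 + x2 * a2) * a1 + (x1 * b1 + x2 * b2) * b1" using 1 by algebra
 moreover have "x2 = (x1 * a1 + x2 * a2) * a2 + (x1 * b1 + x2 * b2) * b2" using 1 by algebra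
 ultimately show ?thesis
  by (auto simp: vec_eq_iff forall_2 inner_vec_def sum_2 a1_a2_b1_b2_x1_x2_def)
qed

lemma orthonormal_second_unique:
 fixes a b c :: "real^2"
 assumes "a \<bullet> a = 1" "b \<bullet> b = 1" "a \<bullet> b = 0" "c \<bullet> c = 1" "a \<bullet> c = 0"
 shows "c = b \<or> c = - b"
proof -
 have c: "c = (c \<bullet> b) *\<^sub>R b"
  using orthonormal_expansion[OF assms(1-3), of c] assms(5) by (simp add: inner_commute)
 hence "c \<bullet> c = ((c \<bullet> b) *\<^sub>R b) \<bullet> ((c \<bullet> b) *\<^sub>R b)" by simp
 hence "(c \<bullet> b)^2 = 1" using assms by (simp add: power2_eq_square)
 hence "c \<bullet> b = 1 \<or> c \<bullet> b = -1" by (simp add: power2_eq_1_iff)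
 thus ?thesis using c by auto
qed

lemma orthonormal_combination_dist:
 fixes a b p :: "'a::real_inner"
 assumes "a \<bullet> a = 1" "b \<bullet> b = 1" "a \<bullet> b = 0"
 shows "dist (p + Re z *\<^sub>R a + Im z *\<^sub>R b) (p + Re z' *\<^sub>R a + Im z' *\<^sub>R b) = dist z z'"
proof -
 define x y where "x = Re z - Re z'" and "y = Im z - Im z'"
 have "(p + Re z *\<^sub>R a + Im z *\<^sub>R b) - (p + Re z' *\<^sub>R a + Im z' *\<^sub>R b) = x *\<^sub>R a + y *\<^sub>R b"
  by (simp add: x_def y_def algebra_simps)
 hence "dist (p + Re z *\<^sub>R a + Im z *\<^sub>R b) (p + Re z' *\<^sub>R a + Im z' *\<^sub>R b) = sqrt ((x *\<^sub>R a + y *\<^sub>R b) \<bullet> (x *\<^sub>R a + y *\<^sub>R b))"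
  by (simp add: dist_norm norm_eq_sqrt_inner)
 also have "(x *\<^sub>R a + y *\<^sub>R b) \<bullet> (x *\<^sub>R a + y *\<^sub>R b) = x^2 + y^2"
  using assms by (simp add: inner_add_left inner_add_right inner_commute power2_eq_square)
 finally show ?thesis by (simp add: dist_norm cmod_def x_def y_def)
qed

lemma isometry_into_plane:
 fixes f :: "complex => real^2"
 assumes iso: "!!x y. x \<in> S ==> y \<in> S ==> dist (f x) (f y) = dist x y"
  and S: "z0 \<in> S" "z0 + cr e \<in> S" "z0 + Complex 0 (k * e) \<in> S" and e: "e > 0" and k: "k = 1 \<or> k = -1"
 shows "\<exists>a b. a \<bullet> a = 1 \<and> b \<bullet> b = 1 \<and> a \<bullet> b = 0 \<and>
  (\<forall>z\<in>S. f z = f z0 + Re (z - z0) *\<^sub>R a + Im (z - z0) *\<^sub>R b)"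
proof -
 have inn: "(f x - f z0) \<bullet> (f y - f z0) = Re (x - z0) * Re (y - z0) + Im (x - z0) * Im (y - z0)"
  if "x \<in> S" "y \<in> S" for x y
 proof -
  have "(f x - f z0) \<bullet> (f y - f z0) = ((norm (f x - f z0))^2 + (norm (f y - f z0))^2 - (norm ((f x - f z0) - (f y - f z0)))^2) / 2"
   by (rule dot_norm_neg)
  also have "\<dots> = ((cmod (x - z0))^2 + (cmod (y - z0))^2 - (cmod (x - y))^2) / 2"
   using iso[of x z0] iso[of y z0] iso[of x y] that S by (auto simp: dist_norm)
  also have "((cmod (x - z0))^2 + (cmod (y - z0))^2 - (cmod (x - y))^2) / 2
    = Re (x - z0) * Re (y - z0) + Im (x - z0) * Im (y - z0)"
  proof -
   have "(cmod (x - z0))^2 + (cmod (y - z0))^2 - (cmod (x - y))^2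
     = 2 * (Re (x - z0) * Re (y - z0) + Im (x - z0) * Im (y - z0))"
    unfolding cmod_power2 by (simp add: power2_eq_square algebra_simps)
   thus ?thesis by simp
  qed
  finally show ?thesis .
 qed
 define a b where "a = (1 / e) *\<^sub>R (f (z0 + cr e) - f z0)" and "b = (1 / (k * e)) *\<^sub>R (f (z0 + Complex 0 (k * e)) - f z0)"
 have kk: "k * k = 1" "k ~= 0" using k by auto
 define P Q where "P = f (z0 + cr e) - f z0" and "Q = f (z0 + Complex 0 (k * e)) - f z0"
 have aP: "a = (1 / e) *\<^sub>R P" "b = (1 / (k * e)) *\<^sub>R Q" by (simp_all add: a_def b_def P_def Q_def)
 have PQ: "P \<bullet> P = e * e" "Q \<bullet> Q = k * e * (k * e)" "P \<bullet> Q = 0"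
  using inn[OF S(2) S(2)] inn[OF S(3) S(3)] inn[OF S(2) S(3)] by (simp_all add: P_def Q_def)
 have ab: "a \<bullet> a = 1" "b \<bullet> b = 1" "a \<bullet> b = 0"
  unfolding aP using e kk by (simp_all add: PQ)
 have "f z = f z0 + Re (z - z0) *\<^sub>R a + Im (z - z0) *\<^sub>R b" if z: "z \<in> S" for z
 proof -
  have "(f z - f z0) \<bullet> P = Re (z - z0) * e" "(f z - f z0) \<bullet> Q = Im (z - z0) * (k * e)"
   using inn[OF z S(2)] inn[OF z S(3)] by (simp_all add: P_def Q_def)
  hence E: "(f z - f z0) \<bullet> a = Re (z - z0)" "(f z - f z0) \<bullet> b = Im (z - z0)"
   unfolding aP using e kk by simp_all
  show ?thesis using orthonormal_expansion[OF ab, of "f z - f z0"] unfolding E by (simp add: algebra_simps)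
 qed
 thus ?thesis using ab by blast
qed

text \<open>
 The second condition, that a whole metric ball is covered, is what makes geodesics that start in the
 chart stay in it.
\<close>

definition isometric_chart :: "(complex => 'm::metric_space) => complex => real => bool" where
 "isometric_chart g z e \<longleftrightarrow> 0 < e \<and> (\<forall>u\<in>ball z e. \<forall>v\<in>ball z e. dist (g u) (g v) = dist u v) \<and>
   ball (g z) e \<subseteq> g ` ball z e"

lemma isometric_chartD:
 assumes "isometric_chart g z e"
 shows "0 < e" "u \<in> ball z e ==> v \<in> ball z e ==> dist (g u) (g v) = dist u v"
  "p \<in> ball (g z) e ==> \<exists>u\<in>ball z e. g u = p"
  "u \<in> ball z e ==> v \<in> ball z e ==> g u = g v ==> u = v"
proof -
 note A = assms[unfolded isometric_chart_def]
 show 1: "0 < e" "!!u v. u \<in> ball z e ==> v \<in> ball z e ==> dist (g u) (g v) = dist u v"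
  using A by simp_all
 show "\<exists>u\<in>ball z e. g u = p" if "p \<in> ball (g z) e"
 proof -
  have "p \<in> g ` ball z e" using A that by blast
  thus ?thesis by (auto simp: image_iff)
 qed
 show "u = v" if "u \<in> ball z e" "v \<in> ball z e" "g u = g v"
  using 1(2)[OF that(1,2)] that(3) by (metis dist_eq_0_iff)
qed

lemma isometric_chartI:
 fixes f :: "'m::metric_space => real^2" and g :: "complex => 'm"
 assumes iso: "!!x y. x \<in> N ==> y \<in> N ==> dist (f x) (f y) = dist x y"
  and N: "ball (g z0) e \<subseteq> N" "g ` ball z0 e \<subseteq> N" and e: "0 < e"
  and ab: "a \<bullet> a = 1" "b \<bullet> b = 1" "a \<bullet> b = 0"
  and fg: "!!z. z \<in> ball z0 e ==> f (g z) = f (g z0) + Re (z - z0) *\<^sub>R a + Im (z - z0) *\<^sub>R b"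
 shows "isometric_chart g z0 e"
 unfolding isometric_chart_def
proof (intro conjI ballI subsetI e)
 fix u v assume uv: "u \<in> ball z0 e" "v \<in> ball z0 e"
 have "dist (g u) (g v) = dist (f (g u)) (f (g v))"
  by (rule iso[symmetric]) (use N(2) uv in auto)
 also have "\<dots> = dist (u - z0) (v - z0)"
  unfolding fg[OF uv(1)] fg[OF uv(2)] by (rule orthonormal_combination_dist[OF ab])
 finally show "dist (g u) (g v) = dist u v" by (simp add: dist_norm)
next
 fix p assume p: "p \<in> ball (g z0) e"
 define x where "x = f p - f (g z0)"
 define z where "z = z0 + Complex (x \<bullet> a) (x \<bullet> b)"
 have x: "(x \<bullet> a) *\<^sub>R a + (x \<bullet> b) *\<^sub>R b = x" by (rule orthonormal_expansion[OF ab, symmetric])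
 have gz: "g z0 \<in> N" using N(1) e by auto
 have "dist z0 z = dist (0 + Re 0 *\<^sub>R a + Im 0 *\<^sub>R b) (0 + Re (z - z0) *\<^sub>R a + Im (z - z0) *\<^sub>R b)"
  unfolding orthonormal_combination_dist[OF ab] by (simp add: dist_norm norm_minus_commute)
 also have "\<dots> = norm x" by (simp add: z_def x)
 also have "\<dots> = dist (f p) (f (g z0))" by (simp add: x_def dist_norm)
 also have "\<dots> = dist p (g z0)" by (rule iso[OF _ gz]) (use N(1) p in blast)
 also have "\<dots> < e" using p by (simp add: dist_commute)
 finally have z: "z \<in> ball z0 e" by simp
 have "f (g z) = f (g z0) + ((x \<bullet> a) *\<^sub>R a + (x \<bullet> b) *\<^sub>R b)" unfolding fg[OF z] by (simp add: z_def)
 hence "f (g z) = f p" unfolding x by (simp add: x_def)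
 moreover have "g z \<in> N" "p \<in> N" using N z p by blast+
 ultimately have "g z = p" using iso[of "g z" p] by (metis dist_eq_0_iff)
 thus "p \<in> g ` ball z0 e" using z by blast
qed

definition local_geodesic_at :: "(real => 'm::metric_space) => real => real => bool" where
 "local_geodesic_at gam L t \<longleftrightarrow> (\<exists>dlt>0. \<forall>a b. \<bar>a - t\<bar> < dlt --> \<bar>b - t\<bar> < dlt --> dist (gam a) (gam b) = L * \<bar>a - b\<bar>)"

text \<open>
 A distance-preserving map from an interval into the plane is affine.
\<close>

lemma geodesic_in_chart:
 assumes g: "isometric_chart g z0 e" and geo: "local_geodesic_at gam L t0" and start: "gam t0 = g z0" and L: "L >= 0"
 shows "\<exists>v dlt. cmod v = L \<and> 0 < dlt \<and> (\<forall>t. \<bar>t - t0\<bar> < dlt -->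
   gam t = g (z0 + cr (t - t0) * v) \<and> z0 + cr (t - t0) * v \<in> ball z0 e)"
proof -
 note C = isometric_chartD[OF g]
 obtain dlt0 where d0: "dlt0 > 0" "!!a b. \<bar>a - t0\<bar> < dlt0 ==> \<bar>b - t0\<bar> < dlt0 ==> dist (gam a) (gam b) = L * \<bar>a - b\<bar>"
  using geo unfolding local_geodesic_at_def by blast
 define dlt where "dlt = min dlt0 (e / (L + 1))"
 have d: "dlt > 0" "dlt <= dlt0" "L * dlt < e"
 proof -
  show "dlt > 0" "dlt <= dlt0" using d0 C(1) L by (auto simp: dlt_def)
  have "L * dlt <= L * (e / (L + 1))" using L by (intro mult_left_mono) (auto simp: dlt_def)
  also have "\<dots> < e" using L C(1) by (simp add: field_simps)
  finally show "L * dlt < e" .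
 qed
 have "\<exists>z\<in>ball z0 e. g z = gam t" if "\<bar>t - t0\<bar> < dlt" for t
 proof (rule C(3))
  have "dist (g z0) (gam t) = L * \<bar>t0 - t\<bar>" using d0(2)[of t0 t] that d start d0 by simp
  also have "\<dots> <= L * dlt" using that L by (intro mult_left_mono) auto
  finally show "gam t \<in> ball (g z0) e" using d by simp
 qed
 then obtain z where z: "!!t. \<bar>t - t0\<bar> < dlt ==> z t \<in> ball z0 e \<and> g (z t) = gam t" by metis
 have zd: "dist (z a) (z b) = L * \<bar>a - b\<bar>" if "\<bar>a - t0\<bar> < dlt" "\<bar>b - t0\<bar> < dlt" for a b
  using C(2)[of "z a" "z b"] z[OF that(1)] z[OF that(2)] d0(2)[of a b] that d by simp
 have zt0: "z t0 = z0" using C(4)[of "z t0" z0] z[of t0] d C(1) start by simp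
 define \<eta> t1 where "\<eta> = dlt / 2" and "t1 = t0 + \<eta>"
 have t1: "\<eta> > 0" "\<bar>t1 - t0\<bar> < dlt" using d by (auto simp: \<eta>_def t1_def)
 define v where "v = (z t1 - z0) / cr \<eta>"
 have nv: "cmod v = L" using zd[of t1 t0] t1 d by (simp add: v_def norm_divide dist_norm zt0 t1_def)
 have "z t = z0 + cr (t - t0) * v" if t: "\<bar>t - t0\<bar> < dlt" for t
 proof -
  define \<tau> x y where "\<tau> = t - t0" and "x = z t - z0" and "y = z t1 - z0"
  have nx: "(cmod x)^2 = L^2 * \<tau>^2" using zd[of t t0] t d by (simp add: x_def \<tau>_def dist_norm zt0 power_mult_distrib)
  have ny: "(cmod y)^2 = L^2 * \<eta>^2" using zd[of t1 t0] t1 d by (simp add: y_def dist_norm zt0 power_mult_distrib t1_def)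
  have "cmod (x - y) = L * \<bar>\<tau> - \<eta>\<bar>" using zd[of t t1] t t1 by (simp add: x_def y_def dist_norm \<tau>_def t1_def algebra_simps)
  hence nxy: "(cmod (x - y))^2 = L^2 * (\<tau> - \<eta>)^2" by (simp add: power_mult_distrib)
  have "(cmod (cr \<eta> * x - cr \<tau> * y))^2
    = \<eta> * (\<eta> - \<tau>) * (cmod x)^2 + \<tau> * (\<tau> - \<eta>) * (cmod y)^2 + \<eta> * \<tau> * (cmod (x - y))^2"
   unfolding cmod_power2 by (simp add: power2_eq_square algebra_simps)
  also have "\<dots> = 0" unfolding nx ny nxy by (simp add: power2_eq_square algebra_simps)
  finally have "cr \<eta> * x = cr \<tau> * y" by simp
  hence "x = cr \<tau> * v" using t1 by (simp add: v_def y_def field_simps)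
  thus ?thesis by (simp add: x_def \<tau>_def algebra_simps)
 qed
 hence "gam t = g (z0 + cr (t - t0) * v) \<and> z0 + cr (t - t0) * v \<in> ball z0 e" if "\<bar>t - t0\<bar> < dlt" for t
  using z[OF that] that by simp
 thus ?thesis using nv d(1) by (intro exI[of _ v] exI[of _ dlt]) blast
qed

lemma small_multiple_in_ball:
 assumes "0 < e" shows "\<exists>dlt>0. \<forall>t::real. \<bar>t\<bar> < dlt --> z0 + cr t * v \<in> ball (z0::complex) e"
proof (intro exI conjI allI impI)
 have p: "0 < cmod v + 1" using norm_ge_zero[of v] by linarith
 show "0 < e / (cmod v + 1)" using assms p by simp
 fix t :: real assume t: "\<bar>t\<bar> < e / (cmod v + 1)"
 have "\<bar>t\<bar> * cmod v <= \<bar>t\<bar> * (cmod v + 1)" by (intro mult_left_mono) auto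
 also have "\<dots> < e" using t p by (simp add: pos_less_divide_eq)
 finally show "z0 + cr t * v \<in> ball z0 e" by (simp add: dist_norm norm_mult)
qed

lemma geodesic_continues_in_chart:
 assumes g: "isometric_chart g z0 e" and geo: "local_geodesic_at gam L t0" and L: "L >= 0"
  and \<eta>: "0 < \<eta>" and left: "!!t. t0 - \<eta> < t ==> t <= t0 ==> gam t = g (z0 + cr (t - t0) * v)"
 shows "\<exists>dlt>0. \<forall>t. \<bar>t - t0\<bar> < dlt --> gam t = g (z0 + cr (t - t0) * v)"
proof -
 note C = isometric_chartD[OF g]
 have "gam t0 = g z0" using left[of t0] \<eta> by simp
 then obtain v' dlt where v': "0 < dlt" "!!t. \<bar>t - t0\<bar> < dlt ==>
   gam t = g (z0 + cr (t - t0) * v') \<and> z0 + cr (t - t0) * v' \<in> ball z0 e"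
  using geodesic_in_chart[OF g geo _ L] by blast
 obtain dlt' where d': "dlt' > 0" "!!t. \<bar>t\<bar> < dlt' ==> z0 + cr t * v \<in> ball z0 e"
  using small_multiple_in_ball[OF C(1)] by blast
 define t where "t = t0 - min \<eta> (min dlt dlt') / 2"
 have t: "t0 - \<eta> < t" "t < t0" "\<bar>t - t0\<bar> < dlt" "\<bar>t - t0\<bar> < dlt'" using \<eta> v'(1) d'(1) by (auto simp: t_def)
 have "g (z0 + cr (t - t0) * v) = g (z0 + cr (t - t0) * v')"
  using left[of t] v'(2)[of t] t by simp
 hence "z0 + cr (t - t0) * v = z0 + cr (t - t0) * v'"
  by (rule C(4)[rotated 2]) (use d'(2)[of "t - t0"] v'(2)[of t] t in auto)
 hence "v = v'" using t by simp
 thus ?thesis using v' by blast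
qed

text \<open>
 The set of times at which the geodesic has left the line has an infimum; there the geodesic agrees with
 the line up to that time, and a chart around that point continues it.
\<close>

lemma geodesic_stays_straight:
 fixes c :: "complex => 'm::metric_space" and z0 v :: complex and t0 :: real
 defines "z \<equiv> %t. z0 + cr (t - t0) * v"
 assumes geo: "!!t. t0 < t ==> t < t1 ==> local_geodesic_at gam L t" and L: "L >= 0"
  and chart: "!!t. t0 < t ==> t < t1 ==> \<exists>g e. isometric_chart g (z t) e \<and> (\<forall>t'. z t' \<in> ball (z t) e --> g (z t') = c (z t'))"
  and dlt: "0 < dlt" and start: "!!t. t0 < t ==> t < t0 + dlt ==> t < t1 ==> gam t = c (z t)"
 shows "t0 < t ==> t < t1 ==> gam t = c (z t)"
proof (rule ccontr)
 assume t: "t0 < t" "t < t1" "gam t ~= c (z t)"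
 define B where "B = {t. t0 < t \<and> t < t1 \<and> gam t ~= c (z t)}"
 have B: "t \<in> B" "bdd_below B" "B ~= {}" using t by (auto simp: B_def intro!: bdd_belowI[of _ t0])
 define s where "s = Inf B"
 have "s <= t" unfolding s_def by (rule cInf_lower[OF B(1,2)])
 moreover have "t0 + dlt <= s" unfolding s_def
 proof (rule cInf_greatest[OF B(3)])
  fix x assume "x \<in> B" thus "t0 + dlt <= x" using start[of x] unfolding B_def by force
 qed
 ultimately have s: "t0 < s" "s < t1" using t dlt by auto
 have before: "gam x = c (z x)" if "t0 < x" "x < s" for x
 proof (rule ccontr)
  assume "gam x ~= c (z x)"
  hence "x \<in> B" using that s by (auto simp: B_def)
  hence "s <= x" unfolding s_def by (rule cInf_lower[OF _ B(2)])
  thus False using that by simp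
 qed
 obtain g e where g: "isometric_chart g (z s) e" "!!t'. z t' \<in> ball (z s) e ==> g (z t') = c (z t')"
  using chart[OF s] by blast
 note C = isometric_chartD[OF g(1)]
 have zz: "z x = z s + cr (x - s) * v" for x by (simp add: z_def algebra_simps)
 obtain dlt1 where dlt1: "dlt1 > 0" "!!t. \<bar>t\<bar> < dlt1 ==> z s + cr t * v \<in> ball (z s) e"
  using small_multiple_in_ball[OF C(1), of "z s" v] by blast
 have d1: "dlt1 > 0" "!!x. \<bar>x - s\<bar> < dlt1 ==> z x \<in> ball (z s) e"
  using dlt1 zz by metis+
 obtain dlt2 where d2: "dlt2 > 0" "!!a b. \<bar>a - s\<bar> < dlt2 ==> \<bar>b - s\<bar> < dlt2 ==> dist (gam a) (gam b) = L * \<bar>a - b\<bar>"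
  using geo[OF s] unfolding local_geodesic_at_def by blast
 have eq: "gam s = g (z s)"
 proof -
  have "dist (gam s) (g (z s)) <= eps" if "eps > 0" for eps
  proof -
   define m where "m = min (min (s - t0) (min dlt1 dlt2)) (eps / (L + cmod v + 1))"
   have Lv: "L + cmod v + 1 > 0" using L norm_ge_zero[of v] by linarith
   have m: "m > 0" using s d1 d2 that Lv by (simp add: m_def)
   define x where "x = s - m / 2"
   have "m <= s - t0" "m <= dlt1" "m <= dlt2" by (auto simp: m_def)
   hence x: "t0 < x" "x < s" "\<bar>x - s\<bar> < dlt1" "\<bar>x - s\<bar> < dlt2" using m s d1(1) d2(1) by (auto simp: x_def)
   have "dist (gam s) (g (z s)) <= dist (gam s) (gam x) + dist (gam x) (g (z s))" by (rule dist_triangle)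
   also have "dist (gam s) (gam x) = L * \<bar>s - x\<bar>" using d2(2)[of s x] d2(1) x by simp
   also have "gam x = g (z x)" using before[OF x(1,2)] g(2) d1(2)[OF x(3)] by simp
   also have "dist (g (z x)) (g (z s)) = dist (z x) (z s)" by (rule C(2)) (use d1(2)[OF x(3)] C(1) in auto)
   also have "\<dots> = \<bar>s - x\<bar> * cmod v"
   proof -
    have "z x - z s = cr (x - s) * v" using zz[of x] by (simp only: add_diff_cancel_left')
    thus ?thesis by (simp add: dist_norm norm_mult abs_minus_commute del: of_real_diff)
   qed
   also have "L * \<bar>s - x\<bar> + \<bar>s - x\<bar> * cmod v <= m * (L + cmod v + 1)"
   proof -
    have "\<bar>s - x\<bar> <= m" using m by (simp add: x_def)
    hence "\<bar>s - x\<bar> * (L + cmod v) <= m * (L + cmod v + 1)" using L m by (intro mult_mono) auto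
    thus ?thesis by (simp add: algebra_simps)
   qed
   also have "\<dots> <= eps / (L + cmod v + 1) * (L + cmod v + 1)" using Lv by (intro mult_right_mono) (auto simp: m_def)
   also have "\<dots> = eps" using Lv by simp
   finally show ?thesis by simp
  qed
  hence "dist (gam s) (g (z s)) <= 0" by (rule field_le_epsilon[of _ 0, simplified])
  thus ?thesis by simp
 qed
 define \<eta> where "\<eta> = min (s - t0) dlt1"
 have "gam x = g (z s + cr (x - s) * v)" if "s - \<eta> < x" "x <= s" for x
 proof (cases "x = s")
  case False
  hence "gam x = c (z x)" using before[of x] that by (auto simp: \<eta>_def)
  also have "\<dots> = g (z x)" using d1(2)[of x] that by (intro g(2)[symmetric]) (auto simp: \<eta>_def)
  finally show ?thesis by (simp only: zz[of x, symmetric])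
 qed (use eq in simp)
 moreover have "\<eta> > 0" using s d1 by (auto simp: \<eta>_def)
 ultimately obtain dlt3 where d3: "dlt3 > 0" "!!x. \<bar>x - s\<bar> < dlt3 ==> gam x = g (z x)"
  using geodesic_continues_in_chart[OF g(1) geo[OF s] L, of \<eta> v] zz by metis
 have "s + min dlt1 dlt3 <= Inf B"
 proof (rule cInf_greatest[OF B(3)])
  fix x assume x: "x \<in> B"
  show "s + min dlt1 dlt3 <= x"
  proof (rule ccontr)
   assume "\<not> ?thesis"
   moreover have "s <= x" unfolding s_def by (rule cInf_lower[OF x B(2)])
   ultimately have "\<bar>x - s\<bar> < dlt1" "\<bar>x - s\<bar> < dlt3" by auto
   hence "gam x = c (z x)" using d3(2) d1(2) g(2) by metis
   thus False using x by (simp add: B_def)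
  qed
 qed
 thus False using d1 d3 by (simp add: s_def[symmetric])
qed

section \<open>Faces as planar triangles\<close>

lemma real_affine_eqI:
 fixes f g :: "complex => 'a::real_vector"
 assumes f: "!!z. f z = p + Re z *\<^sub>R a + Im z *\<^sub>R b" and g: "!!z. g z = p' + Re z *\<^sub>R a' + Im z *\<^sub>R b'"
  and "f 0 = g 0" "f (cr l) = g (cr l)" "l ~= 0" "f w = g w" "Im w ~= 0"
 shows "f z = g z"
proof -
 have p: "p = p'" using assms(3) f[of 0] g[of 0] by simp
 have "l *\<^sub>R a = l *\<^sub>R a'" using assms(4) f[of "cr l"] g[of "cr l"] p by simp
 hence a: "a = a'" using assms(5) by simp
 have "Im w *\<^sub>R b = Im w *\<^sub>R b'" using assms(6) f[of w] g[of w] p a by simp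
 hence b: "b = b'" using assms(7) by simp
 show ?thesis unfolding f g p a b ..
qed

text \<open>
 The notions below refer to the charts of \<open>T\<close>; two triangulations of the same surface are
 compared by two instances of this locale.
\<close>

locale surface_triangulation =
 fixes s :: "'v::finite => 'm::metric_space" and T :: "('v, 'm) geo_tri"
 assumes sphere: "polyhedral_sphere s" and geo: "geodesic_triangulation s T"
begin

sublocale metric_triangulation T
 by unfold_locales (use geo in \<open>auto simp: geodesic_triangulation_def\<close>)

lemma inj_s: "inj s" using sphere by (simp add: polyhedral_sphere_def)

lemma geoD:
 assumes "d \<in> darts T"
 shows "chart T (nxt T d) = chart T d" "chart T d (corner T d) = s (orig T d)"
  "continuous_on (triangle T d) (chart T d)"
  "t \<in> {0..1} ==> chart T d (edge_pt T d t) = chart T (opp T d) (edge_pt T (opp T d) (1 - t))"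
  "x \<in> triangle T d - corner T ` face T d ==> \<exists>e>0.
      \<forall>y\<in>triangle T d \<inter> ball x e. \<forall>z\<in>triangle T d \<inter> ball x e.
       dist (chart T d y) (chart T d z) = dist y z"
  "d' \<in> darts T ==> x \<in> interior (triangle T d) ==> y \<in> triangle T d' ==>
    chart T d x = chart T d' y ==> d' \<in> face T d \<and> y = x"
  "d' \<in> darts T ==> t \<in> {0<..<1} ==> y \<in> triangle T d' ==>
    chart T d (edge_pt T d t) = chart T d' y ==>
     (d' \<in> face T d \<and> y = edge_pt T d t) \<or>
     (d' \<in> face T (opp T d) \<and> y = edge_pt T (opp T d) (1 - t))"
 using geo assms unfolding geodesic_triangulation_def by blast+

lemma chart_cover: "\<exists>d\<in>darts T. \<exists>x\<in>triangle T d. chart T d x = p"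
proof -
 have "p \<in> (\<Union>d\<in>darts T. chart T d ` triangle T d)" using geo by (simp add: geodesic_triangulation_def)
 thus ?thesis by auto
qed

definition along :: "nat => real^2" where
 "along d = (1 / len T d) *\<^sub>R (corner T (nxt T d) - corner T d)"

definition across :: "nat => real^2" where
 "across d = (1 / Im (tip T d)) *\<^sub>R
   (corner T (prv T d) - corner T d - Re (tip T d) *\<^sub>R along d)"

text \<open>
 The isometry of the coordinate plane of the normal form onto the plane of the triangle.
\<close>

definition frame :: "nat => complex => real^2" where
 "frame d z = corner T d + Re z *\<^sub>R along d + Im z *\<^sub>R across d"

lemma frame_orthonormal:
 assumes d: "d \<in> darts T"
 shows "along d \<bullet> along d = 1" "across d \<bullet> across d = 1" "along d \<bullet> across d = 0"
proof -
 define U V w l where "U = corner T (nxt T d) - corner T d"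
  and "V = corner T (prv T d) - corner T d" and "w = tip T d" and "l = len T d"
 have l: "l > 0" "Im w > 0" using d tip_props(1) by (auto simp: l_def w_def)
 have UU: "U \<bullet> U = l^2" unfolding l_def U_def len_def dist_norm
  by (simp add: power2_norm_eq_inner inner_diff inner_commute)
 have "V \<bullet> V = (len T (prv T d))^2" unfolding V_def len_def dist_norm
  using d by (simp add: power2_norm_eq_inner inner_diff inner_commute)
 hence VV: "V \<bullet> V = (Re w)^2 + (Im w)^2" using tip_props(2)[OF d] by (simp add: w_def flip: cmod_power2)
 have UV: "U \<bullet> V = l * Re w" using tip_props(4)[OF d] l by (simp add: U_def V_def w_def l_def)
 have a: "along d = (1 / l) *\<^sub>R U" and b: "across d = (1 / Im w) *\<^sub>R (V - Re w *\<^sub>R along d)"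
  by (simp_all add: along_def across_def U_def V_def w_def l_def)
 show 1: "along d \<bullet> along d = 1" using l by (simp add: a UU power2_eq_square)
 have aV: "along d \<bullet> V = Re w" using l by (simp add: a UV)
 have "(V - Re w *\<^sub>R along d) \<bullet> (V - Re w *\<^sub>R along d) = (Im w)^2"
  using 1 aV VV by (simp add: inner_diff inner_commute power2_eq_square)
 thus "across d \<bullet> across d = 1" using l unfolding b by (simp add: power2_eq_square)
 show "along d \<bullet> across d = 0" unfolding b by (simp add: inner_diff 1 aV)
qed

lemma frame_dist: "d \<in> darts T ==> dist (frame d z) (frame d z') = dist z z'"
 unfolding frame_def by (rule orthonormal_combination_dist[OF frame_orthonormal])

lemma frame_inj: "d \<in> darts T ==> frame d z = frame d z' \<longleftrightarrow> z = z'"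
 using frame_dist[of d z z'] by (metis dist_eq_0_iff)

lemma frame_corners:
 assumes d: "d \<in> darts T"
 shows "frame d 0 = corner T d" "frame d (cr (len T d)) = corner T (nxt T d)"
  "frame d (tip T d) = corner T (prv T d)"
 using tip_props(1)[OF d] d by (simp_all add: frame_def along_def across_def)

lemma frame_surj: "d \<in> darts T ==> \<exists>z. frame d z = x"
proof -
 assume d: "d \<in> darts T"
 have "x - corner T d = ((x - corner T d) \<bullet> along d) *\<^sub>R along d + ((x - corner T d) \<bullet> across d) *\<^sub>R across d"
  by (rule orthonormal_expansion[OF frame_orthonormal[OF d]])
 thus ?thesis unfolding frame_def
  by (intro exI[of _ "Complex ((x - corner T d) \<bullet> along d) ((x - corner T d) \<bullet> across d)"])
   (simp add: algebra_simps)
qed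

lemma frame_frame_nxt:
 assumes d: "d \<in> darts T"
 shows "frame d (frame_nxt d z) = frame (nxt T d) z"
proof (rule real_affine_eqI)
 let ?u = "side_dir d"
 have n: "nxt T d \<in> darts T" using d by simp
 show "frame d (frame_nxt d z) = frame d (cr (len T d)) + Re z *\<^sub>R (Re ?u *\<^sub>R along d + Im ?u *\<^sub>R across d)
   + Im z *\<^sub>R (- Im ?u *\<^sub>R along d + Re ?u *\<^sub>R across d)" for z
  by (simp add: frame_def frame_nxt_def algebra_simps)
 show "frame (nxt T d) z = corner T (nxt T d) + Re z *\<^sub>R along (nxt T d) + Im z *\<^sub>R across (nxt T d)" for z
  by (simp add: frame_def)
 show "frame d (frame_nxt d 0) = frame (nxt T d) 0" using frame_corners[OF d] frame_corners[OF n] by simp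
 show "frame d (frame_nxt d (cr (len T (nxt T d)))) = frame (nxt T d) (cr (len T (nxt T d)))"
  using frame_corners[OF d] frame_corners[OF n] d by simp
 show "frame d (frame_nxt d (tip T (nxt T d))) = frame (nxt T d) (tip T (nxt T d))"
  using frame_corners[OF d] frame_corners[OF n] d tip_nxt[OF d] by simp
 show "len T (nxt T d) ~= 0" "Im (tip T (nxt T d)) ~= 0"
  using n tip_props(1)[OF n] by auto
qed

definition tri :: "nat => complex set" where
 "tri d = {z. 0 <= Im z \<and> Im (z * cnj (tip T d)) <= 0 \<and>
   0 <= Im ((z - cr (len T d)) * cnj (tip T d - cr (len T d)))}"

text \<open>
 The three inequalities place the point to the left of the three sides; they are the barycentric
 coordinates up to positive factors.
\<close>

definition otri :: "nat => complex set" where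
 "otri d = {z. 0 < Im z \<and> Im (z * cnj (tip T d)) < 0 \<and>
   0 < Im ((z - cr (len T d)) * cnj (tip T d - cr (len T d)))}"

lemma tri_barycentric:
 fixes z d defines "l \<equiv> len T d" and "w \<equiv> tip T d"
 shows "Im ((z - cr l) * cnj (w - cr l)) - Im (z * cnj w) + l * Im z = l * Im w"
  "cr (l * Im w) * z = cr (l * Im z) * w + cr (- Im (z * cnj w)) * cr l"
 by (simp_all add: complex_eq_iff algebra_simps)

lemma frame_tri:
 assumes d: "d \<in> darts T"
 shows "triangle T d = frame d ` tri d"
proof -
 define l w where "l = len T d" and "w = tip T d"
 have lw: "l > 0" "Im w > 0" using d tip_props(1) by (auto simp: l_def w_def)
 have fa: "a + b + c = 1 ==> a *\<^sub>R corner T d + b *\<^sub>R corner T (nxt T d) + c *\<^sub>R corner T (prv T d)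
   = frame d (cr (b * l) + cr c * w)" for a b c
 proof -
  assume "a + b + c = 1"
  hence a: "a = 1 - b - c" by simp
  have c1: "corner T (nxt T d) = corner T d + l *\<^sub>R along d" using d by (simp add: along_def l_def)
  have c2: "corner T (prv T d) = corner T d + Re w *\<^sub>R along d + Im w *\<^sub>R across d"
   using frame_corners(3)[OF d] by (simp add: frame_def w_def)
  show ?thesis unfolding c1 c2 a frame_def by (simp add: algebra_simps)
 qed
 show ?thesis
 proof (intro equalityI subsetI)
  fix x assume "x \<in> triangle T d"
  then obtain a b c where abc: "0 <= a" "0 <= b" "0 <= c" "a + b + c = 1"
   "x = a *\<^sub>R corner T d + b *\<^sub>R corner T (nxt T d) + c *\<^sub>R corner T (prv T d)"
   unfolding triangle_def face_def by (auto simp: convex_hull_3)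
  define z where "z = cr (b * l) + cr c * w"
  have I: "Im z = c * Im w" "Im (z * cnj w) = - (b * l * Im w)" by (auto simp: z_def algebra_simps)
  have J: "Im ((z - cr l) * cnj (w - cr l)) = a * (l * Im w)"
  proof -
   have "Im ((z - cr l) * cnj (w - cr l)) = l * Im w + Im (z * cnj w) - l * Im z"
    using tri_barycentric(1)[where z = z and d = d] unfolding l_def[symmetric] w_def[symmetric] by linarith
   also have "\<dots> = (1 - b - c) * (l * Im w)" unfolding I by (simp add: algebra_simps)
   also have "1 - b - c = a" using abc(4) by simp
   finally show ?thesis .
  qed
  have "z \<in> tri d" unfolding tri_def l_def[symmetric] w_def[symmetric] mem_Collect_eq I J
   using abc lw by simp
  moreover have "x = frame d z" using fa[OF abc(4)] abc(5) by (simp add: z_def)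
  ultimately show "x \<in> frame d ` tri d" by blast
 next
  fix x assume "x \<in> frame d ` tri d"
  then obtain z where z: "z \<in> tri d" "x = frame d z" by blast
  note B = tri_barycentric[where z = z and d = d, folded l_def w_def]
  define a b c where "a = Im ((z - cr l) * cnj (w - cr l)) / (l * Im w)"
   and "b = - Im (z * cnj w) / (l * Im w)" and "c = Im z / Im w"
  have nn: "a >= 0" "b >= 0" "c >= 0" using z(1) lw unfolding tri_def a_def b_def c_def l_def[symmetric] w_def[symmetric]
   by (auto simp: zero_le_divide_iff divide_le_0_iff)
  have s1: "a + b + c = 1"
  proof -
   have "c = l * Im z / (l * Im w)" using lw by (simp add: c_def)
   hence "a + b + c = (Im ((z - cr l) * cnj (w - cr l)) - Im (z * cnj w) + l * Im z) / (l * Im w)"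
    unfolding a_def b_def by (simp only: add_divide_distrib diff_divide_distrib minus_divide_left)
   also have "\<dots> = 1" unfolding B(1) using lw by simp
   finally show ?thesis .
  qed
  have "cr (b * l) + cr c * w = (cr (l * Im z) * w + cr (- Im (z * cnj w)) * cr l) / cr (l * Im w)"
  proof -
   define N where "N = Im (z * cnj w)"
   show ?thesis using lw unfolding b_def c_def N_def[symmetric] by (simp add: field_simps)
  qed
  also have "\<dots> = z" unfolding B(2)[symmetric] using lw by simp
  finally have "x = a *\<^sub>R corner T d + b *\<^sub>R corner T (nxt T d) + c *\<^sub>R corner T (prv T d)"
   using fa[OF s1] z(2) by simp
  thus "x \<in> triangle T d" unfolding triangle_def face_def using nn s1 by (auto simp: convex_hull_3)
 qed
qed

lemma otri_subset_tri: "otri d \<subseteq> tri d"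
 by (auto simp: otri_def tri_def)

lemma open_otri: "open (otri d)"
 unfolding otri_def by (intro open_Collect_conj open_Collect_less continuous_intros)

lemma frame_otri:
 assumes d: "d \<in> darts T" and z: "z \<in> otri d"
 shows "frame d z \<in> interior (triangle T d)"
proof -
 obtain e where e: "e > 0" "ball z e \<subseteq> otri d" using openE[OF open_otri z] .
 have "ball (frame d z) e \<subseteq> triangle T d"
 proof
  fix x assume x: "x \<in> ball (frame d z) e"
  obtain z' where z': "frame d z' = x" using frame_surj[OF d] by blast
  have "z' \<in> ball z e" using x z' frame_dist[OF d, of z z'] by simp
  hence "z' \<in> tri d" using e(2) otri_subset_tri by blast
  thus "x \<in> triangle T d" unfolding frame_tri[OF d] z'[symmetric] by (rule imageI)
 qed
 thus ?thesis unfolding mem_interior using e(1) by blast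
qed

lemma tri_cases:
 assumes d: "d \<in> darts T" and z: "z \<in> tri d"
 shows "z \<in> otri d \<or> z = 0 \<or> z = cr (len T d) \<or> z = tip T d \<or>
  (\<exists>t. 0 < t \<and> t < len T d \<and> z = cr t) \<or>
  (\<exists>t. 0 < t \<and> t < len T (nxt T d) \<and> z = frame_nxt d (cr t)) \<or>
  (\<exists>t. 0 < t \<and> t < len T (prv T d) \<and> z = frame_nxt d (frame_nxt (nxt T d) (cr t)))"
proof -
 define l w where "l = len T d" and "w = tip T d"
 have lw: "l > 0" "Im w > 0" using d tip_props(1) by (auto simp: l_def w_def)
 note B = tri_barycentric[where z = z and d = d, folded l_def w_def]
 define A1 A2 A3 where "A1 = Im z" and "A2 = - Im (z * cnj w)" and "A3 = Im ((z - cr l) * cnj (w - cr l))"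
 have nn: "A1 >= 0" "A2 >= 0" "A3 >= 0" using z by (auto simp: tri_def A1_def A2_def A3_def l_def w_def)
 have su: "A3 + A2 + l * A1 = l * Im w" using B(1) by (simp add: A1_def A2_def A3_def)
 have zf: "z = cr (A1 / Im w) * w + cr (A2 / Im w)"
 proof -
  have "cr (l * Im w) * z = cr (l * A1) * w + cr A2 * cr l"
   using B(2) unfolding A1_def A2_def .
  also have "\<dots> = cr (l * Im w) * (cr (A1 / Im w) * w + cr (A2 / Im w))"
   using lw by (simp add: field_simps)
  finally show ?thesis using lw by simp
 qed
 consider "A1 > 0" "A2 > 0" "A3 > 0" | "A1 = 0" | "A1 > 0" "A2 = 0" | "A1 > 0" "A2 > 0" "A3 = 0"
  using nn by linarith
 thus ?thesis
 proof cases
  case 1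
  hence "z \<in> otri d" by (simp add: otri_def A1_def A2_def A3_def l_def w_def)
  thus ?thesis ..
 next
  case 2
  define t where "t = A2 / Im w"
  have zt: "z = cr t" using zf 2 by (simp add: t_def)
  have "0 <= t" using nn lw by (simp add: t_def)
  moreover have "t <= l" using su 2 nn lw by (simp add: t_def divide_le_eq)
  ultimately consider "t = 0" | "t = l" | "0 < t" "t < l" by linarith
  thus ?thesis using zt by cases (auto simp: l_def)
 next
  case 3
  define k m where "k = A1 / Im w" and "m = len T (prv T d)"
  have m: "m > 0" "prv T d \<in> darts T" using d by (auto simp: m_def)
  have "l * A1 <= l * Im w" using su 3 nn by linarith
  hence k: "0 < k" "k <= 1" using 3 lw by (auto simp: k_def)
  have zk: "z = cr k * w" using zf 3 by (simp add: k_def)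
  show ?thesis
  proof (cases "k = 1")
   case True thus ?thesis using zk by (simp add: w_def)
  next
   case False
   have "frame_nxt d (frame_nxt (nxt T d) (cr (m * (1 - k)))) = z"
    unfolding tip_nxt_nxt[OF d] zk using m(1)
    by (simp add: m_def[symmetric] w_def[symmetric] field_simps)
   moreover have "0 < m * (1 - k)" "m * (1 - k) < m" using m k False by (auto simp: mult_less_cancel_left1)
   ultimately show ?thesis unfolding m_def by metis
  qed
 next
  case 4
  define k n where "k = A1 / Im w" and "n = len T (nxt T d)"
  have n: "n > 0" "nxt T d \<in> darts T" using d by (auto simp: n_def)
  have k: "0 < k" "k < 1"
  proof -
   have "l * A1 < l * Im w" using su 4 by linarith
   thus "0 < k" "k < 1" using lw 4 by (auto simp: k_def)
  qed
  have "A2 = l * (Im w - A1)" using su 4 by (simp add: algebra_simps)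
  hence "A2 / Im w = l * (1 - k)" using lw by (simp add: k_def field_simps)
  hence zk: "z = cr k * w + cr (l * (1 - k))" using zf by (simp add: k_def)
  have "frame_nxt d (cr (n * k)) = z"
   using side_dir(2)[OF d] unfolding frame_nxt_def zk w_def n_def l_def by (simp add: algebra_simps)
  moreover have "0 < n * k" "n * k < n" using n k by (auto simp: mult_less_cancel_left2)
  ultimately show ?thesis unfolding n_def by metis
 qed
qed

lemma tri_points:
 assumes d: "d \<in> darts T"
 shows "0 <= t ==> t <= len T d ==> cr t \<in> tri d" "tip T d \<in> tri d"
proof -
 have lw: "len T d > 0" "Im (tip T d) > 0" using d tip_props(1) by auto
 show "0 <= t ==> t <= len T d ==> cr t \<in> tri d"
  using lw by (auto simp: tri_def mult_le_0_iff zero_le_mult_iff)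
 show "tip T d \<in> tri d" using lw by (simp add: tri_def)
qed

lemma frame_nxt_tri:
 assumes d: "d \<in> darts T" shows "frame_nxt d z \<in> tri d \<longleftrightarrow> z \<in> tri (nxt T d)"
proof -
 have n: "nxt T d \<in> darts T" using d by simp
 have "triangle T (nxt T d) = triangle T d" unfolding triangle_def face_nxt[OF d] ..
 hence e: "frame d ` tri d = frame (nxt T d) ` tri (nxt T d)" unfolding frame_tri[OF d] frame_tri[OF n] by (rule sym)
 have i: "inj (frame d)" if "d \<in> darts T" for d using frame_inj[OF that] by (intro injI) blast
 have "frame_nxt d z \<in> tri d \<longleftrightarrow> frame d (frame_nxt d z) \<in> frame d ` tri d"
  by (rule inj_image_mem_iff[OF i[OF d], symmetric])
 also have "\<dots> \<longleftrightarrow> z \<in> tri (nxt T d)"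
  unfolding e frame_frame_nxt[OF d] by (rule inj_image_mem_iff[OF i[OF n]])
 finally show ?thesis .
qed

text \<open>
 The chart of the face, read in the normal form at \<open>d\<close>.
\<close>

definition nchart :: "nat => complex => 'm" where
 "nchart d z = chart T d (frame d z)"

lemma nchart_nxt: "d \<in> darts T ==> nchart (nxt T d) z = nchart d (frame_nxt d z)"
 using frame_frame_nxt[of d z] geoD(1)[of d] by (simp add: nchart_def)

lemma nchart_corners:
 assumes d: "d \<in> darts T"
 shows "nchart d 0 = s (orig T d)" "nchart d (cr (len T d)) = s (orig T (nxt T d))"
  "nchart d (tip T d) = s (orig T (prv T d))"
proof -
 have n: "nxt T d \<in> darts T" "prv T d \<in> darts T" using d by auto
 have 1: "nchart d 0 = s (orig T d)" if "d \<in> darts T" for d using geoD(2)[OF that] frame_corners(1)[OF that] by (simp add: nchart_def)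
 show "nchart d 0 = s (orig T d)" by (rule 1[OF d])
 show "nchart d (cr (len T d)) = s (orig T (nxt T d))" using 1[OF n(1)] nchart_nxt[OF d, of 0] by simp
 show "nchart d (tip T d) = s (orig T (prv T d))"
  using 1[OF n(2)] nchart_nxt[OF n(1), of 0] nchart_nxt[OF d, of "cr (len T (nxt T d))"] d by simp
qed

lemma frame_edge_pt:
 assumes d: "d \<in> darts T"
 shows "frame d (cr t) = edge_pt T d (t / len T d)"
proof -
 have "edge_pt T d (t / len T d) = corner T d + (t / len T d) *\<^sub>R (corner T (nxt T d) - corner T d)"
  by (simp add: edge_pt_def algebra_simps)
 thus ?thesis using d by (simp add: frame_def along_def)
qed

lemma nchart_opp:
 assumes d: "d \<in> darts T" and t: "0 <= t" "t <= len T d"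
 shows "nchart d (cr t) = nchart (opp T d) (cr (len T d - t))"
proof -
 have o: "opp T d \<in> darts T" "len T (opp T d) = len T d" "len T d > 0" using d len_opp by auto
 have "chart T d (edge_pt T d (t / len T d)) = chart T (opp T d) (edge_pt T (opp T d) (1 - t / len T d))"
  using geoD(4)[OF d, of "t / len T d"] t o by auto
 moreover have "1 - t / len T d = (len T d - t) / len T (opp T d)" using o by (simp add: field_simps)
 ultimately show ?thesis unfolding nchart_def frame_edge_pt[OF d] frame_edge_pt[OF o(1)] by simp
qed

lemma nchart_continuous:
 assumes d: "d \<in> darts T" shows "continuous_on (tri d) (nchart d)"
proof -
 have "continuous_on (tri d) (chart T d \<circ> frame d)"
  by (rule continuous_on_compose) (use geoD(3)[OF d] frame_tri[OF d] in \<open>auto simp: frame_def intro!: continuous_intros\<close>)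
 thus ?thesis by (simp add: nchart_def comp_def)
qed

lemma nchart_isometric:
 assumes d: "d \<in> darts T" and z: "z \<in> tri d" "z ~= 0" "z ~= cr (len T d)" "z ~= tip T d"
 shows "\<exists>e>0. \<forall>u\<in>tri d \<inter> ball z e. \<forall>v\<in>tri d \<inter> ball z e. dist (nchart d u) (nchart d v) = dist u v"
proof -
 have "frame d z \<notin> corner T ` face T d"
  using z frame_inj[OF d, of z] by (auto simp: face_def simp flip: frame_corners[OF d])
 moreover have "frame d z \<in> triangle T d" using z frame_tri[OF d] by blast
 ultimately obtain e where e: "e > 0" "!!y y'. y \<in> triangle T d \<inter> ball (frame d z) e ==> y' \<in> triangle T d \<inter> ball (frame d z) e
   ==> dist (chart T d y) (chart T d y') = dist y y'" using geoD(5)[OF d, of "frame d z"] by blast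
 have "dist (nchart d u) (nchart d v) = dist u v" if "u \<in> tri d \<inter> ball z e" "v \<in> tri d \<inter> ball z e" for u v
 proof -
  have "frame d u \<in> triangle T d \<inter> ball (frame d z) e" "frame d v \<in> triangle T d \<inter> ball (frame d z) e"
   using that frame_tri[OF d] frame_dist[OF d] by auto
  thus ?thesis using e(2) frame_dist[OF d] by (simp add: nchart_def)
 qed
 thus ?thesis using e(1) by blast
qed

lemma nchart_cover: "\<exists>d\<in>darts T. \<exists>z\<in>tri d. nchart d z = p"
proof -
 obtain d x where "d \<in> darts T" "x \<in> triangle T d" "chart T d x = p" using chart_cover by blast
 moreover then obtain z where "z \<in> tri d" "x = frame d z" using frame_tri[of d] by blast
 ultimately show ?thesis unfolding nchart_def by blast
qed

lemma nchart_inj_interior: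
 assumes d: "d \<in> darts T" "d' \<in> darts T" and z: "z \<in> otri d" "z' \<in> tri d'" and eq: "nchart d z = nchart d' z'"
 shows "d' \<in> face T d" "frame d' z' = frame d z"
proof -
 have "frame d' z' \<in> triangle T d'" using frame_tri[OF d(2)] z(2) by blast
 from geoD(6)[OF d(1) d(2) frame_otri[OF d(1) z(1)] this eq[unfolded nchart_def]]
 show "d' \<in> face T d" "frame d' z' = frame d z" by blast+
qed

lemma nchart_inj_edge:
 assumes d: "d \<in> darts T" "d' \<in> darts T" and t: "0 < t" "t < len T d" and z: "z' \<in> tri d'"
  and eq: "nchart d (cr t) = nchart d' z'"
 shows "(d' \<in> face T d \<and> frame d' z' = frame d (cr t)) \<or>
  (d' \<in> face T (opp T d) \<and> frame d' z' = frame (opp T d) (cr (len T d - t)))"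
proof -
 have o: "opp T d \<in> darts T" "len T (opp T d) = len T d" "len T d > 0" using d len_opp by auto
 have "1 - t / len T d = (len T d - t) / len T (opp T d)" using o by (simp add: field_simps)
 moreover have "(d' \<in> face T d \<and> frame d' z' = edge_pt T d (t / len T d)) \<or>
     (d' \<in> face T (opp T d) \<and> frame d' z' = edge_pt T (opp T d) (1 - t / len T d))"
  by (rule geoD(7)[OF d]) (use t frame_tri[OF d(2)] z eq in \<open>auto simp: nchart_def frame_edge_pt[OF d(1)]\<close>)
 ultimately show ?thesis using frame_edge_pt[OF d(1), of t] frame_edge_pt[OF o(1), of "len T d - t"]
  by (simp del: of_real_diff)
qed

lemma frame_face_corner:
 assumes d: "d \<in> darts T" "d' \<in> face T d" and z: "frame d' 0 = frame d z"
 shows "z = 0 \<or> z = cr (len T d) \<or> z = tip T d"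
proof -
 have "d' \<in> darts T" using d by (auto simp: face_def)
 hence c: "corner T d' = frame d z" using z frame_corners(1) by simp
 have "d' = d \<or> d' = nxt T d \<or> d' = prv T d" using d(2) by (auto simp: face_def)
 thus ?thesis
 proof (elim disjE)
  assume "d' = d" hence "frame d z = frame d 0" using c frame_corners(1)[OF d(1)] by simp
  thus ?thesis using frame_inj[OF d(1)] by blast
 next
  assume "d' = nxt T d" hence "frame d z = frame d (cr (len T d))" using c frame_corners(2)[OF d(1)] by simp
  thus ?thesis using frame_inj[OF d(1)] by blast
 next
  assume "d' = prv T d" hence "frame d z = frame d (tip T d)" using c frame_corners(3)[OF d(1)] by simp
  thus ?thesis using frame_inj[OF d(1)] by blast
 qed
qed

lemma tip_not_real: "d \<in> darts T ==> tip T d ~= cr t"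
 using tip_props(1)[of d] by auto

lemma interior_not_singular:
 assumes d: "d \<in> darts T" and z: "z \<in> otri d"
 shows "nchart d z \<notin> range s"
proof
 assume "nchart d z \<in> range s"
 then obtain i where i: "nchart d z = s i" by blast
 obtain d' where d': "d' \<in> darts T" "orig T d' = i" using orig_in_darts by blast
 have 0: "0 \<in> tri d'" using tri_points(1)[OF d'(1), of 0] len_pos[OF d'(1)] by simp
 have "nchart d z = nchart d' 0" using i nchart_corners(1)[OF d'(1)] d'(2) by simp
 note f = nchart_inj_interior[OF d d'(1) z 0 this]
 from frame_face_corner[OF d f] show False using z by (elim disjE) (simp_all add: otri_def)
qed

lemma edge_not_singular:
 assumes d: "d \<in> darts T" and t: "0 < t" "t < len T d"
 shows "nchart d (cr t) \<notin> range s"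
proof
 assume "nchart d (cr t) \<in> range s"
 then obtain i where i: "nchart d (cr t) = s i" by blast
 obtain d' where d': "d' \<in> darts T" "orig T d' = i" using orig_in_darts by blast
 have o: "opp T d \<in> darts T" "len T (opp T d) = len T d" using d len_opp by auto
 have 0: "0 \<in> tri d'" using tri_points(1)[OF d'(1), of 0] len_pos[OF d'(1)] by simp
 have "nchart d (cr t) = nchart d' 0" using i nchart_corners(1)[OF d'(1)] d'(2) by simp
 from nchart_inj_edge[OF d d'(1) t 0 this] consider "d' \<in> face T d" "frame d' 0 = frame d (cr t)" |
  "d' \<in> face T (opp T d)" "frame d' 0 = frame (opp T d) (cr (len T d - t))" by blast
 thus False
 proof cases
  case 1
  from frame_face_corner[OF d 1] show False
   using t tip_not_real[OF d, of t] by (elim disjE) simp_all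
 next
  case 2
  have "len T d - t ~= 0" "len T d - t ~= len T (opp T d)" using t o by auto
  hence "(cr (len T d - t) :: complex) ~= 0" "(cr (len T d - t) :: complex) ~= cr (len T (opp T d))"
   "cr (len T d - t) ~= tip T (opp T d)"
   unfolding of_real_eq_iff of_real_eq_0_iff using tip_not_real[OF o(1), of "len T d - t"] by metis+
  thus False using frame_face_corner[OF o(1) 2] by blast
 qed
qed

lemma point_cases:
 obtains i where "p = s i"
 | d z where "d \<in> darts T" "z \<in> otri d" "p = nchart d z"
 | d t where "d \<in> darts T" "0 < t" "t < len T d" "p = nchart d (cr t)"
proof -
 obtain d z where d: "d \<in> darts T" "z \<in> tri d" "nchart d z = p" using nchart_cover by blast
 have n: "nxt T d \<in> darts T" "prv T d \<in> darts T" using d by auto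
 from tri_cases[OF d(1,2)] show ?thesis
 proof (elim disjE exE conjE)
  assume "z \<in> otri d" thus ?thesis using that(2)[OF d(1)] d(3) by blast
 next
  assume "z = 0"
  hence "p = s (orig T d)" using d(3) nchart_corners(1)[OF d(1)] by simp
  thus ?thesis by (rule that(1))
 next
  assume "z = cr (len T d)"
  hence "p = s (orig T (nxt T d))" using d(3) nchart_corners(2)[OF d(1)] by simp
  thus ?thesis by (rule that(1))
 next
  assume "z = tip T d"
  hence "p = s (orig T (prv T d))" using d(3) nchart_corners(3)[OF d(1)] by simp
  thus ?thesis by (rule that(1))
 next
  fix t assume "0 < t" "t < len T d" "z = cr t" thus ?thesis using that(3)[OF d(1), of t] d(3)[symmetric] by simp
 next
  fix t assume t: "0 < t" "t < len T (nxt T d)" "z = frame_nxt d (cr t)"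
  hence "p = nchart (nxt T d) (cr t)" using d(3) nchart_nxt[OF d(1), of "cr t"] by simp
  thus ?thesis by (rule that(3)[OF n(1) t(1,2)])
 next
  fix t assume t: "0 < t" "t < len T (prv T d)" "z = frame_nxt d (frame_nxt (nxt T d) (cr t))"
  hence "p = nchart (prv T d) (cr t)"
   using d(3) nchart_nxt[OF d(1)] nchart_nxt[OF n(1), of "cr t"] by simp
  thus ?thesis by (rule that(3)[OF n(2) t(1,2)])
 qed
qed

end

section \<open>Isometric charts across edges\<close>

definition geodesic_path :: "('v => 'm::metric_space) => (real => 'm) => real => bool" where
 "geodesic_path s gam L \<longleftrightarrow> 0 < L \<and> continuous_on {0..1} gam \<and>
   (\<forall>t\<in>{0<..<1}. local_geodesic_at gam L t \<and> gam t \<notin> range s)"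

lemma geodesic_pathD:
 assumes "geodesic_path s gam L"
 shows "0 < L" "continuous_on {0..1} gam" "0 < t ==> t < 1 ==> local_geodesic_at gam L t"
  "0 < t ==> t < 1 ==> gam t \<notin> range s"
 using assms by (simp_all add: geodesic_path_def)

lemma local_geodesic_at_chart_line:
 assumes g: "isometric_chart g z e" and dlt: "0 < dlt"
  and eq: "!!t. \<bar>t - t0\<bar> < dlt ==> gam t = g (z + cr (t - t0) * v)"
 shows "local_geodesic_at gam (cmod v) t0"
proof -
 note C = isometric_chartD[OF g]
 obtain dlt' where d': "dlt' > 0" "!!t. \<bar>t\<bar> < dlt' ==> z + cr t * v \<in> ball z e"
  using small_multiple_in_ball[OF C(1)] by blast
 have "dist (gam a) (gam b) = cmod v * \<bar>a - b\<bar>" if "\<bar>a - t0\<bar> < min dlt dlt'" "\<bar>b - t0\<bar> < min dlt dlt'" for a b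
 proof -
  have "dist (gam a) (gam b) = dist (g (z + cr (a - t0) * v)) (g (z + cr (b - t0) * v))"
   using eq[of a] eq[of b] that by simp
  also have "\<dots> = dist (z + cr (a - t0) * v) (z + cr (b - t0) * v)"
   by (rule C(2)) (use d'(2)[of "a - t0"] d'(2)[of "b - t0"] that in auto)
  also have "\<dots> = cmod (cr (a - b) * v)" unfolding dist_norm by (simp add: algebra_simps)
  also have "\<dots> = cmod v * \<bar>a - b\<bar>" unfolding norm_mult norm_of_real by simp
  finally show ?thesis .
 qed
 thus ?thesis unfolding local_geodesic_at_def using dlt d'(1) by (intro exI[of _ "min dlt dlt'"]) simp
qed

context surface_triangulation
begin

text \<open>
 The two faces at the edge \<open>d\<close>, laid out in the plane on both sides of the real axis.
\<close>

definition glue :: "nat => complex => 'm" where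
 "glue d z = (if 0 <= Im z then nchart d z else nchart (opp T d) (cr (len T d) - z))"

lemma flat_neighbourhood:
 assumes "p \<notin> range s"
 obtains e and f :: "'m => real^2" where "0 < e" "!!x y. x \<in> ball p e ==> y \<in> ball p e ==> dist (f x) (f y) = dist x y"
proof -
 have "flat_point p" using sphere assms by (simp add: polyhedral_sphere_def)
 then obtain N and f :: "'m => real^2" where N: "open N" "p \<in> N" "\<forall>x\<in>N. \<forall>y\<in>N. dist (f x) (f y) = dist x y"
  unfolding flat_point_def by blast
 obtain e where "e > 0" "ball p e \<subseteq> N" using openE[OF N(1,2)] .
 thus ?thesis using that N(3) by blast
qed

text \<open>
 A flat neighbourhood and the chart of the face are two isometries of a disc; comparing them shows that
 the chart covers a metric ball.
\<close>

lemma face_chart: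
 assumes d: "d \<in> darts T" and z: "z \<in> otri d"
 shows "\<exists>e. isometric_chart (nchart d) z e \<and> ball z e \<subseteq> otri d"
proof -
 obtain eps and f :: "'m => real^2" where f: "0 < eps"
  "!!x y. x \<in> ball (nchart d z) eps ==> y \<in> ball (nchart d z) eps ==> dist (f x) (f y) = dist x y"
  using flat_neighbourhood[OF interior_not_singular[OF d z]] by blast
 obtain e1 where e1: "e1 > 0" "ball z e1 \<subseteq> otri d" using openE[OF open_otri z] .
 have "z ~= 0" "z ~= cr (len T d)" "z ~= tip T d" using z by (auto simp: otri_def)
 then obtain e2 where e2: "e2 > 0"
  "!!u v. u \<in> tri d \<inter> ball z e2 ==> v \<in> tri d \<inter> ball z e2 ==> dist (nchart d u) (nchart d v) = dist u v"
  using nchart_isometric[OF d, of z] z otri_subset_tri by blast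
 define e where "e = min eps (min e1 e2)"
 have e: "e > 0" "e <= eps" "e <= e1" "e <= e2" using f(1) e1(1) e2(1) by (auto simp: e_def)
 have sub: "ball z e \<subseteq> otri d" using e1(2) subset_ball[OF e(3)] by blast
 have inb: "u \<in> tri d \<inter> ball z e2" if "u \<in> ball z e" for u
 proof -
  have "u \<in> tri d" using that sub otri_subset_tri by blast
  moreover have "u \<in> ball z e2" using that e(4) by simp
  ultimately show ?thesis by blast
 qed
 have iso: "dist (nchart d u) (nchart d v) = dist u v" if "u \<in> ball z e" "v \<in> ball z e" for u v
  using e2(2)[OF inb[OF that(1)] inb[OF that(2)]] .
 have N: "nchart d u \<in> ball (nchart d z) eps" if "u \<in> ball z e" for u
  using iso[of z u] that e by simp
 have isof: "dist (f (nchart d u)) (f (nchart d v)) = dist u v" if "u \<in> ball z e" "v \<in> ball z e" for u v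
  using f(2)[OF N[OF that(1)] N[OF that(2)]] iso[OF that] by simp
 have "\<exists>a b. a \<bullet> a = 1 \<and> b \<bullet> b = 1 \<and> a \<bullet> b = 0 \<and>
  (\<forall>u\<in>ball z e. f (nchart d u) = f (nchart d z) + Re (u - z) *\<^sub>R a + Im (u - z) *\<^sub>R b)"
  by (rule isometry_into_plane[where f = "%u. f (nchart d u)" and e = "e / 2" and k = 1, OF isof])
   (use e in \<open>auto simp: dist_norm norm_complex_def\<close>)
 then obtain a b where ab: "a \<bullet> a = 1" "b \<bullet> b = 1" "a \<bullet> b = 0"
  "!!u. u \<in> ball z e ==> f (nchart d u) = f (nchart d z) + Re (u - z) *\<^sub>R a + Im (u - z) *\<^sub>R b" by blast
 have "isometric_chart (nchart d) z e"
 proof (rule isometric_chartI[where N = "ball (nchart d z) eps", OF f(2) _ _ e(1) ab])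
  show "ball (nchart d z) e \<subseteq> ball (nchart d z) eps" using e(2) by (rule subset_ball)
  show "nchart d ` ball z e \<subseteq> ball (nchart d z) eps" using N by blast
 qed
 thus ?thesis using sub by blast
qed

lemma edge_half_disc:
 assumes d: "d \<in> darts T" and t: "0 < t" "t < len T d"
 shows "\<exists>e>0. \<forall>z\<in>ball (cr t) e. (0 <= Im z --> z \<in> tri d) \<and> (0 < Im z --> z \<in> otri d)"
proof -
 let ?w = "tip T d" and ?l = "len T d"
 let ?U = "{z. Im (z * cnj ?w) < 0 \<and> 0 < Im ((z - cr ?l) * cnj (?w - cr ?l))}"
 have w: "Im ?w > 0" using tip_props(1)[OF d] .
 have "open ?U" by (intro open_Collect_conj open_Collect_less continuous_intros)
 moreover have "cr t \<in> ?U" using w t by (simp add: mult_less_0_iff)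
 ultimately obtain e where "e > 0" "ball (cr t) e \<subseteq> ?U" by (rule openE)
 thus ?thesis by (intro exI[of _ e]) (auto simp: tri_def otri_def less_imp_le subset_iff)
qed

text \<open>
 In a flat neighbourhood the two half-discs are mapped by affine isometries that agree on the edge.
 They either continue each other or are folded onto each other; folding would identify interior points
 of faces, which the triangulation excludes.
\<close>

lemma edge_chart:
 assumes d: "d \<in> darts T" and t: "0 < t" "t < len T d"
 shows "\<exists>e. isometric_chart (glue d) (cr t) e \<and>
  (\<forall>z\<in>ball (cr t) e. (0 <= Im z --> z \<in> tri d) \<and> (0 < Im z --> z \<in> otri d) \<and>
    (Im z <= 0 --> cr (len T d) - z \<in> tri (opp T d)) \<and> (Im z < 0 --> cr (len T d) - z \<in> otri (opp T d)))"
proof -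
 define d' l where "d' = opp T d" and "l = len T d"
 have d': "d' \<in> darts T" "len T d' = l" "d' ~= d" "l > 0" using d len_opp[OF d] by (auto simp: d'_def l_def)
 have t': "0 < l - t" "l - t < len T d'" "t < l" using t d' by (auto simp: l_def)
 define c where "c = (cr t :: complex)"
 obtain eps and f :: "'m => real^2" where f: "0 < eps"
  "!!x y. x \<in> ball (nchart d c) eps ==> y \<in> ball (nchart d c) eps ==> dist (f x) (f y) = dist x y"
  using flat_neighbourhood[OF edge_not_singular[OF d t]] unfolding c_def by blast
 obtain e1 where e1: "e1 > 0" "!!z. z \<in> ball c e1 ==> (0 <= Im z --> z \<in> tri d) \<and> (0 < Im z --> z \<in> otri d)"
  using edge_half_disc[OF d t] unfolding c_def by blast
 obtain e2 where e2: "e2 > 0" "!!z. z \<in> ball (cr (l - t)) e2 ==> (0 <= Im z --> z \<in> tri d') \<and> (0 < Im z --> z \<in> otri d')"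
  using edge_half_disc[OF d'(1) t'(1,2)] by blast
 have c0: "c ~= 0" "c ~= cr (len T d)" "c ~= tip T d" "c \<in> tri d"
  using t tip_not_real[OF d, of t] tri_points(1)[OF d, of t] by (auto simp: c_def)
 obtain e3 where e3: "e3 > 0"
  "!!u v. u \<in> tri d \<inter> ball c e3 ==> v \<in> tri d \<inter> ball c e3 ==> dist (nchart d u) (nchart d v) = dist u v"
  using nchart_isometric[OF d c0(4,1,2,3)] by blast
 have "l - t ~= 0" "l - t ~= len T d'" using t' by auto
 hence c0': "(cr (l - t) :: complex) ~= 0" "(cr (l - t) :: complex) ~= cr (len T d')"
  unfolding of_real_eq_iff of_real_eq_0_iff .
 have c1': "cr (l - t) ~= tip T d'" "cr (l - t) \<in> tri d'"
  using tip_not_real[OF d'(1), of "l - t"] tri_points(1)[OF d'(1), of "l - t"] t' by (metis, simp)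
 obtain e4 where e4: "e4 > 0"
  "!!u v. u \<in> tri d' \<inter> ball (cr (l - t)) e4 ==> v \<in> tri d' \<inter> ball (cr (l - t)) e4 ==> dist (nchart d' u) (nchart d' v) = dist u v"
  using nchart_isometric[OF d'(1) c1'(2) c0' c1'(1)] by blast
 define e where "e = min eps (min (min e1 e2) (min e3 e4))"
 have e: "e > 0" "e <= eps" "e <= e1" "e <= e2" "e <= e3" "e <= e4" using f(1) e1(1) e2(1) e3(1) e4(1) by (auto simp: e_def)
 have refl: "cr l - z \<in> ball (cr (l - t)) e'" if "z \<in> ball c e'" for z e'
 proof -
  have "(cr (l - t) :: complex) - (cr l - z) = z - c" by (simp add: c_def)
  hence "dist (cr (l - t)) (cr l - z) = dist c z" by (simp only: dist_norm norm_minus_commute[of c])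
  thus ?thesis using that by simp
 qed
 have D: "(0 <= Im z --> z \<in> tri d) \<and> (0 < Im z --> z \<in> otri d) \<and>
    (Im z <= 0 --> cr l - z \<in> tri d') \<and> (Im z < 0 --> cr l - z \<in> otri d')" if z: "z \<in> ball c e" for z
  using e1(2)[of z] e2(2)[OF refl, of z] z e(3,4) by auto
 define g where "g z = nchart d' (cr l - z)" for z
 let ?P = "{z \<in> ball c e. 0 <= Im z}" and ?M = "{z \<in> ball c e. Im z <= 0}"
 have isoP: "dist (nchart d u) (nchart d v) = dist u v" if "u \<in> ?P" "v \<in> ?P" for u v
  by (rule e3(2)) (use that D[of u] D[of v] e(5) in auto)
 have isoM: "dist (g u) (g v) = dist u v" if "u \<in> ?M" "v \<in> ?M" for u v
 proof -
  have "dist (g u) (g v) = dist (cr l - u) (cr l - v)" unfolding g_def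
   by (rule e4(2)) (use that D[of u] D[of v] refl[of u e4] refl[of v e4] e(6) in auto)
  thus ?thesis by (simp add: dist_norm norm_minus_commute)
 qed
 have real_eq: "nchart d (cr x) = g (cr x)" if "0 <= x" "x <= l" for x
  using nchart_opp[OF d, of x] that by (simp add: g_def d'_def l_def)
 have cP: "c \<in> ?P" and cM: "c \<in> ?M" using e by (auto simp: c_def)
 have gc: "g c = nchart d c" using real_eq[of t] t by (simp add: c_def l_def)
 have NP: "nchart d u \<in> ball (nchart d c) eps" if "u \<in> ?P" for u using isoP[OF cP that] that e by simp
 have NM: "g u \<in> ball (nchart d c) eps" if "u \<in> ?M" for u using isoM[OF cM that] that e gc by simp
 have "\<exists>a b. a \<bullet> a = 1 \<and> b \<bullet> b = 1 \<and> a \<bullet> b = 0 \<and>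
  (\<forall>u\<in>?P. f (nchart d u) = f (nchart d c) + Re (u - c) *\<^sub>R a + Im (u - c) *\<^sub>R b)"
 proof (rule isometry_into_plane[where f = "%u. f (nchart d u)" and e = "e / 2" and k = 1])
  fix u v assume "u \<in> ?P" "v \<in> ?P"
  thus "dist (f (nchart d u)) (f (nchart d v)) = dist u v" using f(2)[OF NP NP] isoP by simp
 qed (use e cP in \<open>auto simp: dist_norm norm_complex_def c_def\<close>)
 then obtain a b where ab: "a \<bullet> a = 1" "b \<bullet> b = 1" "a \<bullet> b = 0"
  "!!u. u \<in> ?P ==> f (nchart d u) = f (nchart d c) + Re (u - c) *\<^sub>R a + Im (u - c) *\<^sub>R b" by blast
 have "\<exists>a b. a \<bullet> a = 1 \<and> b \<bullet> b = 1 \<and> a \<bullet> b = 0 \<and>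
  (\<forall>u\<in>?M. f (g u) = f (g c) + Re (u - c) *\<^sub>R a + Im (u - c) *\<^sub>R b)"
 proof (rule isometry_into_plane[where f = "%u. f (g u)" and e = "e / 2" and k = "-1"])
  fix u v assume "u \<in> ?M" "v \<in> ?M"
  thus "dist (f (g u)) (f (g v)) = dist u v" using f(2)[OF NM NM] isoM by simp
 qed (use e cM in \<open>auto simp: dist_norm norm_complex_def c_def\<close>)
 then obtain a' b' where ab': "a' \<bullet> a' = 1" "b' \<bullet> b' = 1" "a' \<bullet> b' = 0"
  "!!u. u \<in> ?M ==> f (g u) = f (nchart d c) + Re (u - c) *\<^sub>R a' + Im (u - c) *\<^sub>R b'" unfolding gc by blast
 have "a' = a"
 proof -
  define m where "m = min e (l - t) / 2"
  have m: "m > 0" "m < e" "m < l - t" using e t' by (auto simp: m_def)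
  define u where "u = (cr (t + m) :: complex)"
  have u: "u \<in> ?P" "u \<in> ?M" "Re (u - c) = m" "Im (u - c) = 0" using m by (auto simp: u_def c_def dist_norm)
  have "nchart d u = g u" using real_eq[of "t + m"] m t unfolding u_def by simp
  thus ?thesis using ab(4)[OF u(1)] ab'(4)[OF u(2)] m unfolding u(3,4) by auto
 qed
 note ab' = ab'[unfolded this]
 have "b' = b"
 proof (rule ccontr)
  assume "b' ~= b"
  hence b': "b' = - b" using orthonormal_second_unique[OF ab(1-3) ab'(2,3)] by blast
  have fold: "d' \<in> face T d \<and> frame d' (cr (l - t) + cr x * \<i>) = frame d (c + cr x * \<i>)" if x: "0 < x" "x < e" for x
  proof -
   define u where "u = c + cr x * \<i>"
   have u: "u \<in> ?P" "cnj u \<in> ?M" "0 < Im u" "Re (u - c) = 0" "Im (u - c) = x" "Re (cnj u - c) = 0" "Im (cnj u - c) = - x"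
    using x by (auto simp: u_def c_def dist_norm norm_mult)
   have "f (nchart d u) = f (g (cnj u))" using ab(4)[OF u(1)] ab'(4)[OF u(2)] unfolding u(4-7) b' by simp
   hence "nchart d u = g (cnj u)" using f(2)[OF NP[OF u(1)] NM[OF u(2)]] by simp
   hence eq: "nchart d u = nchart d' (cr l - cnj u)" by (simp add: g_def)
   have i: "u \<in> otri d" "cr l - cnj u \<in> tri d'" using D[of u] D[of "cnj u"] u by auto
   have E: "cr l - cnj u = cr (l - t) + cr x * \<i>" by (simp add: u_def c_def complex_eq_iff)
   show ?thesis using nchart_inj_interior[OF d d'(1) i eq] unfolding E unfolding u_def by blast
  qed
  have fold2: "d' \<in> face T d \<and> frame d' (cr (l - t) + cr (e / 2) * \<i>) = frame d (c + cr (e / 2) * \<i>)"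
   "frame d' (cr (l - t) + cr (e / 4) * \<i>) = frame d (c + cr (e / 4) * \<i>)"
   using fold[of "e / 2"] fold[of "e / 4"] e by auto
  have n: "nxt T d \<in> darts T" using d by simp
  have diff: "False" if lin: "!!z. frame d' z = frame d (A + z * k)" and k: "k ~= 1" for A k
  proof -
   define y1 y2 where "y1 = cr (e / 2) * \<i>" and "y2 = cr (e / 4) * \<i>"
   have E: "A + (cr (l - t) + y1) * k = c + y1" "A + (cr (l - t) + y2) * k = c + y2"
    using fold2 unfolding lin frame_inj[OF d] y1_def y2_def by blast+
   have "(y1 - y2) * k = (A + (cr (l - t) + y1) * k) - (A + (cr (l - t) + y2) * k)"
    by (simp add: algebra_simps)
   also have "\<dots> = y1 - y2" unfolding E by simp
   finally have "(y1 - y2) * (k - 1) = 0" by (simp add: right_diff_distrib)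
   moreover have "y1 - y2 ~= 0" using e by (simp add: y1_def y2_def complex_eq_iff)
   ultimately show False using k by simp
  qed
  have "d' = nxt T d \<or> d' = prv T d" using fold2(1) d'(3) by (auto simp: face_def)
  thus False
  proof
   assume "d' = nxt T d"
   hence "frame d' z = frame d (cr (len T d) + z * side_dir d)" for z
    using frame_frame_nxt[OF d, of z] by (simp add: frame_nxt_def)
   thus False using diff side_dir(3)[OF d] by fastforce
  next
   assume d'2: "d' = prv T d"
   let ?k = "tip T d / cr (len T d')"
   have "frame d' z = frame d (tip T d + z * (- ?k))" for z
    using frame_frame_nxt[OF d, of "frame_nxt (nxt T d) z"] frame_frame_nxt[OF n, of z] tip_nxt_nxt[OF d, of z] d'2 d'
    by (simp add: field_simps)
   moreover have "Im (- ?k) ~= 0" using tip_props(1)[OF d] d' by simp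
   ultimately show False using diff[of "tip T d" "- ?k"] by fastforce
  qed
 qed
 note ab' = ab'(4)[unfolded this]
 have glue: "glue d z = (if 0 <= Im z then nchart d z else g z)" for z by (simp add: glue_def g_def d'_def l_def)
 have "isometric_chart (glue d) c e"
 proof (rule isometric_chartI[where N = "ball (nchart d c) eps", OF f(2) _ _ e(1) ab(1-3)])
  have gl: "glue d c = nchart d c" by (simp add: glue c_def)
  show "ball (glue d c) e \<subseteq> ball (nchart d c) eps" unfolding gl using e by auto
  show "glue d ` ball c e \<subseteq> ball (nchart d c) eps"
  proof safe
   fix u assume u: "u \<in> ball c e"
   show "glue d u \<in> ball (nchart d c) eps"
    using NP[of u] NM[of u] u unfolding glue by (cases "0 <= Im u") auto
  qed
  fix u assume u: "u \<in> ball c e"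
  show "f (glue d u) = f (glue d c) + Re (u - c) *\<^sub>R a + Im (u - c) *\<^sub>R b"
   unfolding gl using ab(4)[of u] ab'[of u] u unfolding glue by (cases "0 <= Im u") auto
 qed
 thus ?thesis using D unfolding c_def d'_def l_def by (intro exI[of _ e]) blast
qed

lemma geodesic_path_in_face:
 assumes d: "d \<in> darts T" and seg: "!!t. 0 < t ==> t < 1 ==> z0 + cr t * v \<in> otri d"
  and ends: "z0 \<in> tri d" "z0 + v \<in> tri d" and v: "v ~= 0"
 shows "geodesic_path s (%t. nchart d (z0 + cr t * v)) (cmod v)"
 unfolding geodesic_path_def
proof (intro conjI ballI)
 have *: "z0 + cr t * v \<in> tri d" if t01: "t \<in> {0..1}" for t
 proof -
  consider "t = 0" | "t = 1" | "0 < t \<and> t < 1" using t01 by fastforce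
  thus ?thesis using ends seg[of t] otri_subset_tri by cases auto
 qed
 show "continuous_on {0..1} (%t. nchart d (z0 + cr t * v))"
  by (rule continuous_on_compose2[OF nchart_continuous[OF d]]) (use * in \<open>auto intro!: continuous_intros\<close>)
 fix t :: real assume t: "t \<in> {0<..<1}"
 obtain e where e: "isometric_chart (nchart d) (z0 + cr t * v) e" using face_chart[OF d seg] t by fastforce
 show "local_geodesic_at (%t. nchart d (z0 + cr t * v)) (cmod v) t"
  by (rule local_geodesic_at_chart_line[OF e, of 1]) (simp_all add: algebra_simps)
 show "nchart d (z0 + cr t * v) \<notin> range s" using interior_not_singular[OF d seg] t by simp
qed (use v in simp)

lemma geodesic_path_edge:
 assumes d: "d \<in> darts T"
 shows "geodesic_path s (%t. nchart d (cr (t * len T d))) (len T d)"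
 unfolding geodesic_path_def
proof (intro conjI ballI)
 have l: "len T d > 0" using d by simp
 thus "0 < len T d" .
 have *: "cr (t * len T d) \<in> tri d" if "t \<in> {0..1}" for t
  by (rule tri_points(1)[OF d]) (use that l in \<open>auto simp: mult_le_cancel_right1\<close>)
 show "continuous_on {0..1} (%t. nchart d (cr (t * len T d)))"
  by (rule continuous_on_compose2[OF nchart_continuous[OF d]]) (use * in \<open>auto intro!: continuous_intros\<close>)
 fix t :: real assume t: "t \<in> {0<..<1}"
 have tl: "0 < t * len T d" "t * len T d < len T d" using t l by auto
 obtain e where e: "isometric_chart (glue d) (cr (t * len T d)) e" using edge_chart[OF d tl] by blast
 have "local_geodesic_at (%t. nchart d (cr (t * len T d))) (cmod (cr (len T d))) t"
  by (rule local_geodesic_at_chart_line[OF e, of 1]) (simp_all add: glue_def algebra_simps)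
 thus "local_geodesic_at (%t. nchart d (cr (t * len T d))) (len T d) t" using l by simp
 show "nchart d (cr (t * len T d)) \<notin> range s" using edge_not_singular[OF d tl] .
qed

end

section \<open>The squared distance from the apex\<close>

text \<open>
 At the leftmost minimum a negative value would come with strictly larger values just to its left, which
 contradicts the condition on the midpoint.
\<close>

lemma leftmost_minimum:
 fixes f :: "real => real"
 assumes cont: "continuous_on {0..1} f" and ends: "0 <= f 0" "0 <= f 1"
  and mid: "!!t. 0 < t ==> t < 1 ==> \<exists>dlt>0. \<forall>h. 0 < h --> h < dlt --> f (t - h) + f (t + h) <= 2 * f t"
  and t: "0 <= t" "t <= 1"
 shows "0 <= f t"
proof (rule ccontr)
 assume "\<not> 0 <= f t"
 obtain m where m: "m \<in> {0..1}" "!!x. x \<in> {0..1} ==> f m <= f x"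
  using continuous_attains_inf[OF _ _ cont] by auto
 have fm: "f m < 0" using m(2)[of t] t \<open>\<not> 0 <= f t\<close> by simp
 define A where "A = {x\<in>{0..1}. f x = f m}"
 have A: "m \<in> A" "bdd_below A" "A ~= {}" using m by (auto simp: A_def intro!: bdd_belowI[of _ 0])
 have "closed A" unfolding A_def
  by (rule continuous_closed_preimage_constant[OF cont]) auto
 define a where "a = Inf A"
 have "a \<in> A" unfolding a_def by (rule closed_contains_Inf[OF A(3,2) \<open>closed A\<close>])
 hence a: "0 <= a" "a <= 1" "f a = f m" by (auto simp: A_def)
 have "a ~= 0" "a ~= 1" using a fm ends by auto
 hence a01: "0 < a" "a < 1" using a by auto
 obtain dlt where d: "dlt > 0" "!!h. 0 < h ==> h < dlt ==> f (a - h) + f (a + h) <= 2 * f a" using mid[OF a01] by blast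
 define h where "h = min (dlt / 2) (min (a / 2) ((1 - a) / 2))"
 have "h <= dlt / 2" "h <= a / 2" "h <= (1 - a) / 2" unfolding h_def by linarith+
 moreover have "0 < h" using d(1) a01 by (simp add: h_def)
 ultimately have h: "0 < h" "h < dlt" "h < a" "h < 1 - a" using d(1) a01 by auto
 have "f m <= f (a - h)" "f m <= f (a + h)" using h a01 by (auto intro!: m(2))
 hence "f (a - h) = f m" using d(2)[OF h(1,2)] a(3) by linarith
 hence "a - h \<in> A" using h a01 by (auto simp: A_def)
 hence "a <= a - h" unfolding a_def by (rule cInf_lower[OF _ A(2)])
 thus False using h by simp
qed

context surface_triangulation
begin

text \<open>
 The squared distance of the apex from the point \<open>z\<close> of the face.
\<close>

definition Q :: "real^'v => nat => complex => real" where
 "Q r d z = (cmod (z - foot T r d))^2 + height2 T r d"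

lemma Q_corners:
 assumes d: "d \<in> darts T"
 shows "Q r d 0 = (r $ orig T d)^2" "Q r d (cr (len T d)) = (r $ orig T (nxt T d))^2"
  "Q r d (tip T d) = (r $ orig T (prv T d))^2"
 using foot_equations[OF d, of r] by (simp_all add: Q_def norm_minus_commute)

lemma Q_nxt:
 assumes d: "d \<in> darts T" shows "Q r (nxt T d) z = Q r d (frame_nxt d z)"
 unfolding Q_def foot_nxt(1)[OF d, symmetric] frame_nxt_dist[OF d] foot_nxt(2)[OF d] ..

lemma Q_expand:
 "Q r d z = (cmod z)^2 - 2 * foot_along T r d * Re z - 2 * inset T r d * Im z + (r $ orig T d)^2"
proof -
 have "(cmod (z - foot T r d))^2 = (cmod z)^2 - 2 * foot_along T r d * Re z - 2 * inset T r d * Im z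
   + ((foot_along T r d)^2 + (inset T r d)^2)"
  unfolding cmod_power2 by (simp add: foot_def power2_eq_square algebra_simps)
 thus ?thesis by (simp add: Q_def height2_def line_dist2_def)
qed

lemma Q_face:
 assumes d: "d \<in> darts T" and d': "d' \<in> face T d" and eq: "frame d' z' = frame d z"
 shows "Q r d' z' = Q r d z"
proof -
 have n: "nxt T d \<in> darts T" using d by simp
 have "d' = d \<or> d' = nxt T d \<or> d' = prv T d" using d' by (auto simp: face_def)
 thus ?thesis
 proof (elim disjE)
  assume "d' = d" thus ?thesis using eq frame_inj[OF d] by simp
 next
  assume *: "d' = nxt T d"
  hence "frame d (frame_nxt d z') = frame d z" using eq frame_frame_nxt[OF d] by simp
  thus ?thesis using frame_inj[OF d] Q_nxt[OF d] * by simp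
 next
  assume *: "d' = prv T d"
  hence "frame d (frame_nxt d (frame_nxt (nxt T d) z')) = frame d z"
   using eq frame_frame_nxt[OF d] frame_frame_nxt[OF n] by simp
  thus ?thesis using frame_inj[OF d] Q_nxt[OF d] Q_nxt[OF n] * by simp
 qed
qed

lemma Q_opp:
 assumes d: "d \<in> darts T"
 shows "Q r (opp T d) (cr (len T d) - z) =
   (cmod z)^2 - 2 * foot_along T r d * Re z + 2 * inset T r (opp T d) * Im z + (r $ orig T d)^2"
proof -
 have l: "2 * len T d * foot_along T r d = (r $ orig T d)^2 + (len T d)^2 - (r $ orig T (nxt T d))^2"
  using d by (simp add: foot_along_def)
 have "(cmod (cr (len T d) - z))^2 = (cmod z)^2 - 2 * len T d * Re z + (len T d)^2"
  unfolding cmod_power2 by (simp add: power2_eq_square algebra_simps)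
 thus ?thesis unfolding Q_expand line_dist2_opp[OF d] using l d by (simp add: algebra_simps power2_eq_square)
qed

text \<open>
 On the common edge both faces give the same quadratic function, since it is determined by its values at
 the end points.
\<close>

lemma Q_opp_real:
 assumes d: "d \<in> darts T"
 shows "Q r (opp T d) (cr (len T d - t)) = Q r d (cr t)"
 using Q_opp[OF d, of r "cr t"] Q_expand[of r d "cr t"] by simp

lemma singular_point_is_corner:
 assumes d: "d \<in> darts T" and z: "z \<in> tri d" and i: "nchart d z = s i"
 shows "z = 0 \<or> z = cr (len T d) \<or> z = tip T d"
proof -
 have n: "nxt T d \<in> darts T" "prv T d \<in> darts T" using d by auto
 from tri_cases[OF d z] show ?thesis
 proof (elim disjE exE conjE)
  assume "z \<in> otri d" thus ?thesis using interior_not_singular[OF d] i by auto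
 next
  fix t assume "0 < t" "t < len T d" "z = cr t"
  thus ?thesis using edge_not_singular[OF d, of t] i by auto
 next
  fix t assume t: "0 < t" "t < len T (nxt T d)" "z = frame_nxt d (cr t)"
  have "nchart (nxt T d) (cr t) = s i" using i nchart_nxt[OF d, of "cr t"] t by simp
  thus ?thesis using edge_not_singular[OF n(1) t(1,2)] by auto
 next
  fix t assume t: "0 < t" "t < len T (prv T d)" "z = frame_nxt d (frame_nxt (nxt T d) (cr t))"
  have "nchart (prv T d) (cr t) = s i" using i nchart_nxt[OF d] nchart_nxt[OF n(1), of "cr t"] t by simp
  thus ?thesis using edge_not_singular[OF n(2) t(1,2)] by auto
 qed auto
qed

lemma singular_corner:
 assumes d: "d \<in> darts T" and z: "z \<in> tri d" and i: "nchart d z = s i"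
 shows "Q r d z = (r $ i)^2"
 using singular_point_is_corner[OF assms] nchart_corners[OF d] Q_corners[OF d] i inj_s[THEN injD] by metis

lemma Q_well_defined: "\<exists>c. \<forall>d\<in>darts T. \<forall>z\<in>tri d. nchart d z = p --> Q r d z = c"
proof (cases rule: point_cases[of p])
 case (1 i) thus ?thesis using singular_corner by blast
next
 case (2 d z)
 have "Q r d' z' = Q r d z" if "d' \<in> darts T" "z' \<in> tri d'" "nchart d' z' = p" for d' z'
 proof -
  have "nchart d z = nchart d' z'" using 2(3) that(3) by simp
  from nchart_inj_interior[OF 2(1) that(1) 2(2) that(2) this] show ?thesis by (intro Q_face[OF 2(1)])
 qed
 thus ?thesis by blast
next
 case (3 d t)
 have o: "opp T d \<in> darts T" using 3 by simp
 have "Q r d' z' = Q r d (cr t)" if "d' \<in> darts T" "z' \<in> tri d'" "nchart d' z' = p" for d' z'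
 proof -
  have eq: "nchart d (cr t) = nchart d' z'" using 3(4) that(3) by simp
  from nchart_inj_edge[OF 3(1) that(1) 3(2,3) that(2) eq] show ?thesis
  proof (elim disjE conjE)
   assume "d' \<in> face T d" "frame d' z' = frame d (cr t)"
   thus ?thesis by (rule Q_face[OF 3(1)])
  next
   assume "d' \<in> face T (opp T d)" "frame d' z' = frame (opp T d) (cr (len T d - t))"
   hence "Q r d' z' = Q r (opp T d) (cr (len T d - t))" by (rule Q_face[OF o])
   thus ?thesis unfolding Q_opp_real[OF 3(1)] .
  qed
 qed
 thus ?thesis by blast
qed

text \<open>
 \<open>Q_well_defined\<close> makes the choice irrelevant: the value depends on the point of the
 surface only.
\<close>

definition apex_dist2 :: "real^'v => 'm => real" where
 "apex_dist2 r p = (SOME c. \<forall>d\<in>darts T. \<forall>z\<in>tri d. nchart d z = p --> Q r d z = c)"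

lemma apex_dist2_nchart:
 assumes "d \<in> darts T" "z \<in> tri d" shows "apex_dist2 r (nchart d z) = Q r d z"
proof -
 have "\<forall>d'\<in>darts T. \<forall>z'\<in>tri d'. nchart d' z' = nchart d z --> Q r d' z' = apex_dist2 r (nchart d z)"
  unfolding apex_dist2_def by (rule someI_ex[OF Q_well_defined])
 thus ?thesis using assms by simp
qed

lemma apex_dist2_singular: "apex_dist2 r (s i) = (r $ i)^2"
proof -
 obtain d where d: "d \<in> darts T" "orig T d = i" using orig_in_darts by blast
 have "0 \<in> tri d" using tri_points(1)[OF d(1), of 0] len_pos[OF d(1)] by simp
 from apex_dist2_nchart[OF d(1) this, of r] show ?thesis
  using nchart_corners(1)[OF d(1)] Q_corners(1)[OF d(1), of r] d(2) by simp
qed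

lemma compact_tri:
 assumes d: "d \<in> darts T" shows "compact (tri d)"
proof -
 have "closed (tri d)" unfolding tri_def
  by (intro closed_Collect_conj closed_Collect_le continuous_intros)
 moreover have "bounded (tri d)"
 proof -
  have "bounded (triangle T d)" unfolding triangle_def face_def by (intro bounded_convex_hull finite_imp_bounded) auto
  then obtain e where e: "!!x. x \<in> triangle T d ==> dist (frame d 0) x <= e"
   unfolding bounded_any_center[of _ "frame d 0"] by blast
  have "dist 0 z <= e" if "z \<in> tri d" for z
   using e[of "frame d z"] that frame_dist[OF d, of 0 z] unfolding frame_tri[OF d] by simp
  thus ?thesis unfolding bounded_any_center[of _ 0] by blast
 qed
 ultimately show ?thesis by (simp add: compact_eq_bounded_closed)
qed

lemma continuous_Q: "continuous_on A (Q r d)"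
 unfolding Q_def by (intro continuous_intros)

lemma continuous_apex_dist2: "continuous_on UNIV (apex_dist2 r)"
 unfolding continuous_on_closed_vimage[OF closed_UNIV]
proof (intro allI impI)
 fix B :: "real set" assume B: "closed B"
 have "apex_dist2 r -` B \<inter> UNIV = (\<Union>d\<in>darts T. nchart d ` (tri d \<inter> Q r d -` B))"
 proof (intro equalityI subsetI)
  fix p assume "p \<in> apex_dist2 r -` B \<inter> UNIV"
  moreover obtain d z where d: "d \<in> darts T" "z \<in> tri d" "nchart d z = p" using nchart_cover by blast
  ultimately have "Q r d z \<in> B" using apex_dist2_nchart[OF d(1,2), of r] by simp
  thus "p \<in> (\<Union>d\<in>darts T. nchart d ` (tri d \<inter> Q r d -` B))" using d by blast
 next
  fix p assume "p \<in> (\<Union>d\<in>darts T. nchart d ` (tri d \<inter> Q r d -` B))"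
  then obtain d z where d: "d \<in> darts T" "z \<in> tri d" "Q r d z \<in> B" "p = nchart d z" by blast
  thus "p \<in> apex_dist2 r -` B \<inter> UNIV" using apex_dist2_nchart[OF d(1,2), of r] by simp
 qed
 moreover have "closed (\<Union>d\<in>darts T. nchart d ` (tri d \<inter> Q r d -` B))"
 proof (intro closed_UN finite_darts ballI compact_imp_closed compact_continuous_image)
  fix d assume d: "d \<in> darts T"
  show "continuous_on (tri d \<inter> Q r d -` B) (nchart d)"
   by (rule continuous_on_subset[OF nchart_continuous[OF d]]) auto
  have "closed (Q r d -` B)" using continuous_Q[of UNIV r d] B
   by (metis closed_UNIV continuous_on_closed_vimage Int_UNIV_right)
  thus "compact (tri d \<inter> Q r d -` B)" by (rule compact_Int_closed[OF compact_tri[OF d]])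
 qed
 ultimately show "closed (apex_dist2 r -` B \<inter> UNIV)" by simp
qed

text \<open>
 Positive exactly if the boundary dihedral angle at the edge is less than \<open>pi\<close>.
\<close>

definition bend :: "real^'v => nat => real" where
 "bend r d = inset T r d + inset T r (opp T d)"

lemma apex_dist2_glue:
 assumes d: "d \<in> darts T" and z: "0 <= Im z ==> z \<in> tri d" "Im z <= 0 ==> cr (len T d) - z \<in> tri (opp T d)"
 shows "apex_dist2 r (glue d z) = (cmod z)^2 - 2 * foot_along T r d * Re z + (r $ orig T d)^2
   - (if 0 <= Im z then 2 * inset T r d * Im z else - (2 * inset T r (opp T d) * Im z))"
proof (cases "0 <= Im z")
 case True thus ?thesis using apex_dist2_nchart[OF d z(1)] Q_expand[of r d z] by (simp add: glue_def)
next
 case False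
 have o: "opp T d \<in> darts T" using d by simp
 show ?thesis using False apex_dist2_nchart[OF o z(2)] Q_opp[OF d, of r z] by (simp add: glue_def)
qed

lemma apex_dist2_geodesic_face:
 assumes d: "d \<in> darts T" and z: "z \<in> otri d" and geo: "local_geodesic_at gam L t" "gam t = nchart d z" "0 <= L"
 shows "\<exists>v dlt. 0 < dlt \<and> cmod v = L \<and> (\<forall>h. \<bar>h\<bar> < dlt -->
   apex_dist2 r (gam (t + h)) = apex_dist2 r (gam t) + h^2 * L^2 + 2 * h * Re (cnj v * (z - foot T r d)))"
proof -
 obtain e where e: "isometric_chart (nchart d) z e" "ball z e \<subseteq> otri d" using face_chart[OF d z] by blast
 obtain v dlt where v: "cmod v = L" "0 < dlt" "!!x. \<bar>x - t\<bar> < dlt ==>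
   gam x = nchart d (z + cr (x - t) * v) \<and> z + cr (x - t) * v \<in> ball z e"
  using geodesic_in_chart[OF e(1) geo] by blast
 have "apex_dist2 r (gam (t + h)) = apex_dist2 r (gam t) + h^2 * L^2 + 2 * h * Re (cnj v * (z - foot T r d))" if h: "\<bar>h\<bar> < dlt" for h
 proof -
  have 1: "gam (t + h) = nchart d (z + cr h * v)" "z + cr h * v \<in> tri d"
   using v(3)[of "t + h"] h e(2) otri_subset_tri[of d] by auto
  have z': "z \<in> tri d" using z otri_subset_tri by blast
  show ?thesis unfolding 1(1) geo(2) apex_dist2_nchart[OF d 1(2)] apex_dist2_nchart[OF d z'] v(1)[symmetric] Q_def cmod_power2
   by (simp add: power2_eq_square algebra_simps)
 qed
 thus ?thesis using v(1,2) by blast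
qed

text \<open>
 At the crossing the coefficient of the linear term drops by twice the bend, multiplied by the component
 of the velocity orthogonal to the edge.
\<close>

lemma apex_dist2_geodesic_edge:
 assumes d: "d \<in> darts T" and x: "0 < x" "x < len T d" and geo: "local_geodesic_at gam L t" "gam t = nchart d (cr x)" "0 <= L"
 shows "\<exists>v dlt. 0 < dlt \<and> cmod v = L \<and> (\<forall>h. \<bar>h\<bar> < dlt -->
   apex_dist2 r (gam (t + h)) = apex_dist2 r (gam t) + h^2 * L^2 + 2 * h * Re v * (x - foot_along T r d)
    - (if 0 <= h * Im v then 2 * inset T r d * (h * Im v) else - (2 * inset T r (opp T d) * (h * Im v))))"
proof -
 obtain e where e: "isometric_chart (glue d) (cr x) e"
  "!!z. z \<in> ball (cr x) e ==> (0 <= Im z --> z \<in> tri d) \<and> (Im z <= 0 --> cr (len T d) - z \<in> tri (opp T d))"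
  using edge_chart[OF d x] by blast
 have gx: "glue d (cr x) = nchart d (cr x)" by (simp add: glue_def)
 obtain v dlt where v: "cmod v = L" "0 < dlt" "!!y. \<bar>y - t\<bar> < dlt ==>
   gam y = glue d (cr x + cr (y - t) * v) \<and> cr x + cr (y - t) * v \<in> ball (cr x) e"
  using geodesic_in_chart[OF e(1) geo(1) _ geo(3)] gx geo(2) by metis
 have A: "apex_dist2 r (glue d z) = (cmod z)^2 - 2 * foot_along T r d * Re z + (r $ orig T d)^2
   - (if 0 <= Im z then 2 * inset T r d * Im z else - (2 * inset T r (opp T d) * Im z))"
  if "z \<in> ball (cr x) e" for z
  by (rule apex_dist2_glue[OF d]) (use e(2)[OF that] in auto)
 have x0: "cr x \<in> ball (cr x :: complex) e" using isometric_chartD(1)[OF e(1)] by simp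
 have "apex_dist2 r (gam (t + h)) = apex_dist2 r (gam t) + h^2 * L^2 + 2 * h * Re v * (x - foot_along T r d)
    - (if 0 <= h * Im v then 2 * inset T r d * (h * Im v) else - (2 * inset T r (opp T d) * (h * Im v)))"
  if h: "\<bar>h\<bar> < dlt" for h
 proof -
  define z where "z = cr x + cr h * v"
  have 1: "gam (t + h) = glue d z" "z \<in> ball (cr x) e"
   using v(3)[of "t + h"] h by (auto simp: z_def)
  have z: "Re z = x + h * Re v" "Im z = h * Im v" "(cmod z)^2 = x^2 + 2 * x * (h * Re v) + h^2 * (cmod v)^2"
   unfolding cmod_power2 by (simp_all add: z_def power2_eq_square algebra_simps)
  have "apex_dist2 r (gam t) = x^2 - 2 * foot_along T r d * x + (r $ orig T d)^2"
   using A[OF x0] unfolding gx geo(2) by simp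
  thus ?thesis unfolding 1(1) A[OF 1(2)] z v(1) by (simp add: algebra_simps)
 qed
 thus ?thesis using v(1,2) by blast
qed

lemma apex_dist2_midpoint_concave:
 assumes conv: "!!d. d \<in> darts T ==> 0 <= bend r d"
  and geo: "local_geodesic_at gam L t" "gam t \<notin> range s" "0 <= L"
 shows "\<exists>dlt>0. \<forall>h. 0 < h --> h < dlt -->
   apex_dist2 r (gam (t - h)) + apex_dist2 r (gam (t + h)) <= 2 * apex_dist2 r (gam t) + 2 * h^2 * L^2"
proof (cases rule: point_cases[of "gam t"])
 case (1 i) thus ?thesis using geo(2) by blast
next
 case (2 d z)
 obtain v dlt where v: "0 < dlt" "!!h. \<bar>h\<bar> < dlt ==>
   apex_dist2 r (gam (t + h)) = apex_dist2 r (gam t) + h^2 * L^2 + 2 * h * Re (cnj v * (z - foot T r d))"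
  using apex_dist2_geodesic_face[OF 2(1,2) geo(1) 2(3) geo(3)] by blast
 have "apex_dist2 r (gam (t - h)) + apex_dist2 r (gam (t + h)) <= 2 * apex_dist2 r (gam t) + 2 * h^2 * L^2" if "0 < h" "h < dlt" for h
  using v(2)[of h] v(2)[of "- h"] that by simp
 thus ?thesis using v(1) by blast
next
 case (3 d x)
 obtain v dlt where v: "0 < dlt" "!!h. \<bar>h\<bar> < dlt ==>
   apex_dist2 r (gam (t + h)) = apex_dist2 r (gam t) + h^2 * L^2 + 2 * h * Re v * (x - foot_along T r d)
    - (if 0 <= h * Im v then 2 * inset T r d * (h * Im v) else - (2 * inset T r (opp T d) * (h * Im v)))"
  using apex_dist2_geodesic_edge[OF 3(1,2,3) geo(1) 3(4) geo(3)] by blast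
 have "apex_dist2 r (gam (t - h)) + apex_dist2 r (gam (t + h)) <= 2 * apex_dist2 r (gam t) + 2 * h^2 * L^2" if h: "0 < h" "h < dlt" for h
 proof -
  define y a b where "y = h * Im v" and "a = inset T r d" and "b = inset T r (opp T d)"
  have ab: "0 <= a + b" using conv[OF 3(1)] by (simp add: bend_def a_def b_def)
  have k: "0 <= (if 0 <= y then 2 * a * y else - (2 * b * y)) + (if 0 <= - y then 2 * a * (- y) else - (2 * b * (- y)))"
  proof (cases "0 <= y")
   case True thus ?thesis using mult_nonneg_nonneg[OF ab True] by (auto simp: algebra_simps)
  next
   case False
   hence y: "0 <= - y" by simp
   show ?thesis using mult_nonneg_nonneg[OF ab y] False by (auto simp: algebra_simps)
  qed
  have "apex_dist2 r (gam (t + h)) = apex_dist2 r (gam t) + h^2 * L^2 + 2 * h * Re v * (x - foot_along T r d)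
    - (if 0 <= y then 2 * a * y else - (2 * b * y))" using v(2)[of h] h by (simp add: y_def a_def b_def)
  moreover have "apex_dist2 r (gam (t - h)) = apex_dist2 r (gam t) + h^2 * L^2 - 2 * h * Re v * (x - foot_along T r d)
    - (if 0 <= - y then 2 * a * (- y) else - (2 * b * (- y)))" using v(2)[of "- h"] h by (simp add: y_def a_def b_def)
  ultimately show ?thesis using k by linarith
 qed
 thus ?thesis using v(1) by blast
qed

text \<open>
 This form needs the singular points only as end points of the geodesic, where nothing is known about
 second differences.
\<close>

lemma apex_dist2_above_chord:
 assumes conv: "!!d. d \<in> darts T ==> 0 <= bend r d" and geo: "geodesic_path s gam L" and t: "0 <= t" "t <= 1"
 shows "(1 - t) * apex_dist2 r (gam 0) + t * apex_dist2 r (gam 1) - L^2 * (t * (1 - t)) <= apex_dist2 r (gam t)"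
proof -
 note G = geodesic_pathD[OF geo]
 define A B where "A = apex_dist2 r (gam 0)" and "B = apex_dist2 r (gam 1)"
 define f where "f t = apex_dist2 r (gam t) - ((1 - t) * A + t * B - L^2 * (t * (1 - t)))" for t
 have "0 <= f t"
 proof (rule leftmost_minimum[OF _ _ _ _ t])
  have "continuous_on {0..1} (%t. apex_dist2 r (gam t))"
   by (rule continuous_on_compose2[OF continuous_apex_dist2 G(2)]) auto
  thus "continuous_on {0..1} f" unfolding f_def by (intro continuous_intros)
  show "0 <= f 0" "0 <= f 1" by (simp_all add: f_def A_def B_def)
  fix t :: real assume t: "0 < t" "t < 1"
  obtain dlt where d: "dlt > 0" "!!h. 0 < h ==> h < dlt ==>
   apex_dist2 r (gam (t - h)) + apex_dist2 r (gam (t + h)) <= 2 * apex_dist2 r (gam t) + 2 * h^2 * L^2"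
   using apex_dist2_midpoint_concave[OF conv G(3)[OF t] G(4)[OF t]] G(1) by force
  have "f (t - h) + f (t + h) <= 2 * f t" if "0 < h" "h < dlt" for h
   using d(2)[OF that] by (simp add: f_def power2_eq_square algebra_simps)
  thus "\<exists>dlt>0. \<forall>h. 0 < h --> h < dlt --> f (t - h) + f (t + h) <= 2 * f t" using d(1) by blast
 qed
 thus ?thesis by (simp add: f_def A_def B_def)
qed

lemma Q_segment:
 "Q r d ((1 - t) *\<^sub>R z0 + t *\<^sub>R z1) = (1 - t) * Q r d z0 + t * Q r d z1 - (cmod (z1 - z0))^2 * (t * (1 - t))"
 unfolding Q_def cmod_power2 by (simp add: power2_eq_square algebra_simps)

text \<open>
 The estimate is passed from vertices to edges, and then along segments from a vertex to the opposite
 edge into the faces.  On such segments the function of this triangulation is an equality case.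
\<close>

lemma Q_le_of_chords:
 fixes q :: "'m => real"
 assumes q: "!!gam L t. geodesic_path s gam L ==> 0 <= t ==> t <= 1 ==>
   (1 - t) * q (gam 0) + t * q (gam 1) - L^2 * (t * (1 - t)) <= q (gam t)"
  and sing: "!!i. q (s i) = (r $ i)^2"
 shows "apex_dist2 r p <= q p"
proof -
 have edge: "Q r d (cr x) <= q (nchart d (cr x))" if d: "d \<in> darts T" and x: "0 <= x" "x <= len T d" for d x
 proof -
  define t where "t = x / len T d"
  have l: "len T d > 0" using d by simp
  have t: "0 <= t" "t <= 1" "t * len T d = x" using x l by (auto simp: t_def)
  have "(1 - t) * (r $ orig T d)^2 + t * (r $ orig T (nxt T d))^2 - (len T d)^2 * (t * (1 - t)) <= q (nchart d (cr x))"
   using q[OF geodesic_path_edge[OF d] t(1,2)] nchart_corners[OF d] t(3) by (simp add: sing)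
  moreover have "Q r d (cr x) = (1 - t) * (r $ orig T d)^2 + t * (r $ orig T (nxt T d))^2 - (len T d)^2 * (t * (1 - t))"
   using Q_segment[of r d t 0 "cr (len T d)"] Q_corners[OF d, of r] t(3) by (simp add: scaleR_conv_of_real flip: of_real_mult)
  ultimately show ?thesis by simp
 qed
 show ?thesis
 proof (cases rule: point_cases[of p])
  case (1 i) thus ?thesis using sing apex_dist2_singular by simp
 next
  case (3 d x)
  have "cr x \<in> tri d" using tri_points(1)[OF 3(1), of x] 3 by simp
  from apex_dist2_nchart[OF 3(1) this, of r] edge[OF 3(1), of x] 3 show ?thesis by simp
 next
  case (2 d z)
  define w l where "w = tip T d" and "l = len T d"
  have lw: "Im w > 0" "l > 0" using tip_props(1)[OF 2(1)] 2(1) by (auto simp: w_def l_def)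
  note B = tri_barycentric[where d = d and z = z, folded w_def l_def]
  define A1 A2 A3 where "A1 = Im z" and "A2 = - Im (z * cnj w)" and "A3 = Im ((z - cr l) * cnj (w - cr l))"
  have A: "A1 > 0" "A2 > 0" "A3 > 0" using 2(2) by (auto simp: otri_def A1_def A2_def A3_def w_def l_def)
  have su: "A3 + A2 + l * A1 = l * Im w" using B(1) by (simp add: A1_def A2_def A3_def)
  define \<tau> where "\<tau> = 1 - A1 / Im w"
  have "l * A1 < l * Im w" using su A by linarith
  hence tau: "0 < \<tau>" "\<tau> < 1" using lw A by (auto simp: \<tau>_def)
  define b where "b = A2 / (Im w * \<tau>)"
  have bt: "b * \<tau> = A2 / Im w" using tau by (simp add: b_def)
  have b: "0 < b" "b < l"
  proof -
   show "0 < b" using A lw tau by (simp add: b_def)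
   have "Im w * \<tau> = Im w - A1" using lw by (simp add: \<tau>_def algebra_simps)
   hence "l * (Im w * \<tau>) = l * Im w - l * A1" by (simp add: right_diff_distrib)
   hence "l * (Im w * \<tau>) = A3 + A2" using su by linarith
   hence "A2 < l * (Im w * \<tau>)" using A by simp
   thus "b < l" using lw tau by (simp add: b_def divide_less_eq)
  qed
  have zf: "z = (1 - \<tau>) *\<^sub>R w + \<tau> *\<^sub>R cr b"
  proof -
   have "cr (l * Im w) * z = cr (l * A1) * w + cr A2 * cr l"
    using B(2) unfolding A1_def A2_def .
   also have "\<dots> = cr (l * Im w) * (cr (A1 / Im w) * w + cr (A2 / Im w))"
    using lw by (simp add: field_simps)
   finally have "z = cr (A1 / Im w) * w + cr (A2 / Im w)" using lw by simp
   thus ?thesis unfolding bt[symmetric] by (simp add: \<tau>_def scaleR_conv_of_real mult.commute)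
  qed
  have bt': "cr b \<in> tri d" using tri_points(1)[OF 2(1), of b] b by (simp add: l_def)
  have line: "w + cr t * (cr b - w) \<in> otri d" if t: "0 < t" "t < 1" for t
  proof -
   have "Im (w + cr t * (cr b - w)) = (1 - t) * Im w"
    "Im ((w + cr t * (cr b - w)) * cnj w) = - (t * b * Im w)"
    "Im ((w + cr t * (cr b - w) - cr l) * cnj (w - cr l)) = t * (l - b) * Im w"
    by (simp_all add: algebra_simps)
   moreover have "(1 - t) * Im w > 0" "t * b * Im w > 0" "t * (l - b) * Im w > 0" using t b lw by auto
   ultimately show ?thesis unfolding otri_def w_def[symmetric] l_def[symmetric] mem_Collect_eq by linarith
  qed
  have wt: "w \<in> tri d" using tri_points(2)[OF 2(1)] by (simp add: w_def)
  have bw: "cr b - w ~= 0" using tip_not_real[OF 2(1), of b] unfolding w_def by (metis eq_iff_diff_eq_0)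
  have gp: "geodesic_path s (%t. nchart d (w + cr t * (cr b - w))) (cmod (cr b - w))"
   by (rule geodesic_path_in_face[OF 2(1) line wt _ bw]) (use bt' in simp_all)
  have zt: "w + cr \<tau> * (cr b - w) = z" unfolding zf by (simp add: scaleR_conv_of_real algebra_simps)
  have "(1 - \<tau>) * q (nchart d w) + \<tau> * q (nchart d (cr b)) - (cmod (cr b - w))^2 * (\<tau> * (1 - \<tau>)) <= q p"
   using q[OF gp, of \<tau>] tau zt 2(3) by simp
  moreover have "(1 - \<tau>) * q (nchart d w) = (1 - \<tau>) * Q r d w"
   using nchart_corners(3)[OF 2(1)] Q_corners(3)[OF 2(1), of r] by (simp add: sing w_def)
  moreover have "\<tau> * Q r d (cr b) <= \<tau> * q (nchart d (cr b))"
   using edge[OF 2(1), of b] b tau by (intro mult_left_mono) (auto simp: l_def)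
  moreover have "Q r d z = (1 - \<tau>) * Q r d w + \<tau> * Q r d (cr b) - (cmod (cr b - w))^2 * (\<tau> * (1 - \<tau>))"
   using Q_segment[of r d \<tau> w "cr b"] unfolding zf[symmetric] .
  ultimately have "Q r d z <= q p" by linarith
  moreover have "z \<in> tri d" using 2(2) otri_subset_tri by blast
  ultimately show ?thesis using apex_dist2_nchart[OF 2(1), of z r] 2(3) by simp
 qed
qed

end

text \<open>
 Each of the two functions satisfies the chord estimate along the segments of the other triangulation.
\<close>

lemma apex_dist2_unique:
 assumes A: "surface_triangulation s T" and B: "surface_triangulation s T'"
  and ca: "!!d. d \<in> darts T ==> 0 <= surface_triangulation.bend T r d"
  and cb: "!!d. d \<in> darts T' ==> 0 <= surface_triangulation.bend T' r d"
 shows "surface_triangulation.apex_dist2 T r = surface_triangulation.apex_dist2 T' r"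
proof -
 interpret A: surface_triangulation s T by (rule A)
 interpret B: surface_triangulation s T' by (rule B)
 have "B.apex_dist2 r p <= A.apex_dist2 r p" for p
  by (rule B.Q_le_of_chords) (use A.apex_dist2_above_chord[OF ca] A.apex_dist2_singular in auto)
 moreover have "A.apex_dist2 r p <= B.apex_dist2 r p" for p
  by (rule A.Q_le_of_chords) (use B.apex_dist2_above_chord[OF cb] B.apex_dist2_singular in auto)
 ultimately show ?thesis by (intro ext antisym)
qed

section \<open>Edges shared by two convex triangulations\<close>

lemma local_geodesic_at_reverse:
 assumes "local_geodesic_at gam L t"
 shows "local_geodesic_at (%t. gam (c - t)) L (c - t)"
proof -
 obtain dlt where d: "dlt > 0" "!!a b. \<bar>a - t\<bar> < dlt ==> \<bar>b - t\<bar> < dlt ==> dist (gam a) (gam b) = L * \<bar>a - b\<bar>"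
  using assms unfolding local_geodesic_at_def by blast
 have "dist (gam (c - a)) (gam (c - b)) = L * \<bar>a - b\<bar>" if "\<bar>a - (c - t)\<bar> < dlt" "\<bar>b - (c - t)\<bar> < dlt" for a b
 proof -
  have "dist (gam (c - a)) (gam (c - b)) = L * \<bar>(c - a) - (c - b)\<bar>" by (rule d(2)) (use that in auto)
  thus ?thesis by (simp add: abs_minus_commute)
 qed
 thus ?thesis unfolding local_geodesic_at_def using d(1) by blast
qed

lemma geodesic_path_reverse:
 assumes "geodesic_path s gam L"
 shows "geodesic_path s (%t. gam (1 - t)) L"
proof -
 note G = geodesic_pathD[OF assms]
 have "continuous_on {0..1} (%t. gam (1 - t))"
  by (rule continuous_on_compose2[OF G(2)]) (auto intro!: continuous_intros)
 moreover have "local_geodesic_at (%t. gam (1 - t)) L t \<and> gam (1 - t) \<notin> range s" if "t \<in> {0<..<1}" for t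
  using local_geodesic_at_reverse[OF G(3)[of "1 - t"], of 1] G(4)[of "1 - t"] that by simp
 ultimately show ?thesis using G(1) by (simp add: geodesic_path_def)
qed

lemma agree_at_end:
 fixes f g :: "real => 'm::metric_space"
 assumes f: "continuous_on {a..b} f" and g: "continuous_on {a..b} g" and ab: "a < b"
  and eq: "!!t. a < t ==> t < b ==> f t = g t" and t: "t \<in> {a..b}"
 shows "f t = g t"
proof -
 have cl: "closure {a<..<b} = {a..b}" using ab by (rule closure_greaterThanLessThan)
 have "dist (f t) (g t) = 0"
 proof (rule continuous_constant_on_closure[where S = "{a<..<b}" and f = "%t. dist (f t) (g t)"])
  show "continuous_on (closure {a<..<b}) (%t. dist (f t) (g t))" unfolding cl by (intro continuous_intros f g)
  show "dist (f x) (g x) = 0" if "x \<in> {a<..<b}" for x using eq[of x] that by simp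
  show "t \<in> closure {a<..<b}" unfolding cl by (rule t)
 qed
 thus ?thesis by simp
qed

text \<open>
 Some unit speed geodesic through \<open>p\<close> sees the slopes \<open>-2a\<close> and
 \<open>-2b\<close> in its two directions.  This does not refer to a triangulation.
\<close>

definition two_sided_slopes :: "('m::metric_space => real) => 'm => real => real => bool" where
 "two_sided_slopes q p a b \<longleftrightarrow> (\<exists>gam dlt. 0 < dlt \<and> gam 0 = p \<and> local_geodesic_at gam 1 0 \<and>
   (\<forall>h. 0 < h --> h < dlt --> q (gam h) = q p + h^2 - 2 * a * h \<and> q (gam (- h)) = q p + h^2 - 2 * b * h))"

context surface_triangulation
begin

lemma nchart_along_edge:
 assumes d: "d \<in> darts T" and z: "!!t. t \<in> {a..b} ==> 0 <= f t \<and> f t <= len T d" and f: "continuous_on {a..b} f"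
 shows "continuous_on {a..b} (%t. nchart d (cr (f t)))"
 by (rule continuous_on_compose2[OF nchart_continuous[OF d]])
  (use z tri_points(1)[OF d] in \<open>auto intro!: continuous_intros f\<close>)

lemma geodesic_along_edge_forward:
 assumes d: "d \<in> darts T" and x: "0 < x" "x < len T d" and geo: "geodesic_path s gam L" and fin: "gam 1 \<in> range s"
  and t0: "0 < t0" "t0 < 1" and dlt: "0 < dlt"
  and start: "!!t. t0 <= t ==> t < t0 + dlt ==> gam t = nchart d (cr (x + (t - t0) * L))"
 shows "x + (1 - t0) * L = len T d" "!!t. t0 <= t ==> t <= 1 ==> gam t = nchart d (cr (x + (t - t0) * L))"
proof -
 note G = geodesic_pathD[OF geo]
 define l where "l = len T d"
 define t1 where "t1 = min 1 (t0 + (l - x) / L)"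
 have t1: "t0 < t1" "t1 <= 1" using t0 x G(1) by (auto simp: t1_def l_def)
 have "(t1 - t0) * L <= (l - x) / L * L" using G(1) by (intro mult_right_mono) (auto simp: t1_def)
 hence t1l: "x + (t1 - t0) * L <= l" using G(1) by simp
 have inside: "0 < x + (t - t0) * L \<and> x + (t - t0) * L < l" if "t0 <= t" "t < t1" for t
 proof -
  have "(t - t0) * L < (t1 - t0) * L" using that G(1) by (intro mult_strict_right_mono) auto
  moreover have "0 <= (t - t0) * L" using that G(1) by simp
  ultimately show ?thesis using x t1l by linarith
 qed
 define z where "z t = cr x + cr (t - t0) * (cr L :: complex)" for t
 have zr: "z t = cr (x + (t - t0) * L)" for t by (simp add: z_def)
 have eq: "gam t = nchart d (z t)" if "t0 < t" "t < t1" for t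
  unfolding z_def
 proof (rule geodesic_stays_straight[where L = L and dlt = dlt and gam = gam and ?t1.0 = t1, OF _ _ _ dlt _ that])
  show "0 <= L" using G(1) by simp
  fix t assume t: "t0 < t" "t < t1"
  show "local_geodesic_at gam L t" using G(3)[of t] t t0 t1 by simp
  have i: "0 < x + (t - t0) * L" "x + (t - t0) * L < len T d" using inside[of t] t by (auto simp: l_def)
  obtain e where e: "isometric_chart (glue d) (cr (x + (t - t0) * L)) e" using edge_chart[OF d i] by blast
  show "\<exists>g e. isometric_chart g (cr x + cr (t - t0) * cr L) e \<and>
   (\<forall>t'. cr x + cr (t' - t0) * cr L \<in> ball (cr x + cr (t - t0) * cr L) e -->
    g (cr x + cr (t' - t0) * cr L) = nchart d (cr x + cr (t' - t0) * cr L))"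
   using e by (intro exI[of _ "glue d"] exI[of _ e]) (simp add: glue_def)
 next
  fix t assume "t0 < t" "t < t0 + dlt" "t < t1"
  thus "gam t = nchart d (cr x + cr (t - t0) * cr L)" using start[of t] by simp
 qed
 have cz: "continuous_on {t0..t1} (%t. nchart d (z t))" unfolding zr
 proof (rule nchart_along_edge[OF d])
  fix t assume t: "t \<in> {t0..t1}"
  have "(t - t0) * L <= (t1 - t0) * L" "0 <= (t - t0) * L" using t G(1) by (auto intro!: mult_right_mono)
  thus "0 <= x + (t - t0) * L \<and> x + (t - t0) * L <= len T d" using x t1l by (simp add: l_def)
 qed (intro continuous_intros)
 have cg: "continuous_on {t0..t1} gam" by (rule continuous_on_subset[OF G(2)]) (use t0 t1 in auto)
 have all: "gam t = nchart d (z t)" if "t \<in> {t0..t1}" for t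
  by (rule agree_at_end[OF cg cz t1(1) eq that])
 have sing: "gam t1 \<in> range s"
 proof (cases "t1 = 1")
  case False
  hence "t1 = t0 + (l - x) / L" by (auto simp: t1_def min_def split: if_splits)
  hence "x + (t1 - t0) * L = l" using G(1) by simp
  hence "z t1 = cr (len T d)" by (simp only: zr l_def)
  thus ?thesis using all[of t1] t1 nchart_corners(2)[OF d] by simp
 qed (use fin in simp)
 hence t11: "t1 = 1" using G(4)[of t1] t1 t0 by force
 have "\<not> x + (t1 - t0) * L < l"
 proof
  assume *: "x + (t1 - t0) * L < l"
  have "0 <= (t1 - t0) * L" using t1 G(1) by simp
  hence "0 < x + (t1 - t0) * L" using x by linarith
  from edge_not_singular[OF d this *[unfolded l_def]] show False
   using sing all[of t1] t1 unfolding zr by simp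
 qed
 thus "x + (1 - t0) * L = len T d" using t1l t11 by (simp add: l_def)
 show "gam t = nchart d (cr (x + (t - t0) * L))" if "t0 <= t" "t <= 1" for t
  using all[of t] that t11 unfolding zr by simp
qed

text \<open>
 A geodesic that is tangent to an edge follows it to both ends, and is therefore the edge itself.
\<close>

lemma geodesic_along_edge:
 assumes d: "d \<in> darts T" and x: "0 < x" "x < len T d" and geo: "geodesic_path s gam L"
  and ends: "gam 0 \<in> range s" "gam 1 \<in> range s"
  and t0: "0 < t0" "t0 < 1" and dlt: "0 < dlt" and v: "v = L \<or> v = - L"
  and near: "!!t. \<bar>t - t0\<bar> < dlt ==> gam t = nchart d (cr (x + (t - t0) * v))"
 shows "\<exists>d'\<in>darts T. len T d' = L \<and> (\<forall>t\<in>{0..1}. gam t = nchart d' (cr (t * L)))"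
proof -
 have pos: "\<exists>d'\<in>darts T. len T d' = L \<and> (\<forall>t\<in>{0..1}. gam t = nchart d' (cr (t * L)))"
  if d: "d \<in> darts T" and x: "0 < x" "x < len T d" and dlt: "0 < dlt"
  and near: "!!t. \<bar>t - t0\<bar> < dlt ==> gam t = nchart d (cr (x + (t - t0) * L))" for d x dlt
 proof -
  note G = geodesic_pathD[OF geo]
  have o: "opp T d \<in> darts T" "len T (opp T d) = len T d" using d len_opp by auto
  have f: "x + (1 - t0) * L = len T d" "!!t. t0 <= t ==> t <= 1 ==> gam t = nchart d (cr (x + (t - t0) * L))"
   using geodesic_along_edge_forward[OF d x geo ends(2) t0 dlt] near by auto
  let ?dlt = "min dlt (min (x / L) ((len T d - x) / L))"
  have dd: "0 < ?dlt" using dlt x G(1) by simp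
  have st: "gam (1 - t) = nchart (opp T d) (cr ((len T d - x) + (t - (1 - t0)) * L))"
   if t: "1 - t0 <= t" "t < 1 - t0 + ?dlt" for t
  proof -
   define h where "h = t - (1 - t0)"
   have "h < ?dlt" unfolding h_def using t(2) by (metis add.commute diff_less_eq)
   hence h: "0 <= h" "h < dlt" "h * L < x" using t G(1) by (auto simp: pos_less_divide_eq) (simp add: h_def)
   have "gam (1 - t) = nchart d (cr (x + (1 - t - t0) * L))" by (rule near) (use h in \<open>auto simp: h_def\<close>)
   also have "(1 - t - t0) * L = - (h * L)" by (simp add: h_def algebra_simps)
   also have "nchart d (cr (x + - (h * L))) = nchart (opp T d) (cr (len T d - (x + - (h * L))))"
    by (rule nchart_opp[OF d]) (use h x mult_nonneg_nonneg[OF h(1) less_imp_le[OF G(1)]] in linarith)+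
   also have "len T d - (x + - (h * L)) = (len T d - x) + (t - (1 - t0)) * L" by (simp add: h_def)
   finally show ?thesis .
  qed
  have x': "0 < len T d - x" "len T d - x < len T (opp T d)" using x o by auto
  have t0': "0 < 1 - t0" "1 - t0 < 1" using t0 by auto
  have b: "(len T d - x) + (1 - (1 - t0)) * L = len T (opp T d)"
   "!!t. 1 - t0 <= t ==> t <= 1 ==> gam (1 - t) = nchart (opp T d) (cr ((len T d - x) + (t - (1 - t0)) * L))"
   using geodesic_along_edge_forward[OF o(1) x' geodesic_path_reverse[OF geo] _ t0' dd st] ends(1) by auto
  have xt: "x = t0 * L" using b(1) o by simp
  hence lL: "len T d = L" using f(1) by (simp add: algebra_simps)
  have "gam t = nchart d (cr (t * L))" if t: "t \<in> {0..1}" for t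
  proof (cases "t0 <= t")
   case True
   have "x + (t - t0) * L = t * L" by (simp add: xt algebra_simps)
   thus ?thesis using f(2)[OF True] t by simp
  next
   case False
   have "gam t = nchart (opp T d) (cr ((len T d - x) + ((1 - t) - (1 - t0)) * L))"
    using b(2)[of "1 - t"] False t by simp
   also have "(len T d - x) + ((1 - t) - (1 - t0)) * L = len T d - t * L" by (simp add: xt algebra_simps)
   also have "nchart (opp T d) (cr (len T d - t * L)) = nchart d (cr (t * L))"
    by (rule nchart_opp[OF d, symmetric]) (use t lL G(1) in \<open>auto simp: mult_le_cancel_right1\<close>)
   finally show ?thesis .
  qed
  thus ?thesis using d lL by blast
 qed
 show ?thesis
 proof (cases "v = L")
  case True thus ?thesis using pos[OF d x dlt] near by simp
 next
  case False
  hence v': "v = - L" using v by blast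
  note G = geodesic_pathD[OF geo]
  have o: "opp T d \<in> darts T" "len T (opp T d) = len T d" using d len_opp by auto
  let ?dlt = "min dlt (min (x / L) ((len T d - x) / L))"
  have dd: "0 < ?dlt" using dlt x G(1) by simp
  show ?thesis
  proof (rule pos[OF o(1) _ _ dd])
   show "0 < len T d - x" "len T d - x < len T (opp T d)" using x o by auto
   fix t assume t: "\<bar>t - t0\<bar> < ?dlt"
   have "\<bar>t - t0\<bar> * L < x" "\<bar>t - t0\<bar> * L < len T d - x" using t G(1) by (auto simp: pos_less_divide_eq)
   hence h: "\<bar>(t - t0) * L\<bar> < x" "\<bar>(t - t0) * L\<bar> < len T d - x" using G(1) by (auto simp: abs_mult)
   have "gam t = nchart d (cr (x + (t - t0) * v))" by (rule near) (use t in simp)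
   also have "\<dots> = nchart (opp T d) (cr (len T d - (x + (t - t0) * v)))"
    by (rule nchart_opp[OF d]) (use h in \<open>auto simp: v'\<close>)
   also have "len T d - (x + (t - t0) * v) = len T d - x + (t - t0) * L" by (simp add: v')
   finally show "gam t = nchart (opp T d) (cr (len T d - x + (t - t0) * L))" .
  qed
 qed
qed

lemma edge_path_determines_dart:
 assumes d: "d \<in> darts T" "d' \<in> darts T" and l: "len T d' = len T d"
  and eq: "!!t. t \<in> {0..1} ==> nchart d (cr (t * len T d)) = nchart d' (cr (t * len T d))"
 shows "d' = d"
proof -
 have same: "e' = e \<and> x' = x" if e: "e \<in> darts T" "e' \<in> face T e" and fr: "frame e' (cr x') = frame e (cr x)"
  and x': "0 < x'" "x' < len T e'" for e e' x x'
 proof -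
  have n: "nxt T e \<in> darts T" using e by simp
  have "e' = e \<or> e' = nxt T e \<or> e' = prv T e" using e(2) by (auto simp: face_def)
  thus ?thesis
  proof (elim disjE)
   assume "e' = e" thus ?thesis using fr frame_inj[OF e(1)] by simp
  next
   assume *: "e' = nxt T e"
   hence "frame e (frame_nxt e (cr x')) = frame e (cr x)" using fr frame_frame_nxt[OF e(1)] by simp
   hence "frame_nxt e (cr x') = cr x" by (simp only: frame_inj[OF e(1)])
   hence "Im (frame_nxt e (cr x')) = 0" by simp
   thus ?thesis using side_dir(3)[OF e(1)] x' by (simp add: frame_nxt_def)
  next
   assume *: "e' = prv T e"
   hence "frame e (frame_nxt e (frame_nxt (nxt T e) (cr x'))) = frame e (cr x)"
    using fr frame_frame_nxt[OF e(1)] frame_frame_nxt[OF n] by simp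
   hence "frame_nxt e (frame_nxt (nxt T e) (cr x')) = cr x" by (simp only: frame_inj[OF e(1)])
   hence "Im ((cr (len T e') - cr x') * (tip T e / cr (len T e'))) = 0"
    unfolding tip_nxt_nxt[OF e(1)] * by simp
   moreover have "len T e' > 0" using x' by simp
   ultimately show ?thesis using tip_props(1)[OF e(1)] x' by simp
  qed
 qed
 define x where "x = 1 / 3 * len T d"
 have lp: "len T d > 0" using d by simp
 have x: "0 < x" "x < len T d" "x < len T d'" using lp l by (auto simp: x_def)
 have o: "opp T d \<in> darts T" using d by simp
 have "cr x \<in> tri d'" using tri_points(1)[OF d(2), of x] x by simp
 moreover have "nchart d (cr x) = nchart d' (cr x)" using eq[of "1/3"] by (simp add: x_def)
 ultimately consider "d' \<in> face T d" "frame d' (cr x) = frame d (cr x)"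
  | "d' \<in> face T (opp T d)" "frame d' (cr x) = frame (opp T d) (cr (len T d - x))"
  using nchart_inj_edge[OF d x(1,2)] by blast
 thus ?thesis
 proof cases
  case 1 thus ?thesis using same[OF d(1) 1 x(1,3)] by simp
 next
  case 2
  have "x = len T d - x" using same[OF o 2 x(1,3)] by simp
  thus ?thesis using lp by (simp add: x_def)
 qed
qed

lemma slopes_at_edge:
 assumes d: "d \<in> darts T" and x: "0 < x" "x < len T d"
 shows "two_sided_slopes (apex_dist2 r) (nchart d (cr x)) (inset T r d) (inset T r (opp T d))"
proof -
 obtain e where e: "isometric_chart (glue d) (cr x) e"
  "!!z. z \<in> ball (cr x) e ==> (0 <= Im z --> z \<in> tri d) \<and> (Im z <= 0 --> cr (len T d) - z \<in> tri (opp T d))"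
  using edge_chart[OF d x] by blast
 define gam where "gam t = glue d (cr x + cr (t - 0) * \<i>)" for t :: real
 have e0: "0 < e" by (rule isometric_chartD[OF e(1)])
 have "local_geodesic_at gam (cmod \<i>) 0"
  by (rule local_geodesic_at_chart_line[OF e(1), of 1]) (simp_all add: gam_def)
 moreover have A: "apex_dist2 r (gam t) = x^2 + t^2 - 2 * foot_along T r d * x + (r $ orig T d)^2
   - (if 0 <= t then 2 * inset T r d * t else - (2 * inset T r (opp T d) * t))" if "\<bar>t\<bar> < e" for t
 proof -
  have "cr x + cr (t - 0) * \<i> \<in> ball (cr x) e" using that by (simp add: dist_norm norm_mult)
  note E = e(2)[OF this]
  show ?thesis unfolding gam_def
   by (subst apex_dist2_glue[OF d]) (use E in \<open>auto simp: cmod_power2\<close>)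
 qed
 moreover have g0: "gam 0 = nchart d (cr x)" by (simp add: gam_def glue_def)
 ultimately show ?thesis unfolding two_sided_slopes_def g0[symmetric]
  by (intro exI[of _ gam] exI[of _ e]) (use e0 A[of 0] in auto)
qed

text \<open>
 The squared distance is smooth inside a face, so the slopes in opposite directions cancel.
\<close>

lemma slopes_in_face:
 assumes d: "d \<in> darts T" and z: "z \<in> otri d" and S: "two_sided_slopes (apex_dist2 r) (nchart d z) a b"
 shows "a + b = 0"
proof -
 obtain gam dlt where g: "0 < dlt" "gam 0 = nchart d z" "local_geodesic_at gam 1 0"
  "!!h. 0 < h ==> h < dlt ==> apex_dist2 r (gam h) = apex_dist2 r (nchart d z) + h^2 - 2 * a * h \<and>
    apex_dist2 r (gam (- h)) = apex_dist2 r (nchart d z) + h^2 - 2 * b * h"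
  using S unfolding two_sided_slopes_def by blast
 obtain v dlt' where v: "0 < dlt'" "!!h. \<bar>h\<bar> < dlt' ==>
   apex_dist2 r (gam (0 + h)) = apex_dist2 r (gam 0) + h^2 * 1^2 + 2 * h * Re (cnj v * (z - foot T r d))"
  using apex_dist2_geodesic_face[OF d z g(3) g(2) zero_le_one, of r] by blast
 define h where "h = min dlt dlt' / 2"
 have h: "0 < h" "h < dlt" "h < dlt'" using g(1) v(1) by (auto simp: h_def)
 have "h * (a + b) = 0" using g(4)[OF h(1,2)] v(2)[of h] v(2)[of "- h"] h unfolding g(2) by (simp add: algebra_simps)
 thus ?thesis using h by simp
qed

text \<open>
 The kink is seen at full strength only by geodesics orthogonal to the edge; this is how both insets are
 recovered.
\<close>

lemma slopes_at_edge_bound: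
 assumes d: "d \<in> darts T" and x: "0 < x" "x < len T d" and conv: "0 <= bend r d"
  and S: "two_sided_slopes (apex_dist2 r) (nchart d (cr x)) a b"
 shows "a + b <= bend r d"
  "a + b = bend r d ==> 0 < bend r d ==>
   (a = inset T r d \<and> b = inset T r (opp T d)) \<or> (b = inset T r d \<and> a = inset T r (opp T d))"
proof -
 obtain gam dlt where g: "0 < dlt" "gam 0 = nchart d (cr x)" "local_geodesic_at gam 1 0"
  "!!h. 0 < h ==> h < dlt ==> apex_dist2 r (gam h) = apex_dist2 r (nchart d (cr x)) + h^2 - 2 * a * h \<and>
    apex_dist2 r (gam (- h)) = apex_dist2 r (nchart d (cr x)) + h^2 - 2 * b * h"
  using S unfolding two_sided_slopes_def by blast
 define sd so k where "sd = inset T r d" and "so = inset T r (opp T d)" and "k = x - foot_along T r d"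
 obtain v dlt' where v: "0 < dlt'" "cmod v = 1" "!!h. \<bar>h\<bar> < dlt' ==>
   apex_dist2 r (gam (0 + h)) = apex_dist2 r (gam 0) + h^2 * 1^2 + 2 * h * Re v * k
    - (if 0 <= h * Im v then 2 * sd * (h * Im v) else - (2 * so * (h * Im v)))"
  using apex_dist2_geodesic_edge[OF d x g(3) g(2) zero_le_one, of r] unfolding sd_def so_def k_def by blast
 define h where "h = min dlt dlt' / 2"
 have h: "0 < h" "h < dlt" "h < dlt'" using g(1) v(1) by (auto simp: h_def)
 have E1: "h^2 - 2 * a * h = h^2 + 2 * h * Re v * k - (if 0 <= h * Im v then 2 * sd * (h * Im v) else - (2 * so * (h * Im v)))"
  using g(4)[OF h(1,2)] v(3)[of h] h unfolding g(2) by simp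
 have E2: "h^2 - 2 * b * h = h^2 - 2 * h * Re v * k - (if 0 <= - h * Im v then 2 * sd * (- h * Im v) else - (2 * so * (- h * Im v)))"
  using g(4)[OF h(1,2)] v(3)[of "- h"] h unfolding g(2) by simp
 define m where "m = Im v"
 have ab: "a = - Re v * k + (if 0 <= m then sd * m else - (so * m)) \<and>
      b = Re v * k + (if 0 <= - m then - (sd * m) else so * m)"
 proof -
  have h2: "2 * h ~= 0" using h(1) by simp
  note cancel = mult_left_cancel[OF h2, THEN iffD1]
  consider "m > 0" | "m = 0" | "m < 0" by linarith
  thus ?thesis
  proof cases
   case 1
   hence c: "0 <= h * m" "\<not> 0 <= - h * m" "0 <= m" "\<not> 0 <= - m" using h(1) by (auto simp: mult_le_0_iff)
   have "2 * h * a = 2 * h * (- Re v * k + sd * m)" "2 * h * b = 2 * h * (Re v * k + so * m)"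
    using E1 E2 unfolding m_def[symmetric] if_P[OF c(1)] if_not_P[OF c(2)] by (simp_all add: algebra_simps)
   from this[THEN cancel] show ?thesis using c by simp
  next
   case 2
   have "2 * h * a = 2 * h * (- Re v * k)" "2 * h * b = 2 * h * (Re v * k)"
    using E1 E2 unfolding m_def[symmetric] 2 mult_zero_right if_P[OF order_refl] by algebra+
   from this[THEN cancel] show ?thesis using 2 by simp
  next
   case 3
   hence c: "\<not> 0 <= h * m" "0 <= - h * m" "\<not> 0 <= m" "0 <= - m" using h(1) by (auto simp: zero_le_mult_iff mult_le_0_iff)
   have "2 * h * a = 2 * h * (- Re v * k - so * m)" "2 * h * b = 2 * h * (Re v * k - sd * m)"
    using E1 E2 unfolding m_def[symmetric] if_not_P[OF c(1)] if_P[OF c(2)] by (simp_all add: algebra_simps)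
   from this[THEN cancel] show ?thesis using c by simp
  qed
 qed
 have bd: "bend r d = sd + so" by (simp add: bend_def sd_def so_def)
 have sum: "a + b = (sd + so) * \<bar>Im v\<bar>" using ab by (auto simp: m_def algebra_simps split: if_splits)
 have i: "\<bar>Im v\<bar> <= 1" using abs_Im_le_cmod[of v] v(2) by simp
 show "a + b <= bend r d" unfolding sum bd using mult_left_mono[OF i, of "sd + so"] conv bd by simp
 show "(a = inset T r d \<and> b = inset T r (opp T d)) \<or> (b = inset T r d \<and> a = inset T r (opp T d))"
  if "a + b = bend r d" "0 < bend r d"
 proof -
  have i1: "\<bar>Im v\<bar> = 1" using that unfolding sum bd by simp
  hence "(Re v)^2 + 1 = 1" using v(2) cmod_power2[of v] by (metis one_power2 power2_abs)
  hence re: "Re v = 0" by simp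
  have "m = 1 \<or> m = -1" using i1 by (simp add: m_def) linarith
  thus ?thesis using ab unfolding re sd_def[symmetric] so_def[symmetric] by auto
 qed
qed

end

locale two_convex_triangulations =
 A: surface_triangulation s T + B: surface_triangulation s T'
 for s :: "'v::finite => 'm::metric_space" and T T' :: "('v, 'm) geo_tri" +
 fixes r :: "real^'v"
 assumes convA: "!!d. d \<in> darts T ==> 0 <= A.bend r d"
  and convB: "!!d. d \<in> darts T' ==> 0 <= B.bend r d"
begin

lemma q_eq: "B.apex_dist2 r = A.apex_dist2 r"
 using apex_dist2_unique[OF B.surface_triangulation_axioms A.surface_triangulation_axioms convB convA] .

lemma strict_edge_point:
 assumes d: "d \<in> darts T'" "0 < B.bend r d" and x: "0 < x" "x < len T' d"
 obtains e y where "e \<in> darts T" "0 < y" "y < len T e" "B.nchart d (cr x) = A.nchart e (cr y)"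
proof (cases rule: A.point_cases[of "B.nchart d (cr x)"])
 case (1 i) thus ?thesis using B.edge_not_singular[OF d(1) x] by auto
next
 case (2 e z)
 have "two_sided_slopes (A.apex_dist2 r) (A.nchart e z) (inset T' r d) (inset T' r (opp T' d))"
  using B.slopes_at_edge[OF d(1) x, of r] unfolding q_eq 2(3) .
 from A.slopes_in_face[OF 2(1,2) this] d(2) show ?thesis by (simp add: B.bend_def)
next
 case (3 e y) thus ?thesis using that by blast
qed

text \<open>
 At a kink of the squared distance the other triangulation cannot have a face, so the whole edge is
 covered by its edges, hence by one of them.  Comparing the slopes in both directions shows that the
 insets agree up to exchanging the two sides.
\<close>

lemma strict_edge_shared:
 assumes d: "d \<in> darts T'" "0 < B.bend r d"
 shows "\<exists>e\<in>darts T. len T e = len T' d \<and> 0 < A.bend r e \<and>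
  (\<forall>t\<in>{0..1}. B.nchart d (cr (t * len T' d)) = A.nchart e (cr (t * len T' d))) \<and>
  orig T e = orig T' d \<and> orig T (nxt T e) = orig T' (nxt T' d) \<and>
  ((inset T' r d = inset T r e \<and> inset T' r (opp T' d) = inset T r (opp T e)) \<or>
   (inset T' r (opp T' d) = inset T r e \<and> inset T' r d = inset T r (opp T e)))"
proof -
 define l gam where "l = len T' d" and "gam t = B.nchart d (cr (t * l))" for t
 have l: "l > 0" using d by (simp add: l_def)
 have geo: "geodesic_path s gam l" unfolding gam_def l_def by (rule B.geodesic_path_edge[OF d(1)])
 note G = geodesic_pathD[OF geo]
 have ends: "gam 0 = s (orig T' d)" "gam 1 = s (orig T' (nxt T' d))" using B.nchart_corners[OF d(1)] by (auto simp: gam_def l_def)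
 have onedge: "\<exists>e y. e \<in> darts T \<and> 0 < y \<and> y < len T e \<and> gam t = A.nchart e (cr y)" if "0 < t" "t < 1" for t
 proof -
  have "0 < t * l" "t * l < len T' d" using that l by (auto simp: l_def)
  from strict_edge_point[OF d this] show ?thesis unfolding gam_def by blast
 qed
 obtain e0 y0 where e0: "e0 \<in> darts T" "0 < y0" "y0 < len T e0" "gam (1/2) = A.nchart e0 (cr y0)"
  using onedge[of "1/2"] by auto
 obtain eps where ch: "isometric_chart (A.glue e0) (cr y0) eps"
  "!!z. z \<in> ball (cr y0) eps ==> (0 < Im z --> z \<in> A.otri e0) \<and> (Im z < 0 --> cr (len T e0) - z \<in> A.otri (opp T e0))"
  using A.edge_chart[OF e0(1-3)] by blast
 have g0: "gam (1/2) = A.glue e0 (cr y0)" using e0(4) by (simp add: A.glue_def)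
 obtain v dlt where v: "cmod v = l" "0 < dlt" "!!t. \<bar>t - 1/2\<bar> < dlt ==>
   gam t = A.glue e0 (cr y0 + cr (t - 1/2) * v) \<and> cr y0 + cr (t - 1/2) * v \<in> ball (cr y0) eps"
  using geodesic_in_chart[OF ch(1) G(3)[of "1/2"] g0] G(1) by (auto simp: less_imp_le)
 have noface: "gam t ~= A.nchart e z" if "0 < t" "t < 1" "e \<in> darts T" "z \<in> A.otri e" for t e z
 proof
  assume eq: "gam t = A.nchart e z"
  have tl: "0 < t * l" "t * l < len T' d" using that l by (auto simp: l_def)
  have "two_sided_slopes (A.apex_dist2 r) (A.nchart e z) (inset T' r d) (inset T' r (opp T' d))"
   using B.slopes_at_edge[OF d(1) tl, of r] unfolding q_eq eq[unfolded gam_def] .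
  from A.slopes_in_face[OF that(3,4) this] d(2) show False by (simp add: B.bend_def)
 qed
 have Imv: "Im v = 0"
 proof (rule ccontr)
  assume nz: "Im v ~= 0"
  define h where "h = min dlt (1/2) / 2"
  have h: "0 < h" "h < dlt" "h < 1/2" using v(2) by (auto simp: h_def)
  define t where "t = (if 0 < Im v then 1/2 + h else 1/2 - h)"
  have t: "\<bar>t - 1/2\<bar> < dlt" "0 < t" "t < 1" "0 < (t - 1/2) * Im v"
   using h nz by (auto simp: t_def mult_less_0_iff zero_less_mult_iff)
  define z where "z = cr y0 + cr (t - 1/2) * v"
  have z: "0 < Im z" "gam t = A.glue e0 z" "z \<in> ball (cr y0) eps" using v(3)[OF t(1)] t(4) by (auto simp: z_def)
  have "gam t = A.nchart e0 z" using z by (simp add: A.glue_def)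
  thus False using noface[OF t(2,3) e0(1)] ch(2)[OF z(3)] z(1) by blast
 qed
 have vr: "v = cr (Re v)" using Imv by (simp add: complex_eq_iff)
 have rv: "Re v = l \<or> Re v = - l" using v(1) Imv by (auto simp: cmod_def abs_if split: if_splits)
 have near: "gam t = A.nchart e0 (cr (y0 + (t - 1/2) * Re v))" if "\<bar>t - 1/2\<bar> < dlt" for t
 proof -
  have "cr y0 + cr (t - 1/2) * v = cr (y0 + (t - 1/2) * Re v)" by (simp add: complex_eq_iff Imv)
  hence "gam t = A.glue e0 (cr (y0 + (t - 1/2) * Re v))" using v(3)[OF that] by metis
  thus ?thesis unfolding A.glue_def by (simp only: Im_complex_of_real order_refl if_True)
 qed
 obtain e where e: "e \<in> darts T" "len T e = l" "!!t. t \<in> {0..1} ==> gam t = A.nchart e (cr (t * l))"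
  using A.geodesic_along_edge[OF e0(1-3) geo _ _ _ _ v(2) rv near] ends by auto
 have oe: "orig T e = orig T' d" "orig T (nxt T e) = orig T' (nxt T' d)"
  using e(3)[of 0] e(3)[of 1] A.nchart_corners[OF e(1)] ends e(2) A.inj_s by (auto dest: injD)
 have mid: "0 < 1/2 * l" "1/2 * l < len T e" "1/2 * l < len T' d" using l e(2) by (auto simp: l_def)
 have peq: "B.nchart d (cr (1/2 * l)) = A.nchart e (cr (1/2 * l))" using e(3)[of "1/2"] by (simp add: gam_def)
 have SA: "two_sided_slopes (A.apex_dist2 r) (A.nchart e (cr (1/2 * l))) (inset T' r d) (inset T' r (opp T' d))"
  using B.slopes_at_edge[OF d(1) mid(1,3), of r] unfolding q_eq peq .
 have SB: "two_sided_slopes (B.apex_dist2 r) (B.nchart d (cr (1/2 * l))) (inset T r e) (inset T r (opp T e))"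
  using A.slopes_at_edge[OF e(1) mid(1,2), of r] unfolding q_eq peq .
 have "B.bend r d <= A.bend r e" using A.slopes_at_edge_bound(1)[OF e(1) mid(1,2) convA[OF e(1)] SA] by (simp add: B.bend_def)
 moreover have "A.bend r e <= B.bend r d" using B.slopes_at_edge_bound(1)[OF d(1) mid(1,3) convB[OF d(1)] SB] by (simp add: A.bend_def)
 ultimately have be: "A.bend r e = B.bend r d" by simp
 have "(inset T' r d = inset T r e \<and> inset T' r (opp T' d) = inset T r (opp T e)) \<or>
   (inset T' r (opp T' d) = inset T r e \<and> inset T' r d = inset T r (opp T e))"
  using A.slopes_at_edge_bound(2)[OF e(1) mid(1,2) convA[OF e(1)] SA] be d(2) by (simp add: B.bend_def)
 thus ?thesis using e oe be d(2) unfolding gam_def l_def by metis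
qed

end

lemma (in two_convex_triangulations) swap: "two_convex_triangulations s T' T r"
 by unfold_locales (use convA convB in auto)

text \<open>
 The exchange of the two sides is the reason for the symmetry assumption.
\<close>

lemma (in two_convex_triangulations) strict_edge_sum:
 fixes F :: "'v => 'v => real => real => real => real"
 assumes sym: "!!i j l a b. F i j l a b = F i j l b a"
 shows "(\<Sum>d | d \<in> darts T' \<and> 0 < B.bend r d. F (orig T' d) (orig T' (nxt T' d)) (len T' d) (inset T' r d) (inset T' r (opp T' d)))
  = (\<Sum>d | d \<in> darts T \<and> 0 < A.bend r d. F (orig T d) (orig T (nxt T d)) (len T d) (inset T r d) (inset T r (opp T d)))"
proof -
 interpret sw: two_convex_triangulations s T' T r by (rule swap)
 define P where "P d e \<longleftrightarrow> e \<in> darts T \<and> len T e = len T' d \<and> 0 < A.bend r e \<and>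
  (\<forall>t\<in>{0..1}. B.nchart d (cr (t * len T' d)) = A.nchart e (cr (t * len T' d))) \<and>
  orig T e = orig T' d \<and> orig T (nxt T e) = orig T' (nxt T' d) \<and>
  ((inset T' r d = inset T r e \<and> inset T' r (opp T' d) = inset T r (opp T e)) \<or>
   (inset T' r (opp T' d) = inset T r e \<and> inset T' r d = inset T r (opp T e)))" for d e
 define P' where "P' e d \<longleftrightarrow> d \<in> darts T' \<and> len T' d = len T e \<and> 0 < B.bend r d \<and>
  (\<forall>t\<in>{0..1}. A.nchart e (cr (t * len T e)) = B.nchart d (cr (t * len T e)))" for d e
 define m where "m d = (SOME e. P d e)" for d
 define m' where "m' e = (SOME d. P' e d)" for e
 have m: "P d (m d)" if "d \<in> darts T'" "0 < B.bend r d" for d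
  unfolding m_def by (rule someI_ex) (use strict_edge_shared[OF that] in \<open>auto simp: P_def\<close>)
 have m': "P' e (m' e)" if "e \<in> darts T" "0 < A.bend r e" for e
  unfolding m'_def by (rule someI_ex) (use sw.strict_edge_shared[OF that] in \<open>auto simp: P'_def\<close>)
 show ?thesis
 proof (rule sum.reindex_bij_witness[of _ m' m])
  fix d assume "d \<in> {d \<in> darts T'. 0 < B.bend r d}"
  hence d: "d \<in> darts T'" "0 < B.bend r d" by auto
  note M = m[OF d, unfolded P_def]
  show me: "m d \<in> {d \<in> darts T. 0 < A.bend r d}" using M by blast
  have M': "P' (m d) (m' (m d))" using m' me by blast
  show "m' (m d) = d"
   by (rule B.edge_path_determines_dart[OF d(1)]) (use M M' in \<open>auto simp: P'_def\<close>)
  show "F (orig T (m d)) (orig T (nxt T (m d))) (len T (m d)) (inset T r (m d)) (inset T r (opp T (m d))) =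
   F (orig T' d) (orig T' (nxt T' d)) (len T' d) (inset T' r d) (inset T' r (opp T' d))"
   using M sym by metis
 next
  fix e assume "e \<in> {d \<in> darts T. 0 < A.bend r d}"
  hence e: "e \<in> darts T" "0 < A.bend r e" by auto
  note M' = m'[OF e, unfolded P'_def]
  show me: "m' e \<in> {d \<in> darts T'. 0 < B.bend r d}" using M' by blast
  have M: "P (m' e) (m (m' e))" using m me by blast
  show "m (m' e) = e"
   by (rule A.edge_path_determines_dart[OF e(1)]) (use M M' in \<open>auto simp: P_def\<close>)
 qed
qed

section \<open>Geodesics crossing edges\<close>

lemma Arg_upper_half_plane:
 assumes "0 < Im z" shows "0 < Arg z" "Arg z < pi"
proof -
 have z: "z ~= 0" using assms by auto
 have "Im z = cmod z * sin (Arg z)" by (metis rcis_cmod_Arg Im_rcis)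
 moreover have "0 < cmod z" using z by simp
 ultimately have s: "0 < sin (Arg z)" using assms by (metis zero_less_mult_pos)
 have b: "- pi < Arg z" "Arg z <= pi" using Arg_bounded[of z] by auto
 show "0 < Arg z"
 proof (rule ccontr)
  assume "\<not> 0 < Arg z"
  hence "0 <= sin (- Arg z)" using b by (intro sin_ge_zero) auto
  thus False using s by simp
 qed
 have "Arg z ~= pi" using s by auto
 thus "Arg z < pi" using b by simp
qed

lemma Arg_mult_upper:
 assumes "0 < Im a" "0 < Im b" "0 < Im (a * b)"
 shows "Arg (a * b) = Arg a + Arg b"
proof -
 have nz: "a ~= 0" "b ~= 0" using assms by auto
 note A = Arg_upper_half_plane[OF assms(1)] and B = Arg_upper_half_plane[OF assms(2)]
 have "a * b = rcis (cmod a) (Arg a) * rcis (cmod b) (Arg b)" by (simp add: rcis_cmod_Arg)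
 also have "\<dots> = rcis (cmod a * cmod b) (Arg a + Arg b)" by (rule rcis_mult)
 finally have "Im (a * b) = cmod a * cmod b * sin (Arg a + Arg b)" by simp
 moreover have "0 < cmod a * cmod b" using nz by simp
 ultimately have s: "0 < sin (Arg a + Arg b)" using assms(3) by (metis zero_less_mult_pos)
 have "Arg a + Arg b <= pi"
 proof (rule ccontr)
  assume "\<not> ?thesis"
  hence "sin (Arg a + Arg b) <= 0" using A B by (intro sin_le_zero) auto
  thus False using s by simp
 qed
 thus ?thesis using A B nz by (intro Arg_times) auto
qed

context surface_triangulation
begin

lemma frame_nxt_otri:
 assumes d: "d \<in> darts T" shows "frame_nxt d z \<in> otri d \<longleftrightarrow> z \<in> otri (nxt T d)"
proof -
 define l l' u w w' Z where "l = len T d" and "l' = len T (nxt T d)" and "u = side_dir d" and "w = tip T d"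
  and "w' = tip T (nxt T d)" and "Z = frame_nxt d z"
 have lp: "l > 0" "l' > 0" using d by (auto simp: l_def l'_def)
 have cu: "u * cnj u = 1" using side_dir(1)[OF d] complex_norm_square[of u] by (simp add: u_def)
 have w: "w = cr l + cr l' * u" using side_dir(2)[OF d] by (simp add: w_def l_def l'_def u_def)
 have Z: "Z = cr l + z * u" by (simp add: Z_def frame_nxt_def l_def u_def)
 have "cr l + w' * u = 0" using tip_nxt[OF d] by (simp add: frame_nxt_def l_def w'_def u_def)
 hence "w' * u * cnj u = - cr l * cnj u" by (simp add: add_eq_0_iff2)
 hence w': "w' = - cr l * cnj u" using cu by (simp add: mult.assoc)
 have 1: "Im (z * cnj w') = - l * Im Z" unfolding w' Z by (simp add: algebra_simps)
 have "(Z - cr l) * cnj (w - cr l) = cr l' * (z * (u * cnj u))" unfolding Z w by (simp add: algebra_simps)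
 hence 2: "Im ((Z - cr l) * cnj (w - cr l)) = l' * Im z" unfolding cu by simp
 have "(z - cr l') * cnj (w' - cr l') = - (Z - w) * cnj w"
 proof -
  have "(z - cr l') * cnj (w' - cr l') = - ((z - cr l') * cr l * u + (z - cr l') * cr l' * (u * cnj u))"
   unfolding w' cu by (simp add: algebra_simps)
  also have "\<dots> = - (Z - w) * cnj w" unfolding Z w by (simp add: algebra_simps)
  finally show ?thesis .
 qed
 moreover have "Im (w * cnj w) = 0" by (simp add: complex_norm_square[symmetric] mult.commute)
 ultimately have 3: "Im ((z - cr l') * cnj (w' - cr l')) = - Im (Z * cnj w)"
  by (simp add: left_diff_distrib del: complex_cnj_diff)
 show ?thesis unfolding otri_def mem_Collect_eq Z_def[symmetric] l_def[symmetric] w_def[symmetric]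
   l'_def[symmetric] w'_def[symmetric] 1 2 3 using lp by (auto simp: zero_less_mult_iff)
qed

text \<open>
 At time \<open>t\<close> the geodesic passes the point \<open>x\<close> of the edge \<open>d\<close>
 into the face of \<open>d\<close>, with velocity \<open>v\<close> in the normal form.
\<close>

definition enters :: "(real => 'm) => nat => real => complex => real => bool" where
 "enters gam d x v t0 \<longleftrightarrow> d \<in> darts T \<and> 0 < x \<and> x < len T d \<and> 0 < Im v \<and> 0 < t0 \<and> t0 < 1 \<and>
   (\<exists>dlt>0. \<forall>t. t0 <= t --> t < t0 + dlt --> gam t = nchart d (cr x + cr (t - t0) * v))"

lemma straight_until_exit:
 assumes d: "d \<in> darts T" and geo: "geodesic_path s gam L" and v: "cmod v = L" and t0: "0 < t0" "t0 < 1" and dlt: "0 < dlt"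
  and z: "z = (%t. z0 + cr (t - t0) * v)"
  and start: "!!t. t0 < t ==> t < t0 + dlt ==> z t \<in> otri d \<and> gam t = nchart d (z t)"
 shows "\<exists>t1. t0 < t1 \<and> t1 <= 1 \<and> (\<forall>t. t0 < t --> t < t1 --> z t \<in> otri d \<and> gam t = nchart d (z t)) \<and>
  z t1 \<in> tri d \<and> gam t1 = nchart d (z t1) \<and> (t1 < 1 --> z t1 \<notin> otri d)"
proof -
 note G = geodesic_pathD[OF geo]
 have zc: "continuous_on A z" for A unfolding z by (intro continuous_intros)
 define \<mu> where "\<mu> = min dlt (1 - t0)"
 have mm: "0 < \<mu>" "\<mu> <= dlt" "\<mu> <= 1 - t0" using dlt t0 unfolding \<mu>_def by (simp, linarith, linarith)
 define E where "E = {t \<in> {t0 + \<mu> / 2..1}. z t \<notin> otri d} \<union> {1}"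
 have Ecl: "closed E"
 proof -
  have "closed ({t0 + \<mu> / 2..1} \<inter> z -` (- otri d))"
   by (rule continuous_closed_preimage[OF zc]) (use open_otri in auto)
  moreover have "E = ({t0 + \<mu> / 2..1} \<inter> z -` (- otri d)) \<union> {1}" by (auto simp: E_def)
  ultimately show ?thesis by auto
 qed
 have Eb: "bdd_below E" "E ~= {}"
 proof -
  have "t0 <= x" if "x \<in> E" for x using that mm t0 unfolding E_def by auto
  thus "bdd_below E" by (rule bdd_belowI)
 qed (simp add: E_def)
 define t1 where "t1 = Inf E"
 have t1E: "t1 \<in> E" unfolding t1_def by (rule closed_contains_Inf[OF Eb(2,1) Ecl])
 have t1: "t0 < t1" "t1 <= 1" using t1E mm t0 unfolding E_def by auto
 have inside: "z t \<in> otri d" if t: "t0 < t" "t < t1" for t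
 proof (cases "t < t0 + dlt")
  case True thus ?thesis using start[OF t(1)] by blast
 next
  case False
  show ?thesis
  proof (rule ccontr)
   assume "z t \<notin> otri d"
   moreover have "t0 + \<mu> / 2 <= t" using False mm by simp
   ultimately have "t \<in> E" using t t1 by (auto simp: E_def)
   hence "t1 <= t" unfolding t1_def by (rule cInf_lower[OF _ Eb(1)])
   thus False using t by simp
  qed
 qed
 have eq: "gam t = nchart d (z t)" if "t0 < t" "t < t1" for t
  unfolding z
 proof (rule geodesic_stays_straight[where L = L and dlt = dlt and gam = gam and ?t1.0 = t1, OF _ _ _ dlt _ that])
  show "0 <= L" using G(1) by simp
  fix t assume t: "t0 < t" "t < t1"
  show "local_geodesic_at gam L t" using G(3)[of t] t t0 t1 by simp
  obtain e where "isometric_chart (nchart d) (z t) e" using face_chart[OF d inside[OF t]] by blast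
  thus "\<exists>g e. isometric_chart g (z0 + cr (t - t0) * v) e \<and>
   (\<forall>t'. z0 + cr (t' - t0) * v \<in> ball (z0 + cr (t - t0) * v) e -->
    g (z0 + cr (t' - t0) * v) = nchart d (z0 + cr (t' - t0) * v))"
   unfolding z by blast
 next
  fix t assume "t0 < t" "t < t0 + dlt" "t < t1"
  thus "gam t = nchart d (z0 + cr (t - t0) * v)" using start[of t] unfolding z by blast
 qed
 define a where "a = (t0 + t1) / 2"
 have a: "t0 < a" "a < t1" using t1 by (auto simp: a_def)
 have cl: "closed (tri d)" using compact_tri[OF d] by (rule compact_imp_closed)
 have ztri: "z t1 \<in> tri d"
 proof -
  have "closed ({a..t1} \<inter> z -` tri d)" by (rule continuous_closed_preimage[OF zc _ cl]) simp
  moreover have "{a<..<t1} \<subseteq> {a..t1} \<inter> z -` tri d" using inside a otri_subset_tri by (auto simp: subset_iff)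
  ultimately have "closure {a<..<t1} \<subseteq> {a..t1} \<inter> z -` tri d" by (rule closure_minimal[rotated])
  moreover have "closure {a<..<t1} = {a..t1}" using a by (intro closure_greaterThanLessThan)
  moreover have "t1 \<in> {a..t1}" using a by simp
  ultimately have "t1 \<in> {a..t1} \<inter> z -` tri d" by blast
  thus ?thesis by simp
 qed
 have "gam t1 = nchart d (z t1)"
 proof (rule agree_at_end[OF _ _ a(2)])
  show "continuous_on {a..t1} gam" by (rule continuous_on_subset[OF G(2)]) (use a t0 t1 in auto)
  have "z t \<in> tri d" if "t \<in> {a..t1}" for t
   using inside[of t] ztri that a otri_subset_tri by (cases "t = t1") auto
  thus "continuous_on {a..t1} (%t. nchart d (z t))"
   by (intro continuous_on_compose2[OF nchart_continuous[OF d] zc]) auto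
  show "gam t = nchart d (z t)" if "a < t" "t < t1" for t using eq that a by simp
 qed (use a in auto)
 moreover have "t1 < 1 --> z t1 \<notin> otri d" using t1E by (auto simp: E_def)
 ultimately show ?thesis using t1 inside eq ztri by blast
qed

lemma cross_edge:
 assumes e: "e \<in> darts T" and geo: "geodesic_path s gam L" and v: "cmod v = L" "Im v < 0" and y: "0 < y" "y < len T e"
  and t1: "0 < t1" "t1 < 1" and \<eta>: "0 < \<eta>"
  and before: "!!t. t1 - \<eta> < t ==> t <= t1 ==> gam t = nchart e (cr y + cr (t - t1) * v)"
 shows "enters gam (opp T e) (len T e - y) (- v) t1"
proof -
 note G = geodesic_pathD[OF geo]
 have o: "opp T e \<in> darts T" "len T (opp T e) = len T e" "opp T (opp T e) = e" using e len_opp by auto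
 have y': "0 < len T e - y" "len T e - y < len T (opp T e)" using y o by auto
 obtain eps where ch: "isometric_chart (glue (opp T e)) (cr (len T e - y)) eps" using edge_chart[OF o(1) y'] by blast
 have left: "gam t = glue (opp T e) (cr (len T e - y) + cr (t - t1) * (- v))" if t: "t1 - \<eta> < t" "t <= t1" for t
 proof (cases "t = t1")
  case True
  have "nchart e (cr y) = nchart (opp T e) (cr (len T e - y))" by (rule nchart_opp[OF e]) (use y in auto)
  thus ?thesis using before[OF t] True by (simp add: glue_def)
 next
  case False
  hence "0 < (t - t1) * Im v" using t v(2) by (simp add: zero_less_mult_iff)
  hence "\<not> 0 <= Im (cr (len T e - y) + cr (t - t1) * (- v))" by simp
  hence "glue (opp T e) (cr (len T e - y) + cr (t - t1) * (- v))
    = nchart e (cr (len T e) - (cr (len T e - y) + cr (t - t1) * (- v)))"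
   unfolding glue_def o(2,3) by (simp only: if_False)
  also have "cr (len T e) - (cr (len T e - y) + cr (t - t1) * (- v)) = cr y + cr (t - t1) * v"
   by (simp add: algebra_simps)
  finally show ?thesis using before[OF t] by simp
 qed
 obtain dlt where d: "dlt > 0" "!!t. \<bar>t - t1\<bar> < dlt ==> gam t = glue (opp T e) (cr (len T e - y) + cr (t - t1) * (- v))"
  using geodesic_continues_in_chart[OF ch G(3)[OF t1] less_imp_le[OF G(1)] \<eta> left] by blast
 have "gam t = nchart (opp T e) (cr (len T e - y) + cr (t - t1) * (- v))" if t: "t1 <= t" "t < t1 + dlt" for t
 proof -
  have "0 <= (t - t1) * (- Im v)" using t v(2) by (intro mult_nonneg_nonneg) auto
  hence "0 <= Im (cr (len T e - y) + cr (t - t1) * (- v))" by simp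
  thus ?thesis using d(2)[of t] t unfolding glue_def by simp
 qed
 thus ?thesis unfolding enters_def using o y' v t1 d(1) by auto
qed

text \<open>
 Unfolding: these maps take the normal form of the face behind the left side, or behind the right side,
 to the normal form at \<open>d\<close>.
\<close>

definition left_map :: "nat => complex => complex" where
 "left_map d z = z * (tip T d / cr (len T (prv T d)))"

definition right_map :: "nat => complex => complex" where
 "right_map d z = tip T d - z * side_dir d"

text \<open>
 A geodesic that has entered a face ends at the tip or leaves through the left or the right side, since
 it cannot return to the side through which it came.
\<close>

lemma enters_next:
 assumes ent: "enters gam d x v t0" and geo: "geodesic_path s gam L" and v: "cmod v = L" and fin: "gam 1 \<in> range s"
 shows "cr x + cr (1 - t0) * v = tip T d \<or>
  (\<exists>x' v' t1. t0 < t1 \<and> enters gam (opp T (prv T d)) x' v' t1 \<and> cmod v' = L \<and>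
    v = v' * (tip T d / cr (len T (prv T d))) \<and>
    (\<forall>t. cr x + cr (t - t0) * v = left_map d (cr x' + cr (t - t1) * v'))) \<or>
  (\<exists>x' v' t1. t0 < t1 \<and> enters gam (opp T (nxt T d)) x' v' t1 \<and> cmod v' = L \<and>
    v = v' * (- side_dir d) \<and>
    (\<forall>t. cr x + cr (t - t0) * v = right_map d (cr x' + cr (t - t1) * v')))"
proof -
 obtain dlt0 where E: "d \<in> darts T" "0 < x" "x < len T d" "0 < Im v" "0 < t0" "t0 < 1" "0 < dlt0"
  "!!t. t0 <= t ==> t < t0 + dlt0 ==> gam t = nchart d (cr x + cr (t - t0) * v)"
  using ent unfolding enters_def by blast
 note d = E(1)
 note G = geodesic_pathD[OF geo]
 have n: "nxt T d \<in> darts T" "prv T d \<in> darts T" using d by auto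
 define z where "z = (%t. cr x + cr (t - t0) * v)"
 have imz: "Im (z t) = (t - t0) * Im v" for t by (simp add: z_def)
 obtain e where e: "e > 0" "!!z. z \<in> ball (cr x) e ==> 0 < Im z ==> z \<in> otri d"
  using edge_half_disc[OF d E(2,3)] by blast
 obtain dlt1 where d1: "dlt1 > 0" "!!t. \<bar>t\<bar> < dlt1 ==> cr x + cr t * v \<in> ball (cr x) e"
  using small_multiple_in_ball[OF e(1)] by blast
 have start: "z t \<in> otri d \<and> gam t = nchart d (z t)" if t: "t0 < t" "t < t0 + min dlt0 dlt1" for t
 proof -
  have "z t \<in> ball (cr x) e" using d1(2)[of "t - t0"] t by (simp add: z_def)
  moreover have "0 < Im (z t)" using t E(4) by (simp add: imz)
  ultimately show ?thesis using e(2) E(8)[of t] t by (simp add: z_def)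
 qed
 have mp: "0 < min dlt0 dlt1" using E(7) d1(1) by simp
 obtain t1 where t1: "t0 < t1" "t1 <= 1" "!!t. t0 < t ==> t < t1 ==> z t \<in> otri d \<and> gam t = nchart d (z t)"
  "z t1 \<in> tri d" "gam t1 = nchart d (z t1)" "t1 < 1 ==> z t1 \<notin> otri d"
  using straight_until_exit[OF d geo v E(5,6) mp z_def start] by blast
 have imt1: "0 < Im (z t1)" using t1(1) E(4) by (simp add: imz)
 have sing: "gam t1 \<in> range s \<longleftrightarrow> t1 = 1" using fin G(4)[of t1] t1(1,2) E(5) by (cases "t1 = 1") auto
 have notin: "z t1 \<notin> otri d" using t1(6) interior_not_singular[OF d, of "z t1"] fin t1(2,5) by (cases "t1 = 1") auto
 from tri_cases[OF d t1(4)] show ?thesis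
 proof (elim disjE exE conjE)
  assume "z t1 \<in> otri d" thus ?thesis using notin by blast
 next
  assume "z t1 = 0" thus ?thesis using imt1 by simp
 next
  assume "z t1 = cr (len T d)" thus ?thesis using imt1 by simp
 next
  assume w: "z t1 = tip T d"
  hence "gam t1 \<in> range s" using t1(5) nchart_corners(3)[OF d] by simp
  hence "t1 = 1" using sing by blast
  thus ?thesis using w by (simp add: z_def)
 next
  fix y assume "z t1 = cr y" thus ?thesis using imt1 by simp
 next
  fix y assume y: "0 < y" "y < len T (nxt T d)" "z t1 = frame_nxt d (cr y)"
  have "nchart (nxt T d) (cr y) = gam t1" using nchart_nxt[OF d, of "cr y"] y(3) t1(5) by simp
  hence t11: "t1 < 1" using edge_not_singular[OF n(1) y(1,2)] sing t1(2) by force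
  define u where "u = side_dir d"
  have u: "cmod u = 1" "u * cnj u = 1" "u ~= 0" using side_dir(1)[OF d] complex_norm_square[of u] by (auto simp: u_def)
  define ve where "ve = v * cnj u"
  have ve: "cmod ve = L" "ve * u = v" using v u by (simp_all add: ve_def norm_mult mult.assoc mult.commute[of "cnj u"])
  have zt: "z t = frame_nxt d (cr y + cr (t - t1) * ve)" for t
  proof -
   have "z t = z t1 + cr (t - t1) * v" by (simp add: z_def algebra_simps)
   thus ?thesis unfolding y(3) frame_nxt_def ve(2)[symmetric] u_def by (simp add: algebra_simps)
  qed
  define tm where "tm = (t0 + t1) / 2"
  have tm: "t0 < tm" "tm < t1" using t1(1) by (auto simp: tm_def)
  have "cr y + cr (tm - t1) * ve \<in> otri (nxt T d)"
   using t1(3)[OF tm] unfolding zt frame_nxt_otri[OF d] by blast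
  hence "0 < (tm - t1) * Im ve" by (simp add: otri_def)
  hence imve: "Im ve < 0" using tm by (simp add: zero_less_mult_iff)
  have "enters gam (opp T (nxt T d)) (len T (nxt T d) - y) (- ve) t1"
  proof (rule cross_edge[OF n(1) geo ve(1) imve y(1,2) _ t11])
   show "0 < t1" using t1(1) E(5) by simp
   show "0 < t1 - t0" using t1(1) by simp
   fix t assume t: "t1 - (t1 - t0) < t" "t <= t1"
   have "gam t = nchart d (z t)" using t1(3)[of t] t1(5) t by (cases "t = t1") auto
   thus "gam t = nchart (nxt T d) (cr y + cr (t - t1) * ve)" unfolding zt nchart_nxt[OF d] .
  qed
  moreover have "v = - ve * (- side_dir d)" using ve(2) by (simp add: u_def)
  moreover have "cr x + cr (t - t0) * v = right_map d (cr (len T (nxt T d) - y) + cr (t - t1) * - ve)" for t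
   using zt[of t] side_dir(2)[OF d] unfolding z_def right_map_def frame_nxt_def by (simp add: algebra_simps)
  moreover have "cmod (- ve) = L" using ve(1) by simp
  ultimately show ?thesis using t1(1) by blast
 next
  fix y assume y: "0 < y" "y < len T (prv T d)" "z t1 = frame_nxt d (frame_nxt (nxt T d) (cr y))"
  let ?e = "prv T d"
  have "nchart ?e (cr y) = gam t1" using nchart_nxt[OF d] nchart_nxt[OF n(1), of "cr y"] y(3) t1(5) by simp
  hence t11: "t1 < 1" using edge_not_singular[OF n(2) y(1,2)] sing t1(2) by force
  define k where "k = tip T d / cr (len T ?e)"
  have le: "len T ?e > 0" using n by simp
  have "cmod k = 1" using tip_props(2)[OF d] le by (simp add: k_def norm_divide)
  hence k: "cmod k = 1" "k * cnj k = 1" "k ~= 0" using complex_norm_square[of k] by auto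
  define ve where "ve = - v * cnj k"
  have ve: "cmod ve = L" "ve * k = - v" using v k by (simp_all add: ve_def norm_mult mult.assoc mult.commute[of "cnj k"])
  have zt: "z t = frame_nxt d (frame_nxt (nxt T d) (cr y + cr (t - t1) * ve))" for t
  proof -
   have "z t = z t1 + cr (t - t1) * v" by (simp add: z_def algebra_simps)
   also have "\<dots> = (cr (len T ?e) - cr y) * k - cr (t - t1) * (ve * k)"
    unfolding y(3) tip_nxt_nxt[OF d] ve(2) by (simp add: k_def)
   also have "\<dots> = (cr (len T ?e) - (cr y + cr (t - t1) * ve)) * k" by (simp add: algebra_simps)
   also have "\<dots> = frame_nxt d (frame_nxt (nxt T d) (cr y + cr (t - t1) * ve))"
    unfolding tip_nxt_nxt[OF d] by (simp add: k_def)
   finally show ?thesis .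
  qed
  define tm where "tm = (t0 + t1) / 2"
  have tm: "t0 < tm" "tm < t1" using t1(1) by (auto simp: tm_def)
  have "cr y + cr (tm - t1) * ve \<in> otri ?e"
   using t1(3)[OF tm] unfolding zt frame_nxt_otri[OF d] frame_nxt_otri[OF n(1)] by blast
  hence "0 < (tm - t1) * Im ve" by (simp add: otri_def)
  hence imve: "Im ve < 0" using tm by (simp add: zero_less_mult_iff)
  have "enters gam (opp T ?e) (len T ?e - y) (- ve) t1"
  proof (rule cross_edge[OF n(2) geo ve(1) imve y(1,2) _ t11])
   show "0 < t1" using t1(1) E(5) by simp
   show "0 < t1 - t0" using t1(1) by simp
   fix t assume t: "t1 - (t1 - t0) < t" "t <= t1"
   have "gam t = nchart d (z t)" using t1(3)[of t] t1(5) t by (cases "t = t1") auto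
   thus "gam t = nchart ?e (cr y + cr (t - t1) * ve)" unfolding zt nchart_nxt[OF d] nchart_nxt[OF n(1)] .
  qed
  moreover have "v = - ve * (tip T d / cr (len T ?e))" using ve(2) by (simp add: k_def)
  moreover have "cr x + cr (t - t0) * v = left_map d (cr (len T ?e - y) + cr (t - t1) * - ve)" for t
   using zt[of t] unfolding z_def tip_nxt_nxt[OF d] left_map_def by (simp add: algebra_simps)
  moreover have "cmod (- ve) = L" using ve(1) by simp
  ultimately show ?thesis using t1(1) by blast
 qed
qed

end

section \<open>Lengths of geodesics between singular points\<close>

lemma finite_positive_lower_bound:
 fixes f :: "'a => real"
 assumes "finite A" "!!a. a \<in> A ==> 0 < f a"
 shows "\<exists>c>0. \<forall>a\<in>A. c <= f a"
 by (rule exI[of _ "Min (insert 1 (f ` A))"]) (use assms in auto)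

context surface_triangulation
begin

text \<open>
 The positions, unfolded into the normal form at \<open>d\<close>, at which a geodesic that entered
 through \<open>d\<close> can end after at most \<open>n\<close> further crossings.
\<close>

fun reach :: "nat => nat => complex set" where
 "reach 0 d = {tip T d}"
| "reach (Suc n) d = {tip T d} \<union> left_map d ` reach n (opp T (prv T d))
   \<union> right_map d ` reach n (opp T (nxt T d))"

lemma finite_reach: "finite (reach n d)"
 by (induction n arbitrary: d) auto

lemma tip_in_reach: "tip T d \<in> reach n d"
 by (cases n) auto

lemma reach_mono: "m <= n ==> reach m d \<subseteq> reach n d"
proof (induction m arbitrary: n d)
 case 0 thus ?case using tip_in_reach by simp
next
 case (Suc m)
 then obtain k where n: "n = Suc k" "m <= k" by (cases n) auto
 show ?case unfolding n reach.simps using Suc.IH[OF n(2)] by blast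
qed

text \<open>
 If a geodesic turns left and then right, or right and then left, it has walked between two edges
 without common vertex of two unfolded triangles.  This costs a definite length.
\<close>

lemma opposite_sides_separated:
 "\<exists>c>0. \<forall>d\<in>darts T.
   (\<forall>x\<in>{0..len T d}. \<forall>y\<in>{0..len T (nxt T (opp T (prv T d)))}.
    c <= dist (cr x) (left_map d (frame_nxt (opp T (prv T d)) (cr y)))) \<and>
   (\<forall>x\<in>{0..len T d}. \<forall>y\<in>{0..len T (prv T (opp T (nxt T d)))}.
    c <= dist (cr x) (right_map d (frame_nxt (opp T (nxt T d)) (frame_nxt (nxt T (opp T (nxt T d))) (cr y)))))"
proof -
 have sep: "\<exists>c>0. \<forall>x\<in>{0..a}. \<forall>y\<in>{0..b}. c <= dist (cr x) (g y)"
  if g: "continuous_on {0..b} g" and ne: "!!x y. x \<in> {0..a} ==> y \<in> {0..b} ==> cr x ~= g y" for a b and g :: "real => complex"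
 proof -
  have "compact (complex_of_real ` {0..a})" by (intro compact_continuous_image continuous_intros) auto
  moreover have "closed (g ` {0..b})" by (intro compact_imp_closed compact_continuous_image g) auto
  moreover have "complex_of_real ` {0..a} \<inter> g ` {0..b} = {}" using ne by blast
  ultimately obtain c where "c > 0" "\<forall>x\<in>complex_of_real ` {0..a}. \<forall>y\<in>g ` {0..b}. c <= dist x y"
   by (rule separate_compact_closed[THEN exE]) blast
  thus ?thesis by (intro exI[of _ c]) auto
 qed
 have L: "\<exists>c>0. \<forall>x\<in>{0..len T d}. \<forall>y\<in>{0..len T (nxt T (opp T (prv T d)))}.
    c <= dist (cr x) (left_map d (frame_nxt (opp T (prv T d)) (cr y)))" if d: "d \<in> darts T" for d
 proof (rule sep)
  let ?e = "prv T d" let ?d' = "opp T ?e"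
  have e: "?e \<in> darts T" "?d' \<in> darts T" using d by auto
  show "continuous_on {0..len T (nxt T ?d')} (%y. left_map d (frame_nxt ?d' (cr y)))"
   unfolding left_map_def frame_nxt_def by (intro continuous_intros) (use e in auto)
  fix x y assume xy: "x \<in> {0..len T d}" "y \<in> {0..len T (nxt T ?d')}"
  define k where "k = tip T d / cr (len T ?e)"
  have le: "len T ?e > 0" using e by simp
  have "cmod k = 1" using tip_props(2)[OF d] le by (simp add: k_def norm_divide)
  hence k: "k * cnj k = 1" using complex_norm_square[of k] by simp
  have imk: "0 < Im k" using tip_props(1)[OF d] le by (simp add: k_def)
  show "cr x ~= left_map d (frame_nxt ?d' (cr y))"
  proof
   assume "cr x = left_map d (frame_nxt ?d' (cr y))"
   hence "cr x = (cr (len T ?d') + cr y * side_dir ?d') * k" by (simp add: left_map_def frame_nxt_def k_def)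
   hence "cr x * cnj k = (cr (len T ?d') + cr y * side_dir ?d') * (k * cnj k)" by (simp only: mult.assoc)
   hence E: "cr x * cnj k = cr (len T ?d') + cr y * side_dir ?d'" using k by simp
   have "- (x * Im k) = y * Im (side_dir ?d')" using arg_cong[OF E, of Im] by simp
   moreover have "0 <= x * Im k" "0 <= y * Im (side_dir ?d')" using xy imk side_dir(3)[OF e(2)] by auto
   ultimately have "x * Im k = 0" "y * Im (side_dir ?d') = 0" by linarith+
   hence "x = 0" "y = 0" using imk side_dir(3)[OF e(2)] by auto
   thus False using E e by simp
  qed
 qed
 have R: "\<exists>c>0. \<forall>x\<in>{0..len T d}. \<forall>y\<in>{0..len T (prv T (opp T (nxt T d)))}.
    c <= dist (cr x) (right_map d (frame_nxt (opp T (nxt T d)) (frame_nxt (nxt T (opp T (nxt T d))) (cr y))))"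
  if d: "d \<in> darts T" for d
 proof (rule sep)
  let ?e = "nxt T d" let ?d' = "opp T ?e" let ?e' = "prv T ?d'"
  have e: "?e \<in> darts T" "?d' \<in> darts T" "?e' \<in> darts T" "nxt T ?d' \<in> darts T" using d by auto
  show "continuous_on {0..len T ?e'} (%y. right_map d (frame_nxt ?d' (frame_nxt (nxt T ?d') (cr y))))"
   unfolding right_map_def frame_nxt_def by (intro continuous_intros)
  fix x y assume xy: "x \<in> {0..len T d}" "y \<in> {0..len T ?e'}"
  define k u where "k = tip T ?d' / cr (len T ?e')" and "u = side_dir d"
  have le: "len T ?e' > 0" using e by simp
  have imk: "0 < Im k" using tip_props(1)[OF e(2)] le by (simp add: k_def)
  have u: "u * cnj u = 1" "0 < Im u" using side_dir(1,3)[OF d] complex_norm_square[of u] by (auto simp: u_def)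
  show "cr x ~= right_map d (frame_nxt ?d' (frame_nxt (nxt T ?d') (cr y)))"
  proof
   assume "cr x = right_map d (frame_nxt ?d' (frame_nxt (nxt T ?d') (cr y)))"
   hence "cr x = cr (len T d) + cr (len T ?e) * u - (cr (len T ?e') - cr y) * k * u"
    unfolding right_map_def tip_nxt_nxt[OF e(2)] using side_dir(2)[OF d] by (simp add: k_def u_def)
   hence "(cr (len T ?e') - cr y) * k * u = (cr (len T d) - cr x) + cr (len T ?e) * u"
    by (simp add: algebra_simps)
   hence "(cr (len T ?e') - cr y) * k * u * cnj u = ((cr (len T d) - cr x) + cr (len T ?e) * u) * cnj u" by simp
   also have "\<dots> = (cr (len T d) - cr x) * cnj u + cr (len T ?e) * (u * cnj u)" by (simp add: algebra_simps)
   finally have E: "(cr (len T ?e') - cr y) * k = (cr (len T d) - cr x) * cnj u + cr (len T ?e)"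
    using u(1) by (simp add: mult.assoc)
   have "(len T ?e' - y) * Im k = - ((len T d - x) * Im u)" using arg_cong[OF E, of Im] by simp
   moreover have "0 <= (len T ?e' - y) * Im k" "0 <= (len T d - x) * Im u" using xy imk u(2) by auto
   ultimately have "(len T ?e' - y) * Im k = 0" "(len T d - x) * Im u = 0" by linarith+
   hence "y = len T ?e'" "x = len T d" using imk u(2) by auto
   thus False using E e(1) by simp
  qed
 qed
 obtain cl where cl: "!!d. d \<in> darts T ==> 0 < cl d \<and> (\<forall>x\<in>{0..len T d}. \<forall>y\<in>{0..len T (nxt T (opp T (prv T d)))}.
    cl d <= dist (cr x) (left_map d (frame_nxt (opp T (prv T d)) (cr y))))" using L by metis
 obtain cR where cR: "!!d. d \<in> darts T ==> 0 < cR d \<and> (\<forall>x\<in>{0..len T d}. \<forall>y\<in>{0..len T (prv T (opp T (nxt T d)))}.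
    cR d <= dist (cr x) (right_map d (frame_nxt (opp T (nxt T d)) (frame_nxt (nxt T (opp T (nxt T d))) (cr y)))))" using R by metis
 obtain c where c: "c > 0" "!!d. d \<in> darts T ==> c <= min (cl d) (cR d)"
  using finite_positive_lower_bound[of "darts T" "%d. min (cl d) (cR d)"] cl cR by auto
 have c': "c <= cl d" "c <= cR d" if "d \<in> darts T" for d using c(2)[OF that] by auto
 show ?thesis
 proof (intro exI[of _ c] conjI ballI c(1))
  fix d x y assume d: "d \<in> darts T" and "x \<in> {0..len T d}" "y \<in> {0..len T (nxt T (opp T (prv T d)))}"
  hence "cl d <= dist (cr x) (left_map d (frame_nxt (opp T (prv T d)) (cr y)))" using cl by blast
  thus "c <= dist (cr x) (left_map d (frame_nxt (opp T (prv T d)) (cr y)))" using c'(1)[OF d] by linarith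
 next
  fix d x y assume d: "d \<in> darts T" and "x \<in> {0..len T d}" "y \<in> {0..len T (prv T (opp T (nxt T d)))}"
  hence "cR d <= dist (cr x) (right_map d (frame_nxt (opp T (nxt T d)) (frame_nxt (nxt T (opp T (nxt T d))) (cr y))))" using cR by blast
  thus "c <= dist (cr x) (right_map d (frame_nxt (opp T (nxt T d)) (frame_nxt (nxt T (opp T (nxt T d))) (cr y))))" using c'(2)[OF d] by linarith
 qed
qed

definition left_turn :: "nat => complex" where
 "left_turn d = tip T d / cr (len T (prv T d))"

lemma left_turn: "d \<in> darts T ==> 0 < Im (left_turn d)"
 using tip_props(1)[of d] by (simp add: left_turn_def)

text \<open>
 While a geodesic keeps turning to the same side it goes around a vertex, and its direction relative to
 the edges changes by a corner angle at every step.
\<close>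

lemma turn_angle_bound:
 "\<exists>\<theta>>0. \<forall>d\<in>darts T. \<theta> <= Arg (left_turn d) \<and> \<theta> <= Arg (- cnj (side_dir d))"
proof -
 have "0 < Arg (left_turn d)" "0 < Arg (- cnj (side_dir d))" if "d \<in> darts T" for d
  using Arg_upper_half_plane(1)[OF left_turn[OF that]] Arg_upper_half_plane(1)[of "- cnj (side_dir d)"] side_dir(3)[OF that] by auto
 then obtain \<theta> where "\<theta> > 0" "!!d. d \<in> darts T ==> \<theta> <= min (Arg (left_turn d)) (Arg (- cnj (side_dir d)))"
  using finite_positive_lower_bound[of "darts T" "%d. min (Arg (left_turn d)) (Arg (- cnj (side_dir d)))"] by auto
 thus ?thesis by (intro exI[of _ \<theta>]) auto
qed

definition came_from_left :: "real => nat => real => complex => real => nat => real => complex => real => bool" where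
 "came_from_left L dp xp vp tp d x v t \<longleftrightarrow> dp \<in> darts T \<and> 0 <= xp \<and> xp <= len T dp \<and> cmod vp = L \<and> tp < t \<and>
   d = opp T (prv T dp) \<and> (\<forall>t'. cr xp + cr (t' - tp) * vp = left_map dp (cr x + cr (t' - t) * v))"

definition came_from_right :: "real => nat => real => complex => real => nat => real => complex => real => bool" where
 "came_from_right L dp xp vp tp d x v t \<longleftrightarrow> dp \<in> darts T \<and> 0 <= xp \<and> xp <= len T dp \<and> cmod vp = L \<and> tp < t \<and>
   d = opp T (nxt T dp) \<and> (\<forall>t'. cr xp + cr (t' - tp) * vp = right_map dp (cr x + cr (t' - t) * v))"

lemma entersD:
 assumes "enters gam d x v t"
 shows "d \<in> darts T" "0 < x" "x < len T d" "0 < Im v" "0 < t" "t < 1"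
 using assms by (auto simp: enters_def)

text \<open>
 The remaining length bounds the number of changes between left and right turns, and the direction
 bounds the number of steps in between.  The length is counted from the last two crossings because it
 takes two successive crossings to see a change.
\<close>

lemma endpoint_in_reach:
 assumes geo: "geodesic_path s gam L" and fin: "gam 1 \<in> range s"
  and c: "0 < c" "!!d x y. d \<in> darts T ==> x \<in> {0..len T d} ==> y \<in> {0..len T (nxt T (opp T (prv T d)))} ==>
    c <= dist (cr x) (left_map d (frame_nxt (opp T (prv T d)) (cr y)))"
   "!!d x y. d \<in> darts T ==> x \<in> {0..len T d} ==> y \<in> {0..len T (prv T (opp T (nxt T d)))} ==>
    c <= dist (cr x) (right_map d (frame_nxt (opp T (nxt T d)) (frame_nxt (nxt T (opp T (nxt T d))) (cr y))))"
  and th: "0 < \<theta>" "!!d. d \<in> darts T ==> \<theta> <= Arg (left_turn d)" "!!d. d \<in> darts T ==> \<theta> <= Arg (- cnj (side_dir d))"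
  and n0: "pi <= real n0 * \<theta>"
  and "N = k * (n0 + 1) + m" "enters gam d x v t0" "cmod v = L" "L * ((1 - tp) + (1 - t0)) <= real k * c"
  and "came_from_left L dp xp vp tp d x v t0 \<and> Arg v <= real m * \<theta> \<or>
     came_from_right L dp xp vp tp d x v t0 \<and> pi - Arg v <= real m * \<theta>"
 shows "cr x + cr (1 - t0) * v \<in> reach N d"
 using assms(10-)
proof (induction N arbitrary: k m d x v t0 tp dp xp vp rule: less_induct)
 case (less N)
 note N = less.prems(1) and ent = less.prems(2) and vL = less.prems(3) and bud = less.prems(4) and prev = less.prems(5)
 note E = entersD[OF ent] and G = geodesic_pathD[OF geo]
 note d = E(1)
 have n: "nxt T d \<in> darts T" "prv T d \<in> darts T" using d by auto
 have argv: "0 < Arg v" "Arg v < pi" using Arg_upper_half_plane[OF E(4)] by auto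
 have tp: "tp < t0" "cmod vp = L" "dp \<in> darts T" "xp \<in> {0..len T dp}"
  using prev unfolding came_from_left_def came_from_right_def by auto
 have k1: "0 < k"
 proof (rule ccontr)
  assume "\<not> 0 < k"
  hence "L * ((1 - tp) + (1 - t0)) <= 0" using bud by simp
  moreover have "0 < L * ((1 - tp) + (1 - t0))" using G(1) tp(1) E(6) by (intro mult_pos_pos) auto
  ultimately show False by simp
 qed
 have travelled: "dist (cr xp) (cr xp + cr (t1 - tp) * vp) = L * (t1 - tp)" if "t0 < t1" for t1
 proof -
  have "dist (cr xp) (cr xp + cr (t1 - tp) * vp) = cmod (cr (t1 - tp) * vp)" by (simp add: dist_norm del: of_real_diff)
  also have "\<dots> = \<bar>t1 - tp\<bar> * cmod vp" by (simp only: norm_mult norm_of_real)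
  finally show ?thesis using that tp by (simp add: mult.commute)
 qed
 have same: "L * ((1 - t0) + (1 - t1)) <= real k * c" if "t0 < t1" for t1
 proof -
  have "L * ((1 - t0) + (1 - t1)) <= L * ((1 - tp) + (1 - t0))" using G(1) that tp(1) by (intro mult_left_mono) auto
  thus ?thesis using bud by simp
 qed
 have changed: "L * ((1 - t0) + (1 - t1)) <= real (k - 1) * c" if "c <= L * (t1 - tp)" for t1
 proof -
  have "L * ((1 - t0) + (1 - t1)) = L * ((1 - tp) + (1 - t0)) - L * (t1 - tp)" by (simp add: algebra_simps)
  also have "\<dots> <= real k * c - c" using bud that by simp
  also have "\<dots> = real (k - 1) * c" using k1 by (simp add: algebra_simps of_nat_diff)
  finally show ?thesis .
 qed
 have Nc: "(k - 1) * (n0 + 1) + n0 < N"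
 proof -
  have "(k - 1) * (n0 + 1) + n0 + 1 = k * (n0 + 1)" using k1 by (cases k) auto
  thus ?thesis using N by simp
 qed
 have x01: "0 <= x" "x <= len T d" using E by auto
 consider (C) "cr x + cr (1 - t0) * v = tip T d"
  | (Lf) x' v' t1 where "t0 < t1" "enters gam (opp T (prv T d)) x' v' t1" "cmod v' = L"
    "v = v' * (tip T d / cr (len T (prv T d)))"
    "!!t. cr x + cr (t - t0) * v = left_map d (cr x' + cr (t - t1) * v')"
  | (Rt) x' v' t1 where "t0 < t1" "enters gam (opp T (nxt T d)) x' v' t1" "cmod v' = L"
    "v = v' * (- side_dir d)"
    "!!t. cr x + cr (t - t0) * v = right_map d (cr x' + cr (t - t1) * v')"
  using enters_next[OF ent geo vL fin] by blast
 thus ?case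
 proof cases
  case C thus ?thesis using tip_in_reach by simp
 next
  case (Lf x' v' t1)
  note E' = entersD[OF Lf(2)]
  have cf: "came_from_left L d x v t0 (opp T (prv T d)) x' v' t1"
   unfolding came_from_left_def using d x01 vL Lf(1,5) by blast
  have argv': "0 < Arg v'" "Arg v' < pi" using Arg_upper_half_plane[OF E'(4)] by auto
  have "Arg (v' * left_turn d) = Arg v' + Arg (left_turn d)"
   by (rule Arg_mult_upper[OF E'(4) left_turn[OF d]]) (use Lf(4) E(4) in \<open>simp add: left_turn_def\<close>)
  hence sumA: "Arg v = Arg v' + Arg (left_turn d)" using Lf(4) by (simp add: left_turn_def)
  have "\<exists>N'<N. cr x' + cr (1 - t1) * v' \<in> reach N' (opp T (prv T d))"
   using prev
  proof
   assume p: "came_from_left L dp xp vp tp d x v t0 \<and> Arg v <= real m * \<theta>"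
   have m1: "m ~= 0" using p argv by (cases m) auto
   have lt: "k * (n0 + 1) + (m - 1) < N" using N m1 by simp
   have "Arg v' <= real m * \<theta> - \<theta>" using p sumA th(2)[OF d] by linarith
   also have "\<dots> = real (m - 1) * \<theta>" using m1 by (simp add: algebra_simps of_nat_diff Suc_leI)
   finally have am: "Arg v' <= real (m - 1) * \<theta>" .
   show ?thesis using less.IH[OF lt refl Lf(2,3) same[OF Lf(1)]] cf am lt by blast
  next
   assume p: "came_from_right L dp xp vp tp d x v t0 \<and> pi - Arg v <= real m * \<theta>"
   hence pr: "d = opp T (nxt T dp)" "!!t'. cr xp + cr (t' - tp) * vp = right_map dp (cr x + cr (t' - t0) * v)"
    unfolding came_from_right_def by blast+
   define y where "y = len T (prv T d) - x'"
   have y: "y \<in> {0..len T (prv T d)}" using E'(2,3) n len_opp by (simp add: y_def)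
   have "cr x + cr (t1 - t0) * v = frame_nxt d (frame_nxt (nxt T d) (cr y))"
    using Lf(5)[of t1] unfolding tip_nxt_nxt[OF d] left_map_def by (simp add: y_def)
   hence "cr xp + cr (t1 - tp) * vp = right_map dp (frame_nxt d (frame_nxt (nxt T d) (cr y)))" using pr(2)[of t1] by simp
   moreover have "c <= dist (cr xp) (right_map dp (frame_nxt d (frame_nxt (nxt T d) (cr y))))"
    using c(3)[OF tp(3,4), of y] y unfolding pr(1) by blast
   ultimately have "c <= L * (t1 - tp)" using travelled[OF Lf(1)] by simp
   note b = changed[OF this]
   have "Arg v' <= real n0 * \<theta>" using argv' n0 by linarith
   thus ?thesis using less.IH[OF Nc refl Lf(2,3) b] cf Nc by blast
  qed
  then obtain N' where N': "N' < N" "cr x' + cr (1 - t1) * v' \<in> reach N' (opp T (prv T d))" by blast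
  have "cr x + cr (1 - t0) * v \<in> reach (Suc N') d"
   unfolding Lf(5)[of 1] reach.simps using N'(2) by blast
  thus ?thesis using reach_mono[of "Suc N'" N d] N'(1) by auto
 next
  case (Rt x' v' t1)
  note E' = entersD[OF Rt(2)]
  have cf: "came_from_right L d x v t0 (opp T (nxt T d)) x' v' t1"
   unfolding came_from_right_def using d x01 vL Rt(1,5) by blast
  have argv': "0 < Arg v'" "Arg v' < pi" using Arg_upper_half_plane[OF E'(4)] by auto
  have uu: "side_dir d * cnj (side_dir d) = 1" using side_dir(1)[OF d] complex_norm_square[of "side_dir d"] by simp
  have v': "v * - cnj (side_dir d) = v'" unfolding Rt(4) using uu by (simp add: mult.assoc)
  have "Arg (v * - cnj (side_dir d)) = Arg v + Arg (- cnj (side_dir d))"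
   by (rule Arg_mult_upper[OF E(4)]) (use side_dir(3)[OF d] E'(4) in \<open>simp_all only: v', simp\<close>)
  hence sumA: "Arg v' = Arg v + Arg (- cnj (side_dir d))" unfolding v' .
  have "\<exists>N'<N. cr x' + cr (1 - t1) * v' \<in> reach N' (opp T (nxt T d))"
   using prev
  proof
   assume p: "came_from_right L dp xp vp tp d x v t0 \<and> pi - Arg v <= real m * \<theta>"
   have m1: "m ~= 0" using p argv by (cases m) auto
   have lt: "k * (n0 + 1) + (m - 1) < N" using N m1 by simp
   have "pi - Arg v' <= real m * \<theta> - \<theta>" using p sumA th(3)[OF d] by linarith
   also have "\<dots> = real (m - 1) * \<theta>" using m1 by (simp add: algebra_simps of_nat_diff Suc_leI)
   finally have am: "pi - Arg v' <= real (m - 1) * \<theta>" .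
   show ?thesis using less.IH[OF lt refl Rt(2,3) same[OF Rt(1)]] cf am lt by blast
  next
   assume p: "came_from_left L dp xp vp tp d x v t0 \<and> Arg v <= real m * \<theta>"
   hence pr: "d = opp T (prv T dp)" "!!t'. cr xp + cr (t' - tp) * vp = left_map dp (cr x + cr (t' - t0) * v)"
    unfolding came_from_left_def by blast+
   define y where "y = len T (nxt T d) - x'"
   have y: "y \<in> {0..len T (nxt T d)}" using E'(2,3) n len_opp by (simp add: y_def)
   have "cr x + cr (t1 - t0) * v = frame_nxt d (cr y)"
    using Rt(5)[of t1] side_dir(2)[OF d] unfolding frame_nxt_def right_map_def by (simp add: y_def algebra_simps)
   hence "cr xp + cr (t1 - tp) * vp = left_map dp (frame_nxt d (cr y))" using pr(2)[of t1] by simp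
   moreover have "c <= dist (cr xp) (left_map dp (frame_nxt d (cr y)))"
    using c(2)[OF tp(3,4), of y] y unfolding pr(1) by blast
   ultimately have "c <= L * (t1 - tp)" using travelled[OF Rt(1)] by simp
   note b = changed[OF this]
   have "pi - Arg v' <= real n0 * \<theta>" using argv' n0 by linarith
   thus ?thesis using less.IH[OF Nc refl Rt(2,3) b] cf Nc by blast
  qed
  then obtain N' where N': "N' < N" "cr x' + cr (1 - t1) * v' \<in> reach N' (opp T (nxt T d))" by blast
  have "cr x + cr (1 - t0) * v \<in> reach (Suc N') d"
   unfolding Rt(5)[of 1] reach.simps using N'(2) by blast
  thus ?thesis using reach_mono[of "Suc N'" N d] N'(1) by auto
 qed
qed

lemma endpoint_in_bounded_reach:
 "\<exists>N. \<forall>gam L d x v t0. geodesic_path s gam L --> L <= Lmax --> gam 1 \<in> range s --> enters gam d x v t0 --> cmod v = L -->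
   cr x + cr (1 - t0) * v \<in> reach N d"
proof -
 obtain c where c0: "0 < c" and c1: "\<forall>d\<in>darts T.
   (\<forall>x\<in>{0..len T d}. \<forall>y\<in>{0..len T (nxt T (opp T (prv T d)))}.
    c <= dist (cr x) (left_map d (frame_nxt (opp T (prv T d)) (cr y)))) \<and>
   (\<forall>x\<in>{0..len T d}. \<forall>y\<in>{0..len T (prv T (opp T (nxt T d)))}.
    c <= dist (cr x) (right_map d (frame_nxt (opp T (nxt T d)) (frame_nxt (nxt T (opp T (nxt T d))) (cr y)))))"
  using opposite_sides_separated by blast
 obtain \<theta> where th: "0 < \<theta>" "!!d. d \<in> darts T ==> \<theta> <= Arg (left_turn d)" "!!d. d \<in> darts T ==> \<theta> <= Arg (- cnj (side_dir d))"
  using turn_angle_bound by blast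
 obtain n0 :: nat where "pi / \<theta> <= real n0" using real_arch_simple by blast
 hence n0: "pi <= real n0 * \<theta>" using th(1) by (simp add: pos_divide_le_eq)
 obtain k :: nat where "2 * Lmax / c <= real k" using real_arch_simple by blast
 hence k: "2 * Lmax <= real k * c" using c0 by (simp add: pos_divide_le_eq)
 \<comment> \<open>at most k changes between left and right turns, with at most n0 turns to the same side in between\<close>
 define N where "N = k * (n0 + 1) + n0"
 have "cr x + cr (1 - t0) * v \<in> reach (Suc N) d"
  if geo: "geodesic_path s gam L" and LL: "L <= Lmax" and fin: "gam 1 \<in> range s" and ent: "enters gam d x v t0" and vL: "cmod v = L"
  for gam L d x v t0
 proof -
  note E = entersD[OF ent] and G = geodesic_pathD[OF geo]
  have bud: "L * ((1 - t0) + (1 - t1)) <= real k * c" if "t0 < t1" for t1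
  proof -
   have "L * ((1 - t0) + (1 - t1)) <= L * 2" using G(1) E(5) that by (intro mult_left_mono) auto
   thus ?thesis using LL k by linarith
  qed
  have x01: "0 <= x" "x <= len T d" using E by auto
  have step: "cr x' + cr (1 - t1) * v' \<in> reach N d'"
   if "enters gam d' x' v' t1" "cmod v' = L" "t0 < t1"
    "came_from_left L d x v t0 d' x' v' t1 \<and> Arg v' <= real n0 * \<theta> \<or>
     came_from_right L d x v t0 d' x' v' t1 \<and> pi - Arg v' <= real n0 * \<theta>" for d' x' v' t1
  proof (rule endpoint_in_reach[OF geo fin c0 _ _ th(1) _ _ n0 N_def that(1,2) bud[OF that(3)] that(4)])
  qed (use c1 th in blast)+
  consider (C) "cr x + cr (1 - t0) * v = tip T d"
   | (Lf) x' v' t1 where "t0 < t1" "enters gam (opp T (prv T d)) x' v' t1" "cmod v' = L"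
     "!!t. cr x + cr (t - t0) * v = left_map d (cr x' + cr (t - t1) * v')"
   | (Rt) x' v' t1 where "t0 < t1" "enters gam (opp T (nxt T d)) x' v' t1" "cmod v' = L"
     "!!t. cr x + cr (t - t0) * v = right_map d (cr x' + cr (t - t1) * v')"
   using enters_next[OF ent geo vL fin] by blast
  thus ?thesis
  proof cases
   case C thus ?thesis by simp
  next
   case (Lf x' v' t1)
   have cf: "came_from_left L d x v t0 (opp T (prv T d)) x' v' t1"
    unfolding came_from_left_def using E(1) x01 vL Lf(1,4) by blast
   have "Arg v' <= real n0 * \<theta>" using Arg_upper_half_plane[OF entersD(4)[OF Lf(2)]] n0 by linarith
   hence "cr x' + cr (1 - t1) * v' \<in> reach N (opp T (prv T d))"
    using step[OF Lf(2,3,1)] cf by blast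
   thus ?thesis unfolding Lf(4)[of 1] reach.simps by blast
  next
   case (Rt x' v' t1)
   have cf: "came_from_right L d x v t0 (opp T (nxt T d)) x' v' t1"
    unfolding came_from_right_def using E(1) x01 vL Rt(1,4) by blast
   have "pi - Arg v' <= real n0 * \<theta>" using Arg_upper_half_plane[OF entersD(4)[OF Rt(2)]] n0 by linarith
   hence "cr x' + cr (1 - t1) * v' \<in> reach N (opp T (nxt T d))"
    using step[OF Rt(2,3,1)] cf by blast
   thus ?thesis unfolding Rt(4)[of 1] reach.simps by blast
  qed
 qed
 thus ?thesis by blast
qed

text \<open>
 Following the geodesic from an interior crossing in both directions gives the positions of both its
 ends in the two normal forms at that edge; their difference is the velocity, of norm \<open>L\<close>.
\<close>

lemma crossing_length:
 assumes N: "!!gam L d x v t0. geodesic_path s gam L ==> L <= Lmax ==> gam 1 \<in> range s ==> enters gam d x v t0 ==> cmod v = L ==>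
   cr x + cr (1 - t0) * v \<in> reach N d"
  and geo: "geodesic_path s gam L" "L <= Lmax" "gam 0 \<in> range s" "gam 1 \<in> range s"
  and d: "d \<in> darts T" and x: "0 < x" "x < len T d" and t0: "0 < t0" "t0 < 1" and v: "cmod v = L" "0 < Im v" and dlt: "0 < dlt"
  and near: "!!t. \<bar>t - t0\<bar> < dlt ==> gam t = glue d (cr x + cr (t - t0) * v)"
 shows "\<exists>e\<in>reach N d. \<exists>e'\<in>reach N (opp T d). L = cmod (e + e' - cr (len T d))"
proof -
 have o: "opp T d \<in> darts T" "len T (opp T d) = len T d" using d len_opp by auto
 have "enters gam d x v t0"
  unfolding enters_def
 proof (intro conjI d x v(2) t0 exI[of _ dlt] dlt allI impI)
  fix t assume t: "t0 <= t" "t < t0 + dlt"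
  have "0 <= (t - t0) * Im v" using t v(2) by simp
  hence "0 <= Im (cr x + cr (t - t0) * v)" by simp
  thus "gam t = nchart d (cr x + cr (t - t0) * v)" using near[of t] t by (simp add: glue_def)
 qed
 from N[OF geo(1,2,4) this v(1)] have e: "cr x + cr (1 - t0) * v \<in> reach N d" .
 have "enters (%t. gam (1 - t)) (opp T d) (len T d - x) v (1 - t0)"
  unfolding enters_def
 proof (intro conjI o(1) v(2) exI[of _ dlt] dlt allI impI)
  fix t assume t: "1 - t0 <= t" "t < 1 - t0 + dlt"
  have n: "gam (1 - t) = glue d (cr x + cr (1 - t - t0) * v)" using near[of "1 - t"] t by simp
  show "gam (1 - t) = nchart (opp T d) (cr (len T d - x) + cr (t - (1 - t0)) * v)"
  proof (cases "t = 1 - t0")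
   case True
   have "nchart d (cr x) = nchart (opp T d) (cr (len T d - x))" by (rule nchart_opp[OF d]) (use x in auto)
   thus ?thesis using n True by (simp add: glue_def)
  next
   case False
   hence "(1 - t - t0) * Im v < 0" using t v(2) by (simp add: mult_less_0_iff)
   hence "\<not> 0 <= Im (cr x + cr (1 - t - t0) * v)" by simp
   hence "gam (1 - t) = nchart (opp T d) (cr (len T d) - (cr x + cr (1 - t - t0) * v))"
    unfolding n glue_def by (simp only: if_False)
   also have "cr (len T d) - (cr x + cr (1 - t - t0) * v) = cr (len T d - x) + cr (t - (1 - t0)) * v"
    by (simp add: algebra_simps)
   finally show ?thesis .
  qed
 qed (use x t0 o in auto)
 from N[OF geodesic_path_reverse[OF geo(1)] geo(2) _ this v(1)]
 have e': "cr (len T d - x) + cr (1 - (1 - t0)) * v \<in> reach N (opp T d)" using geo(3) by simp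
 have "(cr x + cr (1 - t0) * v) + (cr (len T d - x) + cr (1 - (1 - t0)) * v) - cr (len T d) = v"
  by (simp add: algebra_simps)
 thus ?thesis using e e' v(1) by metis
qed

definition face_corners :: "nat => complex set" where
 "face_corners d = {0, cr (len T d), tip T d}"

lemma face_exit:
 assumes geo: "geodesic_path s gam L" "gam 1 \<in> range s"
  and noedge: "!!t d x. 0 < t ==> t < 1 ==> d \<in> darts T ==> 0 < x ==> x < len T d ==> gam t ~= nchart d (cr x)"
  and d: "d \<in> darts T" and t0: "0 < t0" "t0 < 1" and v: "cmod v = L" and dlt: "0 < dlt"
  and near: "!!t. t0 < t ==> t < t0 + dlt ==> z0 + cr (t - t0) * v \<in> otri d \<and> gam t = nchart d (z0 + cr (t - t0) * v)"
 shows "z0 + cr (1 - t0) * v \<in> face_corners d"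
proof -
 note G = geodesic_pathD[OF geo(1)]
 have n: "nxt T d \<in> darts T" "prv T d \<in> darts T" using d by auto
 define z where "z = (%t. z0 + cr (t - t0) * v)"
 obtain t1 where t1: "t0 < t1" "t1 <= 1" "z t1 \<in> tri d" "gam t1 = nchart d (z t1)" "t1 < 1 ==> z t1 \<notin> otri d"
  using straight_until_exit[OF d geo(1) v t0 dlt z_def] near unfolding z_def by blast
 have notin: "z t1 \<notin> otri d" using t1(5) interior_not_singular[OF d, of "z t1"] geo(2) t1(2,4) by (cases "t1 = 1") auto
 have noe: "gam t1 ~= nchart e (cr x)" if "e \<in> darts T" "0 < x" "x < len T e" for e x
  using noedge[of t1 e x] edge_not_singular[of e x] that t1(1,2) t0 geo(2) by (cases "t1 = 1") auto
 have corner: "z t1 \<in> face_corners d" unfolding face_corners_def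
  using tri_cases[OF d t1(3)]
 proof (elim disjE exE conjE)
  fix y assume y: "0 < y" "y < len T d" "z t1 = cr y"
  thus "z t1 \<in> {0, cr (len T d), tip T d}" using noe[OF d y(1,2)] t1(4) by simp
 next
  fix y assume y: "0 < y" "y < len T (nxt T d)" "z t1 = frame_nxt d (cr y)"
  thus "z t1 \<in> {0, cr (len T d), tip T d}" using noe[OF n(1) y(1,2)] t1(4) nchart_nxt[OF d, of "cr y"] by simp
 next
  fix y assume y: "0 < y" "y < len T (prv T d)" "z t1 = frame_nxt d (frame_nxt (nxt T d) (cr y))"
  thus "z t1 \<in> {0, cr (len T d), tip T d}"
   using noe[OF n(2) y(1,2)] t1(4) nchart_nxt[OF d] nchart_nxt[OF n(1), of "cr y"] by simp
 qed (use notin in auto)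
 have "gam t1 \<in> range s"
  using corner t1(4) nchart_corners[OF d] unfolding face_corners_def by auto
 hence "t1 = 1" using G(4)[of t1] t1(1,2) t0 by force
 thus ?thesis using corner by (simp add: z_def)
qed

text \<open>
 Geodesics that cross an edge are covered by \<open>crossing_length\<close>, those tangent to an edge
 are edges, and a geodesic that meets the interior of no edge lies in one face and joins two of its
 corners.
\<close>

theorem finite_geodesic_lengths:
 "finite {L. L <= Lmax \<and> (\<exists>gam. geodesic_path s gam L \<and> gam 0 \<in> range s \<and> gam 1 \<in> range s)}"
proof -
 obtain N where N: "!!gam L d x v t0. geodesic_path s gam L ==> L <= Lmax ==> gam 1 \<in> range s ==> enters gam d x v t0 ==> cmod v = L ==>
   cr x + cr (1 - t0) * v \<in> reach N d" using endpoint_in_bounded_reach[of Lmax] by blast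
 define A where "A = len T ` darts T \<union> (\<Union>d\<in>darts T. (%(e, e'). cmod (e + e' - cr (len T d))) ` (reach N d \<times> reach N (opp T d)))
  \<union> (\<Union>d\<in>darts T. (%(e, e'). cmod (e - e')) ` (face_corners d \<times> face_corners d))"
 have crossing_in_A: "cmod (e + e' - cr (len T d)) \<in> A"
  if "d \<in> darts T" "e \<in> reach N d" "e' \<in> reach N (opp T d)" for d e e'
 proof -
  have "(e, e') \<in> reach N d \<times> reach N (opp T d)" using that by simp
  hence "(%(e, e'). cmod (e + e' - cr (len T d))) (e, e') \<in> (%(e, e'). cmod (e + e' - cr (len T d))) ` (reach N d \<times> reach N (opp T d))"
   by (rule imageI)
  thus ?thesis unfolding A_def using that(1) by (intro UnI1 UnI2 UN_I[of d]) simp_all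
 qed
 have corners_in_A: "cmod (e - e') \<in> A" if "d \<in> darts T" "e \<in> face_corners d" "e' \<in> face_corners d" for d e e'
 proof -
  have "(e, e') \<in> face_corners d \<times> face_corners d" using that by simp
  hence "(%(e, e'). cmod (e - e')) (e, e') \<in> (%(e, e'). cmod (e - e')) ` (face_corners d \<times> face_corners d)"
   by (rule imageI)
  thus ?thesis unfolding A_def using that(1) by (intro UnI2 UN_I[of d]) simp_all
 qed
 have "finite A" unfolding A_def using finite_reach by (auto simp: face_corners_def)
 moreover have "L \<in> A" if L: "L <= Lmax" and geo: "geodesic_path s gam L" and ends: "gam 0 \<in> range s" "gam 1 \<in> range s" for L gam
 proof (cases "\<exists>t d x. 0 < t \<and> t < 1 \<and> d \<in> darts T \<and> 0 < x \<and> x < len T d \<and> gam t = nchart d (cr x)")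
  case True
  note G = geodesic_pathD[OF geo]
  obtain t0 d x where t0: "0 < t0" "t0 < 1" and d: "d \<in> darts T" and x: "0 < x" "x < len T d" and eq: "gam t0 = nchart d (cr x)"
   using True by blast
  obtain e where ch: "isometric_chart (glue d) (cr x) e" using edge_chart[OF d x] by blast
  have g0: "gam t0 = glue d (cr x)" using eq by (simp add: glue_def)
  obtain v dlt where v: "cmod v = L" "0 < dlt" "!!t. \<bar>t - t0\<bar> < dlt ==> gam t = glue d (cr x + cr (t - t0) * v)"
   using geodesic_in_chart[OF ch G(3)[OF t0] g0 less_imp_le[OF G(1)]] by blast
  consider "Im v = 0" | "0 < Im v" | "Im v < 0" by linarith
  thus ?thesis
  proof cases
   case 1
   have rv: "Re v = L \<or> Re v = - L" using v(1) 1 by (auto simp: cmod_def abs_if split: if_splits)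
   have near: "gam t = nchart d (cr (x + (t - t0) * Re v))" if "\<bar>t - t0\<bar> < dlt" for t
   proof -
    have "cr x + cr (t - t0) * v = cr (x + (t - t0) * Re v)" by (simp add: complex_eq_iff 1)
    hence "gam t = glue d (cr (x + (t - t0) * Re v))" using v(3)[OF that] by metis
    thus ?thesis unfolding glue_def by (simp only: Im_complex_of_real order_refl if_True)
   qed
   from geodesic_along_edge[OF d x geo ends t0 v(2) rv near] obtain d' where "d' \<in> darts T" "len T d' = L" by blast
   thus ?thesis unfolding A_def by blast
  next
   case 2
   have "\<exists>e\<in>reach N d. \<exists>e'\<in>reach N (opp T d). L = cmod (e + e' - cr (len T d))"
   proof (rule crossing_length[OF _ geo L ends d x t0 v(1) 2 v(2)])
   qed (use N v(3) in blast)+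
   then obtain e e' where
    "e \<in> reach N d" "e' \<in> reach N (opp T d)" "L = cmod (e + e' - cr (len T d))" by (elim bexE)
   thus ?thesis using crossing_in_A[OF d] by (simp only:)
  next
   case 3
   have t0': "0 < 1 - t0" "1 - t0 < 1" using t0 by auto
   have v': "cmod (- v) = L" "0 < Im (- v)" using v(1) 3 by auto
   have near: "gam (1 - t) = glue d (cr x + cr (t - (1 - t0)) * (- v))" if t: "\<bar>t - (1 - t0)\<bar> < dlt" for t
   proof -
    have "cr (t - (1 - t0)) * (- v) = cr ((1 - t) - t0) * v" by (simp add: algebra_simps)
    thus ?thesis using v(3)[of "1 - t"] t by simp
   qed
   have "\<exists>e\<in>reach N d. \<exists>e'\<in>reach N (opp T d). L = cmod (e + e' - cr (len T d))"
   proof (rule crossing_length[OF _ geodesic_path_reverse[OF geo] L _ _ d x t0' v' v(2)])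
    show "gam (1 - 0) \<in> range s" "gam (1 - 1) \<in> range s" using ends by auto
   qed (use N near in blast)+
   then obtain e e' where
    "e \<in> reach N d" "e' \<in> reach N (opp T d)" "L = cmod (e + e' - cr (len T d))" by (elim bexE)
   thus ?thesis using crossing_in_A[OF d] by (simp only:)
  qed
 next
  case False
  note G = geodesic_pathD[OF geo]
  have noedge: "gam t ~= nchart d (cr x)" if "0 < t" "t < 1" "d \<in> darts T" "0 < x" "x < len T d" for t d x using False that by blast
  obtain d z0 where d: "d \<in> darts T" "z0 \<in> otri d" "gam (1/2) = nchart d z0"
  proof -
   have ns: "gam (1/2) ~= s i" for i using G(4)[of "1/2"] by auto
   have ne: "gam (1/2) ~= nchart d (cr x)" if "d \<in> darts T" "0 < x" "x < len T d" for d x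
    by (rule noedge) (use that in auto)
   from point_cases[of "gam (1/2)"] ns ne show ?thesis using that by blast
  qed
  obtain e where ch: "isometric_chart (nchart d) z0 e" "ball z0 e \<subseteq> otri d" using face_chart[OF d(1,2)] by blast
  have h: "0 < (1/2::real)" "(1/2::real) < 1" by auto
  obtain v dlt where v: "cmod v = L" "0 < dlt" "!!t. \<bar>t - 1/2\<bar> < dlt ==> gam t = nchart d (z0 + cr (t - 1/2) * v) \<and> z0 + cr (t - 1/2) * v \<in> ball z0 e"
   using geodesic_in_chart[OF ch(1) G(3)[OF h] d(3) less_imp_le[OF G(1)]] by blast
  have e1: "z0 + cr (1 - 1/2) * v \<in> face_corners d"
   by (rule face_exit[OF geo ends(2) noedge d(1) h v(1,2)]) (use v(3) ch(2) in auto)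
  have near: "z0 + cr (t - 1/2) * (- v) \<in> otri d \<and> gam (1 - t) = nchart d (z0 + cr (t - 1/2) * (- v))"
   if t: "1/2 < t" "t < 1/2 + dlt" for t
  proof -
   have "cr (t - 1/2) * (- v) = cr ((1 - t) - 1/2) * v" by (simp add: algebra_simps)
   moreover have "\<bar>(1 - t) - 1/2\<bar> < dlt" using t by auto
   ultimately show ?thesis using v(3)[of "1 - t"] ch(2) by auto
  qed
  have v': "cmod (- v) = L" using v(1) by simp
  have e2: "z0 + cr (1 - 1/2) * (- v) \<in> face_corners d"
   by (rule face_exit[OF geodesic_path_reverse[OF geo] _ _ d(1) h v' v(2) near]) (use ends noedge in auto)
  have "(z0 + cr (1 - 1/2) * v) - (z0 + cr (1 - 1/2) * (- v)) = v" by (simp add: algebra_simps)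
  hence "L = cmod ((z0 + cr (1 - 1/2) * v) - (z0 + cr (1 - 1/2) * (- v)))" using v(1) by (simp only:)
  thus ?thesis using corners_in_A[OF d(1) e1 e2] by (simp only:)
 qed
 ultimately show ?thesis
 proof (elim finite_subset[rotated], intro subsetI)
  fix L assume L: "L \<in> {L. L <= Lmax \<and> (\<exists>gam. geodesic_path s gam L \<and> gam 0 \<in> range s \<and> gam 1 \<in> range s)}"
  assume m: "!!L gam. L <= Lmax ==> geodesic_path s gam L ==> gam 0 \<in> range s ==> gam 1 \<in> range s ==> L \<in> A"
  obtain gam where "L <= Lmax" "geodesic_path s gam L" "gam 0 \<in> range s" "gam 1 \<in> range s" using L by auto
  thus "L \<in> A" by (rule m)
 qed
qed

end

section \<open>Local isometries into a cone\<close>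

definition circle_dist :: "real => real => real => real" where
 "circle_dist \<alpha> x y = min \<bar>x - y\<bar> (\<alpha> - \<bar>x - y\<bar>)"

lemma cone_dist_circle:
 "cone_dist \<alpha> v w = sqrt ((fst v)^2 + (fst w)^2 - 2 * fst v * fst w * cos (min pi (circle_dist \<alpha> (snd v) (snd w))))"
 by (simp add: cone_dist_def circle_dist_def Let_def)

lemma circle_dist_small_lift:
 assumes xy: "0 <= x" "x < \<alpha>" "0 <= y" "y < \<alpha>" and m: "x - y = t + of_int m * \<alpha>" and t: "\<bar>t\<bar> <= \<alpha> / 2"
 shows "circle_dist \<alpha> x y = \<bar>t\<bar>"
proof -
 have a: "\<alpha> > 0" using xy by simp
 have "\<bar>x - y\<bar> < \<alpha>" using xy by linarith
 hence "\<bar>of_int m * \<alpha>\<bar> < 2 * \<alpha>" using m t a by linarith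
 hence "\<bar>of_int m\<bar> < (2::real)" using a by (simp add: abs_mult)
 hence "m = -1 \<or> m = 0 \<or> m = 1" by linarith
 thus ?thesis using m t xy a unfolding circle_dist_def by (elim disjE) (auto simp: abs_if min_def split: if_splits)
qed

text \<open>
 Differences of angular coordinates are represented by real numbers of least absolute value; these are
 additive as long as they are small.
\<close>

lemma circle_lift_exists:
 assumes "0 <= x" "x < \<alpha>" "0 <= y" "y < \<alpha>"
 shows "\<exists>t m. x - y = t + of_int m * \<alpha> \<and> \<bar>t\<bar> = circle_dist \<alpha> x y"
proof -
 have a: "\<alpha> > 0" using assms by simp
 consider "\<bar>x - y\<bar> <= \<alpha> - \<bar>x - y\<bar>" | "\<bar>x - y\<bar> > \<alpha> - \<bar>x - y\<bar>" "x >= y" | "\<bar>x - y\<bar> > \<alpha> - \<bar>x - y\<bar>" "x < y" by linarith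
 thus ?thesis
 proof cases
  case 1 thus ?thesis by (intro exI[of _ "x - y"] exI[of _ 0]) (simp add: circle_dist_def)
 next
  case 2 thus ?thesis using assms by (intro exI[of _ "x - y - \<alpha>"] exI[of _ 1]) (simp add: circle_dist_def)
 next
  case 3 thus ?thesis using assms by (intro exI[of _ "x - y + \<alpha>"] exI[of _ "-1"]) (simp add: circle_dist_def)
 qed
qed

lemma law_of_cosines_rcis:
 "(cmod (rcis a s - rcis b t))^2 = a^2 + b^2 - 2 * a * b * cos (s - t)"
proof -
 define x y x' y' where "x = cos s" and "y = sin s" and "x' = cos t" and "y' = sin t"
 have 1: "x^2 + y^2 = 1" "x'^2 + y'^2 = 1" by (simp_all add: x_def y_def x'_def y'_def)
 have "(cmod (rcis a s - rcis b t))^2 = (a * x - b * x')^2 + (a * y - b * y')^2"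
  unfolding cmod_power2 by (simp add: x_def y_def x'_def y'_def)
 also have "\<dots> = a^2 + b^2 - 2 * a * b * (x * x' + y * y')" using 1 by algebra
 also have "x * x' + y * y' = cos (s - t)" by (simp add: cos_diff x_def y_def x'_def y'_def)
 finally show ?thesis .
qed

text \<open>
 A point whose angular distance is at least \<open>beta\<close> is no closer than the foot of the
 perpendicular to the ray of angle \<open>beta\<close>.
\<close>

lemma near_in_cone_imp_near_angle:
 assumes v0: "0 < fst v0" and \<beta>: "0 < \<beta>" "\<beta> <= pi / 2" and close: "cone_dist \<alpha> v0 v < fst v0 * sin \<beta>" "0 <= fst v"
  and nn: "0 <= circle_dist \<alpha> (snd v0) (snd v)"
 shows "circle_dist \<alpha> (snd v0) (snd v) < \<beta>"
proof (rule ccontr)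
 assume "\<not> ?thesis"
 hence "\<beta> <= min pi (circle_dist \<alpha> (snd v0) (snd v))" using \<beta> by simp
 hence c: "cos (min pi (circle_dist \<alpha> (snd v0) (snd v))) <= cos \<beta>" using \<beta> by (intro cos_monotone_0_pi_le) auto
 define a b where "a = fst v0" and "b = fst v"
 have "(a * sin \<beta>)^2 <= a^2 + b^2 - 2 * a * b * cos \<beta>"
 proof -
  define x y where "x = cos \<beta>" and "y = sin \<beta>"
  have "x^2 + y^2 = 1" by (simp add: x_def y_def)
  hence "a^2 + b^2 - 2 * a * b * x = (a * y)^2 + (b - a * x)^2" by algebra
  hence "a^2 + b^2 - 2 * a * b * cos \<beta> = (a * sin \<beta>)^2 + (b - a * cos \<beta>)^2" by (simp only: x_def y_def)
  thus ?thesis by simp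
 qed
 also have "\<dots> <= a^2 + b^2 - 2 * a * b * cos (min pi (circle_dist \<alpha> (snd v0) (snd v)))"
  using c v0 close(2) by (auto simp: a_def b_def intro!: mult_left_mono)
 finally have "sqrt ((a * sin \<beta>)^2) <= cone_dist \<alpha> v0 v"
  unfolding cone_dist_circle a_def b_def by (rule real_sqrt_le_mono)
 moreover have "0 <= a * sin \<beta>" using v0 \<beta> by (auto simp: a_def intro!: mult_nonneg_nonneg sin_ge_zero)
 ultimately show False using close(1) by (simp add: a_def)
qed

lemma complex_isometry_affine:
 fixes G :: "complex => complex"
 assumes iso: "!!x y. x \<in> ball z0 e ==> y \<in> ball z0 e ==> dist (G x) (G y) = dist x y" and e: "e > 0"
 shows "\<exists>c k. cmod c = 1 \<and> (k = id \<or> k = cnj) \<and> (\<forall>z\<in>ball z0 e. G z = G z0 + c * k (z - z0))"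
proof -
 define f :: "complex => real^2" where "f = (%z. vector [Re (G z), Im (G z)])"
 have fd: "dist (f x) (f y) = dist (G x) (G y)" for x y
  by (simp add: f_def dist_vec_def L2_set_def sum_2 dist_complex_def cmod_def dist_real_def)
 have i: "dist (f x) (f y) = dist x y" if "x \<in> ball z0 e" "y \<in> ball z0 e" for x y using fd iso[OF that] by simp
 have "\<exists>a b. a \<bullet> a = 1 \<and> b \<bullet> b = 1 \<and> a \<bullet> b = 0 \<and> (\<forall>z\<in>ball z0 e. f z = f z0 + Re (z - z0) *\<^sub>R a + Im (z - z0) *\<^sub>R b)"
  by (rule isometry_into_plane[where S = "ball z0 e" and e = "e / 2" and k = 1]) (use e i in \<open>auto simp: dist_norm cmod_def\<close>)
 then obtain a b where ab: "a \<bullet> a = 1" "b \<bullet> b = 1" "a \<bullet> b = 0" and F: "!!z. z \<in> ball z0 e ==> f z = f z0 + Re (z - z0) *\<^sub>R a + Im (z - z0) *\<^sub>R b"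
  by blast
 define c :: complex where "c = Complex (a $ 1) (a $ 2)"
 define a' :: "real^2" where "a' = vector [- a $ 2, a $ 1]"
 have a': "a' \<bullet> a' = 1" "a \<bullet> a' = 0" using ab(1) by (auto simp: a'_def inner_vec_def sum_2)
 have "(cmod c)^2 = 1" unfolding c_def cmod_power2 using ab(1) by (simp add: inner_vec_def sum_2 power2_eq_square)
 hence c1: "cmod c = 1" by (simp add: power2_eq_1_iff) (metis norm_ge_zero not_one_le_zero add.inverse_inverse le_minus_iff neg_0_le_iff_le order_trans zero_le_one)
 have G: "G z = G z0 + Complex (Re (z - z0) * a $ 1 + Im (z - z0) * b $ 1) (Re (z - z0) * a $ 2 + Im (z - z0) * b $ 2)" if "z \<in> ball z0 e" for z
  using arg_cong[OF F[OF that], of "%v. v $ 1"] arg_cong[OF F[OF that], of "%v. v $ 2"] by (simp add: f_def complex_eq_iff)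
 from orthonormal_second_unique[OF ab(1) a'(1) a'(2) ab(2,3)] show ?thesis
 proof
  assume b: "b = a'"
  show ?thesis by (rule exI[of _ c], rule exI[of _ id]) (use c1 G in \<open>simp add: b a'_def c_def complex_eq_iff algebra_simps\<close>)
 next
  assume b: "b = - a'"
  show ?thesis by (rule exI[of _ c], rule exI[of _ cnj]) (use c1 G in \<open>simp add: b a'_def c_def complex_eq_iff algebra_simps\<close>)
 qed
qed

text \<open>
 Orientation preserving and reversing isometries are treated at once by a map \<open>k\<close> that is
 the identity or the conjugation.
\<close>

lemma id_or_cnj:
 assumes "k = id \<or> k = cnj"
 shows "k (x - y) = k x - k y" "k (k x) = x" "cmod (k x) = cmod x"
 using assms by auto

lemma modulus_of_affine_isometry:
 assumes c: "cmod c = 1" and k: "k = id \<or> k = cnj"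
 shows "cmod (a + c * k (z - z0)) = cmod (z - (z0 - k (cnj c * a)))"
proof -
 have "c * (cnj c * a) = a" using complex_norm_square[of c] c by (simp add: mult.assoc[symmetric])
 hence "a + c * k (z - z0) = c * k (z - (z0 - k (cnj c * a)))" by (simp add: id_or_cnj(1,2)[OF k] right_diff_distrib)
 thus ?thesis using c by (simp add: norm_mult id_or_cnj(3)[OF k])
qed

text \<open>
 Away from its apex, the cone is unfolded into the plane by using the angle relative to \<open>F
 z0\<close> as the argument.  The composition with \<open>F\<close> is a planar isometry.
\<close>

lemma cone_unfolding:
 assumes F: "!!u. u \<in> ball z0 dlt0 ==> F u \<in> cone \<alpha>"
  "!!u v. u \<in> ball z0 dlt0 ==> v \<in> ball z0 dlt0 ==> cone_dist \<alpha> (F u) (F v) = dist u v"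
  and dlt0: "0 < dlt0" and pos: "0 < fst (F z0)"
 shows "\<exists>dlt c k \<tau>. 0 < dlt \<and> cmod c = 1 \<and> (k = id \<or> k = cnj) \<and> (\<forall>z\<in>ball z0 dlt.
   \<bar>\<tau> z\<bar> < pi / 4 \<and> \<bar>\<tau> z\<bar> < \<alpha> / 4 \<and> (\<exists>m. snd (F z) - snd (F z0) = \<tau> z + of_int m * \<alpha>) \<and>
   rcis (fst (F z)) (\<tau> z) = cr (fst (F z0)) + c * k (z - z0))"
proof -
 have C: "0 <= fst (F u)" "0 <= snd (F u)" "snd (F u) < \<alpha>" if "u \<in> ball z0 dlt0" for u
  using F(1)[OF that] by (auto simp: cone_def)
 have z0: "z0 \<in> ball z0 dlt0" using dlt0 by simp
 have \<alpha>: "\<alpha> > 0" using C(2,3)[OF z0] by simp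
 define \<beta> where "\<beta> = min (pi / 4) (\<alpha> / 4)"
 have \<beta>: "0 < \<beta>" "\<beta> <= pi / 4" "\<beta> <= \<alpha> / 4" using \<alpha> by (auto simp: \<beta>_def)
 have "0 < sin \<beta>" using \<beta> pi_gt_zero by (intro sin_gt_zero) linarith+
 define dlt where "dlt = min dlt0 (fst (F z0) * sin \<beta>)"
 have dlt: "0 < dlt" "dlt <= dlt0" using dlt0 pos \<open>0 < sin \<beta>\<close> by (auto simp: dlt_def)
 have "\<exists>t. \<bar>t\<bar> < \<beta> \<and> (\<exists>m. snd (F z) - snd (F z0) = t + of_int m * \<alpha>) \<and> (z = z0 --> t = 0)" if z: "z \<in> ball z0 dlt" for z
 proof -
  have zz: "z \<in> ball z0 dlt0" using z dlt by simp
  obtain t m where t: "snd (F z) - snd (F z0) = t + of_int m * \<alpha>" "\<bar>t\<bar> = circle_dist \<alpha> (snd (F z)) (snd (F z0))"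
   using circle_lift_exists[OF C(2,3)[OF zz] C(2,3)[OF z0]] by blast
  have sym: "circle_dist \<alpha> (snd (F z)) (snd (F z0)) = circle_dist \<alpha> (snd (F z0)) (snd (F z))"
   by (simp add: circle_dist_def abs_minus_commute)
  have "circle_dist \<alpha> (snd (F z0)) (snd (F z)) < \<beta>"
  proof (rule near_in_cone_imp_near_angle[OF pos \<beta>(1)])
   show "\<beta> <= pi / 2" using \<beta> pi_gt_zero by linarith
   show "cone_dist \<alpha> (F z0) (F z) < fst (F z0) * sin \<beta>" using F(2)[OF z0 zz] z by (simp add: dlt_def)
   show "0 <= fst (F z)" by (rule C(1)[OF zz])
   show "0 <= circle_dist \<alpha> (snd (F z0)) (snd (F z))" using t(2) sym by linarith
  qed
  hence b: "\<bar>t\<bar> < \<beta>" using t(2) sym by linarith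
  moreover have "t = 0" if "z = z0" using t(2) that \<alpha> by (simp add: circle_dist_def)
  ultimately show ?thesis using t(1) by blast
 qed
 then obtain \<tau> where \<tau>: "!!z. z \<in> ball z0 dlt ==> \<bar>\<tau> z\<bar> < \<beta>" "!!z. z \<in> ball z0 dlt ==> \<exists>m. snd (F z) - snd (F z0) = \<tau> z + of_int m * \<alpha>"
  "\<tau> z0 = 0" using dlt(1) centre_in_ball by metis
 define G where "G = (%z. rcis (fst (F z)) (\<tau> z))"
 have "dist (G u) (G v) = dist u v" if u: "u \<in> ball z0 dlt" and v: "v \<in> ball z0 dlt" for u v
 proof -
  have uv: "u \<in> ball z0 dlt0" "v \<in> ball z0 dlt0" using u v dlt by auto
  obtain m n where "snd (F u) - snd (F z0) = \<tau> u + of_int m * \<alpha>" "snd (F v) - snd (F z0) = \<tau> v + of_int n * \<alpha>"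
   using \<tau>(2)[OF u] \<tau>(2)[OF v] by blast
  hence "snd (F u) - snd (F v) = (\<tau> u - \<tau> v) + of_int (m - n) * \<alpha>" by (simp add: algebra_simps)
  hence cd: "circle_dist \<alpha> (snd (F u)) (snd (F v)) = \<bar>\<tau> u - \<tau> v\<bar>"
   by (rule circle_dist_small_lift[OF C(2,3)[OF uv(1)] C(2,3)[OF uv(2)]]) (use \<tau>(1)[OF u] \<tau>(1)[OF v] \<beta>(3) in linarith)
  have "min pi \<bar>\<tau> u - \<tau> v\<bar> = \<bar>\<tau> u - \<tau> v\<bar>" using \<tau>(1)[OF u] \<tau>(1)[OF v] \<beta>(2) pi_gt_zero by linarith
  hence "cone_dist \<alpha> (F u) (F v) = sqrt ((cmod (G u - G v))^2)"
   unfolding cone_dist_circle cd G_def law_of_cosines_rcis by simp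
  thus ?thesis using F(2)[OF uv] by (simp add: dist_norm)
 qed
 from complex_isometry_affine[OF this dlt(1)] obtain c k where c: "cmod c = 1" "k = id \<or> k = cnj"
  "!!z. z \<in> ball z0 dlt ==> G z = G z0 + c * k (z - z0)" by blast
 have G0: "G z0 = cr (fst (F z0))" by (simp add: G_def \<tau>(3) rcis_def)
 have b: "\<bar>\<tau> z\<bar> < pi / 4 \<and> \<bar>\<tau> z\<bar> < \<alpha> / 4" if "z \<in> ball z0 dlt" for z using \<tau>(1)[OF that] \<beta> by linarith
 show ?thesis using dlt(1) c(1,2) c(3)[unfolded G0, unfolded G_def] \<tau>(2) b
  by (intro exI[of _ dlt] exI[of _ c] exI[of _ k] exI[of _ \<tau>]) blast
qed

definition locally_into_cone :: "real => (complex => real \<times> real) => complex => bool" where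
 "locally_into_cone \<alpha> F z0 \<longleftrightarrow> (\<exists>dlt>0. \<forall>u\<in>ball z0 dlt. F u \<in> cone \<alpha> \<and> (\<forall>v\<in>ball z0 dlt. cone_dist \<alpha> (F u) (F v) = dist u v))"

lemma unfolding_centre:
 assumes "locally_into_cone \<alpha> F z0" "0 < fst (F z0)"
 shows "\<exists>dlt>0. \<exists>\<zeta>. \<forall>z\<in>ball z0 dlt. fst (F z) = cmod (z - \<zeta>)"
proof -
 obtain dlt0 where d0: "dlt0 > 0" "!!u. u \<in> ball z0 dlt0 ==> F u \<in> cone \<alpha>"
  "!!u v. u \<in> ball z0 dlt0 ==> v \<in> ball z0 dlt0 ==> cone_dist \<alpha> (F u) (F v) = dist u v"
  using assms(1) unfolding locally_into_cone_def by blast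
 from cone_unfolding[OF d0(2,3,1) assms(2)] obtain dlt c k \<tau> where u: "0 < dlt" "cmod c = 1" "k = id \<or> k = cnj"
  "!!z. z \<in> ball z0 dlt ==> rcis (fst (F z)) (\<tau> z) = cr (fst (F z0)) + c * k (z - z0)" by blast
 have "fst (F z) = cmod (z - (z0 - k (cnj c * cr (fst (F z0)))))" if z: "z \<in> ball z0 (min dlt dlt0)" for z
 proof -
  have "0 <= fst (F z)" using d0(2)[of z] z by (auto simp: cone_def)
  moreover have "z \<in> ball z0 dlt" using z by simp
  ultimately show ?thesis using arg_cong[OF u(4), of z cmod] unfolding modulus_of_affine_isometry[OF u(2,3)] by simp
 qed
 moreover have "0 < min dlt dlt0" using u d0 by simp
 ultimately show ?thesis by blast
qed

lemma paraboloid_determined: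
 assumes e: "e > 0" and eq: "!!z. z \<in> ball z0 e ==> (cmod (z - a))^2 + h = (cmod (z - b))^2 + k"
 shows "a = b" "h = k"
proof -
 have E: "2 * (Re z * (Re b - Re a) + Im z * (Im b - Im a)) = (cmod b)^2 - (cmod a)^2 + (k - h)" if "z \<in> ball z0 e" for z
  using eq[OF that] unfolding cmod_power2 by (simp add: power2_eq_square algebra_simps)
 have 0: "z0 \<in> ball z0 e" "z0 + cr (e / 2) \<in> ball z0 e" "z0 + \<i> * cr (e / 2) \<in> ball z0 e"
  using e by (auto simp: dist_norm norm_mult)
 define p q where "p = Re b - Re a" and "q = Im b - Im a"
 note E = E[folded p_def q_def]
 have "2 * ((Re z0 + e / 2) * p + Im z0 * q) = 2 * (Re z0 * p + Im z0 * q)" using E[OF 0(1)] E[OF 0(2)] by simp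
 hence "e * p = 0" by (simp add: distrib_right)
 moreover have "2 * (Re z0 * p + (Im z0 + e / 2) * q) = 2 * (Re z0 * p + Im z0 * q)" using E[OF 0(1)] E[OF 0(3)] by simp
 hence "e * q = 0" by (simp add: distrib_right)
 ultimately have "p = 0" "q = 0" using e by auto
 thus "a = b" by (simp add: p_def q_def complex_eq_iff)
 thus "h = k" using eq[OF 0(1)] by simp
qed

lemma distance_function_centre_unique:
 assumes "e > 0" "!!z. z \<in> ball z0 e ==> cmod (z - a) = cmod (z - b)"
 shows "a = b"
 by (rule paraboloid_determined(1)[OF assms(1), of z0 a 0 b 0]) (simp add: assms(2))

text \<open>
 Locally the distance to the apex of the cone is the distance to a centre in the plane.  The centre is
 locally constant, hence constant on \<open>U\<close>, and it is the origin because the distance tends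
 to zero there.
\<close>

lemma cone_radius_is_modulus:
 assumes U: "open U" "connected U" and F: "!!z. z \<in> U ==> locally_into_cone \<alpha> F z" "!!z. z \<in> U ==> 0 < fst (F z)"
  and lim: "!!\<eta>. 0 < \<eta> ==> \<exists>z\<in>U. cmod z < \<eta> \<and> fst (F z) < \<eta>" and z: "z \<in> U"
 shows "fst (F z) = cmod z"
proof -
 have "\<forall>z0\<in>U. \<exists>\<zeta>. \<exists>dlt>0. \<forall>z\<in>ball z0 dlt. fst (F z) = cmod (z - \<zeta>)" using unfolding_centre F by metis
 then obtain \<zeta> where \<zeta>: "!!z0. z0 \<in> U ==> \<exists>dlt>0. \<forall>z\<in>ball z0 dlt. fst (F z) = cmod (z - \<zeta> z0)" by metis
 have "\<zeta> a = \<zeta> b" if ab: "a \<in> U" "b \<in> U" for a b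
 proof (rule connected_local_const[OF U(2) ab], intro ballI)
  fix x assume x: "x \<in> U"
  obtain dlt where d: "dlt > 0" "!!z. z \<in> ball x dlt ==> fst (F z) = cmod (z - \<zeta> x)" using \<zeta>[OF x] by blast
  have "\<zeta> x = \<zeta> y" if y: "y \<in> U" "dist y x < dlt" for y
  proof -
   obtain dlt' where d': "dlt' > 0" "!!z. z \<in> ball y dlt' ==> fst (F z) = cmod (z - \<zeta> y)" using \<zeta>[OF y(1)] by blast
   have "y \<in> ball x dlt" using y by (simp add: dist_commute)
   then obtain e where e: "e > 0" "ball y e \<subseteq> ball x dlt" using openE[OF open_ball] by blast
   show ?thesis
   proof (rule distance_function_centre_unique[of "min e dlt'" y])
    fix z assume z: "z \<in> ball y (min e dlt')"
    hence "z \<in> ball x dlt" "z \<in> ball y dlt'" using e(2) by auto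
    thus "cmod (z - \<zeta> x) = cmod (z - \<zeta> y)" using d(2)[of z] d'(2)[of z] by simp
   qed (use e d' in simp)
  qed
  thus "eventually (%y. \<zeta> x = \<zeta> y) (at x within U)" unfolding eventually_at using d(1) by blast
 qed
 hence const: "fst (F y) = cmod (y - \<zeta> z)" if "y \<in> U" for y
  using \<zeta>[OF that] z that by (metis centre_in_ball)
 have "cmod (\<zeta> z) <= 0"
 proof (rule field_le_epsilon)
  fix \<eta> :: real assume "0 < \<eta>"
  then obtain y where y: "y \<in> U" "cmod y < \<eta> / 2" "fst (F y) < \<eta> / 2" using lim[of "\<eta> / 2"] by auto
  have "cmod (\<zeta> z) <= cmod y + cmod (y - \<zeta> z)" using norm_triangle_ineq4[of y "y - \<zeta> z"] by simp
  thus "cmod (\<zeta> z) <= 0 + \<eta>" using y const[OF y(1)] by linarith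
 qed
 thus ?thesis using const[OF z] by simp
qed

lemma cis_inj_small:
 assumes "cis s = cis t" "\<bar>s - t\<bar> < 2 * pi" shows "s = t"
proof -
 have "cis (s - t) = 1" using assms(1) by (simp flip: cis_divide)
 hence c: "cos (s - t) = 1" by (metis cis.simps(1) one_complex.simps(1))
 then obtain n :: int where "s - t = of_int n * 2 * pi" using cos_one_2pi_int by auto
 hence "\<bar>of_int n\<bar> * (2 * pi) < 1 * (2 * pi)" using assms(2) by (simp add: abs_mult)
 hence "\<bar>of_int n\<bar> < (1::real)" by (metis mult_less_cancel_right_pos pi_gt_zero zero_less_mult_iff zero_less_numeral)
 hence "n = 0" by linarith
 thus ?thesis using \<open>s - t = _\<close> by simp
qed

text \<open>
 The assumption on the angular coordinate keeps away from the point where it jumps from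
 \<open>alpha\<close> to \<open>0\<close>.
\<close>

lemma angular_coordinate_derivative:
 assumes loc: "locally_into_cone \<alpha> F (rcis eps \<theta>)" and eps: "0 < eps"
  and rad: "\<exists>dlt>0. \<forall>z\<in>ball (rcis eps \<theta>) dlt. fst (F z) = cmod z" and X: "0 < snd (F (rcis eps \<theta>))"
 shows "\<exists>\<sigma>. \<bar>\<sigma>\<bar> = 1 \<and> ((%t. snd (F (rcis eps t))) has_real_derivative \<sigma>) (at \<theta>)"
proof -
 define z0 where "z0 = rcis eps \<theta>"
 obtain dlt0 where d0: "dlt0 > 0" "!!u. u \<in> ball z0 dlt0 ==> F u \<in> cone \<alpha>"
  "!!u v. u \<in> ball z0 dlt0 ==> v \<in> ball z0 dlt0 ==> cone_dist \<alpha> (F u) (F v) = dist u v"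
  using loc unfolding locally_into_cone_def z0_def by blast
 obtain dlt1 where d1: "dlt1 > 0" "!!z. z \<in> ball z0 dlt1 ==> fst (F z) = cmod z" using rad unfolding z0_def by blast
 have f0: "fst (F z0) = eps" using d1 eps by (simp add: z0_def)
 have pos: "0 < fst (F z0)" using f0 eps by simp
 from cone_unfolding[OF d0(2,3,1) pos, unfolded f0] obtain dlt c k \<tau> where u: "0 < dlt" "cmod c = 1" "k = id \<or> k = cnj"
  and U: "!!z. z \<in> ball z0 dlt ==> \<bar>\<tau> z\<bar> < pi / 4"
  "!!z. z \<in> ball z0 dlt ==> \<exists>m. snd (F z) - snd (F z0) = \<tau> z + of_int m * \<alpha>"
  "!!z. z \<in> ball z0 dlt ==> rcis (fst (F z)) (\<tau> z) = cr eps + c * k (z - z0)" by blast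
 note k = id_or_cnj[OF u(3)]
 define \<rho> where "\<rho> = min dlt (min dlt0 dlt1)"
 have \<rho>: "\<rho> > 0" "!!z. z \<in> ball z0 \<rho> ==> z \<in> ball z0 dlt \<and> z \<in> ball z0 dlt0 \<and> z \<in> ball z0 dlt1" using u d0 d1 by (auto simp: \<rho>_def)
 have cc: "c * cnj c = 1" using u(2) complex_norm_square[of c] by auto
 \<comment> \<open>the radii agree with the moduli, so the centre of the unfolding is the origin, and the unfolding is a rotation or a reflection\<close>
 have "cmod (z - (z0 - k (cnj c * cr eps))) = cmod (z - 0)" if z: "z \<in> ball z0 \<rho>" for z
  using arg_cong[OF U(3)[of z], of cmod] d1(2)[of z] \<rho>(2)[OF z] unfolding modulus_of_affine_isometry[OF u(2,3)] by simp
 from distance_function_centre_unique[OF \<rho>(1) this] have "k z0 = k (k (cnj c * cr eps))" by simp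
 hence ckz: "c * k z0 = cr eps" using cc unfolding k(2) by (simp add: mult.assoc[symmetric])
 obtain \<sigma> :: real where \<sigma>: "\<sigma> = 1 \<or> \<sigma> = -1" "!!t. k (rcis eps t) = cr eps * cis (\<sigma> * t)"
 proof -
  assume that: "!!\<sigma>::real. \<sigma> = 1 \<or> \<sigma> = -1 ==> (!!t. k (rcis eps t) = cr eps * cis (\<sigma> * t)) ==> thesis"
  from u(3) show thesis
  proof
   assume "k = id" thus thesis by (intro that[of 1]) (auto simp: rcis_def)
  next
   assume "k = cnj" thus thesis by (intro that[of "-1"]) (auto simp: rcis_def cis_cnj)
  qed
 qed
 have "cr eps * (c * cis (\<sigma> * \<theta>)) = cr eps * 1" using ckz unfolding z0_def \<sigma>(2) by (simp add: mult.left_commute)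
 hence "c * cis (\<sigma> * \<theta>) = 1" using eps by (metis mult_left_cancel of_real_eq_0_iff less_irrefl)
 hence "c * cis (\<sigma> * \<theta>) * cis (- (\<sigma> * \<theta>)) = cis (- (\<sigma> * \<theta>))" by simp
 hence c: "c = cis (- (\<sigma> * \<theta>))" by (simp add: mult.assoc cis_mult)
 have X0: "0 < snd (F z0)" "snd (F z0) < \<alpha>" using X d0(2)[of z0] d0(1) by (auto simp: z0_def cone_def)
 have cont: "isCont (%t. rcis eps t) \<theta>" unfolding rcis_def cis_conv_exp by (intro continuous_intros)
 have "eventually (%t. rcis eps t \<in> ball z0 \<rho>) (at \<theta>)"
  using cont \<rho>(1) unfolding isCont_def z0_def by (auto simp: tendsto_iff dist_commute)
 then obtain \<eta>0 where \<eta>0: "\<eta>0 > 0" "!!t. \<bar>t - \<theta>\<bar> < \<eta>0 ==> rcis eps t \<in> ball z0 \<rho>"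
 proof -
  assume a: "eventually (%t. rcis eps t \<in> ball z0 \<rho>) (at \<theta>)" and that: "!!\<eta>0. \<eta>0 > 0 ==> (!!t. \<bar>t - \<theta>\<bar> < \<eta>0 ==> rcis eps t \<in> ball z0 \<rho>) ==> thesis"
  obtain \<eta> where "\<eta> > 0" "!!t. t ~= \<theta> ==> dist t \<theta> < \<eta> ==> rcis eps t \<in> ball z0 \<rho>" using a unfolding eventually_at by auto
  moreover have "rcis eps \<theta> \<in> ball z0 \<rho>" using \<rho>(1) by (simp add: z0_def)
  ultimately show thesis using that[of \<eta>] by (metis dist_real_def)
 qed
 define \<eta> where "\<eta> = min \<eta>0 (min (pi / 4) (min (snd (F z0)) (\<alpha> - snd (F z0))))"
 have \<eta>: "\<eta> > 0" using \<eta>0 X0 by (simp add: \<eta>_def)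
 have lift: "snd (F (rcis eps t)) = snd (F z0) + \<sigma> * (t - \<theta>)" if t: "\<bar>t - \<theta>\<bar> < \<eta>" for t
 proof -
  define z where "z = rcis eps t"
  have z: "z \<in> ball z0 \<rho>" using \<eta>0(2)[of t] t by (simp add: \<eta>_def z_def)
  have fz: "fst (F z) = eps" using d1(2)[of z] \<rho>(2)[OF z] eps by (simp add: z_def)
  have "cr eps * cis (\<tau> z) = c * k z" using U(3)[of z] \<rho>(2)[OF z] fz ckz by (simp add: rcis_def k(1) right_diff_distrib)
  also have "\<dots> = cr eps * cis (\<sigma> * (t - \<theta>))" by (simp add: c z_def \<sigma>(2) cis_mult mult.left_commute right_diff_distrib)
  finally have "cis (\<tau> z) = cis (\<sigma> * (t - \<theta>))" using eps by simp
  moreover have "\<bar>\<sigma> * (t - \<theta>)\<bar> < pi / 4" using t \<sigma>(1) by (auto simp: \<eta>_def abs_minus_commute)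
  moreover have "\<bar>\<tau> z\<bar> < pi / 4" using U(1)[of z] \<rho>(2)[OF z] by blast
  ultimately have \<tau>: "\<tau> z = \<sigma> * (t - \<theta>)" using pi_gt_zero by (intro cis_inj_small) linarith+
  obtain m where m: "snd (F z) - snd (F z0) = \<tau> z + of_int m * \<alpha>" using U(2)[of z] \<rho>(2)[OF z] by blast
  have "0 <= snd (F z)" "snd (F z) < \<alpha>" using d0(2)[of z] \<rho>(2)[OF z] by (auto simp: cone_def)
  moreover have "\<bar>\<tau> z\<bar> < snd (F z0)" "\<bar>\<tau> z\<bar> < \<alpha> - snd (F z0)" using t \<sigma>(1) by (auto simp: \<tau> \<eta>_def abs_minus_commute)
  ultimately have "\<bar>of_int m * \<alpha>\<bar> < \<alpha>" using m by linarith
  hence "\<bar>of_int m\<bar> < (1::real)" using X0 by (simp add: abs_mult)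
  hence "m = 0" by linarith
  thus ?thesis using m \<tau> by (simp add: z_def)
 qed
 have "((%t. snd (F z0) + \<sigma> * (t - \<theta>)) has_real_derivative \<sigma>) (at \<theta>)" by (auto intro!: derivative_eq_intros)
 hence "((%t. snd (F (rcis eps t))) has_real_derivative \<sigma>) (at \<theta>)"
 proof (rule has_field_derivative_transform_within[OF _ \<eta>])
  fix t assume "dist t \<theta> < \<eta>"
  thus "snd (F z0) + \<sigma> * (t - \<theta>) = snd (F (rcis eps t))" using lift[of t] by (simp add: dist_real_def)
 qed simp
 thus ?thesis using \<sigma>(1) by (intro exI[of _ \<sigma>]) auto
qed

lemma measure_image_unit_speed:
 fixes g :: "real => real"
 assumes "S \<in> lmeasurable" "!!x. x \<in> S ==> \<exists>\<sigma>. \<bar>\<sigma>\<bar> = 1 \<and> (g has_real_derivative \<sigma>) (at x)" "inj_on g S"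
 shows "g ` S \<in> lmeasurable" "measure lebesgue (g ` S) = measure lebesgue S"
proof -
 obtain g' where g': "!!x. x \<in> S ==> \<bar>g' x\<bar> = 1" "!!x. x \<in> S ==> (g has_real_derivative g' x) (at x)" using assms(2) by metis
 have d: "(g has_vector_derivative g' x) (at x within S)" if "x \<in> S" for x
  using g'(2)[OF that] by (metis has_field_derivative_at_within has_real_derivative_iff_has_vector_derivative)
 have 1: "(%x. 1::real) absolutely_integrable_on S" using assms(1) by (simp add: absolutely_integrable_on_const)
 have i: "integral S (%x. 1::real) = measure lebesgue S" using assms(1) by (simp add: lmeasure_integral)
 have "(%x. \<bar>g' x\<bar> *\<^sub>R (1::real)) absolutely_integrable_on S \<and> integral S (%x. \<bar>g' x\<bar> *\<^sub>R (1::real)) = measure lebesgue S"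
 proof
  show "(%x. \<bar>g' x\<bar> *\<^sub>R (1::real)) absolutely_integrable_on S"
   by (rule set_integrable_cong[THEN iffD1, OF refl refl _ 1]) (use g'(1) in auto)
  show "integral S (%x. \<bar>g' x\<bar> *\<^sub>R (1::real)) = measure lebesgue S"
   using i by (metis (mono_tags, lifting) g'(1) integral_cong real_scaleR_def mult_1)
 qed
 hence "(%x. 1::real) absolutely_integrable_on g ` S \<and> integral (g ` S) (%x. 1::real) = measure lebesgue S"
  using has_absolute_integral_change_of_variables_1'[OF fmeasurableD[OF assms(1)], of g g' "%x. 1" "measure lebesgue S"]
   g'(2) assms(3) by (auto intro: has_field_derivative_at_within)
 hence A: "(%x. 1::real) absolutely_integrable_on g ` S" "integral (g ` S) (%x. 1::real) = measure lebesgue S" by auto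
 have "(%x. 1::real) integrable_on g ` S" using A(1) by (simp add: absolutely_integrable_on_def)
 thus m: "g ` S \<in> lmeasurable" by (simp add: lmeasurable_iff_integrable_on)
 show "measure lebesgue (g ` S) = measure lebesgue S" using A(2) lmeasure_integral[OF m] by simp
qed

section \<open>Cone angles as sums of corner angles\<close>

lemma cone_dist_apex: "v \<in> cone \<alpha> ==> cone_dist \<alpha> v (0, 0) = fst v"
 by (auto simp: cone_def cone_dist_def)

context surface_triangulation
begin

lemma small_sector:
 assumes d: "d \<in> darts T"
 defines "w \<equiv> tip T d" and "l \<equiv> len T d"
 assumes eps: "0 < eps" "eps * (cmod w + l) < l * Im w" and \<theta>: "0 < \<theta>" "\<theta> < Arg w"
 shows "rcis eps \<theta> \<in> otri d"
proof -
 have w: "0 < Im w" "l > 0" using tip_props(1)[OF d] d by (auto simp: w_def l_def)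
 have a: "0 < Arg w" "Arg w < pi" using Arg_upper_half_plane[OF w(1)] by auto
 have w0: "w ~= 0" using w by auto
 have 1: "0 < Im (rcis eps \<theta>)" using eps \<theta> a by (auto intro!: mult_pos_pos sin_gt_zero)
 have "rcis eps \<theta> * cnj w = rcis eps \<theta> * cnj (rcis (cmod w) (Arg w))" by (simp add: rcis_cmod_Arg)
 also have "cnj (rcis (cmod w) (Arg w)) = rcis (cmod w) (- Arg w)" by (simp add: rcis_def cis_cnj)
 finally have m: "Im (rcis eps \<theta> * cnj w) = - (eps * cmod w * sin (Arg w - \<theta>))"
  by (simp add: rcis_mult sin_diff algebra_simps)
 have "0 < eps * cmod w * sin (Arg w - \<theta>)" using eps \<theta> a w0 by (intro mult_pos_pos sin_gt_zero) auto
 hence 2: "Im (rcis eps \<theta> * cnj w) < 0" using m by simp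
 have "\<bar>Im (rcis eps \<theta> * cnj w)\<bar> <= eps * cmod w" using abs_Im_le_cmod[of "rcis eps \<theta> * cnj w"] eps by (simp add: norm_mult del: Im_rcis)
 moreover have "\<bar>Im (rcis eps \<theta>)\<bar> <= eps" using abs_Im_le_cmod[of "rcis eps \<theta>"] eps by simp
 hence "l * Im (rcis eps \<theta>) <= l * eps" using w by (intro mult_left_mono) auto
 ultimately have "0 < Im ((rcis eps \<theta> - cr l) * cnj (w - cr l))"
  using tri_barycentric(1)[where z = "rcis eps \<theta>" and d = d] eps(2) unfolding w_def[symmetric] l_def[symmetric]
  by (simp only: distrib_left mult.commute[of eps l])
 thus ?thesis using 1 2 unfolding otri_def mem_Collect_eq w_def[symmetric] l_def[symmetric] by blast
qed

lemma otri_polar: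
 assumes d: "d \<in> darts T" and z: "z \<in> otri d"
 shows "0 < Arg z" "Arg z < Arg (tip T d)" "z = rcis (cmod z) (Arg z)"
proof -
 define w where "w = tip T d"
 have z': "0 < Im z" "Im (z * cnj w) < 0" using z by (auto simp: otri_def w_def)
 have w: "0 < Im w" using tip_props(1)[OF d] by (simp add: w_def)
 have i: "0 < Im (w * cnj z)" using z'(2) by (simp add: algebra_simps)
 have zz: "z * (w * cnj z) = cr ((cmod z)^2) * w" using complex_norm_square[of z] by (simp add: mult.left_commute mult.commute)
 have p: "0 < (cmod z)^2" using z'(1) by auto
 have "Arg (z * (w * cnj z)) = Arg z + Arg (w * cnj z)"
  by (rule Arg_mult_upper[OF z'(1) i]) (use p w in \<open>simp only: zz Im_complex_of_real Re_complex_of_real times_complex.sel mult_zero_left add_0_right mult_pos_pos\<close>)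
 hence "Arg w = Arg z + Arg (w * cnj z)" unfolding zz Arg_times_of_real[OF p] .
 thus "Arg z < Arg (tip T d)" using Arg_upper_half_plane(1)[OF i] by (simp add: w_def)
 show "0 < Arg z" by (rule Arg_upper_half_plane(1)[OF z'(1)])
 show "z = rcis (cmod z) (Arg z)" by (simp add: rcis_cmod_Arg)
qed

lemma frame_nxt_preimage:
 assumes d: "d \<in> darts T" and z: "z \<in> tri d"
 obtains z' where "z' \<in> tri (nxt T d)" "frame_nxt d z' = z" "nchart (nxt T d) z' = nchart d z" "cmod z' = cmod (z - cr (len T d))"
proof -
 have u: "side_dir d ~= 0" "cmod (side_dir d) = 1" using side_dir(1)[OF d] by auto
 define z' where "z' = (z - cr (len T d)) / side_dir d"
 have f: "frame_nxt d z' = z" using u by (simp add: z'_def frame_nxt_def)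
 moreover have "z' \<in> tri (nxt T d)" using frame_nxt_tri[OF d, of z'] z f by simp
 moreover have "nchart (nxt T d) z' = nchart d z" using nchart_nxt[OF d, of z'] f by simp
 moreover have "cmod z' = cmod (z - cr (len T d))" using u by (simp add: z'_def norm_divide)
 ultimately show ?thesis using that by blast
qed

text \<open>
 By compactness of the faces, points close to a singular point are close to one of its corners.
\<close>

lemma near_singular_point:
 assumes e: "0 < e"
 shows "\<exists>\<eta>>0. \<forall>p. dist p (s i) < \<eta> --> (\<exists>d\<in>darts T. orig T d = i \<and> (\<exists>z\<in>tri d. cmod z < e \<and> nchart d z = p))"
proof -
 define corners where "corners = (%d. {c \<in> {0, cr (len T d), tip T d}. nchart d c = s i})"
 define K where "K = (%d. tri d - (\<Union>c\<in>corners d. ball c e))"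
 have "\<exists>\<eta>>0. \<forall>z\<in>K d. \<eta> <= dist (nchart d z) (s i)" if d: "d \<in> darts T" for d
 proof -
  have "compact (K d)" unfolding K_def by (intro compact_diff compact_tri[OF d]) auto
  hence "closed (nchart d ` K d)"
   by (intro compact_imp_closed compact_continuous_image continuous_on_subset[OF nchart_continuous[OF d]]) (auto simp: K_def)
  moreover have "s i \<notin> nchart d ` K d"
  proof
   assume "s i \<in> nchart d ` K d"
   then obtain z where z: "z \<in> tri d" "nchart d z = s i" "z \<notin> (\<Union>c\<in>corners d. ball c e)" by (auto simp: K_def)
   hence "z \<in> corners d" using singular_point_is_corner[OF d z(1,2)] by (auto simp: corners_def)
   thus False using z(3) e by auto
  qed
  ultimately obtain \<eta> where "\<eta> > 0" "ball (s i) \<eta> \<subseteq> - (nchart d ` K d)" using openE[of "- (nchart d ` K d)" "s i"] by auto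
  thus ?thesis by (intro exI[of _ \<eta>]) (force simp: dist_commute subset_iff)
 qed
 then obtain h where h: "!!d. d \<in> darts T ==> 0 < h d" "!!d z. d \<in> darts T ==> z \<in> K d ==> h d <= dist (nchart d z) (s i)" by metis
 obtain \<eta> where \<eta>: "\<eta> > 0" "!!d. d \<in> darts T ==> \<eta> <= h d" using finite_positive_lower_bound[of "darts T" h] h(1) by auto
 have "\<exists>d\<in>darts T. orig T d = i \<and> (\<exists>z\<in>tri d. cmod z < e \<and> nchart d z = p)" if p: "dist p (s i) < \<eta>" for p
 proof -
  obtain d z where d: "d \<in> darts T" and z: "z \<in> tri d" "nchart d z = p" using nchart_cover by blast
  have n: "nxt T d \<in> darts T" "prv T d \<in> darts T" using d by auto
  have "z \<notin> K d" using h(2)[OF d, of z] \<eta>(2)[OF d] p z(2) by auto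
  then obtain c where c: "c \<in> corners d" "dist c z < e" using z(1) by (auto simp: K_def)
  note inj = inj_s[THEN injD]
  obtain z1 where z1: "z1 \<in> tri (nxt T d)" "frame_nxt d z1 = z" "nchart (nxt T d) z1 = nchart d z" "cmod z1 = cmod (z - cr (len T d))"
   by (rule frame_nxt_preimage[OF d z(1)])
  obtain z2 where z2: "z2 \<in> tri (prv T d)" "frame_nxt (nxt T d) z2 = z1" "nchart (prv T d) z2 = nchart (nxt T d) z1"
    "cmod z2 = cmod (z1 - cr (len T (nxt T d)))"
   by (rule frame_nxt_preimage[OF n(1) z1(1)])
  have w: "frame_nxt d (cr (len T (nxt T d))) = tip T d" using side_dir(2)[OF d] by (simp add: frame_nxt_def)
  have z2': "cmod z2 = cmod (z - tip T d)"
   using frame_nxt_dist[OF d, of z1 "cr (len T (nxt T d))"] unfolding z1(2) w z2(4) by simp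
  consider "c = 0" "orig T d = i" | "c = cr (len T d)" "orig T (nxt T d) = i" | "c = tip T d" "orig T (prv T d) = i"
   using c(1) nchart_corners[OF d] inj unfolding corners_def by auto
  thus ?thesis
  proof cases
   case 1 thus ?thesis using d z c(2) by (intro bexI[of _ d] conjI bexI[of _ z]) auto
  next
   case 2 thus ?thesis using n z z1 c(2) by (intro bexI[of _ "nxt T d"] conjI bexI[of _ z1]) (auto simp: dist_norm norm_minus_commute)
  next
   case 3 thus ?thesis using n z z1 z2 z2' c(2) by (intro bexI[of _ "prv T d"] conjI bexI[of _ z2]) (auto simp: dist_norm norm_minus_commute)
  qed
 qed
 thus ?thesis using \<eta>(1) by blast
qed

text \<open>
 Close to a corner no two corners of the same face interfere.
\<close>

lemma corner_separation:
 assumes d: "d \<in> darts T" and d': "d' \<in> face T d" and fr: "frame d' z' = frame d z"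
  and small: "2 * cmod z < len T d" "2 * cmod z' < len T d" "cmod z + cmod z' < cmod (tip T d)"
 shows "d' = d \<and> z' = z"
proof -
 have n: "nxt T d \<in> darts T" using d by simp
 consider "d' = d" | "d' = nxt T d" | "d' = prv T d" using d' by (auto simp: face_def)
 thus ?thesis
 proof cases
  case 1 thus ?thesis using fr frame_inj[OF d] by simp
 next
  case 2
  have "frame_nxt d z' = z" using fr frame_inj[OF d] unfolding 2 frame_frame_nxt[OF d, symmetric] by blast
  hence "cmod (z - cr (len T d)) = cmod z'" using frame_nxt_dist[OF d, of z' 0] by simp
  moreover have "len T d <= cmod z + cmod (z - cr (len T d))" using norm_triangle_ineq4[of z "z - cr (len T d)"] len_pos[OF d] by simp
  ultimately show ?thesis using small by linarith
 next
  case 3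
  have "frame_nxt d (frame_nxt (nxt T d) z') = z" using fr frame_inj[OF d] unfolding 3 frame_frame_nxt[OF n, symmetric] frame_frame_nxt[OF d, symmetric] by blast
  moreover have "frame_nxt d (frame_nxt (nxt T d) 0) = tip T d" using side_dir(2)[OF d] by (simp add: frame_nxt_def)
  ultimately have "cmod (z - tip T d) = cmod z'" using frame_nxt_dist[OF d, of "frame_nxt (nxt T d) z'" "frame_nxt (nxt T d) 0"] frame_nxt_dist[OF n, of z' 0] by simp
  moreover have "cmod (tip T d) <= cmod z + cmod (z - tip T d)" using norm_triangle_ineq4[of z "z - tip T d"] by simp
  ultimately show ?thesis using small by linarith
 qed
qed

lemma convex_otri: "convex (otri d)"
proof -
 define w l where "w = tip T d" and "l = len T d"
 have "otri d = {z. 0 < Im z} \<inter> {z. Im (z * cnj w) < 0} \<inter> {z. Im (cr l * cnj (w - cr l)) < Im (z * cnj (w - cr l))}"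
  unfolding otri_def w_def[symmetric] l_def[symmetric] by (auto simp only: left_diff_distrib minus_complex.sel diff_gt_0_iff_gt)
 moreover have lin: "convex {z. c < Im (z * a)}" "convex {z. Im (z * a) < c}" for a c
  using convex_halfspace_gt[of c "Complex (Im a) (Re a)"] convex_halfspace_lt[of "Complex (Im a) (Re a)" c]
  by (simp_all add: inner_complex_def algebra_simps)
 ultimately show ?thesis using lin(1)[of 0 1] by (simp only: mult_1_right) (intro convex_Int lin)
qed

end

context surface_triangulation
begin

lemma third_side_far:
 assumes "cmod z * (cmod (tip T d) + len T d) < len T d * Im (tip T d)" and d: "d \<in> darts T"
 shows "0 < Im ((z - cr (len T d)) * cnj (tip T d - cr (len T d)))"
proof -
 define w l where "w = tip T d" and "l = len T d"
 have l: "l > 0" using d by (simp add: l_def)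
 have "\<bar>Im (z * cnj w)\<bar> <= cmod z * cmod w" using abs_Im_le_cmod[of "z * cnj w"] by (simp add: norm_mult)
 moreover have "l * Im z <= l * cmod z" using l abs_Im_le_cmod[of z] by (intro mult_left_mono) auto
 moreover have "cmod z * cmod w + l * cmod z < l * Im w" using assms(1) by (simp add: w_def[symmetric] l_def[symmetric] algebra_simps)
 moreover have "Im ((z - cr l) * cnj (w - cr l)) - Im (z * cnj w) + l * Im z = l * Im w"
  unfolding w_def l_def by (rule tri_barycentric(1))
 ultimately show ?thesis unfolding w_def[symmetric] l_def[symmetric] by linarith
qed

lemma segment_into_otri:
 assumes z: "z \<in> tri d" and c: "c \<in> otri d" and t: "0 < t" "t <= 1"
 shows "z + cr t * (c - z) \<in> otri d"
proof -
 define w l where "w = tip T d" and "l = len T d"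
 have mix: "0 < (1 - t) * a + t * b" if "0 <= a" "0 < b" for a b :: real
  using that t by (intro add_nonneg_pos mult_nonneg_nonneg mult_pos_pos) auto
 have Z: "0 <= Im z" "0 <= - Im (z * cnj w)" "0 <= Im ((z - cr l) * cnj (w - cr l))" using z by (auto simp: tri_def w_def l_def)
 have C: "0 < Im c" "0 < - Im (c * cnj w)" "0 < Im ((c - cr l) * cnj (w - cr l))" using c by (auto simp: otri_def w_def l_def)
 define y where "y = z + cr t * (c - z)"
 have "Im y = (1 - t) * Im z + t * Im c" by (simp add: y_def algebra_simps)
 moreover have "- Im (y * cnj w) = (1 - t) * (- Im (z * cnj w)) + t * (- Im (c * cnj w))" by (simp add: y_def algebra_simps)
 moreover have "Im ((y - cr l) * cnj (w - cr l)) = (1 - t) * Im ((z - cr l) * cnj (w - cr l)) + t * Im ((c - cr l) * cnj (w - cr l))"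
  by (simp add: y_def algebra_simps)
 ultimately have "0 < Im y" "0 < - Im (y * cnj w)" "0 < Im ((y - cr l) * cnj (w - cr l))"
  using mix[OF Z(1) C(1)] mix[OF Z(2) C(2)] mix[OF Z(3) C(3)] by (simp_all only:)
 thus ?thesis unfolding otri_def mem_Collect_eq y_def[symmetric] w_def[symmetric] l_def[symmetric] by simp
qed

text \<open>
 The chart of the face need not be isometric near its corner, where only continuity is given.  The
 distance to the corner is nevertheless preserved, by \<open>cone_radius_is_modulus\<close> in the
 interior and by continuity on the two sides.
\<close>

lemma cone_chart_at_corner:
 assumes N: "open N" "s i \<in> N" and f: "!!x. x \<in> N ==> f x \<in> cone \<alpha>" "f (s i) = (0, 0)"
  and iso: "!!x y. x \<in> N ==> y \<in> N ==> cone_dist \<alpha> (f x) (f y) = dist x y"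
  and d: "d \<in> darts T" "orig T d = i"
 shows "\<exists>e>0. (\<forall>z\<in>tri d. cmod z < e --> nchart d z \<in> N \<and> fst (f (nchart d z)) = cmod z) \<and>
   (\<forall>z\<in>otri d. cmod z < e --> locally_into_cone \<alpha> (%z. f (nchart d z)) z)"
proof -
 define F where "F = (%z. f (nchart d z))"
 have z0: "0 \<in> tri d" using tri_points(1)[OF d(1), of 0] len_pos[OF d(1)] by simp
 have n0: "nchart d 0 = s i" using nchart_corners(1)[OF d(1)] d(2) by simp
 have near: "\<exists>e>0. \<forall>z\<in>tri d. cmod z < e --> dist (nchart d z) (s i) < \<eta>" if "\<eta> > 0" for \<eta>
  using nchart_continuous[OF d(1), unfolded continuous_on_iff] z0 that n0 by (metis dist_0_norm dist_commute)
 obtain \<eta> where \<eta>: "\<eta> > 0" "ball (s i) \<eta> \<subseteq> N" using openE[OF N] .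
 obtain e where e: "e > 0" "!!z. z \<in> tri d ==> cmod z < e ==> dist (nchart d z) (s i) < \<eta>" using near[OF \<eta>(1)] by blast
 have inN: "nchart d z \<in> N" if "z \<in> tri d" "cmod z < e" for z using e(2)[OF that] \<eta>(2) by (auto simp: dist_commute)
 have rad: "fst (F z) = dist (nchart d z) (s i)" if "z \<in> tri d" "cmod z < e" for z
  using iso[OF inN[OF that] N(2)] cone_dist_apex[OF f(1)[OF inN[OF that]]] f(2) by (simp add: F_def)
 define U where "U = otri d \<inter> ball 0 e"
 have U: "open U" "connected U" "convex U" unfolding U_def by (auto intro!: convex_connected convex_Int convex_otri open_otri)
 have Ut: "z \<in> tri d" "cmod z < e" if "z \<in> U" for z using that otri_subset_tri by (auto simp: U_def)
 have loc: "locally_into_cone \<alpha> F z" if z: "z \<in> U" for z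
 proof -
  have nc: "z ~= 0" "z ~= cr (len T d)" "z ~= tip T d" using z by (auto simp: U_def otri_def)
  obtain e2 where e2: "e2 > 0" "!!u v. u \<in> tri d \<inter> ball z e2 ==> v \<in> tri d \<inter> ball z e2 ==> dist (nchart d u) (nchart d v) = dist u v"
   using nchart_isometric[OF d(1) Ut(1)[OF z] nc] by blast
  obtain e3 where e3: "e3 > 0" "ball z e3 \<subseteq> U" using openE[OF U(1) z] .
  have "F u \<in> cone \<alpha> \<and> cone_dist \<alpha> (F u) (F v) = dist u v" if uv: "u \<in> ball z (min e2 e3)" "v \<in> ball z (min e2 e3)" for u v
  proof -
   have "u \<in> U" "v \<in> U" using uv e3 by auto
   thus ?thesis using f(1)[OF inN[OF Ut]] iso[OF inN[OF Ut] inN[OF Ut]] e2(2)[of u v] uv Ut(1) by (auto simp: F_def)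
  qed
  moreover have "0 < min e2 e3" using e2 e3 by simp
  ultimately show ?thesis unfolding locally_into_cone_def by blast
 qed
 have pos: "0 < fst (F z)" if "z \<in> U" for z
  using rad[OF Ut[OF that]] interior_not_singular[OF d(1), of z] that by (auto simp: U_def)
 define w l where "w = tip T d" and "l = len T d"
 have wl: "0 < Im w" "0 < l" "0 < cmod w + l" using tip_props(1)[OF d(1)] d by (auto simp: w_def l_def intro: add_nonneg_pos)
 have Aw: "0 < Arg w" using Arg_upper_half_plane[OF wl(1)] by simp
 have pick: "\<exists>z\<in>U. cmod z < \<eta>" if h: "0 < \<eta>" for \<eta>
 proof -
  define m where "m = min (min \<eta> e) (l * Im w / (cmod w + l))"
  define t where "t = m / 2"
  have "0 < m" "m <= \<eta>" "m <= e" "m <= l * Im w / (cmod w + l)" using h e(1) wl by (simp_all add: m_def)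
  moreover from this have "0 < t" "t < m" by (simp_all add: t_def)
  ultimately have t: "0 < t" "t < \<eta>" "t < e" "t < l * Im w / (cmod w + l)" by linarith+
  have "rcis t (Arg w / 2) \<in> otri d"
   unfolding w_def using t wl Aw by (intro small_sector[OF d(1)]) (auto simp: w_def[symmetric] l_def[symmetric] pos_less_divide_eq)
  thus ?thesis using t by (intro bexI[of _ "rcis t (Arg w / 2)"]) (auto simp: U_def)
 qed
 have radU: "fst (F z) = cmod z" if "z \<in> U" for z
 proof (rule cone_radius_is_modulus[OF U(1,2) loc pos _ that])
  fix h :: real assume h: "0 < h"
  obtain e' where e': "e' > 0" "!!z. z \<in> tri d ==> cmod z < e' ==> dist (nchart d z) (s i) < h" using near[OF h] by blast
  obtain y where "y \<in> U" "cmod y < min h e'" using pick[of "min h e'"] h e' by auto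
  thus "\<exists>z\<in>U. cmod z < h \<and> fst (F z) < h" using rad[OF Ut] e'(2) Ut(1) by (intro bexI[of _ y]) auto
 qed
 have "fst (F z) = cmod z" if z: "z \<in> tri d" "cmod z < e" for z
 proof -
  obtain c where c: "c \<in> U" using pick[of 1] by auto
  define y where "y = (%n. z + cr (1 / real (Suc n)) * (c - z))"
  have yU: "y n \<in> U" for n
  proof -
   have "y n \<in> otri d" unfolding y_def using c by (intro segment_into_otri[OF z(1)]) (auto simp: U_def)
   moreover have "z + cr q * (c - z) = (1 - q) *\<^sub>R z + q *\<^sub>R c" for q by (simp add: scaleR_conv_of_real algebra_simps)
   hence "y n = (1 - 1 / real (Suc n)) *\<^sub>R z + (1 / real (Suc n)) *\<^sub>R c" unfolding y_def .
   hence "y n \<in> ball 0 e" using convexD_alt[OF convex_ball, of z 0 e c "1 / real (Suc n)"] z c by (auto simp: U_def)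
   ultimately show ?thesis by (simp add: U_def)
  qed
  have "(%n. complex_of_real (1 / real (Suc n))) \<longlonglongrightarrow> cr 0" using LIMSEQ_inverse_real_of_nat by (intro tendsto_of_real) (simp add: inverse_eq_divide)
  hence "(%n. z + cr (1 / real (Suc n)) * (c - z)) \<longlonglongrightarrow> z + cr 0 * (c - z)"
   by (intro tendsto_add tendsto_mult tendsto_const)
  moreover have "z + cr 0 * (c - z) = z" by simp
  ultimately have lim: "y \<longlonglongrightarrow> z" unfolding y_def by (simp only:)
  have "(%n. dist (nchart d (y n)) (s i) - cmod (y n)) \<longlonglongrightarrow> dist (nchart d z) (s i) - cmod z"
   using continuous_on_tendsto_compose[OF nchart_continuous[OF d(1)] lim z(1)] Ut(1)[OF yU] lim by (intro tendsto_intros) auto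
  moreover have "dist (nchart d (y n)) (s i) - cmod (y n) = 0" for n using radU[OF yU] rad[OF Ut[OF yU]] by simp
  ultimately have "(%n. 0) \<longlonglongrightarrow> dist (nchart d z) (s i) - cmod z" by (simp only:)
  hence "dist (nchart d z) (s i) - cmod z = 0" by (simp only: LIMSEQ_const_iff)
  thus ?thesis using rad[OF z] by simp
 qed
 thus ?thesis using e(1) inN loc unfolding U_def F_def by (intro exI[of _ e]) auto
qed

text \<open>
 The circle of small radius around the singular point is parametrised by its angular coordinate in
 \<open>[0, alpha)\<close>.  The open arcs in the faces at this point are mapped to disjoint sets that
 leave out finitely many points, and each is mapped with unit speed.  Hence the lengths of the arcs add
 up to \<open>alpha\<close>.
\<close>

theorem corner_angle_sum:
 assumes \<alpha>: "0 < \<alpha>" and cp: "cone_point \<alpha> (s i)"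
 shows "(\<Sum>d | d \<in> darts T \<and> orig T d = i. Arg (tip T d)) = \<alpha>"
proof -
 obtain N W and f :: "'m => real \<times> real" where N: "open N" "s i \<in> N" and W: "cone_open \<alpha> W" "f ` N = W" and f0: "f (s i) = (0, 0)"
  and iso: "!!x y. x \<in> N ==> y \<in> N ==> cone_dist \<alpha> (f x) (f y) = dist x y"
  using cp unfolding cone_point_def by blast
 have fc: "f x \<in> cone \<alpha>" if "x \<in> N" for x using W that unfolding cone_open_def by blast
 have finj: "x = y" if "x \<in> N" "y \<in> N" "f x = f y" for x y
  using iso[OF that(1,2)] iso[OF that(1,1)] that(3) by simp
 define D where "D = {d \<in> darts T. orig T d = i}"
 have finD: "finite D" unfolding D_def by simp
 define \<psi> where "\<psi> = (%d. Arg (tip T d))"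
 have "\<forall>d\<in>D. \<exists>e>0. (\<forall>z\<in>tri d. cmod z < e --> nchart d z \<in> N \<and> fst (f (nchart d z)) = cmod z) \<and>
   (\<forall>z\<in>otri d. cmod z < e --> locally_into_cone \<alpha> (%z. f (nchart d z)) z)"
  using cone_chart_at_corner[where f = f, OF N fc f0 iso] unfolding D_def by blast
 then obtain ed where ed: "!!d. d \<in> D ==> 0 < ed d"
  "!!d z. d \<in> D ==> z \<in> tri d ==> cmod z < ed d ==> nchart d z \<in> N \<and> fst (f (nchart d z)) = cmod z"
  "!!d z. d \<in> D ==> z \<in> otri d ==> cmod z < ed d ==> locally_into_cone \<alpha> (%z. f (nchart d z)) z" by metis
 \<comment> \<open>at radii below these bounds the corners of a face are apart and the opposite side is out of reach\<close>
 define b where "b = (%d. min (min (ed d) (len T d / 2)) (min (cmod (tip T d) / 2) (len T d * Im (tip T d) / (cmod (tip T d) + len T d))))"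
 have wl: "0 < Im (tip T d)" "0 < cmod (tip T d)" "0 < len T d" "0 < cmod (tip T d) + len T d" if "d \<in> D" for d
 proof -
  have d: "d \<in> darts T" using that by (simp add: D_def)
  show 1: "0 < Im (tip T d)" "0 < len T d" using tip_props(1)[OF d] d by auto
  show "0 < cmod (tip T d)" using 1 by auto
  thus "0 < cmod (tip T d) + len T d" using 1 by (intro add_pos_pos)
 qed
 have "0 < b d" if "d \<in> D" for d unfolding b_def using ed(1)[OF that] wl[OF that] by simp
 then obtain e where e: "e > 0" "!!d. d \<in> D ==> e <= b d" using finite_positive_lower_bound[OF finD, of b] by blast
 have eb: "e <= ed d" "2 * e <= len T d" "2 * e <= cmod (tip T d)" "e * (cmod (tip T d) + len T d) <= len T d * Im (tip T d)"
  if "d \<in> D" for d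
  using e(2)[OF that] wl[OF that] by (auto simp: b_def pos_le_divide_eq)
 obtain \<eta> where \<eta>: "\<eta> > 0" "!!p. dist p (s i) < \<eta> ==> \<exists>d\<in>darts T. orig T d = i \<and> (\<exists>z\<in>tri d. cmod z < e \<and> nchart d z = p)"
  using near_singular_point[OF e(1), of i] by blast
 have "(0, 0) \<in> W" using W(2) N(2) f0 by force
 then obtain eW where eW: "eW > 0" "!!v. v \<in> cone \<alpha> ==> cone_dist \<alpha> (0, 0) v < eW ==> v \<in> W" using W(1) unfolding cone_open_def by blast
 define eps where "eps = min e (min \<eta> eW) / 2"
 have eps: "0 < eps" "eps < e" "eps < \<eta>" "eps < eW" using e \<eta> eW by (auto simp: eps_def)
 define X where "X = (%d \<theta>. snd (f (nchart d (rcis eps \<theta>))))"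
 have sector: "rcis eps \<theta> \<in> otri d" "nchart d (rcis eps \<theta>) \<in> N" "f (nchart d (rcis eps \<theta>)) = (eps, X d \<theta>)" "0 <= X d \<theta>" "X d \<theta> < \<alpha>"
  if d: "d \<in> D" and \<theta>: "\<theta> \<in> {0<..<\<psi> d}" for d \<theta>
 proof -
  have dd: "d \<in> darts T" using d by (simp add: D_def)
  have "eps * (cmod (tip T d) + len T d) < e * (cmod (tip T d) + len T d)" using eps wl[OF d] by (intro mult_strict_right_mono)
  thus o: "rcis eps \<theta> \<in> otri d" using eps \<theta> eb(4)[OF d] by (intro small_sector[OF dd]) (auto simp: \<psi>_def)
  have c: "cmod (rcis eps \<theta>) < ed d" using eps eb(1)[OF d] by simp
  show n: "nchart d (rcis eps \<theta>) \<in> N" and r: "f (nchart d (rcis eps \<theta>)) = (eps, X d \<theta>)"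
   using ed(2)[OF d _ c] o otri_subset_tri eps(1) by (auto simp: X_def prod_eq_iff)
  show "0 <= X d \<theta>" "X d \<theta> < \<alpha>" using fc[OF n] unfolding r by (auto simp: cone_def)
 qed
 have inj: "d = d' \<and> \<theta> = \<theta>'" if d: "d \<in> D" "d' \<in> D" and \<theta>: "\<theta> \<in> {0<..<\<psi> d}" "\<theta>' \<in> {0<..<\<psi> d'}" and eq: "X d \<theta> = X d' \<theta>'" for d d' \<theta> \<theta>'
 proof -
  note A = sector[OF d(1) \<theta>(1)] and B = sector[OF d(2) \<theta>(2)]
  have dd: "d \<in> darts T" "d' \<in> darts T" using d by (auto simp: D_def)
  have "nchart d (rcis eps \<theta>) = nchart d' (rcis eps \<theta>')" by (rule finj[OF A(2) B(2)]) (simp only: A(3) B(3) eq)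
  note I = nchart_inj_interior[OF dd A(1) subsetD[OF otri_subset_tri B(1)] this]
  have "d' = d \<and> rcis eps \<theta>' = rcis eps \<theta>"
   by (rule corner_separation[OF dd(1) I]) (use eps eb[OF d(1)] in auto)
  hence "d' = d" "cis \<theta>' = cis \<theta>" using eps(1) by (auto simp: rcis_def)
  moreover have "\<psi> d < pi" "\<psi> d' < pi" unfolding \<psi>_def using Arg_upper_half_plane(2) wl(1) d by blast+
  hence "\<bar>\<theta>' - \<theta>\<bar> < 2 * pi" using \<theta> unfolding greaterThanLessThan_iff by linarith
  ultimately show ?thesis using cis_inj_small by blast
 qed
 define S where "S = (%d. {0<..<\<psi> d} - {\<theta> \<in> {0<..<\<psi> d}. X d \<theta> = 0})"
 have piece: "X d ` S d \<in> lmeasurable" "measure lebesgue (X d ` S d) = \<psi> d" if d: "d \<in> D" for d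
 proof -
  have "inj_on (X d) {0<..<\<psi> d}" using inj[OF d d] by (intro inj_onI) blast
  moreover have "{\<theta> \<in> {0<..<\<psi> d}. X d \<theta> = 0} = {0<..<\<psi> d} \<inter> X d -` {0}" by auto
  ultimately have fin: "finite {\<theta> \<in> {0<..<\<psi> d}. X d \<theta> = 0}" using finite_vimage_IntI[of "{0}" "X d" "{0<..<\<psi> d}"] by (simp add: Int_commute)
  have neg: "negligible (({0<..<\<psi> d} - S d) \<union> (S d - {0<..<\<psi> d}))"
   by (rule negligible_finite, rule finite_subset[OF _ fin]) (auto simp: S_def)
  have I: "{0<..<\<psi> d} \<in> lmeasurable" by (rule lmeasurable_interval)
  have m: "S d \<in> lmeasurable" by (rule lmeasurable_negligible_symdiff[OF I neg])
  have "\<psi> d > 0" unfolding \<psi>_def using Arg_upper_half_plane(1) wl(1)[OF d] by blast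
  hence mS: "measure lebesgue (S d) = \<psi> d" using measure_negligible_symdiff[OF I neg] by simp
  have der: "\<exists>\<sigma>. \<bar>\<sigma>\<bar> = 1 \<and> (X d has_real_derivative \<sigma>) (at \<theta>)" if \<theta>: "\<theta> \<in> S d" for \<theta>
  proof -
   have t: "\<theta> \<in> {0<..<\<psi> d}" "X d \<theta> ~= 0" using \<theta> by (auto simp: S_def)
   note A = sector[OF d t(1)]
   have c: "cmod (rcis eps \<theta>) < ed d" using eps eb(1)[OF d] by simp
   have "open (otri d \<inter> ball 0 (ed d))" by (intro open_Int open_otri) auto
   then obtain dlt where "dlt > 0" "ball (rcis eps \<theta>) dlt \<subseteq> otri d \<inter> ball 0 (ed d)" using A(1) c openE[of "otri d \<inter> ball 0 (ed d)" "rcis eps \<theta>"] by auto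
   hence rad: "\<exists>dlt>0. \<forall>z\<in>ball (rcis eps \<theta>) dlt. fst (f (nchart d z)) = cmod z"
    using ed(2)[OF d] otri_subset_tri by (intro exI[of _ dlt]) (auto simp: subset_iff)
   show ?thesis unfolding X_def
    by (rule angular_coordinate_derivative[OF ed(3)[OF d A(1) c] eps(1) rad]) (use A(4) t(2) in \<open>simp add: X_def\<close>)
  qed
  have injS: "inj_on (X d) (S d)" using inj[OF d d] by (intro inj_onI) (auto simp: S_def)
  show "X d ` S d \<in> lmeasurable" "measure lebesgue (X d ` S d) = \<psi> d" using measure_image_unit_speed[OF m der injS] mS by auto
 qed
 define A where "A = (\<Union>d\<in>D. X d ` S d)"
 have mA: "measure lebesgue A = (\<Sum>d\<in>D. \<psi> d)"
 proof -
  have "pairwise (%d d'. disjnt (X d ` S d) (X d' ` S d')) D"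
   unfolding pairwise_def disjnt_def using inj by (auto simp: S_def)
  hence "measure lebesgue A = (\<Sum>d\<in>D. measure lebesgue (X d ` S d))" unfolding A_def using finD piece(1) by (intro measure_UNION') auto
  thus ?thesis using piece(2) by simp
 qed
 \<comment> \<open>the angular coordinates of the sides of the faces, and the coordinate at which the circle is cut open\<close>
 define E where "E = insert 0 ((%d. snd (f (nchart d (cr eps)))) ` D \<union> (%d. snd (f (nchart d (cr eps * (tip T d / cr (len T (prv T d))))))) ` D)"
 have cover: "x \<in> A" if x: "0 <= x" "x < \<alpha>" "x \<notin> E" for x
 proof -
  have v: "(eps, x) \<in> cone \<alpha>" using x eps by (auto simp: cone_def)
  have "cone_dist \<alpha> (0, 0) (eps, x) = eps" using eps(1) by (simp add: cone_dist_def)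
  then obtain p where p: "p \<in> N" "f p = (eps, x)" using eW(2)[OF v] eps(4) W(2) by auto
  have "dist p (s i) = eps" using iso[OF p(1) N(2)] cone_dist_apex[OF v] p(2) f0 by simp
  then obtain d z where d: "d \<in> D" and z: "z \<in> tri d" "cmod z < e" "nchart d z = p" using \<eta>(2)[of p] eps(3) by (auto simp: D_def)
  have dd: "d \<in> darts T" using d by (simp add: D_def)
  have n: "nxt T d \<in> darts T" "prv T d \<in> darts T" using dd by auto
  have cz: "cmod z = eps" using ed(2)[OF d z(1)] z(2,3) eb(1)[OF d] p(2) by simp
  have snd: "snd (f (nchart d z)) = x" using p(2) z(3) by simp
  have "cmod z * (cmod (tip T d) + len T d) < e * (cmod (tip T d) + len T d)" using z(2) wl[OF d] by (intro mult_strict_right_mono)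
  hence far: "0 < Im ((z - cr (len T d)) * cnj (tip T d - cr (len T d)))" using eb(4)[OF d] by (intro third_side_far dd) linarith
  from tri_cases[OF dd z(1)] show ?thesis
  proof (elim disjE exE conjE)
   assume o: "z \<in> otri d"
   note P = otri_polar[OF dd o]
   have "X d (Arg z) = x" using snd P(3) unfolding cz X_def by simp
   moreover have "x ~= 0" using x(3) by (auto simp: E_def)
   ultimately show ?thesis using P d unfolding A_def by (intro UN_I[of d] image_eqI[of _ _ "Arg z"]) (auto simp: S_def \<psi>_def)
  next
   assume "z = 0" thus ?thesis using cz eps by simp
  next
   assume "z = cr (len T d)" thus ?thesis using far by simp
  next
   assume "z = tip T d" thus ?thesis using cz eps eb(3)[OF d] by simp
  next
   fix t assume "0 < t" "t < len T d" "z = cr t"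
   hence "z = cr eps" using cz by simp
   hence "x \<in> E" unfolding E_def using snd d by blast
   thus ?thesis using x(3) by blast
  next
   fix t assume t: "0 < t" "z = frame_nxt d (cr t)"
   define u where "u = side_dir d"
   have uu: "u * cnj u = 1" using side_dir(1)[OF dd] complex_norm_square[of u] by (simp add: u_def)
   have "(z - cr (len T d)) * cnj (tip T d - cr (len T d)) = cr (t * len T (nxt T d)) * (u * cnj u)"
    unfolding side_dir(2)[OF dd] t(2) frame_nxt_def u_def[symmetric] by simp
   thus ?thesis using far unfolding uu by simp
  next
   fix t assume t: "0 < t" "t < len T (prv T d)" "z = frame_nxt d (frame_nxt (nxt T d) (cr t))"
   define k where "k = tip T d / cr (len T (prv T d))"
   have "cmod k = 1" using tip_props(2)[OF dd] len_pos[OF n(2)] by (simp add: k_def norm_divide)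
   moreover have zk: "z = cr (len T (prv T d) - t) * k" using t(3) tip_nxt_nxt[OF dd, of "cr t"] by (simp add: k_def)
   ultimately have "cmod z = len T (prv T d) - t" using t(2) by (simp add: norm_mult del: of_real_diff)
   hence "len T (prv T d) - t = eps" using cz by simp
   hence "z = cr eps * k" using zk by (simp only:)
   hence "x \<in> E" unfolding E_def using snd d k_def by blast
   thus ?thesis using x(3) by blast
  qed
 qed
 have sub: "A \<subseteq> {0..<\<alpha>}" unfolding A_def using sector(4,5) by (auto simp: S_def)
 have "negligible (({0..<\<alpha>} - A) \<union> (A - {0..<\<alpha>}))"
 proof (rule negligible_finite, rule finite_subset)
  show "({0..<\<alpha>} - A) \<union> (A - {0..<\<alpha>}) \<subseteq> E"
  proof
   fix x assume "x \<in> ({0..<\<alpha>} - A) \<union> (A - {0..<\<alpha>})"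
   hence "0 <= x" "x < \<alpha>" "x \<notin> A" using sub by auto
   thus "x \<in> E" using cover[of x] by blast
  qed
  show "finite E" unfolding E_def using finD by simp
 qed
 moreover have "{0..<\<alpha>} \<in> lmeasurable" by (rule lmeasurable_negligible_symdiff[of "{0..\<alpha>}"]) (auto intro!: negligible_finite finite_subset[of _ "{\<alpha>}"])
 ultimately have "measure lebesgue A = measure lebesgue {0..<\<alpha>}" by (intro measure_negligible_symdiff)
 also have "\<dots> = \<alpha>" using \<alpha> by simp
 finally show ?thesis using mA by (simp add: D_def \<psi>_def)
qed

end

section \<open>Independence of the triangulation\<close>

lemma acot_eq_Arg:
 assumes "0 < Im w" shows "acot (Re w / Im w) = Arg w"
proof -
 define \<theta> where "\<theta> = Arg w"
 have t: "0 < \<theta>" "\<theta> < pi" using Arg_upper_half_plane[OF assms] by (auto simp: \<theta>_def)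
 have w: "w = rcis (cmod w) \<theta>" by (simp add: \<theta>_def rcis_cmod_Arg)
 have s: "0 < sin \<theta>" using t by (intro sin_gt_zero) auto
 have "cmod w ~= 0" using assms by auto
 moreover have "Re w = cmod w * cos \<theta>" "Im w = cmod w * sin \<theta>" using arg_cong[OF w, of Re] arg_cong[OF w, of Im] by simp_all
 ultimately have "Re w / Im w = cos \<theta> / sin \<theta>" by simp
 also have "\<dots> = tan (pi / 2 - \<theta>)" by (simp add: tan_def sin_diff cos_diff)
 finally have "arctan (Re w / Im w) = pi / 2 - \<theta>" using t by (intro arctan_unique) auto
 thus ?thesis by (simp add: acot_def \<theta>_def)
qed

lemma tendsto_ratio_far:
 fixes L k p a b :: real
 shows "((%c. ((L + c) * k - p) / (sqrt (a + c) * sqrt (b + c))) \<longlongrightarrow> k) at_top"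
proof -
 have z: "((%c. x / c) \<longlongrightarrow> 0) at_top" for x :: real
  by (rule tendsto_divide_0[OF tendsto_const]) (rule filterlim_at_top_imp_at_infinity[OF filterlim_ident])
 have "((%c. ((1 + L / c) * k - p / c) / (sqrt (1 + a / c) * sqrt (1 + b / c))) \<longlongrightarrow>
   ((1 + 0) * k - 0) / (sqrt (1 + 0) * sqrt (1 + 0))) at_top"
  by (intro tendsto_intros z) simp
 moreover have "eventually (%c. ((1 + L / c) * k - p / c) / (sqrt (1 + a / c) * sqrt (1 + b / c)) =
   ((L + c) * k - p) / (sqrt (a + c) * sqrt (b + c))) at_top"
  using eventually_gt_at_top[of 0]
 proof eventually_elim
  fix c :: real assume c: "0 < c"
  have s: "sqrt (x + c) = sqrt c * sqrt (1 + x / c)" for x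
   using c by (simp add: real_sqrt_mult[symmetric] algebra_simps)
  have "(L + c) * k - p = c * ((1 + L / c) * k - p / c)" using c by (simp add: field_simps)
  moreover have "sqrt (a + c) * sqrt (b + c) = c * (sqrt (1 + a / c) * sqrt (1 + b / c))"
   unfolding s using c by (simp add: mult.assoc mult.left_commute)
  ultimately show "((1 + L / c) * k - p / c) / (sqrt (1 + a / c) * sqrt (1 + b / c)) =
   ((L + c) * k - p) / (sqrt (a + c) * sqrt (b + c))" using c by simp
 qed
 ultimately show ?thesis by (simp add: tendsto_cong)
qed

text \<open>
 The apex is moved away from all faces at once: in every pyramid its foot stays, and the square of its
 height grows by \<open>c\<close>.
\<close>

definition lift_apex :: "real^'v::finite => real => real^'v" where
 "lift_apex r c = (\<chi> i. sqrt ((r $ i)^2 + c))"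

context surface_triangulation
begin

lemma lift_apex_simps:
 assumes c: "0 <= c"
 shows "(lift_apex r c $ i)^2 = (r $ i)^2 + c" "foot_along T (lift_apex r c) d = foot_along T r d"
  "inset T (lift_apex r c) d = inset T r d" "line_dist2 T (lift_apex r c) d = line_dist2 T r d + c"
  "height2 T (lift_apex r c) d = height2 T r d + c" "bend (lift_apex r c) d = bend r d"
proof -
 show 1: "(lift_apex r c $ i)^2 = (r $ i)^2 + c" for i using c by (simp add: lift_apex_def)
 show 2: "foot_along T (lift_apex r c) d = foot_along T r d" by (simp add: foot_along_def 1)
 show 3: "inset T (lift_apex r c) d = inset T r d" for d by (simp add: inset_def foot_along_def 1)
 show "line_dist2 T (lift_apex r c) d = line_dist2 T r d + c" by (simp add: line_dist2_def 1 2)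
 thus "height2 T (lift_apex r c) d = height2 T r d + c" by (simp add: height2_def 3)
 show "bend (lift_apex r c) d = bend r d" by (simp add: bend_def 3)
qed

lemma lift_apex_0: "admissible r ==> lift_apex r 0 = r"
 by (simp add: lift_apex_def vec_eq_iff admissibleD(1) less_imp_le)

lemma admissible_lift_apex:
 assumes r: "admissible r" and c: "0 <= c" shows "admissible (lift_apex r c)"
 unfolding admissible_def lift_apex_simps[OF c]
proof (intro conjI allI ballI)
 fix i
 have "0 < (r $ i)^2" using admissibleD(1)[OF r, of i] by simp
 thus "0 < lift_apex r c $ i" using c by (auto simp: lift_apex_def intro: add_pos_nonneg)
next
 fix d assume "d \<in> darts T"
 thus "0 < height2 T r d + c" using admissibleD(2)[OF r] c by (simp add: add_pos_nonneg)
qed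

text \<open>
 From far away a pyramid looks like a prism, whose dihedral angles are the angles of its base.
\<close>

lemma kappa_far_apex:
 assumes r: "admissible r"
 shows "((%c. kappa T (lift_apex r c) i) \<longlongrightarrow> 2 * pi - (\<Sum>d | d \<in> darts T \<and> orig T d = i. Arg (tip T d))) at_top"
proof -
 have "((%c. side_dihedral T (lift_apex r c) d) \<longlongrightarrow> Arg (tip T d)) at_top" if d: "d \<in> darts T" for d
 proof -
  define k where "k = Re (tip T d) / Im (tip T d)"
  have eq: "side_dihedral T (lift_apex r c) d =
   acot (((line_dist2 T r d + c) * k - foot_along T r d * inset T r d) / (sqrt ((r $ orig T d)^2 + c) * sqrt (height2 T r d + c)))" if c: "0 <= c" for c
   unfolding side_dihedral_eq[OF d admissible_lift_apex[OF r c]] side_cot_def apex_height_def lift_apex_simps[OF c] k_def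
   by (simp add: lift_apex_def)
  have ev: "eventually (%c. acot (((line_dist2 T r d + c) * k - foot_along T r d * inset T r d) / (sqrt ((r $ orig T d)^2 + c) * sqrt (height2 T r d + c)))
   = side_dihedral T (lift_apex r c) d) at_top"
   by (rule eventually_mono[OF eventually_ge_at_top[of 0]]) (rule eq[symmetric])
  have "((%c. acot (((line_dist2 T r d + c) * k - foot_along T r d * inset T r d) / (sqrt ((r $ orig T d)^2 + c) * sqrt (height2 T r d + c)))) \<longlongrightarrow> acot k) at_top"
   unfolding acot_def by (intro tendsto_intros tendsto_ratio_far)
  thus ?thesis using tendsto_cong[OF ev] acot_eq_Arg[OF tip_props(1)[OF d]] by (simp add: k_def)
 qed
 thus ?thesis unfolding kappa_def omega_def by (intro tendsto_intros) auto
qed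

end

text \<open>
 The summand of the Jacobian that belongs to a dart, written with data that convex triangulations share.
\<close>

definition shared_edge_term :: "'v => real^'v::finite => real^'v => 'v => 'v => real => real => real => real" where
 "shared_edge_term k r v i j l a b = (if i = k then
   (let p = ((r $ i)^2 + l^2 - (r $ j)^2) / (2 * l); q = (r $ i)^2 - p^2
   in (a / sqrt (q - a^2) + b / sqrt (q - b^2)) * ((r $ i * ((r $ i * v $ i - r $ j * v $ j) / l) - p * v $ i) / q)) else 0)"

definition shared_bend_term :: "real^'v::finite => 'v => 'v => real => real => real => real" where
 "shared_bend_term r i j l a b =
   (let p = ((r $ i)^2 + l^2 - (r $ j)^2) / (2 * l); q = (r $ i)^2 - p^2
   in l * (pi - (arccos (a / sqrt q) + arccos (b / sqrt q))))"

context surface_triangulation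
begin

text \<open>
 Where the bend vanishes the two cotangents cancel, and the angle at the edge is \<open>pi\<close>.
\<close>

lemma sum_over_strict_edges:
 assumes r: "admissible r" and conv: "!!d. d \<in> darts T ==> 0 <= bend r d"
 shows "(\<Sum>d | d \<in> darts T \<and> orig T d = k. edge_cot T r d * edge_rate T r v d) =
   (\<Sum>d | d \<in> darts T \<and> 0 < bend r d. shared_edge_term k r v (orig T d) (orig T (nxt T d)) (len T d) (inset T r d) (inset T r (opp T d)))"
  "(\<Sum>d\<in>darts T. len T d * (pi - theta T r d)) =
   (\<Sum>d | d \<in> darts T \<and> 0 < bend r d. shared_bend_term r (orig T d) (orig T (nxt T d)) (len T d) (inset T r d) (inset T r (opp T d)))"
proof -
 have flat: "bend r d = 0" if "d \<in> darts T" "\<not> 0 < bend r d" for d using conv[OF that(1)] that(2) by simp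
 have t: "shared_edge_term k r v (orig T d) (orig T (nxt T d)) (len T d) (inset T r d) (inset T r (opp T d))
   = (if orig T d = k then edge_cot T r d * edge_rate T r v d else 0)" if d: "d \<in> darts T" for d
  unfolding shared_edge_term_def Let_def edge_cot_def edge_rate_def foot_along_deriv_def apex_height_def height2_def line_dist2_opp[OF d]
  by (simp add: line_dist2_def foot_along_def)
 have "(\<Sum>d | d \<in> darts T \<and> orig T d = k. edge_cot T r d * edge_rate T r v d) = (\<Sum>d\<in>darts T. if orig T d = k then edge_cot T r d * edge_rate T r v d else 0)"
  by (rule sum.inter_filter) simp
 also have "\<dots> = (\<Sum>d | d \<in> darts T \<and> 0 < bend r d. if orig T d = k then edge_cot T r d * edge_rate T r v d else 0)"
  by (rule sum.mono_neutral_right) (use flat edge_cot_sign(2)[OF _ r, folded bend_def] in auto)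
 also have "\<dots> = (\<Sum>d | d \<in> darts T \<and> 0 < bend r d. shared_edge_term k r v (orig T d) (orig T (nxt T d)) (len T d) (inset T r d) (inset T r (opp T d)))"
  by (rule sum.cong) (use t in auto)
 finally show "(\<Sum>d | d \<in> darts T \<and> orig T d = k. edge_cot T r d * edge_rate T r v d) =
   (\<Sum>d | d \<in> darts T \<and> 0 < bend r d. shared_edge_term k r v (orig T d) (orig T (nxt T d)) (len T d) (inset T r d) (inset T r (opp T d)))" .
 have b: "shared_bend_term r (orig T d) (orig T (nxt T d)) (len T d) (inset T r d) (inset T r (opp T d)) = len T d * (pi - theta T r d)" if d: "d \<in> darts T" for d
 proof -
  have o: "opp T d \<in> darts T" using d by simp
  show ?thesis unfolding shared_bend_term_def Let_def theta_def base_dihedral_eq(2)[OF d r] base_dihedral_eq(2)[OF o r] line_dist_def line_dist2_opp[OF d]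
   by (simp add: line_dist2_def foot_along_def)
 qed
 have "(\<Sum>d\<in>darts T. len T d * (pi - theta T r d)) = (\<Sum>d | d \<in> darts T \<and> 0 < bend r d. len T d * (pi - theta T r d))"
 proof (rule sum.mono_neutral_right)
  have "len T d * (pi - theta T r d) = 0" if "d \<in> darts T" "\<not> 0 < bend r d" for d
   using flat[OF that] theta_le_pi_iff(2)[OF that(1) r, folded bend_def] by simp
  thus "\<forall>d\<in>darts T - {d \<in> darts T. 0 < bend r d}. len T d * (pi - theta T r d) = 0" by blast
 qed auto
 also have "\<dots> = (\<Sum>d | d \<in> darts T \<and> 0 < bend r d. shared_bend_term r (orig T d) (orig T (nxt T d)) (len T d) (inset T r d) (inset T r (opp T d)))"
  by (rule sum.cong) (use b in auto)
 finally show "(\<Sum>d\<in>darts T. len T d * (pi - theta T r d)) =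
   (\<Sum>d | d \<in> darts T \<and> 0 < bend r d. shared_bend_term r (orig T d) (orig T (nxt T d)) (len T d) (inset T r d) (inset T r (opp T d)))" .
qed

end

context two_convex_triangulations
begin

lemma edge_sum_eq:
 assumes a: "A.admissible r" and b: "B.admissible r"
 shows "(\<Sum>d | d \<in> darts T' \<and> orig T' d = i. edge_cot T' r d * edge_rate T' r v d) = (\<Sum>d | d \<in> darts T \<and> orig T d = i. edge_cot T r d * edge_rate T r v d)"
 using A.sum_over_strict_edges(1)[where k = i and v = v, OF a] B.sum_over_strict_edges(1)[where k = i and v = v, OF b] convA convB
  strict_edge_sum[of "shared_edge_term i r v"] by (simp add: shared_edge_term_def Let_def add.commute)

lemma jacobian_eq:
 assumes a: "A.admissible r" and b: "B.admissible r"
 shows "B.jacobian r i j = A.jacobian r i j"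
 unfolding A.jacobian_def B.jacobian_def edge_sum_eq[OF a b] ..

lemma lift: "0 <= c ==> two_convex_triangulations s T T' (lift_apex r c)"
 by unfold_locales (use convA convB in \<open>auto simp: A.lift_apex_simps B.lift_apex_simps\<close>)

text \<open>
 The difference of the curvatures is constant along \<open>lift_apex\<close>, and its limit is the
 difference of the two sums of corner angles, which both are the cone angle.
\<close>

theorem kappa_eq:
 assumes a: "A.admissible r" and b: "B.admissible r"
 shows "kappa T' r i = kappa T r i"
proof -
 define g where "g = (%c. kappa T' (lift_apex r c) i - kappa T (lift_apex r c) i)"
 have der: "(g has_real_derivative 0) (at c)" if c: "0 <= c" for c
 proof -
  interpret L: two_convex_triangulations s T T' "lift_apex r c" by (rule lift[OF c])
  define v :: "real^'v" where "v = (\<chi> i. 1 / (2 * sqrt ((r $ i)^2 + c)))"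
  have dy: "((%c. lift_apex r c $ i) has_real_derivative v $ i) (at c)" for i
  proof -
   have "0 < (r $ i)^2 + c" using A.admissibleD(1)[OF a, of i] c by (intro add_pos_nonneg) auto
   thus ?thesis unfolding lift_apex_def v_def by (auto intro!: derivative_eq_intros simp: field_simps)
  qed
  note ad = A.admissible_lift_apex[OF a c] B.admissible_lift_apex[OF b c]
  have "(g has_real_derivative
    - (\<Sum>d | d \<in> darts T' \<and> orig T' d = i. edge_cot T' (lift_apex r c) d * edge_rate T' (lift_apex r c) v d)
    - - (\<Sum>d | d \<in> darts T \<and> orig T d = i. edge_cot T (lift_apex r c) d * edge_rate T (lift_apex r c) v d)) (at c)"
   unfolding g_def by (rule DERIV_diff[OF B.kappa_derivative[OF dy ad(2)] A.kappa_derivative[OF dy ad(1)]])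
  thus ?thesis unfolding L.edge_sum_eq[OF ad] by (simp only: cancel_comm_monoid_add_class.diff_cancel)
 qed
 have const: "g c = g 0" if "0 <= c" for c
 proof (cases "c = 0")
  case False
  hence "0 < c" using that by simp
  thus ?thesis
  proof (rule DERIV_isconst_end)
   show "continuous_on {0..c} g" by (rule DERIV_continuous_on) (rule has_field_derivative_at_within[OF der], simp)
   show "(g has_real_derivative 0) (at x)" if "0 < x" "x < c" for x by (rule der) (use that in simp)
  qed
 qed simp
 obtain \<alpha> where \<alpha>: "\<alpha> > 0" "cone_point \<alpha> (s i)" using A.sphere unfolding polyhedral_sphere_def by blast
 have "(g \<longlongrightarrow> (2 * pi - \<alpha>) - (2 * pi - \<alpha>)) at_top"
  unfolding g_def using A.kappa_far_apex[OF a, of i] B.kappa_far_apex[OF b, of i]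
  unfolding A.corner_angle_sum[OF \<alpha>] B.corner_angle_sum[OF \<alpha>] by (intro tendsto_diff)
 moreover have "(g \<longlongrightarrow> g 0) at_top"
  by (rule tendsto_eventually) (rule eventually_mono[OF eventually_ge_at_top[of 0] const])
 ultimately have "(2 * pi - \<alpha>) - (2 * pi - \<alpha>) = g 0" by (rule tendsto_unique[OF trivial_limit_at_top_linorder])
 hence "g 0 = 0" by (simp only: cancel_comm_monoid_add_class.diff_cancel)
 thus ?thesis unfolding g_def A.lift_apex_0[OF a] by (simp only: right_minus_eq)
qed

theorem total_scalar_curvature_eq:
 assumes a: "A.admissible r" and b: "B.admissible r"
 shows "total_scalar_curvature T' r = total_scalar_curvature T r"
proof -
 have "(\<Sum>d\<in>darts T'. len T' d * (pi - theta T' r d)) = (\<Sum>d\<in>darts T. len T d * (pi - theta T r d))"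
  using A.sum_over_strict_edges(2)[OF a] B.sum_over_strict_edges(2)[OF b] convA convB
   strict_edge_sum[of "shared_bend_term r"] by (simp add: shared_bend_term_def Let_def add.commute)
 thus ?thesis unfolding total_scalar_curvature_def kappa_eq[OF a b] by simp
qed

end

section \<open>Finiteness of the combinatorial types\<close>

context metric_triangulation
begin

lemma card_darts: "card (darts T) + 12 = 6 * CARD('v)"
proof -
 have fin: "finite (darts T)" by simp
 have e: "2 * card (edges T) = card (\<Union>(edges T))"
 proof (rule card_partition)
  show "finite (edges T)" unfolding edges_def by simp
  show "finite (\<Union>(edges T))" unfolding edges_def by auto
  show "card c = 2" if c: "c \<in> edges T" for c
  proof -
   obtain d where d: "d \<in> darts T" "c = {d, opp T d}" using c unfolding edges_def by auto
   have "opp T d ~= d" using tri d(1) unfolding sphere_triangulation_def by blast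
   thus ?thesis unfolding d(2) by auto
  qed
  show "c \<inter> c' = {}" if cc: "c \<in> edges T" "c' \<in> edges T" "c ~= c'" for c c'
  proof -
   obtain d d' where d: "d \<in> darts T" "d' \<in> darts T" "c = {d, opp T d}" "c' = {d', opp T d'}" using cc(1,2) unfolding edges_def by blast
   have o: "opp T (opp T d) = d" "opp T (opp T d') = d'" using d by auto
   show ?thesis using cc(3) o unfolding d(3,4) by auto
  qed
 qed
 have f: "3 * card (faces T) = card (\<Union>(faces T))"
 proof (rule card_partition)
  show "finite (faces T)" unfolding faces_def by simp
  show "finite (\<Union>(faces T))" unfolding faces_def face_def by auto
  show "card c = 3" if c: "c \<in> faces T" for c
  proof -
   obtain d where d: "d \<in> darts T" "c = {d, nxt T d, prv T d}" using c unfolding faces_def face_def by auto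
   have n: "nxt T x ~= x" "prv T (nxt T x) = x" "nxt T x \<in> darts T" if "x \<in> darts T" for x
    using tri that unfolding sphere_triangulation_def by auto
   have "prv T d ~= d" using n(1,2)[OF d(1)] by metis
   thus ?thesis using n(1)[OF d(1)] n(1)[OF n(3)[OF d(1)]] unfolding d(2) by auto
  qed
  show "c \<inter> c' = {}" if cc: "c \<in> faces T" "c' \<in> faces T" "c ~= c'" for c c'
  proof -
   obtain d d' where d: "d \<in> darts T" "d' \<in> darts T" "c = face T d" "c' = face T d'" using cc(1,2) unfolding faces_def by blast
   have eq: "face T x = face T d" if "d \<in> darts T" "x \<in> face T d" for x d
    using that unfolding face_def by auto
   show ?thesis using cc(3) eq[OF d(1)] eq[OF d(2)] unfolding d(3,4) by blast
  qed
 qed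
 have u: "\<Union>(edges T) = darts T" "\<Union>(faces T) = darts T" unfolding edges_def faces_def face_def by auto
 have "int CARD('v) - int (card (edges T)) + int (card (faces T)) = 2" using tri unfolding sphere_triangulation_def by blast
 moreover have "2 * card (edges T) = card (darts T)" "3 * card (faces T) = card (darts T)" using e f unfolding u by auto
 ultimately show ?thesis by linarith
qed

end

text \<open>
 Equal combinatorics and edge lengths: convexity at given radii is determined by these.
\<close>

definition same_type :: "('v::finite, 'm::metric_space) geo_tri => ('v, 'm) geo_tri => bool" where
 "same_type T T' \<longleftrightarrow> (\<exists>f. bij_betw f (darts T) (darts T') \<and>
   (\<forall>d\<in>darts T. opp T' (f d) = f (opp T d) \<and> nxt T' (f d) = f (nxt T d) \<and> orig T' (f d) = orig T d \<and> len T' (f d) = len T d))"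

lemma gen_convex_polytope_same_type:
 assumes P: "gen_convex_polytope s T r" and T': "geodesic_triangulation s T'" and st: "same_type T T'"
 shows "gen_convex_polytope s T' r"
proof -
 obtain f where f: "bij_betw f (darts T) (darts T')" and F: "!!d. d \<in> darts T ==> opp T' (f d) = f (opp T d)"
  "!!d. d \<in> darts T ==> nxt T' (f d) = f (nxt T d)" "!!d. d \<in> darts T ==> orig T' (f d) = orig T d" "!!d. d \<in> darts T ==> len T' (f d) = len T d"
  using st unfolding same_type_def by blast
 have c: "opp T d \<in> darts T" "nxt T d \<in> darts T" if "d \<in> darts T" for d
  using P that unfolding gen_convex_polytope_def geodesic_triangulation_def sphere_triangulation_def by auto
 have pyr: "is_pyramid T' r (f d) = is_pyramid T r d" if d: "d \<in> darts T" for d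
  unfolding is_pyramid_def F(2)[OF d] F(2)[OF c(2)[OF d]] F(3)[OF d] F(3)[OF c(2)[OF d]] F(3)[OF c(2)[OF c(2)[OF d]]]
   F(4)[OF d] F(4)[OF c(2)[OF d]] F(4)[OF c(2)[OF c(2)[OF d]]] ..
 have bd: "base_dihedral T' r (f d) = base_dihedral T r d" if d: "d \<in> darts T" for d
  unfolding base_dihedral_def pyramid_def pyr[OF d] ..
 have th: "theta T' r (f d) = theta T r d" if d: "d \<in> darts T" for d
  unfolding theta_def F(1)[OF d] bd[OF d] bd[OF c(1)[OF d]] ..
 have surj: "\<exists>d\<in>darts T. e = f d" if "e \<in> darts T'" for e using f that unfolding bij_betw_def by blast
 show ?thesis
  unfolding gen_convex_polytope_def
 proof (intro conjI ballI T')
  show "\<forall>i. 0 < r $ i" using P unfolding gen_convex_polytope_def by blast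
  fix e assume "e \<in> darts T'"
  then obtain d where d: "d \<in> darts T" "e = f d" using surj by blast
  show "\<exists>p. is_pyramid T' r e p" "theta T' r e <= pi" using P d(1) unfolding d(2) pyr[OF d(1)] th[OF d(1)] gen_convex_polytope_def by auto
 qed
qed

definition dart_number :: "('v::finite, 'm::metric_space) geo_tri => nat => nat" where
 "dart_number T = (SOME g. bij_betw g (darts T) {..<card (darts T)})"

text \<open>
 The type as a list of numbers, vertices and lengths, so that counting lists counts types.
\<close>

definition type_code :: "('v::finite, 'm::metric_space) geo_tri => (nat \<times> nat \<times> 'v \<times> real) list" where
 "type_code T = map (%k. let d = inv_into (darts T) (dart_number T) k
   in (dart_number T (opp T d), dart_number T (nxt T d), orig T d, len T d)) [0..<card (darts T)]"

lemma dart_number: "finite (darts T) ==> bij_betw (dart_number T) (darts T) {..<card (darts T)}"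
 unfolding dart_number_def using someI_ex[OF ex_bij_betw_finite_nat[of "darts T"]] by (simp add: atLeast0LessThan)

lemma type_code_nth:
 assumes "finite (darts T)" "d \<in> darts T"
 shows "dart_number T d < length (type_code T)"
  "type_code T ! dart_number T d = (dart_number T (opp T d), dart_number T (nxt T d), orig T d, len T d)"
proof -
 note b = dart_number[OF assms(1)]
 show l: "dart_number T d < length (type_code T)" using b assms(2) by (auto simp: type_code_def bij_betw_def)
 have "inv_into (darts T) (dart_number T) (dart_number T d) = d" using b assms(2) by (simp add: bij_betw_def)
 thus "type_code T ! dart_number T d = (dart_number T (opp T d), dart_number T (nxt T d), orig T d, len T d)"
  using l unfolding type_code_def by (simp add: Let_def)
qed

lemma same_type_code:
 assumes T: "sphere_triangulation T" and T': "sphere_triangulation T'" and eq: "type_code T = type_code T'"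
 shows "same_type T T'"
proof -
 have fin: "finite (darts T)" "finite (darts T')" using T T' by (auto simp: sphere_triangulation_def)
 have n: "card (darts T) = card (darts T')" using arg_cong[OF eq, of length] by (simp add: type_code_def)
 note b = dart_number[OF fin(1)] and b' = dart_number[OF fin(2)]
 define f where "f = inv_into (darts T') (dart_number T') \<circ> dart_number T"
 have f: "bij_betw f (darts T) (darts T')" unfolding f_def using b bij_betw_inv_into[OF b'] unfolding n by (rule bij_betw_trans)
 have num: "dart_number T' (f d) = dart_number T d" if "d \<in> darts T" for d
 proof -
  have "dart_number T d \<in> dart_number T' ` darts T'" using b b' that n unfolding bij_betw_def by auto
  thus ?thesis unfolding f_def comp_def by (rule f_inv_into_f)
 qed
 have inj: "x = y" if "x \<in> darts T'" "y \<in> darts T'" "dart_number T' x = dart_number T' y" for x y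
  using b' that unfolding bij_betw_def inj_on_def by blast
 have "opp T' (f d) = f (opp T d) \<and> nxt T' (f d) = f (nxt T d) \<and> orig T' (f d) = orig T d \<and> len T' (f d) = len T d" if d: "d \<in> darts T" for d
 proof -
  have fd: "f d \<in> darts T'" using f d unfolding bij_betw_def by blast
  have m: "opp T d \<in> darts T" "nxt T d \<in> darts T" "opp T' (f d) \<in> darts T'" "nxt T' (f d) \<in> darts T'"
   using T T' d fd by (auto simp: sphere_triangulation_def)
  have E: "(dart_number T' (opp T' (f d)), dart_number T' (nxt T' (f d)), orig T' (f d), len T' (f d)) =
    (dart_number T (opp T d), dart_number T (nxt T d), orig T d, len T d)"
   using type_code_nth(2)[OF fin(1) d] type_code_nth(2)[OF fin(2) fd] unfolding num[OF d] eq by (simp only:)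
  have "opp T' (f d) = f (opp T d)"
   by (rule inj[OF m(3)]) (use f m(1) E num[OF m(1)] in \<open>auto simp: bij_betw_def\<close>)
  moreover have "nxt T' (f d) = f (nxt T d)"
   by (rule inj[OF m(4)]) (use f m(2) E num[OF m(2)] in \<open>auto simp: bij_betw_def\<close>)
  ultimately show ?thesis using E by simp
 qed
 thus ?thesis unfolding same_type_def using f by blast
qed

context surface_triangulation
begin

lemma edge_length_is_geodesic_length:
 assumes d: "d \<in> darts T"
 shows "\<exists>gam. geodesic_path s gam (len T d) \<and> gam 0 \<in> range s \<and> gam 1 \<in> range s"
 using geodesic_path_edge[OF d] nchart_corners(1,2)[OF d] by (intro exI[of _ "%t. nchart d (cr (t * len T d))"]) simp

end

lemma edge_length_le_radii:
 assumes P: "gen_convex_polytope s T r" and d: "d \<in> darts T"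
 shows "len T d <= 2 * norm r"
proof -
 obtain a x y z where p: "is_pyramid T r d (a, x, y, z)" using P d unfolding gen_convex_polytope_def by (metis prod_cases4)
 have "len T d = dist x y" "dist a x = r $ orig T d" "dist a y = r $ orig T (nxt T d)" using p by (auto simp: is_pyramid_def)
 moreover have "dist x y <= dist a x + dist a y" by (metis dist_commute dist_triangle)
 moreover have "r $ i <= norm r" for i using component_le_norm_cart[of r i] by simp
 ultimately show ?thesis by (smt (verit))
qed

text \<open>
 The number of darts is fixed by Euler's formula, and the lengths of the edges are lengths of geodesics
 bounded by twice the norm of the radii.
\<close>

theorem finitely_many_types:
 fixes s :: "'v::finite => 'm::metric_space"
 assumes s: "polyhedral_sphere s"
 shows "\<exists>\<T>. finite \<T> \<and> (\<forall>T\<in>\<T>. geodesic_triangulation s T) \<and>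
  (\<forall>T y. gen_convex_polytope s T y --> norm y <= B --> (\<exists>T'\<in>\<T>. gen_convex_polytope s T' y))"
proof (cases "\<exists>T0. geodesic_triangulation s T0")
 case False
 thus ?thesis by (intro exI[of _ "{}"]) (auto simp: gen_convex_polytope_def)
next
 case True
 have loc: "surface_triangulation s T" if "geodesic_triangulation s T" for T by unfold_locales (use s that in auto)
 define LEN where "LEN = {L. L <= 2 * B \<and> (\<exists>gam. geodesic_path s gam L \<and> gam 0 \<in> range s \<and> gam 1 \<in> range s)}"
 have fL: "finite LEN" unfolding LEN_def using True surface_triangulation.finite_geodesic_lengths[OF loc] by blast
 define N where "N = 6 * CARD('v) - 12"
 define \<C> where "\<C> = {xs. set xs \<subseteq> {..<N} \<times> {..<N} \<times> (UNIV :: 'v set) \<times> LEN \<and> length xs = N}"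
 have fC: "finite \<C>" unfolding \<C>_def by (intro finite_lists_length_eq finite_cartesian_product fL) auto
 define S where "S = {T. geodesic_triangulation s T \<and> type_code T \<in> \<C>}"
 define rep where "rep = (%c. SOME T. T \<in> S \<and> type_code T = c)"
 have rep: "rep (type_code T) \<in> S \<and> type_code (rep (type_code T)) = type_code T" if "T \<in> S" for T
  unfolding rep_def by (rule someI[of _ T]) (use that in simp)
 have "finite (type_code ` S)" by (rule finite_subset[OF _ fC]) (auto simp: S_def)
 hence 1: "finite (rep ` type_code ` S)" by (rule finite_imageI)
 have 2: "geodesic_triangulation s T" if "T \<in> rep ` type_code ` S" for T using that rep unfolding S_def by auto
 have 3: "\<exists>T'\<in>rep ` type_code ` S. gen_convex_polytope s T' y" if P: "gen_convex_polytope s T y" and y: "norm y <= B" for T y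
 proof -
  have geo: "geodesic_triangulation s T" using P by (simp add: gen_convex_polytope_def)
  interpret surface_triangulation s T by (rule loc[OF geo])
  have fin: "finite (darts T)" by simp
  have N: "card (darts T) = N" using card_darts by (simp add: N_def)
  have bij: "dart_number T d < N" if "d \<in> darts T" for d using dart_number[OF fin] that N by (auto simp: bij_betw_def)
  have len: "len T d \<in> LEN" if "d \<in> darts T" for d
   using edge_length_is_geodesic_length[OF that] edge_length_le_radii[OF P that] y by (simp add: LEN_def)
  have "type_code T \<in> \<C>"
  proof -
   have "type_code T ! k \<in> {..<N} \<times> {..<N} \<times> UNIV \<times> LEN" if k: "k < N" for k
   proof -
    obtain d where d: "d \<in> darts T" "dart_number T d = k" using dart_number[OF fin] k N unfolding bij_betw_def by (metis imageE lessThan_iff)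
    have o: "opp T d \<in> darts T" "nxt T d \<in> darts T" using d by auto
    show ?thesis using type_code_nth(2)[OF fin d(1)] bij[OF o(1)] bij[OF o(2)] len[OF d(1)] unfolding d(2) by simp
   qed
   moreover have "length (type_code T) = N" by (simp add: type_code_def N)
   ultimately show ?thesis unfolding \<C>_def mem_Collect_eq subset_iff in_set_conv_nth by metis
  qed
  hence TS: "T \<in> S" using geo by (simp add: S_def)
  define T' where "T' = rep (type_code T)"
  have T': "geodesic_triangulation s T'" "type_code T' = type_code T" using rep[OF TS] by (auto simp: T'_def S_def)
  have "same_type T T'" by (rule same_type_code) (use geo T' in \<open>auto simp: geodesic_triangulation_def\<close>)
  hence "gen_convex_polytope s T' y" by (rule gen_convex_polytope_same_type[OF P T'(1)])
  thus ?thesis using TS unfolding T'_def by blast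
 qed
 show ?thesis by (rule exI[of _ "rep ` type_code ` S"]) (use 1 2 3 in blast)
qed

section \<open>Convexity as a closed condition\<close>

context surface_triangulation
begin

lemma gen_convex_polytope_iff:
 "gen_convex_polytope s T r \<longleftrightarrow> admissible r \<and> (\<forall>d\<in>darts T. 0 <= bend r d)"
 unfolding gen_convex_polytope_def using geo admissible_iff[of r] theta_le_pi_iff(1)[of _ r] unfolding bend_def by blast

text \<open>
 The points to be avoided lie on edges, and a point of an edge is a limit of points of an adjacent face.
\<close>

lemma interior_points_dense:
 assumes U: "open U" "p \<in> U" and p: "p \<notin> range s"
 shows "\<exists>d\<in>darts T. \<exists>z\<in>otri d. nchart d z \<in> U"
proof (cases rule: point_cases[of p])
 case (1 i) thus ?thesis using p by blast
next
 case (2 d z) thus ?thesis using U by blast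
next
 case (3 d t)
 obtain e where e: "e > 0" "!!z. z \<in> ball (cr t) e ==> 0 <= Im z ==> z \<in> tri d" "!!z. z \<in> ball (cr t) e ==> 0 < Im z ==> z \<in> otri d"
  using edge_half_disc[OF 3(1-3)] by blast
 obtain eps where eps: "eps > 0" "ball p eps \<subseteq> U" using openE[OF U] .
 have "cr t \<in> tri d" using e(1) by (intro e(2)) auto
 then obtain dlt where dlt: "dlt > 0" "!!z. z \<in> tri d ==> dist z (cr t) < dlt ==> dist (nchart d z) p < eps"
  using nchart_continuous[OF 3(1), unfolded continuous_on_iff] eps(1) unfolding 3(4) by blast
 define z where "z = cr t + \<i> * cr (min e dlt / 2)"
 have dz: "dist z (cr t) = min e dlt / 2" using e(1) dlt(1) by (simp add: z_def dist_norm norm_mult)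
 have "z \<in> otri d" using dz e(1) dlt(1) by (intro e(3)) (auto simp: z_def dist_commute)
 moreover have "nchart d z \<in> U"
 proof -
  have "dist (nchart d z) p < eps" using \<open>z \<in> otri d\<close> otri_subset_tri dz e(1) dlt(1) by (intro dlt(2)) auto
  thus ?thesis using eps(2) by (auto simp: dist_commute)
 qed
 ultimately show ?thesis using 3(1) by blast
qed

lemma height_at_face:
 assumes d: "d \<in> darts T" "z \<in> tri d"
 shows "apex_dist2 r (nchart d z) = (cmod (z - foot T r d))^2 + height2 T r d"
 using apex_dist2_nchart[OF d] by (simp add: Q_def)

lemma otri_nonempty:
 assumes d: "d \<in> darts T" shows "otri d ~= {}"
proof -
 define w l where "w = tip T d" and "l = len T d"
 have wl: "0 < Im w" "0 < l" using tip_props(1)[OF d] d by (auto simp: w_def l_def)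
 have "(w + cr l) / 3 \<in> otri d"
  unfolding otri_def mem_Collect_eq w_def[symmetric] l_def[symmetric]
  using wl by (auto simp: field_simps)
 thus ?thesis by blast
qed

end

context two_convex_triangulations
begin

text \<open>
 A face of one triangulation overlaps a face of the other one.  There the squared distance from the apex
 is given by two paraboloids, related by a planar isometry, and a paraboloid determines its minimum.
\<close>

lemma height_matches:
 assumes d: "d \<in> darts T'"
 shows "\<exists>e\<in>darts T. height2 T' r d = height2 T r e"
proof -
 obtain z0 where z0: "z0 \<in> B.otri d" using B.otri_nonempty[OF d] by blast
 obtain eps where eps: "isometric_chart (B.nchart d) z0 eps" "ball z0 eps \<subseteq> B.otri d" using B.face_chart[OF d z0] by blast
 note C = isometric_chartD[OF eps(1)]
 obtain e z1 where e: "e \<in> darts T" "z1 \<in> A.otri e" "A.nchart e z1 \<in> ball (B.nchart d z0) eps"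
  using A.interior_points_dense[of "ball (B.nchart d z0) eps" "B.nchart d z0"] B.interior_not_singular[OF d z0] C(1) by auto
 obtain z where z: "z \<in> ball z0 eps" "B.nchart d z = A.nchart e z1" using C(3)[OF e(3)] by blast
 obtain eps' where eps': "isometric_chart (A.nchart e) z1 eps'" "ball z1 eps' \<subseteq> A.otri e" using A.face_chart[OF e(1,2)] by blast
 note C' = isometric_chartD[OF eps'(1)]
 obtain \<eta>0 where \<eta>0: "\<eta>0 > 0" "ball z \<eta>0 \<subseteq> ball z0 eps" using openE[OF open_ball z(1)] .
 define \<eta> where "\<eta> = min \<eta>0 eps'"
 have \<eta>: "\<eta> > 0" "ball z \<eta> \<subseteq> ball z0 eps" using \<eta>0 C'(1) by (auto simp: \<eta>_def)
 have "\<exists>u\<in>ball z1 eps'. A.nchart e u = B.nchart d x" if x: "x \<in> ball z \<eta>" for x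
 proof -
  have "dist (B.nchart d z) (B.nchart d x) = dist z x" using C(2) z(1) \<eta>(2) x by blast
  also have "\<dots> < eps'" using x by (simp add: \<eta>_def)
  finally have "B.nchart d x \<in> ball (A.nchart e z1) eps'" using z(2) by simp
  from C'(3)[OF this] show ?thesis .
 qed
 then obtain \<phi> where \<phi>: "!!x. x \<in> ball z \<eta> ==> \<phi> x \<in> ball z1 eps'" "!!x. x \<in> ball z \<eta> ==> A.nchart e (\<phi> x) = B.nchart d x" by metis
 have iso: "dist (\<phi> x) (\<phi> y) = dist x y" if "x \<in> ball z \<eta>" "y \<in> ball z \<eta>" for x y
  using C'(2)[OF \<phi>(1)[OF that(1)] \<phi>(1)[OF that(2)]] C(2)[OF subsetD[OF \<eta>(2) that(1)] subsetD[OF \<eta>(2) that(2)]]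
   \<phi>(2)[OF that(1)] \<phi>(2)[OF that(2)] by simp
 have eq: "(cmod (\<phi> x - foot T r e))^2 + height2 T r e = (cmod (x - foot T' r d))^2 + height2 T' r d" if x: "x \<in> ball z \<eta>" for x
 proof -
  have "\<phi> x \<in> A.tri e" "x \<in> B.tri d" using \<phi>(1)[OF x] eps'(2) \<eta>(2) eps(2) x A.otri_subset_tri B.otri_subset_tri by blast+
  thus ?thesis using A.height_at_face[OF e(1), of "\<phi> x" r] B.height_at_face[OF d, of x r] q_eq \<phi>(2)[OF x] by simp
 qed
 obtain c k where c: "cmod c = 1" "k = id \<or> k = cnj" "!!x. x \<in> ball z \<eta> ==> \<phi> x = \<phi> z + c * k (x - z)"
  using complex_isometry_affine[OF iso \<eta>(1)] by blast
 define b where "b = z - k (cnj c * (\<phi> z - foot T r e))"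
 have b: "cmod (\<phi> x - foot T r e) = cmod (x - b)" if "x \<in> ball z \<eta>" for x
  unfolding b_def modulus_of_affine_isometry[OF c(1,2), symmetric] using c(3)[OF that] by (simp add: algebra_simps)
 have "(cmod (x - b))^2 + height2 T r e = (cmod (x - foot T' r d))^2 + height2 T' r d" if "x \<in> ball z \<eta>" for x
  using eq[OF that] unfolding b[OF that] .
 hence "height2 T r e = height2 T' r d" by (rule paraboloid_determined(2)[OF \<eta>(1)])
 thus ?thesis using e(1) by (intro bexI[of _ e]) simp_all
qed

end

context surface_triangulation
begin

lemma bend_continuous: "((%y. bend y d) \<longlongrightarrow> bend r d) (at r within S)"
proof -
 have c: "((%y::real^'v. y $ i) \<longlongrightarrow> r $ i) (at r within S)" for i by (intro tendsto_intros)
 have "((%y. inset T y d) \<longlongrightarrow> inset T r d) (at r within S)" for d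
  unfolding inset_def foot_along_def divide_inverse by (intro tendsto_intros)
 thus ?thesis unfolding bend_def by (intro tendsto_intros)
qed

end

text \<open>
 The condition on the bends is closed.  That a limit of convex polytopes has no pyramid of height zero
 is seen by comparison with the polytope that is known to exist.
\<close>

lemma convexity_closed:
 assumes s: "polyhedral_sphere s" and P: "gen_convex_polytope s T0 r" and geo: "geodesic_triangulation s T"
  and n: "\<not> gen_convex_polytope s T r"
 shows "\<exists>dlt>0. \<forall>y\<in>ball r dlt. \<not> gen_convex_polytope s T y"
proof -
 interpret A: surface_triangulation s T0 using s P by unfold_locales (simp_all add: gen_convex_polytope_def)
 interpret B: surface_triangulation s T using s geo by unfold_locales
 note PA = P[unfolded A.gen_convex_polytope_iff]
 have "\<exists>d\<in>darts T. B.bend r d < 0"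
 proof (rule ccontr)
  assume "\<not> ?thesis"
  hence b: "0 <= B.bend r d" if "d \<in> darts T" for d using that by force
  interpret two_convex_triangulations s T0 T r by unfold_locales (use PA b in auto)
  have "0 < height2 T r d" if d: "d \<in> darts T" for d
  proof -
   obtain e where "e \<in> darts T0" "height2 T r d = height2 T0 r e" using height_matches[OF d] by blast
   thus ?thesis using A.admissibleD(2)[of r e] PA by simp
  qed
  hence "B.admissible r" unfolding B.admissible_def using A.admissibleD(1)[of r] PA by blast
  thus False using n b unfolding B.gen_convex_polytope_iff by blast
 qed
 then obtain d where d: "d \<in> darts T" "B.bend r d < 0" by blast
 have "eventually (%y. B.bend y d < 0) (at r)" using order_tendstoD(2)[OF B.bend_continuous d(2)] .
 then obtain dlt where "dlt > 0" "!!y. y ~= r ==> dist y r < dlt ==> B.bend y d < 0" unfolding eventually_at by auto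
 hence "B.bend y d < 0" if "y \<in> ball r dlt" for y using that d(2) by (cases "y = r") (auto simp: dist_commute)
 hence "\<not> gen_convex_polytope s T y" if "y \<in> ball r dlt" for y using that d(1) unfolding B.gen_convex_polytope_iff by force
 thus ?thesis using \<open>dlt > 0\<close> by blast
qed

theorem finitely_many_local_triangulations:
 assumes s: "polyhedral_sphere s" and P: "gen_convex_polytope s T0 r"
 shows "\<exists>\<T> dlt. finite \<T> \<and> 0 < dlt \<and> (\<forall>T\<in>\<T>. gen_convex_polytope s T r) \<and>
  (\<forall>y\<in>ball r dlt \<inter> polytope_space s. \<exists>T\<in>\<T>. gen_convex_polytope s T y)"
proof -
 obtain \<T> where T: "finite \<T>" "!!T. T \<in> \<T> ==> geodesic_triangulation s T"
  "!!T y. gen_convex_polytope s T y ==> norm y <= norm r + 1 ==> \<exists>T'\<in>\<T>. gen_convex_polytope s T' y"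
  using finitely_many_types[OF s, of "norm r + 1"] by blast
 define \<N> where "\<N> = {T \<in> \<T>. \<not> gen_convex_polytope s T r}"
 have "\<forall>T\<in>\<N>. \<exists>dlt>0. \<forall>y\<in>ball r dlt. \<not> gen_convex_polytope s T y"
  using convexity_closed[OF s P] T(2) unfolding \<N>_def by blast
 then obtain dl where dl: "!!T. T \<in> \<N> ==> 0 < dl T" "!!T y. T \<in> \<N> ==> y \<in> ball r (dl T) ==> \<not> gen_convex_polytope s T y" by metis
 obtain dlt0 where d0: "dlt0 > 0" "!!T. T \<in> \<N> ==> dlt0 <= dl T" using finite_positive_lower_bound[of \<N> dl] dl(1) T(1) unfolding \<N>_def by auto
 define dlt where "dlt = min dlt0 1"
 have "\<exists>T\<in>\<T> - \<N>. gen_convex_polytope s T y" if y: "y \<in> ball r dlt \<inter> polytope_space s" for y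
 proof -
  have "norm y <= norm r + norm (y - r)" using norm_triangle_ineq[of r "y - r"] by simp
  hence "norm y <= norm r + 1" using y by (simp add: dlt_def dist_norm norm_minus_commute)
  moreover obtain T where "gen_convex_polytope s T y" using y unfolding polytope_space_def by blast
  ultimately obtain T' where T': "T' \<in> \<T>" "gen_convex_polytope s T' y" using T(3) by blast
  have "T' \<notin> \<N>" using dl(2)[of T' y] d0(2)[of T'] y T'(2) by (auto simp: dlt_def)
  thus ?thesis using T' by blast
 qed
 moreover have "finite (\<T> - \<N>)" using T(1) by simp
 moreover have "\<forall>T\<in>\<T> - \<N>. gen_convex_polytope s T r" by (auto simp: \<N>_def)
 moreover have "0 < dlt" using d0 by (simp add: dlt_def)
 ultimately show ?thesis by (intro exI[of _ "\<T> - \<N>"] exI[of _ dlt]) blast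
qed

section \<open>The Hessians\<close>

text \<open>
 A function that selects among finitely many functions with the same value and derivative at
 \<open>x\<close> is differentiable at \<open>x\<close>, no matter how it selects.
\<close>

lemma finite_selection_derivative:
 fixes f :: "'a => real => real"
 assumes fin: "finite A" and sel: "eventually (%t. \<exists>a\<in>A. g t = f a t) (at x)"
  and der: "!!a. a \<in> A ==> (f a has_real_derivative D) (at x)" and val: "!!a. a \<in> A ==> f a x = g x"
 shows "(g has_real_derivative D) (at x)"
 unfolding has_field_derivative_iff tendsto_iff
proof (intro allI impI)
 fix e :: real assume e: "0 < e"
 have "eventually (%t. dist ((f a t - f a x) / (t - x)) D < e) (at x)" if "a \<in> A" for a
  using der[OF that] e unfolding has_field_derivative_iff tendsto_iff by blast
 hence "eventually (%t. \<forall>a\<in>A. dist ((f a t - f a x) / (t - x)) D < e) (at x)" using fin by (intro eventually_ball_finite) auto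
 thus "eventually (%t. dist ((g t - g x) / (t - x)) D < e) (at x)"
  using sel
 proof eventually_elim
  case (elim t)
  then obtain a where "a \<in> A" "g t = f a t" by blast
  thus ?case using elim(1) val by auto
 qed
qed

context metric_triangulation
begin

lemma jacobian_continuous:
 assumes r: "admissible r"
 shows "((%y. jacobian y i j) \<longlongrightarrow> jacobian r i j) (at r within S)"
proof -
 note A = admissibleD[OF r]
 have c: "((%y::real^'v. y $ i) \<longlongrightarrow> r $ i) (at r within S)" for i by (intro tendsto_intros)
 have fa: "((%y. foot_along T y d) \<longlongrightarrow> foot_along T r d) (at r within S)" for d
  unfolding foot_along_def divide_inverse by (intro tendsto_intros)
 have fi: "((%y. inset T y d) \<longlongrightarrow> inset T r d) (at r within S)" for d
  unfolding inset_def divide_inverse by (intro tendsto_intros fa)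
 have ld: "((%y. line_dist2 T y d) \<longlongrightarrow> line_dist2 T r d) (at r within S)" for d
  unfolding line_dist2_def by (intro tendsto_intros fa)
 have ah: "((%y. apex_height T y d) \<longlongrightarrow> apex_height T r d) (at r within S)" for d
  unfolding apex_height_def height2_def by (intro tendsto_intros ld fi)
 have ec: "((%y. edge_cot T y d) \<longlongrightarrow> edge_cot T r d) (at r within S)" if "d \<in> darts T" for d
 proof -
  have "apex_height T r d ~= 0" "apex_height T r (opp T d) ~= 0" using A(3)[OF that] A(3)[of "opp T d"] that by auto
  thus ?thesis unfolding edge_cot_def by (intro tendsto_intros ah fi)
 qed
 have fd: "((%y. foot_along_deriv T y v d) \<longlongrightarrow> foot_along_deriv T r v d) (at r within S)" for d v
  unfolding foot_along_deriv_def divide_inverse by (intro tendsto_intros)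
 have er: "((%y. edge_rate T y v d) \<longlongrightarrow> edge_rate T r v d) (at r within S)" if "d \<in> darts T" for d v
  unfolding edge_rate_def using A(5)[OF that] by (intro tendsto_intros fa fd ld) auto
 show ?thesis unfolding jacobian_def by (intro tendsto_intros ec er) auto
qed

lemma face_area_has_partial_on:
 assumes r: "admissible r"
 shows "has_partial_on UNIV (face_area T (apex_angle T r) i) j (jacobian r i j) (dual_altitude r)"
proof -
 let ?\<phi> = "apex_angle T r"
 define g where "g = (%h. \<Sum>d | d \<in> darts T \<and> orig T d = i. dual_len T ?\<phi> h d * edge_altitude T ?\<phi> (axis j 1) d)"
 have g: "has_partial (face_area T ?\<phi> i) j (g h) h" for h
  unfolding has_partial_def g_def by (rule face_area_derivative)
 have "g (dual_altitude r) = jacobian r i j"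
  using g[of "dual_altitude r"] face_area_jacobian[OF r, of i j] unfolding has_partial_def by (rule DERIV_unique)
 thus ?thesis unfolding has_partial_on_def using g by (intro exI[of _ g]) simp
qed

end

lemma two_convex_at:
 assumes s: "polyhedral_sphere s" and P: "gen_convex_polytope s T r" "gen_convex_polytope s T' r"
 shows "kappa T' r i = kappa T r i" "total_scalar_curvature T' r = total_scalar_curvature T r"
  "metric_triangulation.jacobian T' r i j = metric_triangulation.jacobian T r i j"
proof -
 interpret A: surface_triangulation s T using s P by unfold_locales (simp_all add: gen_convex_polytope_def)
 interpret B: surface_triangulation s T' using s P by unfold_locales (simp_all add: gen_convex_polytope_def)
 note PA = P(1)[unfolded A.gen_convex_polytope_iff] and PB = P(2)[unfolded B.gen_convex_polytope_iff]
 interpret two_convex_triangulations s T T' r by unfold_locales (use PA PB in auto)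
 show "kappa T' r i = kappa T r i" "total_scalar_curvature T' r = total_scalar_curvature T r" "B.jacobian r i j = A.jacobian r i j"
  using PA PB kappa_eq total_scalar_curvature_eq jacobian_eq by blast+
qed

lemma polytope_tri_convex: "r \<in> polytope_space s ==> gen_convex_polytope s (polytope_tri s r) r"
 unfolding polytope_tri_def polytope_space_def by (auto intro: someI)

lemma curvature_eq:
 assumes "polyhedral_sphere s" "gen_convex_polytope s T r"
 shows "curvature s i r = kappa T r i" "scalar_curvature s r = total_scalar_curvature T r"
proof -
 have "r \<in> polytope_space s" using assms(2) unfolding polytope_space_def by blast
 note two_convex_at(1,2)[OF assms(1,2) polytope_tri_convex[OF this]]
 thus "curvature s i r = kappa T r i" "scalar_curvature s r = total_scalar_curvature T r"
  by (simp_all add: curvature_def scalar_curvature_def)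
qed

lemma interior_partials:
 assumes s: "polyhedral_sphere s" and P: "gen_convex_polytope s T r" and r: "r \<in> interior (polytope_space s)"
 shows "has_partial (curvature s i) j (metric_triangulation.jacobian T r i j) r"
  "has_partial (scalar_curvature s) j (curvature s j r) r"
proof -
 obtain \<T> dlt where T: "finite \<T>" "0 < dlt" "!!T. T \<in> \<T> ==> gen_convex_polytope s T r"
  "!!y. y \<in> ball r dlt \<inter> polytope_space s ==> \<exists>T\<in>\<T>. gen_convex_polytope s T y"
  using finitely_many_local_triangulations[OF s P] by metis
 obtain e where e: "e > 0" "ball r e \<subseteq> interior (polytope_space s)" using openE[OF open_interior r] .
 define y where "y = (%t::real. r + t *\<^sub>R axis j 1)"
 have y0: "y 0 = r" by (simp add: y_def)
 have sel: "eventually (%t. \<exists>T\<in>\<T>. gen_convex_polytope s T (y t)) (at 0)"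
  unfolding eventually_at
 proof (intro exI[of _ "min dlt e"] conjI ballI impI)
  fix t :: real assume "t ~= 0 \<and> dist t 0 < min dlt e"
  hence "y t \<in> ball r dlt" "y t \<in> ball r e" by (auto simp: y_def dist_norm)
  thus "\<exists>T\<in>\<T>. gen_convex_polytope s T (y t)" using T(4) e(2) interior_subset by blast
 qed (use T(2) e(1) in simp)
 have loc: "surface_triangulation s T'" if "T' \<in> \<T>" for T'
  using T(3)[OF that] s by unfold_locales (simp_all add: gen_convex_polytope_def)
 have adm: "metric_triangulation.admissible T' r" if "T' \<in> \<T>" for T'
  using T(3)[OF that] surface_triangulation.gen_convex_polytope_iff[OF loc[OF that]] by blast
 have mt: "metric_triangulation T'" if "T' \<in> \<T>" for T'
 proof -
  interpret B: surface_triangulation s T' by (rule loc[OF that])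
  show ?thesis by unfold_locales
 qed
 have "((%t. curvature s i (y t)) has_real_derivative metric_triangulation.jacobian T r i j) (at 0)"
 proof (rule finite_selection_derivative[OF T(1), where f = "%T' t. kappa T' (y t) i"])
  show "eventually (%t. \<exists>T'\<in>\<T>. curvature s i (y t) = kappa T' (y t) i) (at 0)"
   by (rule eventually_mono[OF sel]) (use curvature_eq(1)[OF s] in blast)
  fix T' assume T': "T' \<in> \<T>"
  show "((%t. kappa T' (y t) i) has_real_derivative metric_triangulation.jacobian T r i j) (at 0)"
   using metric_triangulation.kappa_jacobian[OF mt[OF T'] adm[OF T'], of i j] two_convex_at(3)[OF s P T(3)[OF T'], of i j]
   by (simp only: has_partial_def y_def)
  show "kappa T' (y 0) i = curvature s i (y 0)" unfolding y0 using curvature_eq(1)[OF s T(3)[OF T']] by simp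
 qed
 thus "has_partial (curvature s i) j (metric_triangulation.jacobian T r i j) r" by (simp only: has_partial_def y_def)
 have "((%t. scalar_curvature s (y t)) has_real_derivative curvature s j r) (at 0)"
 proof (rule finite_selection_derivative[OF T(1), where f = "%T' t. total_scalar_curvature T' (y t)"])
  show "eventually (%t. \<exists>T'\<in>\<T>. scalar_curvature s (y t) = total_scalar_curvature T' (y t)) (at 0)"
   by (rule eventually_mono[OF sel]) (use curvature_eq(2)[OF s] in blast)
  fix T' assume T': "T' \<in> \<T>"
  show "((%t. total_scalar_curvature T' (y t)) has_real_derivative curvature s j r) (at 0)"
   using metric_triangulation.total_scalar_curvature_gradient[OF mt[OF T'] adm[OF T'], of j] curvature_eq(1)[OF s T(3)[OF T'], of j]
   by (simp only: has_partial_def y_def)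
  show "total_scalar_curvature T' (y 0) = scalar_curvature s (y 0)" unfolding y0 using curvature_eq(2)[OF s T(3)[OF T']] by simp
 qed
 thus "has_partial (scalar_curvature s) j (curvature s j r) r" by (simp only: has_partial_def y_def)
qed

text \<open>
 Near \<open>r\<close> the Jacobian is one of finitely many continuous functions that take the same
 value at \<open>r\<close>.
\<close>

lemma curvature_has_partial_on:
 assumes s: "polyhedral_sphere s" and P: "gen_convex_polytope s T r"
 shows "has_partial_on (polytope_space s) (curvature s i) j (metric_triangulation.jacobian T r i j) r"
proof -
 define g where "g = (%y. metric_triangulation.jacobian (polytope_tri s y) y i j)"
 have g: "g y = metric_triangulation.jacobian T' y i j" if "gen_convex_polytope s T' y" for y T'
 proof -
  have "y \<in> polytope_space s" using that unfolding polytope_space_def by blast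
  thus ?thesis unfolding g_def by (rule two_convex_at(3)[OF s that polytope_tri_convex])
 qed
 have 1: "has_partial (curvature s i) j (g y) y" if y: "y \<in> interior (polytope_space s)" for y
  unfolding g_def using y interior_subset by (intro interior_partials(1)[OF s polytope_tri_convex]) auto
 have "(g \<longlongrightarrow> metric_triangulation.jacobian T r i j) (at r within interior (polytope_space s))"
 proof -
  obtain \<T> dlt where T: "finite \<T>" "0 < dlt" "!!T. T \<in> \<T> ==> gen_convex_polytope s T r"
   "!!y. y \<in> ball r dlt \<inter> polytope_space s ==> \<exists>T\<in>\<T>. gen_convex_polytope s T y"
   using finitely_many_local_triangulations[OF s P] by metis
  let ?F = "at r within interior (polytope_space s)"
  have lim: "((%y. metric_triangulation.jacobian T' y i j) \<longlongrightarrow> metric_triangulation.jacobian T r i j) ?F" if T': "T' \<in> \<T>" for T'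
  proof -
   interpret B: surface_triangulation s T' using T(3)[OF T'] s by unfold_locales (simp_all add: gen_convex_polytope_def)
   have "B.admissible r" using T(3)[OF T'] B.gen_convex_polytope_iff by blast
   from B.jacobian_continuous[OF this, of i j "interior (polytope_space s)"] show ?thesis
    unfolding two_convex_at(3)[OF s P T(3)[OF T'], of i j] .
  qed
  show ?thesis unfolding tendsto_iff
  proof (intro allI impI)
   fix e :: real assume e: "0 < e"
   have "eventually (%y. \<forall>T'\<in>\<T>. dist (metric_triangulation.jacobian T' y i j) (metric_triangulation.jacobian T r i j) < e) ?F"
    using T(1) lim e by (intro eventually_ball_finite) (auto simp: tendsto_iff)
   moreover have "eventually (%y. y \<in> ball r dlt \<inter> polytope_space s) ?F"
    unfolding eventually_at using T(2) interior_subset[of "polytope_space s"] by (intro exI[of _ dlt]) (auto simp: dist_commute)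
   ultimately show "eventually (%y. dist (g y) (metric_triangulation.jacobian T r i j) < e) ?F"
   proof eventually_elim
    case (elim y)
    then obtain T' where "T' \<in> \<T>" "gen_convex_polytope s T' y" using T(4) by blast
    thus ?case using elim(1) g by simp
   qed
  qed
 qed
 thus ?thesis unfolding has_partial_on_def using 1 g[OF P] by (intro exI[of _ g]) auto
qed

theorem theorem4:
  fixes s :: "'v::finite \<Rightarrow> 'm::metric_space"
    and T :: "('v, 'm) geo_tri"
    and r :: "real^'v"
  assumes "polyhedral_sphere s"
    and "gen_convex_polytope s T r"
  shows "gen_convex_polyhedron T (apex_angle T r) (dual_altitude r) \<and>
    (\<forall>i j. \<exists>D.
       has_partial2_on (polytope_space s) (scalar_curvature s) i j D r \<and>
       has_partial2_on UNIV (polyhedron_volume T (apex_angle T r)) i j D (dual_altitude r)) \<and>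
    (\<forall>i j. \<exists>D.
       has_partial_on (polytope_space s) (curvature s i) j D r \<and>
       has_partial_on UNIV (face_area T (apex_angle T r) i) j D (dual_altitude r))"
proof -
 interpret surface_triangulation s T using assms by unfold_locales (simp_all add: gen_convex_polytope_def)
 have r: "admissible r" using assms(2) gen_convex_polytope_iff by blast
 have k: "has_partial_on (polytope_space s) (curvature s i) j (jacobian r i j) r" for i j
  by (rule curvature_has_partial_on[OF assms])
 have a: "has_partial_on UNIV (face_area T (apex_angle T r) i) j (jacobian r i j) (dual_altitude r)" for i j
  by (rule face_area_has_partial_on[OF r])
 have "has_partial2_on (polytope_space s) (scalar_curvature s) i j (jacobian r j i) r" for i j
  unfolding has_partial2_on_def
 proof (intro exI[of _ "curvature s j"] conjI ballI k)
  fix y assume y: "y \<in> interior (polytope_space s)"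
  hence "y \<in> polytope_space s" using interior_subset by blast
  thus "has_partial (scalar_curvature s) j (curvature s j y) y" by (rule interior_partials(2)[OF assms(1) polytope_tri_convex y])
 qed
 moreover have "has_partial2_on UNIV (polyhedron_volume T (apex_angle T r)) i j (jacobian r j i) (dual_altitude r)" for i j
  unfolding has_partial2_on_def
  by (intro exI[of _ "face_area T (apex_angle T r) j"] conjI ballI a volume_gradient[OF r])
 moreover have "gen_convex_polyhedron T (apex_angle T r) (dual_altitude r)"
  by (rule gen_convex_polyhedron_dual[OF r]) (use assms(2) in \<open>auto simp: gen_convex_polytope_def\<close>)
 ultimately show ?thesis using k a by blast
qed

end
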